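(* Let $k$ be such that the eigenvalue $\Lambda_k^0$ of the limit problem is simple and such that both $U_k^0(P^0)$ and $U_k^0(P^1)$ are nonzero. Then, for all sufficiently small $\epsilon>0$, the spectral band $\Upsilon_k^\epsilon$ of the linear water-wave problem in the periodic channel $\Pi^\epsilon$ is an interval of positive length (it does not degenerate into a single point).
   Context: Geometry. Points are $x=(x_1,x_2,x_3)$, $x'=(x_2,x_3)$, $z=x_3$. Let $\varpi_\bullet\subset\mathbb{R}^3$ be a domain with Lipschitz boundary and compact closure whose intersections with the planes $\{x_1=0\}$ and $\{x_1=1\}$ are simply connected planar domains of positive area containing $P^0=(0,P_2,P_3)$ and $P^1=(1,P_2,P_3)$ respectively, with $P_3<0$. The periodicity cell is the bounded domain $\varpi=\{x\in\varpi_\bullet: x_3<0,\ 0<x_1<1\}$, with translates $\varpi_j=\{x:(x_1-j,x_2,x_3)\in\varpi\}$, $j\in\mathbb{Z}$; its free surface is $\gamma$, the part of $\partial\varpi$ in $\{x_3=0\}$ (of positive area). It is a standing fact that the form $(\nabla u,\nabla v)_{L^2(\varpi)}+(u,v)_{L^2(\gamma)}$ induces a norm equivalent to the $H^1(\varpi)$-norm and that the trace map $H^1(\varpi)\to L^2(\gamma)$ is compact. Let $\theta\subset\mathbb{R}^2$ be a bounded planar domain containing the origin, with $C^2$ boundary, so small that $\{j\}\times\overline{(2\theta+(P_2,P_3))}\subset\partial\varpi$ for $j=0,1$ and $\sup_{(x_2,x_3)\in\theta}(x_3+P_3)<0$; moreover the set $\{0\}\times\overline\theta+P^0$ has a neighbourhood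 $N_0$ with $N_0\cap\{x_1=0\}\subset\partial\varpi$ and $N_0\cap\{x_1>0\}\subset\varpi$, and analogously at $P^1$ with $\{x_1=1\}$, $\{x_1<1\}$. For small $\epsilon>0$ the apertures are $\theta_j^\epsilon=\{(j,x'):\epsilon^{-1}(x'-(P_2,P_3))\in\theta\}$, $j\in\mathbb{Z}$. The channel is $\Pi^\epsilon=\bigcup_{j\in\mathbb{Z}}(\varpi_j\cup\theta_j^\epsilon)$, its free surface is $\Gamma^\epsilon=\partial\Pi^\epsilon\cap\{x_3=0\}$, and $\Sigma^\epsilon=\partial\Pi^\epsilon\setminus\overline{\Gamma^\epsilon}$. The water-wave problem is $-\Delta u=0$ in $\Pi^\epsilon$, $\partial_nu=0$ on $\Sigma^\epsilon$, $\partial_zu=\lambda u$ on $\Gamma^\epsilon$. Bands. For $\eta\in[0,2\pi)$ let $H^1_{\epsilon,\eta}(\varpi)$ be the space of (complex-valued) $u\in H^1(\varpi)$ with $u(0,x')=e^{-i\eta}u(1,x')$ for $(0,x')\in\theta_0^\epsilon$, and let $0\le\Lambda_1^\epsilon(\eta)\le\Lambda_2^\epsilon(\eta)\le\dots\to\infty$ be the eigenvalues (with multiplicity) of the problem: $U\in H^1_{\epsilon,\eta}(\varpi)$, $(\nabla U,\nabla V)_{L^2(\varpi)}=\Lambda(U,V)_{L^2(\gamma)}$ for all $V\in H^1_{\epsilon,\eta}(\varpi)$. The functions $\eta\mapsto\Lambda_k^\epsilon(\eta)$ are continuous and $2\pi$-periodic, and the $k$-th spectral band is the closed interval (possibly a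 point) $\Upsilon_k^\epsilon=\{\Lambda_k^\epsilon(\eta):\eta\in[0,2\pi)\}$; by Floquet–Bloch theory the essential spectrum of the water-wave problem is $\bigcup_k\Upsilon_k^\epsilon$. Limit problem. Find $\Lambda$ and $0\ne U\in H^1(\varpi)$ with $(\nabla U,\nabla V)_{L^2(\varpi)}=\Lambda\,(U,V)_{L^2(\gamma)}$ for all $V\in H^1(\varpi)$. Its eigenvalues, repeated according to multiplicity, are $0=\Lambda_1^0\le\Lambda_2^0\le\dots\to+\infty$, with an $L^2(\gamma)$-orthonormal sequence of eigenfunctions $(U_k^0)_{k\ge1}$; these are smooth up to the flat walls near $P^0,P^1$, so $U_k^0(P^j)$ makes sense. *)

theory Defs
  imports "HOL-Analysis.Analysis"
begin

text \<open>
  A point \<open>x = (x\<^sub>1, x\<^sub>2, x\<^sub>3)\<close> is a nested pair, so that \<open>snd x\<close> is \<open>x' = (x\<^sub>2, x\<^sub>3)\<close>.  The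
  product norm and \<open>lborel\<close> on these types are the Euclidean norm and the Lebesgue measure.
\<close>

type_synonym plane = "real \<times> real"
type_synonym point = "real \<times> real \<times> real"


section \<open>Regularity of functions and of boundaries\<close>

primrec Ck :: "nat \<Rightarrow> ('a::euclidean_space \<Rightarrow> 'b::real_normed_vector) \<Rightarrow> bool" where
  "Ck 0 f \<longleftrightarrow> continuous_on UNIV f"
| "Ck (Suc n) f \<longleftrightarrow>
     (\<forall>x. f differentiable (at x)) \<and> (\<forall>e\<in>Basis. Ck n (\<lambda>x. frechet_derivative f (at x) e))"

text \<open>
  Near each boundary point the set is the region on one side of a graph over a hyperplane with
  unit normal \<open>e\<close>.  The graph function is taken on the whole space but is evaluated only on the
  hyperplane; composing with the orthogonal projection shows that this is no restriction.
\<close>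

definition graph_boundary :: "(('a::euclidean_space \<Rightarrow> real) \<Rightarrow> bool) \<Rightarrow> 'a set \<Rightarrow> bool" where
  "graph_boundary R S \<longleftrightarrow>
     (\<forall>p\<in>frontier S. \<exists>e h r. norm e = 1 \<and> R h \<and> r > 0 \<and>
        (\<forall>x\<in>ball p r. x \<in> S \<longleftrightarrow> x \<bullet> e < h (x - (x \<bullet> e) *\<^sub>R e)))"

definition Lipschitz_boundary :: "'a::euclidean_space set \<Rightarrow> bool" where
  "Lipschitz_boundary = graph_boundary (\<lambda>h. \<exists>L. L-lipschitz_on UNIV h)"

definition C2_boundary :: "'a::euclidean_space set \<Rightarrow> bool" where
  "C2_boundary = graph_boundary (Ck 2)"


section \<open>The Sobolev space of order one and traces on flat boundary pieces\<close>

text \<open>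
  Elements of \<open>L\<^sup>2\<close> and \<open>H\<^sup>1\<close> are functions rather than classes: equality of elements is equality
  almost everywhere on the set, and values outside the set are irrelevant.
\<close>

abbreviation leb :: "'a::euclidean_space set \<Rightarrow> 'a measure" where
  "leb S \<equiv> restrict_space lborel S"

definition L2 :: "'a::euclidean_space set \<Rightarrow> ('a \<Rightarrow> complex) set" where
  "L2 S = {f. f \<in> borel_measurable (leb S) \<and> integrable (leb S) (\<lambda>x. (cmod (f x))\<^sup>2)}"

definition L2_inner ::
    "'a::euclidean_space set \<Rightarrow> ('a \<Rightarrow> complex) \<Rightarrow> ('a \<Rightarrow> complex) \<Rightarrow> complex" where
  "L2_inner S f g = (\<integral>x. f x * cnj (g x) \<partial>leb S)"

definition L2_norm_sq :: "'a::euclidean_space set \<Rightarrow> ('a \<Rightarrow> complex) \<Rightarrow> real" where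
  "L2_norm_sq S f = (\<integral>x. (cmod (f x))\<^sup>2 \<partial>leb S)"

definition test_function :: "'a::euclidean_space set \<Rightarrow> ('a \<Rightarrow> real) \<Rightarrow> bool" where
  "test_function \<Omega> \<phi> \<longleftrightarrow>
     Ck 1 \<phi> \<and> compact (closure {x. \<phi> x \<noteq> 0}) \<and> closure {x. \<phi> x \<noteq> 0} \<subseteq> \<Omega>"

definition weak_deriv ::
    "'a::euclidean_space set \<Rightarrow> 'a \<Rightarrow> ('a \<Rightarrow> complex) \<Rightarrow> ('a \<Rightarrow> complex) \<Rightarrow> bool" where
  "weak_deriv \<Omega> e u g \<longleftrightarrow>
     (\<forall>\<phi>. test_function \<Omega> \<phi> \<longrightarrow>
        (\<integral>x. u x * of_real (frechet_derivative \<phi> (at x) e) \<partial>leb \<Omega>)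
          = - (\<integral>x. g x * of_real (\<phi> x) \<partial>leb \<Omega>))"

definition H1 :: "'a::euclidean_space set \<Rightarrow> ('a \<Rightarrow> complex) set" where
  "H1 \<Omega> = {u \<in> L2 \<Omega>. \<forall>e\<in>Basis. \<exists>g\<in>L2 \<Omega>. weak_deriv \<Omega> e u g}"

definition wgrad :: "'a::euclidean_space set \<Rightarrow> ('a \<Rightarrow> complex) \<Rightarrow> 'a \<Rightarrow> 'a \<Rightarrow> complex" where
  "wgrad \<Omega> u e = (SOME g. g \<in> L2 \<Omega> \<and> weak_deriv \<Omega> e u g)"

definition grad_inner ::
    "'a::euclidean_space set \<Rightarrow> ('a \<Rightarrow> complex) \<Rightarrow> ('a \<Rightarrow> complex) \<Rightarrow> complex" where
  "grad_inner \<Omega> u v = (\<Sum>e\<in>Basis. L2_inner \<Omega> (wgrad \<Omega> u e) (wgrad \<Omega> v e))"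

definition grad_norm_sq :: "'a::euclidean_space set \<Rightarrow> ('a \<Rightarrow> complex) \<Rightarrow> real" where
  "grad_norm_sq \<Omega> u = (\<Sum>e\<in>Basis. L2_norm_sq \<Omega> (wgrad \<Omega> u e))"

definition H1_norm_sq :: "'a::euclidean_space set \<Rightarrow> ('a \<Rightarrow> complex) \<Rightarrow> real" where
  "H1_norm_sq \<Omega> u = L2_norm_sq \<Omega> u + grad_norm_sq \<Omega> u"

text \<open>
  \<open>\<iota>\<close> is an isometric parametrisation, over the planar set \<open>S\<close>, of a flat piece of the boundary of
  \<open>\<Omega>\<close>; so surface measure on the piece is planar Lebesgue measure on \<open>S\<close>.  The trace is the
  extension by continuity of the restriction of functions that are \<open>C\<^sup>1\<close> up to the boundary.
\<close>

definition has_trace ::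
    "point set \<Rightarrow> (plane \<Rightarrow> point) \<Rightarrow> plane set \<Rightarrow> (point \<Rightarrow> complex) \<Rightarrow> (plane \<Rightarrow> complex) \<Rightarrow> bool"
  where
  "has_trace \<Omega> \<iota> S u g \<longleftrightarrow> u \<in> H1 \<Omega> \<and> g \<in> L2 S \<and>
     (\<exists>f :: nat \<Rightarrow> point \<Rightarrow> complex. (\<forall>n. Ck 1 (f n)) \<and>
        (\<lambda>n. H1_norm_sq \<Omega> (\<lambda>x. f n x - u x)) \<longlonglongrightarrow> 0 \<and>
        (\<lambda>n. L2_norm_sq S (\<lambda>y. f n (\<iota> y) - g y)) \<longlonglongrightarrow> 0)"

definition trace ::
    "point set \<Rightarrow> (plane \<Rightarrow> point) \<Rightarrow> plane set \<Rightarrow> (point \<Rightarrow> complex) \<Rightarrow> plane \<Rightarrow> complex" where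
  "trace \<Omega> \<iota> S u = (SOME g. has_trace \<Omega> \<iota> S u g)"

text \<open>
  The value at a boundary point of an \<open>H\<^sup>1\<close> function having a representative that is continuous
  up to that point.
\<close>

definition has_boundary_value :: "point set \<Rightarrow> (point \<Rightarrow> complex) \<Rightarrow> point \<Rightarrow> complex \<Rightarrow> bool" where
  "has_boundary_value \<Omega> u p a \<longleftrightarrow>
     (\<exists>w. (AE x in leb \<Omega>. w x = u x) \<and> (w \<longlongrightarrow> a) (at p within \<Omega>))"


section \<open>Geometry of the channel\<close>

text \<open>
  \<open>B\<close> is the domain called \<open>\<varpi>\<^sub>\<bullet>\<close> in the literature and \<open>P = (P\<^sub>2, P\<^sub>3)\<close>, so that the two
  distinguished points are \<open>(0, P)\<close> and \<open>(1, P)\<close>.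
\<close>

definition cell :: "point set \<Rightarrow> point set" where
  "cell B = {x \<in> B. snd (snd x) < 0 \<and> 0 < fst x \<and> fst x < 1}"

definition surface_pt :: "plane \<Rightarrow> point" where
  "surface_pt y = (fst y, snd y, 0)"

definition free_surface :: "point set \<Rightarrow> plane set" where
  "free_surface B = {y. surface_pt y \<in> frontier (cell B)}"

definition aperture :: "plane \<Rightarrow> plane set \<Rightarrow> real \<Rightarrow> plane set" where
  "aperture P \<theta> \<epsilon> = {y. (1 / \<epsilon>) *\<^sub>R (y - P) \<in> \<theta>}"

text \<open>
  The last three assumptions are the standing facts on the cell: the trace on the free surface is
  defined on all of \<open>H\<^sup>1\<close>, the form \<open>(\<nabla>u, \<nabla>v) + (u, v)\<^sub>\<gamma>\<close> gives an equivalent norm on \<open>H\<^sup>1\<close>, and the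
  trace map is compact.  They do not follow from the other assumptions, since a Lipschitz domain
  cut by a plane may have cusps.
\<close>

locale periodic_channel =
  fixes B :: "point set" and P :: plane and \<theta> :: "plane set"
  assumes B_domain: "open B" "connected B" "compact (closure B)" "Lipschitz_boundary B"
    and section_domain: "\<And>j. j \<in> {0, 1} \<Longrightarrow> open {y. (j, y) \<in> B} \<and>
          simply_connected {y. (j, y) \<in> B} \<and> measure lborel {y. (j, y) \<in> B} > 0 \<and> (j, P) \<in> B"
    and P_below: "snd P < 0"
    and cell_connected: "connected (cell B)"
    and surface_area: "measure lborel (free_surface B) > 0"
    and \<theta>_domain: "open \<theta>" "connected \<theta>" "bounded \<theta>" "0 \<in> \<theta>" "C2_boundary \<theta>"
    and \<theta>_wall: "\<And>j. j \<in> {0, 1} \<Longrightarrow>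
          Pair j ` closure ((\<lambda>y. 2 *\<^sub>R y + P) ` \<theta>) \<subseteq> frontier (cell B)"
    and \<theta>_below: "(SUP y\<in>\<theta>. snd y + snd P) < 0"
    and flat_0: "\<exists>N. open N \<and> (\<lambda>y. (0, y + P)) ` closure \<theta> \<subseteq> N \<and>
          N \<inter> {x. fst x = 0} \<subseteq> frontier (cell B) \<and> N \<inter> {x. fst x > 0} \<subseteq> cell B"
    and flat_1: "\<exists>N. open N \<and> (\<lambda>y. (1, y + P)) ` closure \<theta> \<subseteq> N \<and>
          N \<inter> {x. fst x = 1} \<subseteq> frontier (cell B) \<and> N \<inter> {x. fst x < 1} \<subseteq> cell B"
    and trace_exists: "\<And>u. u \<in> H1 (cell B) \<Longrightarrow>
          \<exists>g. has_trace (cell B) surface_pt (free_surface B) u g"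
    and norm_equivalence: "\<exists>c>0. \<exists>C. \<forall>u g.
          has_trace (cell B) surface_pt (free_surface B) u g \<longrightarrow>
          c * H1_norm_sq (cell B) u
            \<le> grad_norm_sq (cell B) u + L2_norm_sq (free_surface B) g \<and>
          grad_norm_sq (cell B) u + L2_norm_sq (free_surface B) g
            \<le> C * H1_norm_sq (cell B) u"
    and trace_compact: "\<And>(u :: nat \<Rightarrow> point \<Rightarrow> complex) g M.
          (\<And>n. has_trace (cell B) surface_pt (free_surface B) (u n) (g n)) \<Longrightarrow>
          (\<And>n. H1_norm_sq (cell B) (u n) \<le> M) \<Longrightarrow>
          \<exists>r h. strict_mono r \<and> h \<in> L2 (free_surface B) \<and>
            (\<lambda>n. L2_norm_sq (free_surface B) (\<lambda>y. g (r n) y - h y)) \<longlonglongrightarrow> 0"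


section \<open>Spectral problems on the cell\<close>

definition surface_inner :: "point set \<Rightarrow> (point \<Rightarrow> complex) \<Rightarrow> (point \<Rightarrow> complex) \<Rightarrow> complex" where
  "surface_inner B u v =
     L2_inner (free_surface B)
       (trace (cell B) surface_pt (free_surface B) u)
       (trace (cell B) surface_pt (free_surface B) v)"

text \<open>
  Below, \<open>W\<close> is the space of trial and test functions: \<open>H1 (cell B)\<close> for the limit problem, or its
  quasi-periodic subspace.  Taking \<open>V = U\<close> shows that eigenvalues are real.
\<close>

definition eigenfunction ::
    "point set \<Rightarrow> (point \<Rightarrow> complex) set \<Rightarrow> real \<Rightarrow> (point \<Rightarrow> complex) \<Rightarrow> bool" where
  "eigenfunction B W \<mu> U \<longleftrightarrow>
     U \<in> W \<and> \<not> (AE x in leb (cell B). U x = 0) \<and>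
     (\<forall>V\<in>W. grad_inner (cell B) U V = of_real \<mu> * surface_inner B U V)"

definition simple_eigenvalue :: "point set \<Rightarrow> (point \<Rightarrow> complex) set \<Rightarrow> real \<Rightarrow> bool" where
  "simple_eigenvalue B W \<mu> \<longleftrightarrow>
     (\<exists>U. eigenfunction B W \<mu> U \<and>
        (\<forall>V. eigenfunction B W \<mu> V \<longrightarrow> (\<exists>c. AE x in leb (cell B). V x = c * U x)))"

text \<open>
  \<open>\<Lambda> 1 \<le> \<Lambda> 2 \<le> \<dots>\<close> lists all eigenvalues according to multiplicity, with \<open>L\<^sup>2(\<gamma>)\<close>-orthonormal
  eigenfunctions \<open>U 1, U 2, \<dots>\<close>; index 0 is not used.  By the last clause the \<open>U k\<close> with
  \<open>\<Lambda> k = \<mu>\<close> span the eigenspace of \<open>\<mu>\<close>.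
\<close>

definition eigenvalue_sequence ::
    "point set \<Rightarrow> (point \<Rightarrow> complex) set \<Rightarrow> (nat \<Rightarrow> real) \<Rightarrow> (nat \<Rightarrow> point \<Rightarrow> complex) \<Rightarrow> bool" where
  "eigenvalue_sequence B W \<Lambda> U \<longleftrightarrow>
     (\<forall>k\<ge>1. eigenfunction B W (\<Lambda> k) (U k)) \<and>
     (\<forall>j\<ge>1. \<forall>k\<ge>1. surface_inner B (U j) (U k) = (if j = k then 1 else 0)) \<and>
     mono_on {1..} \<Lambda> \<and> filterlim \<Lambda> at_top sequentially \<and>
     (\<forall>\<mu> V. eigenfunction B W \<mu> V \<longrightarrow>
        (\<exists>c. AE x in leb (cell B). V x = (\<Sum>k | k \<ge> 1 \<and> \<Lambda> k = \<mu>. c k * U k x)))"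

definition kth_eigenvalue :: "point set \<Rightarrow> (point \<Rightarrow> complex) set \<Rightarrow> nat \<Rightarrow> real" where
  "kth_eigenvalue B W k = (THE \<mu>. \<exists>\<Lambda> U. eigenvalue_sequence B W \<Lambda> U \<and> \<mu> = \<Lambda> k)"

definition H1_quasiperiodic ::
    "point set \<Rightarrow> plane \<Rightarrow> plane set \<Rightarrow> real \<Rightarrow> real \<Rightarrow> (point \<Rightarrow> complex) set" where
  "H1_quasiperiodic B P \<theta> \<epsilon> \<eta> =
     {u \<in> H1 (cell B). AE y in leb (aperture P \<theta> \<epsilon>).
        trace (cell B) (Pair 0) (aperture P \<theta> \<epsilon>) u y
          = exp (- \<i> * of_real \<eta>) * trace (cell B) (Pair 1) (aperture P \<theta> \<epsilon>) u y}"

definition spectral_band :: "point set \<Rightarrow> plane \<Rightarrow> plane set \<Rightarrow> real \<Rightarrow> nat \<Rightarrow> real set" where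
  "spectral_band B P \<theta> \<epsilon> k =
     (\<lambda>\<eta>. kth_eigenvalue B (H1_quasiperiodic B P \<theta> \<epsilon> \<eta>) k) ` {0..<2 * pi}"

end

theory Submission
  imports Defs "HOL-Library.Function_Algebras"
begin

text \<open>
  The quasi-periodic spaces \<open>W\<close> exhaust \<open>H\<^sup>1\<close> as \<open>\<epsilon> \<rightarrow> 0\<close>, since points have zero capacity; so the \<open>k\<close>-th eigenvalue on
  \<open>W\<close> exceeds the simple limit eigenvalue by a small shift \<open>\<Delta>\<close>.  If \<open>u\<close> is the suitably normalised eigenvector and
  \<open>v = U - u\<close> its defect, then \<open>\<Delta>\<close> is asymptotically the energy of \<open>v\<close>, and at most asymptotically the Dirichlet energy
  of any \<open>w\<close> that vanishes on the free surface and has \<open>U - w \<in> W\<close>.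

  Choose \<open>\<eta>\<close> such that \<open>a\<^sub>0\<close> and \<open>e a\<^sub>1\<close>, where \<open>e = exp (- \<i> \<eta>)\<close>, have the same argument, and \<open>\<eta>'\<close> with phase \<open>- e\<close>.  From the
  defect \<open>v\<close> for \<open>\<eta>'\<close> one gets a competitor for \<open>\<eta>\<close>: it is \<open>c v\<close> near the wall at \<open>0\<close> and \<open>- c v\<close> near the wall at \<open>1\<close>,
  with \<open>c = (\<bar>a\<^sub>0\<bar> - \<bar>a\<^sub>1\<bar>) / (\<bar>a\<^sub>0\<bar> + \<bar>a\<^sub>1\<bar>)\<close>, up to corrections of energy \<open>o(\<epsilon>)\<close> that are supported at the
  apertures.  A Hardy inequality with a boundary term bounds the cost of the cutoffs, and also shows that the energy of
  \<open>v\<close> is at least of order \<open>\<epsilon>\<close>, because \<open>a\<^sub>0 + e a\<^sub>1 \<noteq> 0\<close>.  As \<open>\<bar>c\<bar> < 1\<close>, the shift for \<open>\<eta>\<close> is smaller than that for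
  \<open>\<eta>'\<close> once \<open>\<epsilon>\<close> is small, and the eigenvalues depend continuously on the quasi-momentum.
\<close>

text \<open>The obvious route, an asymptotic expansion of the eigenvalue in \<epsilon>, needs a
  boundary layer at the apertures and the capacity of \<theta>. Comparing two quasi-momenta avoids
  both: only the ratio of the two shifts matters. The price is that the main terms must be sharp to
  leading order. If the defect v for \<eta>' has energy q^2, the argument ends with q^2 \<le> (1 +
  o(1)) Z^2 q^2, where Z < 1 depends on c alone. Rough constants are allowed only in remainders
  o(\<epsilon>), which are absorbed because q^2 is at least of order \<epsilon>. The constant c is
  forced: with c v and - c v at the two walls, the terms that contain U - v satisfy the
  \<eta>-condition by the \<eta>'-condition, and the constants that are left satisfy it if (1 - c)
  a0 = (1 + c) e a1. If one of the two boundary values vanished, then |c| would be 1 and nothing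
  would be gained. Of U only continuity at the two points is known, not a bound on its gradient
  there; harmonicity makes up for this.\<close>

section \<open>Positive semidefinite sesquilinear forms\<close>

text \<open>The form is only semidefinite because L2 and H1 consist of functions and not of classes:
  a function that vanishes almost everywhere is a null vector without being \<open>0\<close>. The
  carrier \<open>V\<close> sits inside a type of all functions, so membership in \<open>V\<close>
  has to be carried along.\<close>

locale psd_form = vector_space scale
  for scale :: "complex \<Rightarrow> 'v::ab_group_add \<Rightarrow> 'v" (infixr "\<odot>" 75) +
  fixes V :: "'v set" and f :: "'v \<Rightarrow> 'v \<Rightarrow> complex"
  assumes subspace_V: "subspace V"
    and add_left: "\<lbrakk>x \<in> V; y \<in> V; z \<in> V\<rbrakk> \<Longrightarrow> f (x + y) z = f x z + f y z"
    and scale_left: "\<lbrakk>x \<in> V; y \<in> V\<rbrakk> \<Longrightarrow> f (c \<odot> x) y = c * f x y"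
    and hermitian: "\<lbrakk>x \<in> V; y \<in> V\<rbrakk> \<Longrightarrow> f y x = cnj (f x y)"
    and nonneg: "x \<in> V \<Longrightarrow> 0 \<le> Re (f x x)"
begin

lemma closed_ops [intro, simp]:
  "0 \<in> V" "\<lbrakk>x \<in> V; y \<in> V\<rbrakk> \<Longrightarrow> x + y \<in> V" "\<lbrakk>x \<in> V; y \<in> V\<rbrakk> \<Longrightarrow> x - y \<in> V" "x \<in> V \<Longrightarrow> c \<odot> x \<in> V"
  "x \<in> V \<Longrightarrow> - x \<in> V"
  using subspace_V by (simp_all add: subspace_0 subspace_add subspace_diff subspace_scale subspace_neg)

lemma sum_closed [intro]: "(\<And>i. i \<in> I \<Longrightarrow> x i \<in> V) \<Longrightarrow> (\<Sum>i\<in>I. x i) \<in> V"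
  by (rule subspace_sum[OF subspace_V])

lemma zero_left [simp]: "y \<in> V \<Longrightarrow> f 0 y = 0"
  using scale_left[of 0 y 0] by simp

lemma add_right: "\<lbrakk>x \<in> V; y \<in> V; z \<in> V\<rbrakk> \<Longrightarrow> f z (x + y) = f z x + f z y"
  by (metis add_left closed_ops(2) complex_cnj_add hermitian)

lemma scale_right: "\<lbrakk>x \<in> V; y \<in> V\<rbrakk> \<Longrightarrow> f x (c \<odot> y) = cnj c * f x y"
  by (metis closed_ops(4) complex_cnj_mult hermitian scale_left)

lemma zero_right [simp]: "y \<in> V \<Longrightarrow> f y 0 = 0"
  using scale_right[of y 0 0] by simp

lemma minus_left: "\<lbrakk>x \<in> V; z \<in> V\<rbrakk> \<Longrightarrow> f (- x) z = - f x z"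
  using scale_left[of x z "-1"] by simp

lemma minus_right: "\<lbrakk>x \<in> V; z \<in> V\<rbrakk> \<Longrightarrow> f z (- x) = - f z x"
  using scale_right[of z x "-1"] by simp

lemma diff_left: "\<lbrakk>x \<in> V; y \<in> V; z \<in> V\<rbrakk> \<Longrightarrow> f (x - y) z = f x z - f y z"
  using add_left[of x "- y" z] minus_left[of y z] by simp

lemma diff_right: "\<lbrakk>x \<in> V; y \<in> V; z \<in> V\<rbrakk> \<Longrightarrow> f z (x - y) = f z x - f z y"
  using add_right[of x "- y" z] minus_right[of y z] by simp

lemma sum_left: "\<lbrakk>\<And>i. i \<in> I \<Longrightarrow> x i \<in> V; z \<in> V\<rbrakk> \<Longrightarrow> f (\<Sum>i\<in>I. x i) z = (\<Sum>i\<in>I. f (x i) z)"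
  by (induction I rule: infinite_finite_induct) (auto simp: add_left sum_closed)

lemma sum_right: "\<lbrakk>\<And>i. i \<in> I \<Longrightarrow> x i \<in> V; z \<in> V\<rbrakk> \<Longrightarrow> f z (\<Sum>i\<in>I. x i) = (\<Sum>i\<in>I. f z (x i))"
  by (induction I rule: infinite_finite_induct) (auto simp: add_right sum_closed)

lemma self_real: "x \<in> V \<Longrightarrow> f x x = of_real (Re (f x x))"
  by (metis Reals_cnj_iff hermitian of_real_Re)

lemma Re_diff:
  assumes "x \<in> V" "y \<in> V"
  shows "Re (f (x - y) (x - y)) = Re (f x x) - 2 * Re (f x y) + Re (f y y)"
proof -
  have "f y x = cnj (f x y)" using assms hermitian by blast
  then show ?thesis using assms by (simp add: diff_left diff_right)
qed

lemma Re_add: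
  assumes "x \<in> V" "y \<in> V"
  shows "Re (f (x + y) (x + y)) = Re (f x x) + 2 * Re (f x y) + Re (f y y)"
proof -
  have "f y x = cnj (f x y)" using assms hermitian by blast
  then show ?thesis using assms by (simp add: add_left add_right)
qed

lemma Re_scale: "x \<in> V \<Longrightarrow> Re (f (c \<odot> x) (c \<odot> x)) = (cmod c)\<^sup>2 * Re (f x x)"
proof -
  assume x: "x \<in> V"
  have "f (c \<odot> x) (c \<odot> x) = (c * cnj c) * f x x"
    using x by (simp add: scale_left scale_right)
  then show ?thesis
    by (simp add: complex_norm_square[symmetric] del: complex_mult_cnj flip: of_real_power)
qed

lemma parallelogram:
  "\<lbrakk>x \<in> V; y \<in> V\<rbrakk> \<Longrightarrow>
    Re (f (x - y) (x - y)) = 2 * Re (f x x) + 2 * Re (f y y) - Re (f (x + y) (x + y))"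
  by (simp add: Re_diff Re_add)

text \<open>Nonnegativity of \<open>f\<close> at \<open>x - t f(x,y) y\<close> for real
  \<open>t\<close> gives a quadratic in \<open>t\<close>. For \<open>Re (f y y) > 0\<close> the
  choice \<open>t = 1 / Re (f y y)\<close> is optimal; for a null vector \<open>y\<close> the
  expression is affine in \<open>t\<close>, and only slope zero keeps it nonnegative.\<close>

lemma cauchy_schwarz_sq:
  assumes x: "x \<in> V" and y: "y \<in> V"
  shows "(cmod (f x y))\<^sup>2 \<le> Re (f x x) * Re (f y y)"
proof -
  have key: "0 \<le> Re (f x x) - 2 * t * (cmod (f x y))\<^sup>2 + t\<^sup>2 * (cmod (f x y))\<^sup>2 * Re (f y y)" for t
  proof -
    define c where "c = of_real t * f x y"
    have "0 \<le> Re (f (x - c \<odot> y) (x - c \<odot> y))" using nonneg x y by blast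
    also have "\<dots> = Re (f x x) - 2 * Re (cnj c * f x y) + (cmod c)\<^sup>2 * Re (f y y)"
      using x y by (simp add: Re_diff scale_right[OF x y] Re_scale del: times_complex.sel)
    also have "Re (cnj c * f x y) = t * (cmod (f x y))\<^sup>2"
      unfolding c_def cmod_power2 by (simp add: power2_eq_square algebra_simps)
    also have "(cmod c)\<^sup>2 = t\<^sup>2 * (cmod (f x y))\<^sup>2"
      unfolding c_def by (simp add: norm_mult power_mult_distrib)
    finally show ?thesis by (simp add: mult_ac)
  qed
  show ?thesis
  proof (cases "Re (f y y) = 0")
    case True
    have "cmod (f x y) = 0"
    proof (rule ccontr)
      assume "cmod (f x y) \<noteq> 0"
      then show False
        using key[of "(Re (f x x) + 1) / (2 * (cmod (f x y))\<^sup>2)"] True nonneg[OF x] by simp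
    qed
    then show ?thesis using True by simp
  next
    case False
    then have pos: "Re (f y y) > 0" using nonneg[OF y] by linarith
    from key[of "1 / Re (f y y)"] pos have "(cmod (f x y))\<^sup>2 / Re (f y y) \<le> Re (f x x)"
      by (simp add: power2_eq_square field_simps)
    with pos show ?thesis by (simp add: field_simps)
  qed
qed

lemma cauchy_schwarz:
  assumes "x \<in> V" "y \<in> V"
  shows "cmod (f x y) \<le> sqrt (Re (f x x)) * sqrt (Re (f y y))"
  using cauchy_schwarz_sq[OF assms] by (metis real_le_rsqrt real_sqrt_mult)

lemma triangle:
  assumes "x \<in> V" "y \<in> V"
  shows "sqrt (Re (f (x + y) (x + y))) \<le> sqrt (Re (f x x)) + sqrt (Re (f y y))"
proof -
  have "Re (f x y) \<le> sqrt (Re (f x x)) * sqrt (Re (f y y))"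
    using cauchy_schwarz[OF assms] complex_Re_le_cmod order_trans by blast
  then have "Re (f (x + y) (x + y)) \<le> (sqrt (Re (f x x)) + sqrt (Re (f y y)))\<^sup>2"
    using assms nonneg by (simp add: Re_add power2_sum)
  then show ?thesis
    using assms nonneg by (simp add: real_le_lsqrt)
qed

lemma triangle_diff:
  assumes "x \<in> V" "y \<in> V"
  shows "sqrt (Re (f (x - y) (x - y))) \<le> sqrt (Re (f x x)) + sqrt (Re (f y y))"
  using triangle[of x "- y"] assms by (simp add: minus_left minus_right)

lemma triangle_sum:
  "\<lbrakk>finite I; \<And>i. i \<in> I \<Longrightarrow> x i \<in> V\<rbrakk> \<Longrightarrow>
    sqrt (Re (f (\<Sum>i\<in>I. x i) (\<Sum>i\<in>I. x i))) \<le> (\<Sum>i\<in>I. sqrt (Re (f (x i) (x i))))"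
proof (induction I rule: finite_induct)
  case (insert j I)
  then show ?case using triangle[of "x j" "\<Sum>i\<in>I. x i"] by (auto simp: sum_closed)
qed simp

lemma sqrt_scale: "x \<in> V \<Longrightarrow> sqrt (Re (f (c \<odot> x) (c \<odot> x))) = cmod c * sqrt (Re (f x x))"
  by (simp add: Re_scale real_sqrt_mult)

lemma Re_add_le:
  assumes "x \<in> V" "y \<in> V"
  shows "Re (f (x + y) (x + y)) \<le> 2 * Re (f x x) + 2 * Re (f y y)"
  using parallelogram[OF assms] nonneg[of "x - y"] assms by simp

lemma Re_diff_le:
  assumes "x \<in> V" "y \<in> V"
  shows "Re (f (x - y) (x - y)) \<le> 2 * Re (f x x) + 2 * Re (f y y)"
  using parallelogram[OF assms] nonneg[of "x + y"] assms by simp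

text \<open>Null vectors lie in the radical of the form. This turns minimality into an Euler
  equation later: a minimiser is a null vector of the form \<open>a - m b\<close>.\<close>

lemma null_left: "\<lbrakk>x \<in> V; y \<in> V; Re (f x x) = 0\<rbrakk> \<Longrightarrow> f x y = 0"
  using cauchy_schwarz_sq[of x y] by simp

lemma mono_subspace: "\<lbrakk>subspace W; W \<subseteq> V\<rbrakk> \<Longrightarrow> psd_form scale W f"
  by unfold_locales (auto simp: subset_iff add_left scale_left nonneg intro: hermitian)

end

text \<open>Gaussian elimination: a pivot \<open>j0\<close> in one equation removes one unknown. In
  min-max arguments it supplies a vector of an \<open>n\<close>-dimensional span that is orthogonal
  to \<open>n - 1\<close> given vectors.\<close>

lemma nontrivial_solution:
  fixes M :: "'i \<Rightarrow> 'j \<Rightarrow> complex"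
  assumes "finite I" "finite J" "card I < card J"
  shows "\<exists>c. (\<exists>j\<in>J. c j \<noteq> 0) \<and> (\<forall>i\<in>I. (\<Sum>j\<in>J. c j * M i j) = 0)"
  using assms
proof (induction I arbitrary: J M rule: finite_induct)
  case empty
  then obtain j where "j \<in> J" by fastforce
  then show ?case by (intro exI[of _ "\<lambda>_. 1"]) auto
next
  case (insert i I)
  show ?case
  proof (cases "\<forall>j\<in>J. M i j = 0")
    case True
    from insert.IH[of J M] insert.prems insert.hyps obtain c where
      "(\<exists>j\<in>J. c j \<noteq> 0)" "(\<forall>i\<in>I. (\<Sum>j\<in>J. c j * M i j) = 0)" by auto
    with True show ?thesis by (intro exI[of _ c]) auto
  next
    case False
    then obtain j0 where j0: "j0 \<in> J" "M i j0 \<noteq> 0" by blast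
    define J' where "J' = J - {j0}"
    have J': "finite J'" "card I < card J'" and J: "J = insert j0 J'" "j0 \<notin> J'"
      using insert.prems insert.hyps j0 by (auto simp: J'_def)
    from insert.IH[OF J', of "\<lambda>i' j. M i' j - M i' j0 * M i j / M i j0"] obtain c where
      c: "\<exists>j\<in>J'. c j \<noteq> 0" "\<forall>i'\<in>I. (\<Sum>j\<in>J'. c j * (M i' j - M i' j0 * M i j / M i j0)) = 0" by blast
    define s where "s = (\<Sum>j\<in>J'. c j * M i j) / M i j0"
    define c' where "c' j = (if j = j0 then - s else c j)" for j
    have sum: "(\<Sum>j\<in>J. c' j * M i' j) = (\<Sum>j\<in>J'. c j * M i' j) - s * M i' j0" for i'
    proof -
      have "(\<Sum>j\<in>J'. c' j * M i' j) = (\<Sum>j\<in>J'. c j * M i' j)"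
        by (rule sum.cong) (use J in \<open>auto simp: c'_def\<close>)
      then show ?thesis using J J'(1) by (simp add: c'_def)
    qed
    have "(\<Sum>j\<in>J. c' j * M i j) = 0" unfolding sum using j0 by (simp add: s_def)
    moreover have "(\<Sum>j\<in>J. c' j * M i' j) = 0" if "i' \<in> I" for i'
    proof -
      have "0 = (\<Sum>j\<in>J'. c j * M i' j) - (\<Sum>j\<in>J'. c j * M i j) * M i' j0 / M i j0"
        using c(2)[rule_format, OF that]
        by (simp add: algebra_simps sum_subtractf sum_distrib_left sum_divide_distrib)
      then show ?thesis unfolding sum by (simp add: s_def)
    qed
    moreover have "\<exists>j\<in>J. c' j \<noteq> 0" using c(1) J by (auto simp: c'_def)
    ultimately show ?thesis by blast
  qed
qed

section \<open>Rayleigh quotients and min-max for two semidefinite forms\<close>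

section \<open>Spectral theory of a pair of forms\<close>

lemma cnj_mult_self: "cnj z * z = (of_real (cmod z))\<^sup>2"
  by (metis complex_norm_square mult.commute of_real_power)

locale form_pair = a: psd_form scale W a + b: psd_form scale W b
  for scale :: "complex \<Rightarrow> 'v::ab_group_add \<Rightarrow> 'v" (infixr "\<odot>" 75)
    and W :: "'v set" and a b :: "'v \<Rightarrow> 'v \<Rightarrow> complex"
begin

abbreviation q :: "'v \<Rightarrow> 'v \<Rightarrow> complex" where "q x y \<equiv> a x y + b x y"

sublocale q: psd_form scale W q
  by unfold_locales
    (auto simp: a.subspace_V a.add_left b.add_left a.scale_left b.scale_left a.nonneg b.nonneg
        algebra_simps simp flip: a.hermitian b.hermitian)

text \<open>"Nonzero" and "equal" are read modulo vectors of zero \<open>q\<close>-norm, here and in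
  \<open>eigen_sequence\<close>; on the cell these are exactly the functions that vanish almost
  everywhere.\<close>

definition eigenvector :: "real \<Rightarrow> 'v \<Rightarrow> bool" where
  "eigenvector m x \<longleftrightarrow> x \<in> W \<and> Re (q x x) \<noteq> 0 \<and> (\<forall>y\<in>W. a x y = of_real m * b x y)"

definition eigen_sequence :: "(nat \<Rightarrow> real) \<Rightarrow> (nat \<Rightarrow> 'v) \<Rightarrow> bool" where
  "eigen_sequence L U \<longleftrightarrow>
     (\<forall>k\<ge>1. eigenvector (L k) (U k)) \<and>
     (\<forall>j\<ge>1. \<forall>k\<ge>1. b (U j) (U k) = (if j = k then 1 else 0)) \<and>
     mono_on {1..} L \<and> filterlim L at_top sequentially \<and>
     (\<forall>m x. eigenvector m x \<longrightarrow>
        (\<exists>c. let y = x - (\<Sum>k | k \<ge> 1 \<and> L k = m. c k \<odot> U k) in Re (q y y) = 0))"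

lemma a_le_q: "x \<in> W \<Longrightarrow> Re (a x x) \<le> Re (q x x)" and b_le_q: "x \<in> W \<Longrightarrow> Re (b x x) \<le> Re (q x x)"
  using a.nonneg b.nonneg by auto

lemma eigen_a_left: "\<lbrakk>eigenvector m x; y \<in> W\<rbrakk> \<Longrightarrow> a x y = of_real m * b x y"
  by (auto simp: eigenvector_def)

lemma eigen_a_right:
  assumes "eigenvector m x" "y \<in> W" shows "a y x = of_real m * b y x"
proof -
  have "x \<in> W" using assms by (simp add: eigenvector_def)
  then show ?thesis
    using eigen_a_left[OF assms] a.hermitian[of x y] b.hermitian[of x y] assms by simp
qed

lemma orthonormal_sum:
  assumes I: "finite I" and U: "\<And>i. i \<in> I \<Longrightarrow> U i \<in> W"
    and o: "\<And>i j. \<lbrakk>i \<in> I; j \<in> I\<rbrakk> \<Longrightarrow> b (U i) (U j) = (if i = j then 1 else 0)"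
  shows "j \<in> I \<Longrightarrow> b (\<Sum>i\<in>I. c i \<odot> U i) (U j) = c j"
    and "Re (b (\<Sum>i\<in>I. c i \<odot> U i) (\<Sum>i\<in>I. c i \<odot> U i)) = (\<Sum>i\<in>I. (cmod (c i))\<^sup>2)"
proof -
  show 1: "b (\<Sum>i\<in>I. c i \<odot> U i) (U j) = c j" if "j \<in> I" for j
  proof -
    have "b (\<Sum>i\<in>I. c i \<odot> U i) (U j) = (\<Sum>i\<in>I. c i * b (U i) (U j))"
      using that U by (simp add: b.sum_left b.scale_left)
    also have "\<dots> = (\<Sum>i\<in>I. if i = j then c i else 0)"
      by (rule sum.cong) (use that o in auto)
    finally show ?thesis using I that by simp
  qed
  have "b (\<Sum>i\<in>I. c i \<odot> U i) (\<Sum>i\<in>I. c i \<odot> U i) = (\<Sum>j\<in>I. cnj (c j) * c j)"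
    using U by (simp add: b.sum_right b.sum_closed b.scale_right 1)
  also have "\<dots> = of_real (\<Sum>j\<in>I. (cmod (c j))\<^sup>2)"
    unfolding of_real_sum by (simp add: cnj_mult_self)
  finally show "Re (b (\<Sum>i\<in>I. c i \<odot> U i) (\<Sum>i\<in>I. c i \<odot> U i)) = (\<Sum>i\<in>I. (cmod (c i))\<^sup>2)" by simp
qed

lemma eigen_sum_a:
  assumes I: "finite I" and e: "\<And>i. i \<in> I \<Longrightarrow> eigenvector (L i) (U i)"
    and o: "\<And>i j. \<lbrakk>i \<in> I; j \<in> I\<rbrakk> \<Longrightarrow> b (U i) (U j) = (if i = j then 1 else 0)"
  shows "Re (a (\<Sum>i\<in>I. c i \<odot> U i) (\<Sum>i\<in>I. c i \<odot> U i)) = (\<Sum>i\<in>I. L i * (cmod (c i))\<^sup>2)"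
proof -
  have U: "U i \<in> W" if "i \<in> I" for i using e that by (simp add: eigenvector_def)
  have "a (\<Sum>i\<in>I. c i \<odot> U i) (\<Sum>i\<in>I. c i \<odot> U i)
      = (\<Sum>j\<in>I. cnj (c j) * (of_real (L j) * b (\<Sum>i\<in>I. c i \<odot> U i) (U j)))"
    using U by (simp add: a.sum_right a.sum_closed a.scale_right eigen_a_right[OF e])
  also have "\<dots> = (\<Sum>j\<in>I. cnj (c j) * (of_real (L j) * c j))"
    by (rule sum.cong) (use orthonormal_sum(1)[where U=U and c=c] I U o in auto)
  also have "\<dots> = of_real (\<Sum>j\<in>I. L j * (cmod (c j))\<^sup>2)"
    unfolding of_real_sum by (intro sum.cong) (simp_all add: cnj_mult_self mult.left_commute[of "cnj _"])
  finally show ?thesis by simp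
qed

end

text \<open>\<open>complete\<close> and \<open>compact\<close> say that the seminorm of
  \<open>q\<close> is complete and that \<open>b\<close> is compact relative to it; a Cauchy
  condition replaces convergence in the latter, so that no limit space of traces has to be named.
  \<open>infinite_rank\<close> keeps the sequence of eigenvalues from ending.\<close>

locale spectral_pair = form_pair scale W a b
  for scale :: "complex \<Rightarrow> 'v::ab_group_add \<Rightarrow> 'v" (infixr "\<odot>" 75)
    and W :: "'v set" and a b :: "'v \<Rightarrow> 'v \<Rightarrow> complex" +
  assumes complete: "\<And>x. \<lbrakk>\<And>n::nat. x n \<in> W;
        \<And>e. e > 0 \<Longrightarrow> \<exists>N. \<forall>m\<ge>N. \<forall>n\<ge>N. Re (q (x m - x n) (x m - x n)) < e\<rbrakk>
      \<Longrightarrow> \<exists>l\<in>W. (\<lambda>n. Re (q (x n - l) (x n - l))) \<longlonglongrightarrow> 0"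
    and compact: "\<And>x M. \<lbrakk>\<And>n::nat. x n \<in> W; \<And>n. Re (q (x n) (x n)) \<le> M\<rbrakk>
      \<Longrightarrow> \<exists>r::nat\<Rightarrow>nat. strict_mono r \<and>
        (\<forall>e>0. \<exists>N. \<forall>m\<ge>N. \<forall>n\<ge>N. Re (b (x (r m) - x (r n)) (x (r m) - x (r n))) < e)"
    and infinite_rank: "\<And>(U :: nat \<Rightarrow> 'v) n. (\<And>i. U i \<in> W) \<Longrightarrow>
        \<exists>x\<in>W. Re (b x x) \<noteq> 0 \<and> (\<forall>i<n. b x (U i) = 0)"
begin

text \<open>Direct method: minimise the Rayleigh quotient of \<open>a\<close> against
  \<open>b\<close> on the \<open>b\<close>-orthogonal complement \<open>V\<close> of the
  eigenvectors already found. Relative compactness of \<open>b\<close> makes the infimum a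
  minimum.\<close>

lemma minimizer:
  fixes I :: "nat set"
  assumes I: "finite I" and e: "\<And>i. i \<in> I \<Longrightarrow> eigenvector (L i) (U i)"
    and o: "\<And>i j. \<lbrakk>i \<in> I; j \<in> I\<rbrakk> \<Longrightarrow> b (U i) (U j) = (if i = j then 1 else 0)"
  shows "\<exists>m x. eigenvector m x \<and> b x x = 1 \<and> (\<forall>i\<in>I. b x (U i) = 0) \<and>
     (\<forall>y\<in>W. (\<forall>i\<in>I. b y (U i) = 0) \<longrightarrow> m * Re (b y y) \<le> Re (a y y))"
proof -
  have UW: "U i \<in> W" if "i \<in> I" for i using e that by (simp add: eigenvector_def)
  define V where "V = {x\<in>W. \<forall>i\<in>I. b x (U i) = 0}"
  have VW: "V \<subseteq> W" by (auto simp: V_def)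
  have subV: "a.subspace V"
    unfolding V_def using UW by (auto simp: a.subspace_def b.add_left b.scale_left)
  define S where "S = {Re (a x x) |x. x \<in> V \<and> Re (b x x) = 1}"
  define m where "m = Inf S"
  obtain y0 where y0: "y0 \<in> V" "Re (b y0 y0) \<noteq> 0"
  proof -
    obtain N where N: "I \<subseteq> {..<N}" using I finite_nat_iff_bounded by blast
    obtain x where "x \<in> W" "Re (b x x) \<noteq> 0" "\<forall>i<N. b x (if i \<in> I then U i else 0) = 0"
      using infinite_rank[of "\<lambda>i. if i \<in> I then U i else 0" N] UW by fastforce
    then show ?thesis using N by (intro that[of x]) (force simp: V_def)+
  qed
  have scal: "\<exists>c. (1 / sqrt (Re (b x x)))\<^sup>2 * Re (b x x) = 1 \<and> (cmod c)\<^sup>2 = 1 / Re (b x x)"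
    if "x \<in> V" "Re (b x x) \<noteq> 0" for x
  proof (intro exI conjI)
    have "Re (b x x) > 0" using b.nonneg[of x] that VW by fastforce
    then show "(1 / sqrt (Re (b x x)))\<^sup>2 * Re (b x x) = 1"
       "(cmod (of_real (1 / sqrt (Re (b x x)))))\<^sup>2 = 1 / Re (b x x)"
      by (simp_all add: power_divide norm_divide)
  qed
  have bdd: "bdd_below S"
    by (rule bdd_belowI[of _ 0]) (use VW a.nonneg in \<open>auto simp: S_def\<close>)
  have mle: "m * Re (b x x) \<le> Re (a x x)" if x: "x \<in> V" for x
  proof (cases "Re (b x x) = 0")
    case True then show ?thesis using x VW a.nonneg by auto
  next
    case False
    obtain c where c: "(cmod c)\<^sup>2 = 1 / Re (b x x)" using scal[OF x False] by blast
    have xW: "x \<in> W" using x VW by auto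
    have pos: "Re (b x x) > 0" using b.nonneg[OF xW] False by linarith
    have "c \<odot> x \<in> V" using subV x by (simp add: a.subspace_scale)
    moreover have "Re (b (c \<odot> x) (c \<odot> x)) = 1" using xW c False by (simp add: b.Re_scale)
    ultimately have "Re (a (c \<odot> x) (c \<odot> x)) \<in> S" by (auto simp: S_def)
    then have "m \<le> Re (a (c \<odot> x) (c \<odot> x))" unfolding m_def using bdd by (rule cInf_lower)
    also have "\<dots> = Re (a x x) / Re (b x x)" using xW c by (simp add: a.Re_scale)
    finally show ?thesis using pos by (simp add: field_simps)
  qed
  have Sne: "S \<noteq> {}"
  proof -
    obtain c where c: "(cmod c)\<^sup>2 = 1 / Re (b y0 y0)" using scal[OF y0] by blast
    have "c \<odot> y0 \<in> V" using subV y0 by (simp add: a.subspace_scale)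
    moreover have "Re (b (c \<odot> y0) (c \<odot> y0)) = 1" using y0 VW c by (auto simp: b.Re_scale)
    ultimately show ?thesis by (auto simp: S_def)
  qed
  have "\<exists>x. x \<in> V \<and> Re (b x x) = 1 \<and> Re (a x x) < m + 1 / real (Suc n)" for n
  proof -
    have "\<exists>s\<in>S. s < m + 1 / real (Suc n)"
      using cInf_lessD[OF Sne, of "m + 1 / real (Suc n)"] by (simp add: m_def)
    then show ?thesis by (auto simp: S_def)
  qed
  then obtain x where x: "\<And>n::nat. x n \<in> V" "\<And>n. Re (b (x n) (x n)) = 1"
      "\<And>n. Re (a (x n) (x n)) < m + 1 / real (Suc n)" by metis
  have xW: "x n \<in> W" for n using x(1) VW by auto
  have m0: "m \<ge> 0" unfolding m_def
    by (rule cInf_greatest[OF Sne]) (use VW a.nonneg in \<open>auto simp: S_def\<close>)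
  have "Re (q (x n) (x n)) \<le> m + 2" for n
  proof -
    have "1 / real (Suc n) \<le> 1" by simp
    then have "Re (a (x n) (x n)) \<le> m + 1" using x(3)[of n] by linarith
    then show ?thesis using x(2)[of n] by simp
  qed
  from compact[of x, OF xW this] obtain r :: "nat \<Rightarrow> nat" where r: "strict_mono r"
    and rb: "\<forall>e>0. \<exists>N. \<forall>j\<ge>N. \<forall>n\<ge>N. Re (b (x (r j) - x (r n)) (x (r j) - x (r n))) < e"
    by blast
  \<comment> \<open>By the parallelogram law and the lower bound at \<open>x j + x n\<close>, a
    minimising sequence is \<open>a\<close>-Cauchy as soon as it is \<open>b\<close>-Cauchy.\<close>
  have adiff: "Re (a (x j - x n) (x j - x n)) \<le> m * Re (b (x j - x n) (x j - x n)) + 2 / real (Suc j) + 2 / real (Suc n)" for j n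
  proof -
    have "m * Re (b (x j + x n) (x j + x n)) \<le> Re (a (x j + x n) (x j + x n))"
      by (rule mle) (use subV x(1) a.subspace_add in blast)
    then have "Re (a (x j - x n) (x j - x n)) - m * Re (b (x j - x n) (x j - x n))
       \<le> 2 * (Re (a (x j) (x j)) - m) + 2 * (Re (a (x n) (x n)) - m)"
      using x(2) by (simp add: a.parallelogram b.parallelogram xW algebra_simps)
    also have "\<dots> \<le> 2 * (1 / real (Suc j)) + 2 * (1 / real (Suc n))"
      using x(3)[of j] x(3)[of n] by (intro add_mono mult_left_mono) auto
    finally show ?thesis by simp
  qed
  have "\<exists>l\<in>W. (\<lambda>n. Re (q (x (r n) - l) (x (r n) - l))) \<longlonglongrightarrow> 0"
  proof (rule complete[of "\<lambda>n. x (r n)"])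
    fix e :: real assume e: "e > 0"
    define d where "d = e / (2 * (m + 1))"
    have d: "d > 0" using e m0 by (simp add: d_def)
    from rb[rule_format, OF d] obtain N1 where N1: "\<And>j n. \<lbrakk>j \<ge> N1; n \<ge> N1\<rbrakk> \<Longrightarrow> Re (b (x (r j) - x (r n)) (x (r j) - x (r n))) < d"
      by blast
    obtain N2 :: nat where N2: "1 / real (Suc N2) < e / 8" using e reals_Archimedean[of "e/8"] by (auto simp: inverse_eq_divide)
    have small: "2 / real (Suc (r j)) < e / 4" if "j \<ge> N2" for j
    proof -
      have "real (Suc N2) \<le> real (Suc (r j))" using that seq_suble[OF r, of j] by simp
      then have "1 / real (Suc (r j)) \<le> 1 / real (Suc N2)" by (simp add: frac_le)
      then have "1 / real (Suc (r j)) < e / 8" using N2 by linarith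
      then show ?thesis by linarith
    qed
    show "\<exists>N. \<forall>j\<ge>N. \<forall>n\<ge>N. Re (q (x (r j) - x (r n)) (x (r j) - x (r n))) < e"
    proof (intro exI[of _ "max N1 N2"] allI impI)
      fix j n assume jn: "max N1 N2 \<le> j" "max N1 N2 \<le> n"
      let ?b = "Re (b (x (r j) - x (r n)) (x (r j) - x (r n)))"
      have "Re (q (x (r j) - x (r n)) (x (r j) - x (r n))) \<le> (m + 1) * ?b + 2 / real (Suc (r j)) + 2 / real (Suc (r n))"
        using adiff[of "r j" "r n"] by (simp add: algebra_simps)
      also have "\<dots> < (m + 1) * d + e / 4 + e / 4"
        using small[of j] small[of n] jn N1[of j n] m0
        by (intro add_strict_mono) (auto intro: mult_strict_left_mono)
      also have "\<dots> = e" using m0 by (simp add: d_def field_simps)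
      finally show "Re (q (x (r j) - x (r n)) (x (r j) - x (r n))) < e" .
    qed
  qed (rule xW)
  then obtain l where l: "l \<in> W" "(\<lambda>n. Re (q (x (r n) - l) (x (r n) - l))) \<longlonglongrightarrow> 0" by blast
  have la: "(\<lambda>n. sqrt (Re (a (x (r n) - l) (x (r n) - l)))) \<longlonglongrightarrow> 0"
    and lb: "(\<lambda>n. sqrt (Re (b (x (r n) - l) (x (r n) - l)))) \<longlonglongrightarrow> 0"
  proof -
    have "(\<lambda>n. Re (a (x (r n) - l) (x (r n) - l))) \<longlonglongrightarrow> 0"
      by (rule tendsto_sandwich[OF _ _ tendsto_const l(2)])
        (use a_le_q a.nonneg xW l in \<open>auto intro!: always_eventually\<close>)
    from tendsto_real_sqrt[OF this] show "(\<lambda>n. sqrt (Re (a (x (r n) - l) (x (r n) - l)))) \<longlonglongrightarrow> 0" by simp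
    have "(\<lambda>n. Re (b (x (r n) - l) (x (r n) - l))) \<longlonglongrightarrow> 0"
      by (rule tendsto_sandwich[OF _ _ tendsto_const l(2)])
        (use b_le_q b.nonneg xW l in \<open>auto intro!: always_eventually\<close>)
    from tendsto_real_sqrt[OF this] show "(\<lambda>n. sqrt (Re (b (x (r n) - l) (x (r n) - l)))) \<longlonglongrightarrow> 0" by simp
  qed
  have lV: "l \<in> V"
  proof -
    have "b l (U i) = 0" if i: "i \<in> I" for i
    proof -
      have "cmod (b l (U i)) \<le> sqrt (Re (b (x (r n) - l) (x (r n) - l))) * sqrt (Re (b (U i) (U i)))" for n
      proof -
        have "b (x (r n) - l) (U i) = - b l (U i)"
          using x(1)[of "r n"] xW l i UW by (simp add: b.diff_left V_def)
        then show ?thesis using b.cauchy_schwarz[of "x (r n) - l" "U i"] xW l UW i by simp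
      qed
      moreover have "(\<lambda>n. sqrt (Re (b (x (r n) - l) (x (r n) - l))) * sqrt (Re (b (U i) (U i)))) \<longlonglongrightarrow> 0 * sqrt (Re (b (U i) (U i)))"
        by (intro tendsto_intros lb)
      ultimately have "cmod (b l (U i)) \<le> 0"
        by (intro LIMSEQ_le_const[of _ 0]) auto
      then show ?thesis by simp
    qed
    then show ?thesis using l by (auto simp: V_def)
  qed
  have conv: "(\<lambda>n. sqrt (Re (f (x (r n)) (x (r n))))) \<longlonglongrightarrow> sqrt (Re (f l l))"
    if "psd_form scale W f" "(\<lambda>n. sqrt (Re (f (x (r n) - l) (x (r n) - l)))) \<longlonglongrightarrow> 0" for f
  proof -
    interpret f: psd_form scale W f by fact
    have "\<bar>sqrt (Re (f (x (r n)) (x (r n)))) - sqrt (Re (f l l))\<bar> \<le> sqrt (Re (f (x (r n) - l) (x (r n) - l)))" for n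
      using f.triangle[of "x (r n) - l" l] f.triangle_diff[of "x (r n)" "x (r n) - l"] xW l by simp
    then have "(\<lambda>n. sqrt (Re (f (x (r n)) (x (r n)))) - sqrt (Re (f l l))) \<longlonglongrightarrow> 0"
      by (intro Lim_null_comparison[OF always_eventually that(2)]) simp
    then show ?thesis by (simp add: LIM_zero_iff)
  qed
  have bl: "Re (b l l) = 1"
    using conv[OF b.psd_form_axioms lb] x(2) by (simp add: LIMSEQ_const_iff)
  have al: "Re (a l l) = m"
  proof -
    have "(\<lambda>n. Re (a (x (r n)) (x (r n)))) \<longlonglongrightarrow> Re (a l l)"
      using tendsto_power[OF conv[OF a.psd_form_axioms la], of 2] xW l a.nonneg by simp
    moreover have "(\<lambda>n. m + 1 / real (Suc (r n))) \<longlonglongrightarrow> m + 0"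
      using LIMSEQ_subseq_LIMSEQ[OF LIMSEQ_inverse_real_of_nat r]
      by (intro tendsto_intros) (simp add: o_def inverse_eq_divide)
    ultimately have "Re (a l l) \<le> m"
      using x(3) by (intro LIMSEQ_le[of "\<lambda>n. Re (a (x (r n)) (x (r n)))" _ "\<lambda>n. m + 1 / real (Suc (r n))"])
         (auto intro!: less_imp_le)
    then show ?thesis using mle[OF lV] bl by simp
  qed
  \<comment> \<open>\<open>a - m b\<close> is semidefinite on \<open>V\<close> and \<open>l\<close>
    is null for it, so \<open>null_left\<close> gives the eigenvalue equation against
    \<open>V\<close>.\<close>
  have psdd: "psd_form scale V (\<lambda>x y. a x y - of_real m * b x y)"
    by unfold_locales (use subV VW mle in \<open>auto simp: subset_iff a.add_left b.add_left a.scale_left b.scale_left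
        algebra_simps simp flip: a.hermitian b.hermitian\<close>)
  have el: "a l y = of_real m * b l y" if y: "y \<in> V" for y
  proof -
    interpret d: psd_form scale V "\<lambda>x y. a x y - of_real m * b x y" by (rule psdd)
    show ?thesis using d.null_left[OF lV y] al bl by simp
  qed
  have "eigenvector m l"
    unfolding eigenvector_def
  proof (intro conjI ballI)
    show "Re (q l l) \<noteq> 0" using al bl m0 by simp
    fix y assume y: "y \<in> W"
    \<comment> \<open>A general test vector differs from one in \<open>V\<close> by its projection
      \<open>z\<close> onto the earlier eigenvectors; against these both forms vanish at
      \<open>l\<close>.\<close>
    define z where "z = (\<Sum>i\<in>I. b y (U i) \<odot> U i)"
    have zW: "z \<in> W" unfolding z_def using UW by (auto intro!: a.sum_closed)
    have lU: "b l (U i) = 0" "a l (U i) = 0" if "i \<in> I" for i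
      using lV that l eigen_a_right[OF e[OF that], of l] by (auto simp: V_def)
    have "b (y - z) (U i) = 0" if "i \<in> I" for i
      using orthonormal_sum(1)[OF I UW o that, of "\<lambda>i. b y (U i)"] y zW UW that
      by (simp add: b.diff_left z_def)
    then have yz: "y - z \<in> V" using y zW by (simp add: V_def)
    have "a l z = 0" "b l z = 0"
      unfolding z_def using UW l lU by (simp_all add: a.sum_right b.sum_right a.scale_right b.scale_right)
    then show "a l y = of_real m * b l y" using el[OF yz] y zW l by (simp add: a.diff_right b.diff_right)
  qed (rule l)
  moreover have "b l l = 1" using b.self_real[OF l(1)] bl by simp
  ultimately show ?thesis using lV mle by (auto simp: V_def)
qed

text \<open>Successive minimisation by dependent choice. \<open>P\<close> records the minimality of
  each step along with the eigenvalue equation, since monotonicity and the spanning clause are read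
  off from it.\<close>

lemma eigen_sequence_exists: "\<exists>L U. eigen_sequence L U"
proof -
  define P :: "(nat \<Rightarrow> real \<times> 'v) \<Rightarrow> nat \<Rightarrow> real \<times> 'v \<Rightarrow> bool" where
    "P F n r \<longleftrightarrow> eigenvector (fst r) (snd r) \<and> b (snd r) (snd r) = 1 \<and> (\<forall>i<n. b (snd r) (snd (F i)) = 0) \<and>
     (\<forall>y\<in>W. (\<forall>i<n. b y (snd (F i)) = 0) \<longrightarrow> fst r * Re (b y y) \<le> Re (a y y))" for F n r
  have "\<exists>F. \<forall>n. P F n (F n)"
  proof (rule dependent_wellorder_choice)
    show "P f x r = P g x r" if "\<And>y. y < x \<Longrightarrow> f y = g y" for r f g x
      using that by (simp add: P_def)
    fix n F assume IH: "\<And>i. i < n \<Longrightarrow> P F i (F i)"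
    have "b (snd (F i)) (snd (F j)) = (if i = j then 1 else 0)" if "i \<in> {..<n}" "j \<in> {..<n}" for i j
    proof -
      have W: "snd (F i) \<in> W" "snd (F j) \<in> W" using IH[of i] IH[of j] that by (auto simp: P_def eigenvector_def)
      consider "i < j" | "i = j" | "j < i" by linarith
      then show ?thesis
      proof cases
        case 1 then have "b (snd (F j)) (snd (F i)) = 0" using IH[of j] that by (simp add: P_def)
        then show ?thesis using 1 b.hermitian[OF W(2,1)] by simp
      qed (use IH[of i] that in \<open>auto simp: P_def\<close>)
    qed
    moreover have "eigenvector (fst (F i)) (snd (F i))" if "i \<in> {..<n}" for i
      using IH that by (simp add: P_def)
    ultimately obtain m x where
      "eigenvector m x" "b x x = 1" "\<forall>i\<in>{..<n}. b x (snd (F i)) = 0"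
      "\<forall>y\<in>W. (\<forall>i\<in>{..<n}. b y (snd (F i)) = 0) \<longrightarrow> m * Re (b y y) \<le> Re (a y y)"
      using minimizer[of "{..<n}" "\<lambda>i. fst (F i)" "\<lambda>i. snd (F i)"] by blast
    then show "\<exists>r. P F n r" by (intro exI[of _ "(m, x)"]) (simp add: P_def)
  qed
  then obtain F where F: "\<And>n. P F n (F n)" by blast
  \<comment> \<open>The recursion counts from 0, eigenvalue sequences from 1.\<close>
  define L where "L n = fst (F (n - 1))" for n
  define U where "U n = snd (F (n - 1))" for n
  have eig: "eigenvector (fst (F n)) (snd (F n))" for n using F by (simp add: P_def)
  have W: "snd (F n) \<in> W" for n using eig by (simp add: eigenvector_def)
  have orth: "b (snd (F i)) (snd (F j)) = (if i = j then 1 else 0)" for i j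
  proof -
    consider "i < j" | "i = j" | "j < i" by linarith
    then show ?thesis
    proof cases
      case 1 then have "b (snd (F j)) (snd (F i)) = 0" using F[of j] by (simp add: P_def)
      then show ?thesis using 1 b.hermitian[OF W W, of j i] by simp
    qed (use F[of i] in \<open>auto simp: P_def\<close>)
  qed
  have aF: "Re (a (snd (F n)) (snd (F n))) = fst (F n)" for n
    using eigen_a_left[OF eig W, of n n] orth by simp
  have le: "fst (F i) * Re (b y y) \<le> Re (a y y)" if "y \<in> W" "\<And>j. j < i \<Longrightarrow> b y (snd (F j)) = 0" for i y
    using F[of i] that by (auto simp: P_def)
  have monoF: "fst (F i) \<le> fst (F j)" if "i \<le> j" for i j
    using le[OF W[of j], of i] that orth aF by simp
  \<comment> \<open>Under a bound on the eigenvalues the eigenvectors would have a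
    \<open>b\<close>-Cauchy subsequence, but distinct orthonormal vectors have squared distance
    2.\<close>
  have unb: "\<exists>n. fst (F n) > M" for M
  proof (rule ccontr)
    assume "\<not> ?thesis"
    then have "Re (q (snd (F n)) (snd (F n))) \<le> M + 1" for n using aF orth by (simp add: not_less)
    from compact[of "\<lambda>n. snd (F n)", OF W this] obtain r :: "nat \<Rightarrow> nat" where r: "strict_mono r"
      and rb: "\<forall>e>0. \<exists>N. \<forall>j\<ge>N. \<forall>n\<ge>N. Re (b (snd (F (r j)) - snd (F (r n))) (snd (F (r j)) - snd (F (r n)))) < e"
      by blast
    from rb[rule_format, of 1] obtain N where
      "\<forall>j\<ge>N. \<forall>n\<ge>N. Re (b (snd (F (r j)) - snd (F (r n))) (snd (F (r j)) - snd (F (r n)))) < 1" by auto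
    then obtain N where "Re (b (snd (F (r N)) - snd (F (r (Suc N)))) (snd (F (r N)) - snd (F (r (Suc N))))) < 1"
      using Suc_n_not_le_n nat_le_linear by blast
    moreover have "r N \<noteq> r (Suc N)" using strict_monoD[OF r, of N "Suc N"] by simp
    ultimately show False using orth W by (simp add: b.Re_diff)
  qed
  have "eigen_sequence L U"
    unfolding eigen_sequence_def
  proof (intro conjI allI impI)
    show "eigenvector (L k) (U k)" for k by (simp add: L_def U_def eig)
    show "b (U j) (U k) = (if j = k then 1 else 0)" if "1 \<le> j" "1 \<le> k" for j k
      using that orth by (auto simp: U_def)
    show "mono_on {1..} L" by (auto simp: mono_on_def L_def intro!: monoF)
    show "filterlim L at_top sequentially"
      unfolding filterlim_at_top eventually_sequentially
    proof
      fix Z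
      obtain n where n: "fst (F n) > Z" using unb by blast
      have "Z \<le> L k" if "k \<ge> Suc n" for k
        proof -
        have "n \<le> k - 1" using that by linarith
        from monoF[OF this] n show ?thesis by (simp add: L_def)
      qed
      then show "\<exists>N. \<forall>n\<ge>N. Z \<le> L n" by blast
    qed
    fix m x assume ex: "eigenvector m x"
    then have xW: "x \<in> W" by (simp add: eigenvector_def)
    obtain n0 where n0: "fst (F n0) > m" using unb by blast
    define K where "K = {k. k \<ge> 1 \<and> L k = m}"
    have "K \<subseteq> {..Suc n0}"
    proof
      fix k assume "k \<in> K"
      then have "L k = m" by (simp add: K_def)
      then have "\<not> n0 \<le> k - 1" using monoF[of n0 "k - 1"] n0 by (auto simp: L_def)
      then show "k \<in> {..Suc n0}" by auto
    qed
    then have K: "finite K" using finite_subset by blast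
    define z where "z = (\<Sum>k\<in>K. b x (U k) \<odot> U k)"
    define y where "y = x - z"
    have UW: "U k \<in> W" for k by (simp add: U_def W)
    have zW: "z \<in> W" unfolding z_def using UW by (auto intro!: a.sum_closed)
    have yW: "y \<in> W" using xW zW by (simp add: y_def)
    have yeig: "a y w = of_real m * b y w" if w: "w \<in> W" for w
    proof -
      have "a z w = of_real m * b z w"
        unfolding z_def using UW w
        by (simp add: a.sum_left b.sum_left a.scale_left b.scale_left sum_distrib_left)
          (auto intro!: sum.cong simp: K_def L_def U_def eigen_a_left[OF eig])
      then show ?thesis using eigen_a_left[OF ex w] xW zW w by (simp add: y_def a.diff_left b.diff_left algebra_simps)
    qed
    \<comment> \<open>The remainder \<open>y\<close> is orthogonal to the eigenvectors of
      \<open>m\<close> by projection and to all others because the eigenvalues differ. Minimality at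
      \<open>n0\<close> then bounds its quotient below by a number above \<open>m\<close>, so that
      \<open>y\<close> is null.\<close>
    have yU: "b y (snd (F j)) = 0" for j
    proof (cases "Suc j \<in> K")
      case True
      have "b z (U (Suc j)) = b x (U (Suc j))"
        unfolding z_def by (rule orthonormal_sum(1)[OF K UW]) (use True orth in \<open>auto simp: U_def K_def\<close>)
      then show ?thesis using xW zW UW W by (simp add: y_def b.diff_left U_def)
    next
      case False
      then have "fst (F j) \<noteq> m" by (simp add: K_def L_def)
      moreover have "of_real m * b y (snd (F j)) = of_real (fst (F j)) * b y (snd (F j))"
        using yeig[OF W[of j]] eigen_a_right[OF eig[of j] yW] by metis
      ultimately show ?thesis by auto
    qed
    have "Re (b y y) = 0"
    proof (rule ccontr)
      assume "Re (b y y) \<noteq> 0"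
      then have "Re (b y y) > 0" using b.nonneg[OF yW] by simp
      moreover have "fst (F n0) * Re (b y y) \<le> m * Re (b y y)"
        using le[OF yW, of n0] yU yeig[OF yW] by simp
      ultimately show False using n0 by simp
    qed
    then have "Re (q y y) = 0" using yeig[OF yW] by simp
    then show "\<exists>c. let y = x - (\<Sum>k | k \<ge> 1 \<and> L k = m. c k \<odot> U k) in Re (q y y) = 0"
      unfolding y_def z_def K_def by (intro exI[of _ "\<lambda>k. b x (U k)"]) (simp add: Let_def)
  qed
  then show ?thesis by blast
qed

text \<open>An arbitrary \<open>eigen_sequence\<close> need not come from the construction above.
  The minimiser on the complement is an eigenvector for some \<open>m\<close>; if
  \<open>m < L n\<close>, then the spanning clause writes it through \<open>U k\<close> with
  \<open>k < n\<close>, to which it is orthogonal, against \<open>b y y = 1\<close>.\<close>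

lemma variational:
  assumes S: "eigen_sequence L U" and n: "n \<ge> 1" and x: "x \<in> W" "\<And>i. \<lbrakk>1 \<le> i; i < n\<rbrakk> \<Longrightarrow> b x (U i) = 0"
  shows "L n * Re (b x x) \<le> Re (a x x)"
proof -
  note S' = S[unfolded eigen_sequence_def]
  have "b (U i) (U j) = (if i = j then 1 else 0)" if "i \<in> {1..<n}" "j \<in> {1..<n}" for i j using S' that by simp
  moreover have "eigenvector (L i) (U i)" if "i \<in> {1..<n}" for i
    using S' that by simp
  ultimately obtain m y where y: "eigenvector m y" "b y y = 1" "\<forall>i\<in>{1..<n}. b y (U i) = 0"
     and le: "\<forall>y\<in>W. (\<forall>i\<in>{1..<n}. b y (U i) = 0) \<longrightarrow> m * Re (b y y) \<le> Re (a y y)"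
    using minimizer[of "{1..<n}" L U] by blast
  have "L n \<le> m"
  proof (rule ccontr)
    assume less: "\<not> L n \<le> m"
    obtain c where c: "let z = y - (\<Sum>k | k \<ge> 1 \<and> L k = m. c k \<odot> U k) in Re (q z z) = 0"
      using S' y(1) by blast
    define z where "z = (\<Sum>k | k \<ge> 1 \<and> L k = m. c k \<odot> U k)"
    have kn: "k < n" if "k \<ge> 1" "L k = m" for k
    proof (rule ccontr)
      assume "\<not> k < n"
      then have "L n \<le> L k" using S' n that by (auto intro: mono_onD)
      then show False using less that by simp
    qed
    have UW: "U k \<in> W" if "k \<ge> 1" for k using S' that by (simp add: eigenvector_def)
    have yW: "y \<in> W" using y by (simp add: eigenvector_def)
    have zW: "z \<in> W" unfolding z_def using UW by (auto intro!: a.sum_closed)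
    have "b y z = (\<Sum>k | k \<ge> 1 \<and> L k = m. b y (c k \<odot> U k))"
      unfolding z_def by (rule b.sum_right) (use UW yW in auto)
    also have "\<dots> = 0"
      by (rule sum.neutral) (use UW yW y(3) kn in \<open>auto simp: b.scale_right\<close>)
    finally have "b y z = 0" .
    moreover have "b (y - z) y = 0"
    proof -
      have "Re (q (y - z) (y - z)) = 0" using c by (simp add: z_def Let_def)
      then have "Re (b (y - z) (y - z)) = 0"
        using b_le_q[of "y - z"] b.nonneg[of "y - z"] yW zW by simp
      then show ?thesis using b.null_left yW zW by simp
    qed
    ultimately show False using y(2) yW zW b.hermitian[OF yW zW] by (simp add: b.diff_left)
  qed
  then have "L n * Re (b x x) \<le> m * Re (b x x)" using b.nonneg[OF x(1)] by (rule mult_right_mono)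
  also have "\<dots> \<le> Re (a x x)" using le x by auto
  finally show ?thesis .
qed

text \<open>Upper half of min-max: some nontrivial combination of the \<open>n\<close> trial vectors
  is orthogonal to the first \<open>n - 1\<close> eigenvectors. Positivity of \<open>b\<close> in
  the hypothesis also encodes linear independence of the trial vectors.\<close>

lemma eigenvalue_le:
  assumes S: "eigen_sequence L U" and n: "n \<ge> 1" and y: "\<And>i. i \<in> {1..n} \<Longrightarrow> y i \<in> W"
    and K: "\<And>c. \<exists>j\<in>{1..n}. c j \<noteq> 0 \<Longrightarrow> let x = (\<Sum>i\<in>{1..n}. c i \<odot> y i) in
              Re (a x x) \<le> K * Re (b x x) \<and> Re (b x x) > 0"
  shows "L n \<le> K"
proof -
  have UW: "U k \<in> W" if "k \<ge> 1" for k using S that by (simp add: eigen_sequence_def eigenvector_def)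
  obtain c where c: "\<exists>j\<in>{1..n}. c j \<noteq> 0" "\<forall>i\<in>{1..<n}. (\<Sum>j\<in>{1..n}. c j * b (y j) (U i)) = 0"
    using nontrivial_solution[of "{1..<n}" "{1..n}" "\<lambda>i j. b (y j) (U i)"] n by auto
  define x where "x = (\<Sum>i\<in>{1..n}. c i \<odot> y i)"
  have xW: "x \<in> W" unfolding x_def using y by (intro a.sum_closed) auto
  have "b x (U i) = 0" if "1 \<le> i" "i < n" for i
  proof -
    have "b x (U i) = (\<Sum>j\<in>{1..n}. b (c j \<odot> y j) (U i))"
      unfolding x_def by (rule b.sum_left) (use y UW that in auto)
    also have "\<dots> = (\<Sum>j\<in>{1..n}. c j * b (y j) (U i))"
      by (rule sum.cong) (use y UW that in \<open>auto simp: b.scale_left\<close>)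
    finally show ?thesis using c(2) that by simp
  qed
  then have "L n * Re (b x x) \<le> Re (a x x)" using variational[OF S n xW] by blast
  also have "\<dots> \<le> K * Re (b x x)" using K[OF c(1)] by (simp add: x_def Let_def)
  finally show ?thesis using K[OF c(1)] by (simp add: x_def Let_def)
qed

end

section \<open>Eigenvalue shifts caused by linear constraints\<close>

section \<open>Perturbation of a simple eigenvalue by constraints\<close>

lemma sum_cmod_sq_pos:
  assumes "finite I" "\<exists>j\<in>I. c j \<noteq> 0"
  shows "0 < (\<Sum>i\<in>I. (cmod (c i))\<^sup>2)"
proof -
  obtain j where "j \<in> I" "c j \<noteq> 0" using assms(2) by blast
  then show ?thesis using assms(1) by (intro sum_pos2[of I j]) auto
qed

context spectral_pair
begin

lemma eigen_sequenceD:
  assumes "eigen_sequence L U"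
  shows "j \<ge> 1 \<Longrightarrow> eigenvector (L j) (U j)" "j \<ge> 1 \<Longrightarrow> U j \<in> W"
    "\<lbrakk>i \<ge> 1; j \<ge> 1\<rbrakk> \<Longrightarrow> b (U i) (U j) = (if i = j then 1 else 0)"
    "\<lbrakk>1 \<le> i; i \<le> j\<rbrakk> \<Longrightarrow> L i \<le> L j" "filterlim L at_top sequentially"
proof -
  note S = assms[unfolded eigen_sequence_def]
  show 1: "j \<ge> 1 \<Longrightarrow> eigenvector (L j) (U j)" for j using S by blast
  then show "j \<ge> 1 \<Longrightarrow> U j \<in> W" unfolding eigenvector_def by blast
  show "\<lbrakk>i \<ge> 1; j \<ge> 1\<rbrakk> \<Longrightarrow> b (U i) (U j) = (if i = j then 1 else 0)" using S by blast
  have "mono_on {1..} L" using S by blast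
  then show "\<lbrakk>1 \<le> i; i \<le> j\<rbrakk> \<Longrightarrow> L i \<le> L j" by (auto intro: mono_onD)
  show "filterlim L at_top sequentially" using S by blast
qed

text \<open>On the complement of the first \<open>N - 1\<close> eigenvectors \<open>b\<close> is at
  most \<open>a / L N\<close>, so an energy bound makes the tail uniformly small; finitely many
  coefficients remain, and these tend to zero.\<close>

lemma null_if_coefficients_null:
  assumes S: "eigen_sequence L U" and x: "\<And>n::nat. x n \<in> W" "\<And>n. Re (q (x n) (x n)) \<le> M"
    and c: "\<And>j. j \<ge> 1 \<Longrightarrow> (\<lambda>n. b (x n) (U j)) \<longlonglongrightarrow> 0"
  shows "(\<lambda>n. Re (b (x n) (x n))) \<longlonglongrightarrow> 0"
proof -
  note D = eigen_sequenceD[OF S]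
  have M: "M \<ge> 0" using order_trans[OF q.nonneg[OF x(1)] x(2)] .
  have "(\<lambda>n. sqrt (Re (b (x n) (x n)))) \<longlonglongrightarrow> 0"
  proof (rule LIMSEQ_I)
    fix e :: real assume e: "e > 0"
    \<comment> \<open>With this threshold \<open>sqrt (M / t) < e\<close>; the 1 added to
      \<open>M\<close> keeps \<open>t\<close> positive.\<close>
    define t where "t = (4 * (M + 1)) / e\<^sup>2"
    have t: "t > 0" using e M by (simp add: t_def)
    have "\<forall>\<^sub>F N in sequentially. N \<ge> 1 \<and> L N \<ge> t"
      using D(5) eventually_ge_at_top[of "1::nat"] unfolding filterlim_at_top
      by (intro eventually_conj) auto
    then obtain N where N: "N \<ge> 1" "L N \<ge> t" unfolding eventually_sequentially by (metis order_refl)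
    define I where "I = {1..<N}"
    have I: "finite I" and UI: "\<And>i. i \<in> I \<Longrightarrow> U i \<in> W" and eI: "\<And>i. i \<in> I \<Longrightarrow> eigenvector (L i) (U i)"
      and oI: "\<And>i j. \<lbrakk>i \<in> I; j \<in> I\<rbrakk> \<Longrightarrow> b (U i) (U j) = (if i = j then 1 else 0)"
      using D(1-3) by (auto simp: I_def)
    define z where "z n = (\<Sum>i\<in>I. b (x n) (U i) \<odot> U i)" for n
    have zW: "z n \<in> W" for n unfolding z_def using UI by (intro a.sum_closed) auto
    have bz_eq: "Re (b (z n) (z n)) = (\<Sum>i\<in>I. (cmod (b (x n) (U i)))\<^sup>2)" for n
      unfolding z_def by (rule orthonormal_sum(2)[OF I UI oI])
    have az_eq: "Re (a (z n) (z n)) = (\<Sum>i\<in>I. L i * (cmod (b (x n) (U i)))\<^sup>2)" for n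
      unfolding z_def by (rule eigen_sum_a[OF I eI oI])
    have bz: "(\<lambda>n. sqrt (Re (b (z n) (z n)))) \<longlonglongrightarrow> sqrt (\<Sum>i\<in>I. (cmod 0)\<^sup>2)"
      unfolding bz_eq by (intro tendsto_intros c) (simp add: I_def)
    have az: "(\<lambda>n. sqrt (Re (a (z n) (z n)))) \<longlonglongrightarrow> sqrt (\<Sum>i\<in>I. L i * (cmod 0)\<^sup>2)"
      unfolding az_eq by (intro tendsto_intros c) (simp add: I_def)
    have bound: "sqrt (Re (b (x n) (x n))) \<le> (sqrt M + sqrt (Re (a (z n) (z n)))) / sqrt t + sqrt (Re (b (z n) (z n)))" for n
    proof -
      let ?y = "x n - z n"
      have yW: "?y \<in> W" using x(1) zW by simp
      have "b ?y (U i) = 0" if "1 \<le> i" "i < N" for i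
        using orthonormal_sum(1)[OF I UI oI, of i "\<lambda>i. b (x n) (U i)"] that x(1) zW UI
        by (simp add: b.diff_left z_def I_def)
      then have "L N * Re (b ?y ?y) \<le> Re (a ?y ?y)" using variational[OF S N(1) yW] by blast
      moreover have "t * Re (b ?y ?y) \<le> L N * Re (b ?y ?y)" using N b.nonneg[OF yW] by (rule_tac mult_right_mono)
      ultimately have "t * Re (b ?y ?y) \<le> Re (a ?y ?y)" by linarith
      then have "sqrt t * sqrt (Re (b ?y ?y)) \<le> sqrt (Re (a ?y ?y))"
        unfolding real_sqrt_mult[symmetric] by simp
      also have "\<dots> \<le> sqrt (Re (a (x n) (x n))) + sqrt (Re (a (z n) (z n)))"
        by (rule a.triangle_diff[OF x(1) zW])
      also have "\<dots> \<le> sqrt M + sqrt (Re (a (z n) (z n)))"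
        using a_le_q[OF x(1), of n] x(2)[of n] by simp
      finally have "sqrt (Re (b ?y ?y)) \<le> (sqrt M + sqrt (Re (a (z n) (z n)))) / sqrt t"
        using t by (simp add: field_simps)
      then show ?thesis using b.triangle[OF yW zW, of n] by simp
    qed
    have lim: "(\<lambda>n. (sqrt M + sqrt (Re (a (z n) (z n)))) / sqrt t + sqrt (Re (b (z n) (z n)))) \<longlonglongrightarrow> (sqrt M + 0) / sqrt t + 0"
      using az bz by (intro tendsto_intros) (use t in auto)
    have "(sqrt M + 0) / sqrt t + 0 = sqrt (M / t)" by (simp add: real_sqrt_divide)
    also have "\<dots> < e"
    proof -
      have "M / t = e\<^sup>2 * (M / (4 * (M + 1)))" using e by (simp add: t_def)
      also have "\<dots> < e\<^sup>2 * 1" using e M by (intro mult_strict_left_mono) (auto simp: field_simps)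
      finally have "sqrt (M / t) < sqrt (e\<^sup>2)" by (simp only: mult_1_right real_sqrt_less_iff)
      then show ?thesis using e by simp
    qed
    finally have "\<forall>\<^sub>F n in sequentially. (sqrt M + sqrt (Re (a (z n) (z n)))) / sqrt t + sqrt (Re (b (z n) (z n))) < e"
      using order_tendstoD(2)[OF lim] by blast
    then have "\<forall>\<^sub>F n in sequentially. norm (sqrt (Re (b (x n) (x n))) - 0) < e"
      by (rule eventually_mono) (use bound b.nonneg[OF x(1)] in \<open>auto intro: le_less_trans\<close>)
    then show "\<exists>N. \<forall>n\<ge>N. norm (sqrt (Re (b (x n) (x n))) - 0) < e"
      by (simp add: eventually_sequentially)
  qed
  from tendsto_power[OF this, of 2] show ?thesis using b.nonneg[OF x(1)] by simp
qed

text \<open>The first \<open>k\<close> eigenvectors on \<open>V\<close> are trial vectors in the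
  larger space \<open>W\<close>.\<close>

lemma eigenvalue_le_subspace:
  assumes S: "eigen_sequence L U" and k: "k \<ge> 1" and V: "spectral_pair scale V a b" "V \<subseteq> W"
    and S': "form_pair.eigen_sequence scale V a b L' U'"
  shows "L k \<le> L' k"
proof -
  interpret V: spectral_pair scale V a b by (rule V(1))
  note D = V.eigen_sequenceD[OF S']
  show ?thesis
  proof (rule eigenvalue_le[OF S k])
    show "U' i \<in> W" if "i \<in> {1..k}" for i using V(2) D(2)[of i] that by auto
    fix c :: "nat \<Rightarrow> complex" assume c: "\<exists>j\<in>{1..k}. c j \<noteq> 0"
    let ?x = "\<Sum>i\<in>{1..k}. c i \<odot> U' i"
    have A: "Re (a ?x ?x) = (\<Sum>i\<in>{1..k}. L' i * (cmod (c i))\<^sup>2)"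
      by (rule V.eigen_sum_a) (simp_all add: D(1,3))
    have B: "Re (b ?x ?x) = (\<Sum>i\<in>{1..k}. (cmod (c i))\<^sup>2)"
      by (rule V.orthonormal_sum(2)) (simp_all add: D(2,3))
    have "Re (a ?x ?x) \<le> L' k * Re (b ?x ?x)"
      unfolding A B sum_distrib_left by (intro sum_mono mult_right_mono D(4)) auto
    moreover have "Re (b ?x ?x) > 0" unfolding B using c by (intro sum_cmod_sq_pos) auto
    ultimately show "let x = ?x in Re (a x x) \<le> L' k * Re (b x x) \<and> Re (b x x) > 0" by (simp add: Let_def)
  qed
qed

text \<open>The comparison with \<open>V = W\<close>, used in both directions. It makes the definite
  description in \<open>kth_eigenvalue\<close> meaningful.\<close>

lemma eigen_sequence_unique:
  assumes "eigen_sequence L U" "eigen_sequence L' U'" "k \<ge> 1"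
  shows "L k = L' k"
  using eigenvalue_le_subspace[OF assms(1,3) spectral_pair_axioms subset_refl assms(2)]
    eigenvalue_le_subspace[OF assms(2,3) spectral_pair_axioms subset_refl assms(1)] by linarith

end

text \<open>\<open>H\<close> carries the limit problem, \<open>W n\<close> the problem with the
  constraint of the \<open>n\<close>-th aperture. \<open>approximable\<close> says that the
  constraints disappear in the limit. Simplicity is stated for indices, the form in which one
  divides by \<open>L j - L k\<close>.\<close>

locale constrained_pairs = H: spectral_pair scale H a b
  for scale :: "complex \<Rightarrow> 'v::ab_group_add \<Rightarrow> 'v" (infixr "\<odot>" 75)
    and H :: "'v set" and a b :: "'v \<Rightarrow> 'v \<Rightarrow> complex" +
  fixes W :: "nat \<Rightarrow> 'v set" and L :: "nat \<Rightarrow> real" and U :: "nat \<Rightarrow> 'v" and k :: nat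
    and Ln :: "nat \<Rightarrow> nat \<Rightarrow> real" and Vn :: "nat \<Rightarrow> nat \<Rightarrow> 'v"
  assumes pairs: "\<And>n. spectral_pair scale (W n) a b"
    and W_subset: "\<And>n. W n \<subseteq> H"
    and approximable: "\<And>x. x \<in> H \<Longrightarrow>
          \<exists>y. (\<forall>n. y n \<in> W n) \<and> (\<lambda>n. Re (H.q (x - y n) (x - y n))) \<longlonglongrightarrow> 0"
    and seq: "H.eigen_sequence L U"
    and k: "k \<ge> 1" and simple: "\<And>j. \<lbrakk>j \<ge> 1; L j = L k\<rbrakk> \<Longrightarrow> j = k"
    and seq_n: "\<And>n. form_pair.eigen_sequence scale (W n) a b (Ln n) (Vn n)"
begin

text \<open>The form of the limit problem shifted to its \<open>k\<close>-th eigenvalue, with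
  \<open>U k\<close> in its kernel. It is indefinite for \<open>k > 1\<close>, so estimates go
  through the \<open>q\<close>-norm as in \<open>Q_bound\<close> instead of Cauchy-Schwarz for
  \<open>Q\<close>.\<close>

definition Q :: "'v \<Rightarrow> 'v \<Rightarrow> complex" where "Q x y = a x y - of_real (L k) * b x y"

lemma U_eigen: "j \<ge> 1 \<Longrightarrow> H.eigenvector (L j) (U j)"
  by (rule H.eigen_sequenceD[OF seq])

lemma U_in: "j \<ge> 1 \<Longrightarrow> U j \<in> H"
  using U_eigen by (simp add: H.eigenvector_def)

lemma U_orth: "\<lbrakk>i \<ge> 1; j \<ge> 1\<rbrakk> \<Longrightarrow> b (U i) (U j) = (if i = j then 1 else 0)"
  by (rule H.eigen_sequenceD[OF seq])

lemma L_mono: "\<lbrakk>1 \<le> i; i \<le> j\<rbrakk> \<Longrightarrow> L i \<le> L j"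
  by (rule H.eigen_sequenceD[OF seq])

lemma L_nonneg: "j \<ge> 1 \<Longrightarrow> L j \<ge> 0"
  using H.eigen_a_left[OF U_eigen U_in, of j j] H.a.nonneg[OF U_in, of j] by (simp add: U_orth)

lemma in_H: "x \<in> W n \<Longrightarrow> x \<in> H"
  using W_subset by blast

lemma Q_U: "y \<in> H \<Longrightarrow> Q (U k) y = 0"
  using H.eigen_a_left[OF U_eigen] k by (simp add: Q_def)

lemma Q_U_right: "y \<in> H \<Longrightarrow> Q y (U k) = 0"
  using H.eigen_a_right[OF U_eigen] k by (simp add: Q_def)

lemma Q_simps:
  "\<lbrakk>x \<in> H; y \<in> H; z \<in> H\<rbrakk> \<Longrightarrow> Q (x + y) z = Q x z + Q y z"
  "\<lbrakk>x \<in> H; y \<in> H; z \<in> H\<rbrakk> \<Longrightarrow> Q (x - y) z = Q x z - Q y z"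
  "\<lbrakk>x \<in> H; y \<in> H; z \<in> H\<rbrakk> \<Longrightarrow> Q x (y + z) = Q x y + Q x z"
  "\<lbrakk>x \<in> H; y \<in> H; z \<in> H\<rbrakk> \<Longrightarrow> Q x (y - z) = Q x y - Q x z"
  "\<lbrakk>x \<in> H; y \<in> H\<rbrakk> \<Longrightarrow> Q (c \<odot> x) y = c * Q x y"
  by (simp_all add: Q_def H.a.add_left H.b.add_left H.a.diff_left H.b.diff_left H.a.add_right H.b.add_right
      H.a.diff_right H.b.diff_right H.a.scale_left H.b.scale_left algebra_simps)

lemma Q_bound:
  assumes "x \<in> H" "y \<in> H"
  shows "cmod (Q x y) \<le> (1 + L k) * (sqrt (Re (H.q x x)) * sqrt (Re (H.q y y)))"
proof -
  let ?s = "sqrt (Re (H.q x x)) * sqrt (Re (H.q y y))"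
  have le: "cmod (f x y) \<le> ?s" if "psd_form scale H f" "\<And>z. z \<in> H \<Longrightarrow> Re (f z z) \<le> Re (H.q z z)" for f
  proof -
    interpret f: psd_form scale H f by fact
    have "cmod (f x y) \<le> sqrt (Re (f x x)) * sqrt (Re (f y y))" by (rule f.cauchy_schwarz[OF assms])
    also have "\<dots> \<le> ?s" using assms that f.nonneg H.q.nonneg by (intro mult_mono real_sqrt_le_mono) auto
    finally show ?thesis .
  qed
  have "cmod (Q x y) \<le> cmod (a x y) + L k * cmod (b x y)"
    unfolding Q_def using norm_triangle_ineq4[of "a x y" "of_real (L k) * b x y"] L_nonneg[OF k] by (simp add: norm_mult)
  also have "\<dots> \<le> ?s + L k * ?s"
    using le[OF H.a.psd_form_axioms H.a_le_q] le[OF H.b.psd_form_axioms H.b_le_q] L_nonneg[OF k]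
    by (intro add_mono mult_left_mono) auto
  finally show ?thesis by (simp add: algebra_simps)
qed

text \<open>Testing with \<open>U j\<close> gives \<open>L j - L k\<close> times the
  \<open>j\<close>-th coefficient, so by simplicity the coefficients with
  \<open>j \<noteq> k\<close> tend to zero; the remaining one is zero by hypothesis.\<close>

lemma weak_null:
  assumes x: "\<And>n::nat. x n \<in> H" "\<And>n. Re (H.q (x n) (x n)) \<le> M" "\<And>n. b (x n) (U k) = 0"
    and Q0: "\<And>R. R \<in> H \<Longrightarrow> (\<lambda>n. Q (x n) R) \<longlonglongrightarrow> 0"
  shows "(\<lambda>n. Re (b (x n) (x n))) \<longlonglongrightarrow> 0"
proof (rule H.null_if_coefficients_null[OF seq x(1,2)])
  fix j :: nat assume j: "j \<ge> 1"
  show "(\<lambda>n. b (x n) (U j)) \<longlonglongrightarrow> 0"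
  proof (cases "j = k")
    case True then show ?thesis by (simp add: x(3))
  next
    case False
    then have ne: "L j - L k \<noteq> 0" using simple[OF j] by auto
    have "Q (x n) (U j) = of_real (L j - L k) * b (x n) (U j)" for n
      using H.eigen_a_right[OF U_eigen[OF j] x(1)] by (simp add: Q_def algebra_simps)
    then have "b (x n) (U j) = Q (x n) (U j) / of_real (L j - L k)" for n
      using ne by (metis nonzero_mult_div_cancel_left of_real_eq_0_iff)
    moreover have "(\<lambda>n. Q (x n) (U j) / of_real (L j - L k)) \<longlonglongrightarrow> 0 / of_real (L j - L k)"
      using ne by (intro tendsto_intros Q0 U_in j) auto
    ultimately show ?thesis by simp
  qed
qed

lemma Vn_eigen: "j \<ge> 1 \<Longrightarrow> form_pair.eigenvector (W n) a b (Ln n j) (Vn n j)"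
proof -
  interpret W: spectral_pair scale "W n" a b by (rule pairs)
  show "j \<ge> 1 \<Longrightarrow> ?thesis" by (rule W.eigen_sequenceD[OF seq_n])
qed

lemma Vn_in: "j \<ge> 1 \<Longrightarrow> Vn n j \<in> W n"
proof -
  interpret W: spectral_pair scale "W n" a b by (rule pairs)
  show "j \<ge> 1 \<Longrightarrow> ?thesis" using Vn_eigen[of j n] by (simp add: W.eigenvector_def)
qed

lemma Vn_orth: "\<lbrakk>i \<ge> 1; j \<ge> 1\<rbrakk> \<Longrightarrow> b (Vn n i) (Vn n j) = (if i = j then 1 else 0)"
proof -
  interpret W: spectral_pair scale "W n" a b by (rule pairs)
  show "\<lbrakk>i \<ge> 1; j \<ge> 1\<rbrakk> \<Longrightarrow> ?thesis" by (rule W.eigen_sequenceD[OF seq_n])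
qed

lemma Vn_a: "\<lbrakk>j \<ge> 1; y \<in> W n\<rbrakk> \<Longrightarrow> a (Vn n j) y = of_real (Ln n j) * b (Vn n j) y"
proof -
  interpret W: spectral_pair scale "W n" a b by (rule pairs)
  show "\<lbrakk>j \<ge> 1; y \<in> W n\<rbrakk> \<Longrightarrow> ?thesis" using W.eigen_a_left[OF Vn_eigen] by simp
qed

lemma L_le_Ln: "L k \<le> Ln n k"
  by (rule H.eigenvalue_le_subspace[OF seq k pairs W_subset seq_n])

text \<open>Approximants in \<open>W n\<close> of the first \<open>k\<close> eigenvectors are trial
  vectors for the upper bound; the lower bound is monotonicity in the space.\<close>

lemma Ln_tendsto: "(\<lambda>n. Ln n k) \<longlonglongrightarrow> L k"
proof -
  have "\<forall>i. \<exists>y. i \<ge> 1 \<longrightarrow> (\<forall>n. y n \<in> W n) \<and> (\<lambda>n. Re (H.q (U i - y n) (U i - y n))) \<longlonglongrightarrow> 0"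
    using approximable U_in by blast
  from choice[OF this] obtain y where y': "\<forall>i. i \<ge> 1 \<longrightarrow> (\<forall>n. y i n \<in> W n) \<and>
      (\<lambda>n. Re (H.q (U i - y i n) (U i - y i n))) \<longlonglongrightarrow> 0" ..
  have y: "y i n \<in> W n" if "i \<ge> 1" for i n using y' that by blast
  have y0: "(\<lambda>n. Re (H.q (U i - y i n) (U i - y i n))) \<longlonglongrightarrow> 0" if "i \<ge> 1" for i using y' that by blast
  have yH: "y i n \<in> H" if "i \<ge> 1" for i n by (rule in_H[OF y[OF that]])
  define r where "r n = (\<Sum>i\<in>{1..k}. sqrt (Re (H.q (U i - y i n) (U i - y i n))))" for n
  have r0: "r \<longlonglongrightarrow> 0"
  proof -
    have "(\<lambda>n. sqrt (Re (H.q (U i - y i n) (U i - y i n)))) \<longlonglongrightarrow> 0" if "i \<in> {1..k}" for i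
      using tendsto_real_sqrt[OF y0[of i]] that by simp
    then have "r \<longlonglongrightarrow> (\<Sum>i\<in>{1..k}. 0)" unfolding r_def[abs_def] by (rule tendsto_sum)
    then show ?thesis by simp
  qed
  \<comment> \<open>A combination with coefficient norm \<open>s\<close> moves by at most
    \<open>s * r n\<close> in the energy norm when the \<open>U i\<close> are replaced by their
    approximants. Its \<open>a\<close>-norm is then at most \<open>(sqrt (L k) + r n) * s\<close>
    and its \<open>b\<close>-norm at least \<open>(1 - r n) * s\<close>.\<close>
  have upper: "Ln n k \<le> ((sqrt (L k) + r n) / (1 - r n))\<^sup>2" if rn: "r n < 1" for n
  proof -
    interpret W: spectral_pair scale "W n" a b by (rule pairs)
    show ?thesis
    proof (rule W.eigenvalue_le[OF seq_n k])
      show "y i n \<in> W n" if "i \<in> {1..k}" for i using that y by simp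
      fix c :: "nat \<Rightarrow> complex" assume c: "\<exists>j\<in>{1..k}. c j \<noteq> 0"
      let ?x = "\<Sum>i\<in>{1..k}. c i \<odot> y i n" and ?u = "\<Sum>i\<in>{1..k}. c i \<odot> U i"
      define s where "s = sqrt (\<Sum>i\<in>{1..k}. (cmod (c i))\<^sup>2)"
      have xH: "?x \<in> H" by (rule H.a.sum_closed) (simp add: yH)
      have uH: "?u \<in> H" by (rule H.a.sum_closed) (simp add: U_in)
      have spos: "s > 0" unfolding s_def using sum_cmod_sq_pos[OF _ c] by simp
      have cs: "cmod (c i) \<le> s" if "i \<in> {1..k}" for i
        unfolding s_def using that by (intro real_le_rsqrt member_le_sum) auto
      have r_nonneg: "r n \<ge> 0" unfolding r_def
        by (intro sum_nonneg real_sqrt_ge_zero H.q.nonneg) (simp add: U_in yH)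
      have dq: "sqrt (Re (H.q (?u - ?x) (?u - ?x))) \<le> s * r n"
      proof -
        have "?u - ?x = (\<Sum>i\<in>{1..k}. c i \<odot> (U i - y i n))"
          by (simp add: sum_subtractf H.a.scale_right_diff_distrib)
        then have "sqrt (Re (H.q (?u - ?x) (?u - ?x)))
            \<le> (\<Sum>i\<in>{1..k}. sqrt (Re (H.q (c i \<odot> (U i - y i n)) (c i \<odot> (U i - y i n)))))"
          using H.q.triangle_sum[of "{1..k}" "\<lambda>i. c i \<odot> (U i - y i n)"] U_in yH by simp
        also have "\<dots> = (\<Sum>i\<in>{1..k}. cmod (c i) * sqrt (Re (H.q (U i - y i n) (U i - y i n))))"
          using U_in yH by (intro sum.cong refl H.q.sqrt_scale) auto
        also have "\<dots> \<le> (\<Sum>i\<in>{1..k}. s * sqrt (Re (H.q (U i - y i n) (U i - y i n))))"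
          by (intro sum_mono mult_right_mono cs real_sqrt_ge_zero H.q.nonneg) (simp_all add: U_in yH)
        finally show ?thesis by (simp add: r_def sum_distrib_left)
      qed
      have ux: "?u - ?x \<in> H" using uH xH by blast
      have bu: "sqrt (Re (b ?u ?u)) = s" unfolding s_def
        by (subst H.orthonormal_sum(2)) (simp_all add: U_in U_orth)
      have au: "sqrt (Re (a ?u ?u)) \<le> sqrt (L k) * s" unfolding s_def real_sqrt_mult[symmetric]
      proof (rule real_sqrt_le_mono)
        have "Re (a ?u ?u) = (\<Sum>i\<in>{1..k}. L i * (cmod (c i))\<^sup>2)"
          by (rule H.eigen_sum_a) (simp_all add: U_eigen U_orth)
        also have "\<dots> \<le> (\<Sum>i\<in>{1..k}. L k * (cmod (c i))\<^sup>2)"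
          by (intro sum_mono mult_right_mono L_mono) auto
        finally show "Re (a ?u ?u) \<le> L k * (\<Sum>i\<in>{1..k}. (cmod (c i))\<^sup>2)" by (simp add: sum_distrib_left)
      qed
      have "sqrt (Re (a ?x ?x)) \<le> sqrt (Re (a ?u ?u)) + sqrt (Re (a (?u - ?x) (?u - ?x)))"
        using H.a.triangle_diff[OF uH ux] by simp
      also have "\<dots> \<le> sqrt (L k) * s + s * r n"
        using au dq real_sqrt_le_mono[OF H.a_le_q[OF ux]] by linarith
      finally have ax: "sqrt (Re (a ?x ?x)) \<le> (sqrt (L k) + r n) * s" by (simp add: algebra_simps)
      have "s \<le> sqrt (Re (b ?x ?x)) + sqrt (Re (b (?u - ?x) (?u - ?x)))"
        using H.b.triangle[OF xH ux] bu by simp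
      moreover have "sqrt (Re (b (?u - ?x) (?u - ?x))) \<le> s * r n"
        using dq real_sqrt_le_mono[OF H.b_le_q[OF ux]] by linarith
      moreover have "(1 - r n) * s = s - s * r n" by (simp add: algebra_simps)
      ultimately have bx: "(1 - r n) * s \<le> sqrt (Re (b ?x ?x))" by linarith
      have pos: "0 < (1 - r n) * s" using rn spos by simp
      then have "0 < sqrt (Re (b ?x ?x))" using bx by linarith
      then have "Re (b ?x ?x) > 0" by (simp only: real_sqrt_gt_0_iff)
      moreover have "Re (a ?x ?x) \<le> ((sqrt (L k) + r n) / (1 - r n))\<^sup>2 * Re (b ?x ?x)"
      proof -
        have "sqrt (Re (a ?x ?x)) \<le> (sqrt (L k) + r n) / (1 - r n) * ((1 - r n) * s)"
          using ax rn by simp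
        also have "\<dots> \<le> (sqrt (L k) + r n) / (1 - r n) * sqrt (Re (b ?x ?x))"
          using bx rn r_nonneg L_nonneg[OF k] by (intro mult_left_mono) auto
        finally have "(sqrt (Re (a ?x ?x)))\<^sup>2 \<le> ((sqrt (L k) + r n) / (1 - r n) * sqrt (Re (b ?x ?x)))\<^sup>2"
          using H.a.nonneg[OF xH] by (intro power_mono) auto
        then show ?thesis
          by (simp only: power_mult_distrib real_sqrt_pow2[OF H.a.nonneg[OF xH]] real_sqrt_pow2[OF H.b.nonneg[OF xH]])
      qed
      ultimately show "let x = ?x in Re (a x x) \<le> ((sqrt (L k) + r n) / (1 - r n))\<^sup>2 * Re (b x x) \<and> Re (b x x) > 0"
        by (simp add: Let_def)
    qed
  qed
  have "(\<lambda>n. ((sqrt (L k) + r n) / (1 - r n))\<^sup>2) \<longlonglongrightarrow> ((sqrt (L k) + 0) / (1 - 0))\<^sup>2"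
    by (intro tendsto_intros r0) simp
  then have "(\<lambda>n. ((sqrt (L k) + r n) / (1 - r n))\<^sup>2) \<longlonglongrightarrow> L k" using L_nonneg[OF k] by simp
  moreover have "\<forall>\<^sub>F n in sequentially. Ln n k \<le> ((sqrt (L k) + r n) / (1 - r n))\<^sup>2"
    
    by (rule eventually_mono[OF order_tendstoD(2)[OF r0, of 1] upper]) simp
  moreover have "\<forall>\<^sub>F n in sequentially. L k \<le> Ln n k" by (simp add: L_le_Ln)
  ultimately show ?thesis by (rule_tac tendsto_sandwich[OF _ _ tendsto_const])
qed

text \<open>
  The vector \<open>v n\<close> is the defect \<open>U k - u\<close> of the constrained eigenvector \<open>u\<close> normalised by \<open>b u (U k) = 1\<close>.
  The eigenvalue shift is then \<open>a (v n) w\<close> for every admissible correction \<open>w\<close> of \<open>U k\<close>.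
\<close>

lemma perturbation:
  obtains v \<rho> where "\<And>n. v n \<in> H" "\<rho> \<longlonglongrightarrow> 0"
    "\<forall>\<^sub>F n in sequentially. U k - v n \<in> W n \<and>
       Re (H.q (v n) (v n)) \<le> (1 + \<rho> n) * (Ln n k - L k) \<and>
       (\<forall>w\<in>H. (\<forall>y\<in>H. b w y = 0) \<longrightarrow> U k - w \<in> W n \<longrightarrow> Ln n k - L k \<le> (1 + \<rho> n) * Re (a w w))"
proof -
  define d where "d n = Ln n k - L k" for n
  define u where "u n = Vn n k" for n
  define \<beta> where "\<beta> n = b (u n) (U k)" for n
  have d0: "d \<longlonglongrightarrow> 0" unfolding d_def[abs_def] using Ln_tendsto by (simp add: LIM_zero)
  have dn: "d n \<ge> 0" for n using L_le_Ln by (simp add: d_def)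
  have UH: "U k \<in> H" by (rule U_in[OF k])
  have uW: "u n \<in> W n" for n unfolding u_def by (rule Vn_in[OF k])
  have uH: "u n \<in> H" for n by (rule in_H[OF uW])
  have bu: "b (u n) (u n) = 1" for n unfolding u_def using k by (simp add: Vn_orth)
  have bU: "b (U k) (U k) = 1" using k by (simp add: U_orth)
  \<comment> \<open>On \<open>W n\<close> the constrained eigenvector solves the limit equation up
    to the shift \<open>d n\<close>; a test vector outside \<open>W n\<close> costs in addition its
    distance from an approximant in \<open>W n\<close>.\<close>
  have Qu: "Q (u n) y = of_real (d n) * b (u n) y" if "y \<in> W n" for n y
    using Vn_a[OF k that] by (simp add: Q_def d_def u_def algebra_simps)
  have L0: "L k \<ge> 0" by (rule L_nonneg[OF k])
  have Qw: "Q (u n) R = Q (u n) (R - y) + of_real (d n) * b (u n) y" if "R \<in> H" "y \<in> W n" for n R y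
    using Qu[OF that(2)] Q_simps(4)[OF uH[of n] that(1) in_H[OF that(2)]] by simp
  obtain M where M: "\<And>n. Re (H.q (u n) (u n)) \<le> M"
  proof -
    have "convergent (\<lambda>n. Ln n k)" using Ln_tendsto by (auto simp: convergent_def)
    then have "Bseq (\<lambda>n. Ln n k)" by (rule convergent_imp_Bseq)
    then obtain K where "\<And>n. \<bar>Ln n k\<bar> \<le> K" by (auto simp: Bseq_def)
    then have "Ln n k \<le> K" for n using abs_le_D1 by blast
    moreover have "Re (H.q (u n) (u n)) = Ln n k + 1" for n
      using Vn_a[OF k uW] bu by (simp add: u_def)
    ultimately show ?thesis by (intro that[of "K + 1"]) simp
  qed
  have bound_b: "cmod (b x y) \<le> sqrt (Re (b x x)) * (sqrt (Re (H.q R R)) + sqrt (Re (H.q (R - y) (R - y))))"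
    if "x \<in> H" "y \<in> H" "R \<in> H" for x y R
  proof -
    have "sqrt (Re (b y y)) \<le> sqrt (Re (H.q y y))" using H.b_le_q[OF that(2)] by (rule real_sqrt_le_mono)
    also have "\<dots> \<le> sqrt (Re (H.q R R)) + sqrt (Re (H.q (R - y) (R - y)))"
      using H.q.triangle_diff[of R "R - y"] that by simp
    finally show ?thesis using H.b.cauchy_schwarz[OF that(1,2)] H.b.nonneg[OF that(1)]
      by (meson mult_left_mono order_trans real_sqrt_ge_zero)
  qed
  have approx: "\<exists>y e. (\<forall>n. y n \<in> W n) \<and> e \<longlonglongrightarrow> 0 \<and> (\<forall>n. sqrt (Re (H.q (R - y n) (R - y n))) = e n)"
    if R: "R \<in> H" for R
  proof -
    obtain y where y: "\<forall>n. y n \<in> W n" "(\<lambda>n. Re (H.q (R - y n) (R - y n))) \<longlonglongrightarrow> 0"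
      using approximable[OF R] by blast
    from tendsto_real_sqrt[OF y(2)]
    have "(\<lambda>n. sqrt (Re (H.q (R - y n) (R - y n)))) \<longlonglongrightarrow> 0" by simp
    with y(1) show ?thesis by (intro exI[of _ y] exI[of _ "\<lambda>n. sqrt (Re (H.q (R - y n) (R - y n)))"]) simp
  qed
  have \<beta>1: "cmod (\<beta> n) \<le> 1" for n
    using H.b.cauchy_schwarz[OF uH UH, of n] by (simp add: \<beta>_def bu bU)
  \<comment> \<open>In the \<open>b\<close>-norm \<open>u n\<close> approaches the line through
    \<open>U k\<close>. This forces the modulus of \<open>\<beta> n\<close> to tend to 1 and makes
    the later division by \<open>\<beta> n\<close> legitimate.\<close>
  have "(\<lambda>n. Re (b (u n - \<beta> n \<odot> U k) (u n - \<beta> n \<odot> U k))) \<longlonglongrightarrow> 0"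
  proof (rule weak_null)
    show "u n - \<beta> n \<odot> U k \<in> H" for n using uH UH by simp
    show "b (u n - \<beta> n \<odot> U k) (U k) = 0" for n
      using uH UH by (simp add: H.b.diff_left H.b.scale_left bU \<beta>_def)
    show "Re (H.q (u n - \<beta> n \<odot> U k) (u n - \<beta> n \<odot> U k)) \<le> 2 * M + 2 * Re (H.q (U k) (U k))" for n
    proof -
      have "Re (H.q (u n - \<beta> n \<odot> U k) (u n - \<beta> n \<odot> U k))
          \<le> 2 * Re (H.q (u n) (u n)) + 2 * Re (H.q (\<beta> n \<odot> U k) (\<beta> n \<odot> U k))"
        by (rule H.q.Re_diff_le) (use uH UH in simp_all)
      also have "Re (H.q (\<beta> n \<odot> U k) (\<beta> n \<odot> U k)) \<le> 1 * Re (H.q (U k) (U k))"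
        unfolding H.q.Re_scale[OF UH] using \<beta>1 H.q.nonneg[OF UH] by (intro mult_right_mono) (simp_all add: power_le_one)
      finally show ?thesis using M[of n] by linarith
    qed
    fix R assume R: "R \<in> H"
    obtain y e where y: "\<forall>n. y n \<in> W n" "e \<longlonglongrightarrow> 0" "\<forall>n. sqrt (Re (H.q (R - y n) (R - y n))) = e n"
      using approx[OF R] by blast
    have yH: "y n \<in> H" for n using y(1) by (blast intro: in_H)
    have "cmod (Q (u n - \<beta> n \<odot> U k) R) \<le> (1 + L k) * (sqrt M * e n) + d n * (sqrt (Re (H.q R R)) + e n)" for n
    proof -
      have "Q (u n - \<beta> n \<odot> U k) R = Q (u n) (R - y n) + of_real (d n) * b (u n) (y n)"
        using uH UH R y(1) Q_U[OF R] by (simp add: Q_simps Qw)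
      also have "cmod \<dots> \<le> cmod (Q (u n) (R - y n)) + d n * cmod (b (u n) (y n))"
        using norm_triangle_ineq dn by (metis abs_of_nonneg norm_mult norm_of_real)
      also have "\<dots> \<le> (1 + L k) * (sqrt M * e n) + d n * (sqrt (Re (H.q R R)) + e n)"
      proof (rule add_mono)
        have "cmod (Q (u n) (R - y n)) \<le> (1 + L k) * (sqrt (Re (H.q (u n) (u n))) * e n)"
          using Q_bound[OF uH[of n], of "R - y n"] R yH y(3) by simp
        also have "\<dots> \<le> (1 + L k) * (sqrt M * e n)"
          using M[of n] y(3) L0 H.q.nonneg[of "R - y n"] R yH
          by (intro mult_left_mono mult_right_mono real_sqrt_le_mono)
            (auto simp del: plus_complex.sel simp flip: y(3)[rule_format])
        finally show "cmod (Q (u n) (R - y n)) \<le> (1 + L k) * (sqrt M * e n)" .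
        show "d n * cmod (b (u n) (y n)) \<le> d n * (sqrt (Re (H.q R R)) + e n)"
          using bound_b[OF uH[of n] yH[of n] R] y(3) bu dn by (intro mult_left_mono) auto
      qed
      finally show ?thesis .
    qed
    moreover have "(\<lambda>n. (1 + L k) * (sqrt M * e n) + d n * (sqrt (Re (H.q R R)) + e n))
        \<longlonglongrightarrow> (1 + L k) * (sqrt M * 0) + 0 * (sqrt (Re (H.q R R)) + 0)"
      by (intro tendsto_intros d0 y(2))
    ultimately show "(\<lambda>n. Q (u n - \<beta> n \<odot> U k) R) \<longlonglongrightarrow> 0"
      by (rule_tac Lim_null_comparison[OF always_eventually]) auto
  qed
  moreover have "Re (b (u n - \<beta> n \<odot> U k) (u n - \<beta> n \<odot> U k)) = 1 - (cmod (\<beta> n))\<^sup>2" for n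
  proof -
    have "Re (b (u n) (\<beta> n \<odot> U k)) = (cmod (\<beta> n))\<^sup>2"
      unfolding H.b.scale_right[OF uH UH] by (simp add: \<beta>_def[symmetric] cnj_mult_self flip: of_real_power)
    then show ?thesis using uH[of n] UH by (simp add: H.b.Re_diff H.b.Re_scale bu bU)
  qed
  ultimately have lim1: "(\<lambda>n. 1 - (cmod (\<beta> n))\<^sup>2) \<longlonglongrightarrow> 0" by simp
  have \<beta>0: "\<forall>\<^sub>F n in sequentially. \<beta> n \<noteq> 0"
    using order_tendstoD(2)[OF lim1, of 1] by (auto elim!: eventually_mono)
  \<comment> \<open>The value 0 only keeps \<open>v n\<close> in \<open>H\<close> for the finitely
    many \<open>n\<close> with \<open>\<beta> n = 0\<close>.\<close>
  define v where "v n = (if \<beta> n = 0 then 0 else U k - inverse (\<beta> n) \<odot> u n)" for n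
  define s where "s n = 1 / sqrt (Re (H.q (v n) (v n)))" for n
  \<comment> \<open>\<open>x n\<close> is the defect normalised in the \<open>q\<close>-norm; since
    division by zero yields zero, \<open>s n = 0\<close> for a null defect.\<close>
  define x where "x n = of_real (s n) \<odot> v n" for n
  have vH: "v n \<in> H" for n using uH UH by (simp add: v_def)
  have qv: "Re (H.q (v n) (v n)) \<ge> 0" for n by (rule H.q.nonneg[OF vH])
  have s0: "s n \<ge> 0" for n unfolding s_def using qv by (intro divide_nonneg_nonneg real_sqrt_ge_zero) auto
  have sq: "s n * sqrt (Re (H.q (v n) (v n))) \<le> 1" for n unfolding s_def by (cases "Re (H.q (v n) (v n)) = 0") auto
  have bvU: "b (v n) (U k) = 0" for n
    using uH[of n] UH by (simp add: v_def H.b.diff_left H.b.scale_left bU \<beta>_def[symmetric])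
  have xH: "x n \<in> H" for n using vH by (simp add: x_def)
  have Qv: "Q (v n) y = - inverse (\<beta> n) * Q (u n) y" if "y \<in> H" for n y
    using that uH[of n] UH Q_U[OF that] by (auto simp: v_def Q_simps) (simp add: Q_def)
  have bv: "1 + Re (b (v n) (v n)) = 1 / (cmod (\<beta> n))\<^sup>2" if "\<beta> n \<noteq> 0" for n
  proof -
    have "b (U k) (v n) = 0" using bvU[of n] H.b.hermitian[OF vH UH, of n] by simp
    then have "Re (b (U k - v n) (U k - v n)) = 1 + Re (b (v n) (v n))"
      using vH[of n] UH by (simp add: H.b.Re_diff bU)
    moreover have "U k - v n = inverse (\<beta> n) \<odot> u n" using that by (simp add: v_def)
    ultimately show ?thesis using uH[of n] that
      by (simp add: H.b.Re_scale bu norm_inverse power_divide divide_inverse power_inverse)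
  qed
  \<comment> \<open>Energy identity: \<open>Q\<close> annihilates \<open>U k\<close>, and
    \<open>U k - v n\<close> is a multiple of \<open>u n\<close>, to which \<open>Qu\<close>
    applies.\<close>
  have Qvv: "Re (a (v n) (v n)) - L k * Re (b (v n) (v n)) = d n / (cmod (\<beta> n))\<^sup>2" if "\<beta> n \<noteq> 0" for n
  proof -
    have w: "inverse (\<beta> n) \<odot> u n \<in> W n"
    proof -
      interpret W: spectral_pair scale "W n" a b by (rule pairs)
      show ?thesis using uW by simp
    qed
    have "Q (v n) (v n) = Q (v n) (U k) - Q (v n) (inverse (\<beta> n) \<odot> u n)"
      using that vH UH uH by (simp add: v_def Q_simps)
    also have "\<dots> = inverse (\<beta> n) * Q (u n) (inverse (\<beta> n) \<odot> u n)"
      using vH uH by (simp add: Q_U_right Qv)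
    also have "\<dots> = of_real (d n) * (inverse (\<beta> n) * cnj (inverse (\<beta> n)))"
      using uH[of n] by (simp add: Qu[OF w] H.b.scale_right bu mult_ac)
    also have "inverse (\<beta> n) * cnj (inverse (\<beta> n)) = of_real (1 / (cmod (\<beta> n))\<^sup>2)"
      by (simp only: complex_norm_square[symmetric] norm_inverse) (simp add: power_divide divide_inverse power_inverse)
    finally have "Re (Q (v n) (v n)) = d n / (cmod (\<beta> n))\<^sup>2"
      by (simp only: of_real_mult[symmetric] Re_complex_of_real) simp
    then show ?thesis by (simp add: Q_def)
  qed
  \<comment> \<open>The surface part of the defect is negligible against its energy. This is what
    makes the shift equal to the energy to leading order.\<close>
  have "(\<lambda>n. Re (b (x n) (x n))) \<longlonglongrightarrow> 0"
  proof (rule weak_null[OF xH])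
    show "b (x n) (U k) = 0" for n using vH UH by (simp add: x_def H.b.scale_left bvU)
    have qx: "Re (H.q (x n) (x n)) = (s n * sqrt (Re (H.q (v n) (v n))))\<^sup>2" for n
      unfolding x_def H.q.Re_scale[OF vH] using qv by (simp only: power_mult_distrib real_sqrt_pow2 norm_of_real power2_abs)
    show "Re (H.q (x n) (x n)) \<le> 1" for n
      unfolding qx using sq s0 qv by (intro power_le_one mult_nonneg_nonneg real_sqrt_ge_zero) auto
    fix R assume R: "R \<in> H"
    obtain y e where y: "\<forall>n. y n \<in> W n" "e \<longlonglongrightarrow> 0" "\<forall>n. sqrt (Re (H.q (R - y n) (R - y n))) = e n"
      using approx[OF R] by blast
    have yH: "y n \<in> H" for n using y(1) by (blast intro: in_H)
    have e0: "e n \<ge> 0" for n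
      using H.q.nonneg[of "R - y n"] R yH by (simp only: y(3)[rule_format, symmetric] real_sqrt_ge_zero H.q.closed_ops)
    have "cmod (Q (x n) R) \<le> (1 + L k) * e n + sqrt (d n) * (sqrt (Re (H.q R R)) + e n)" for n
    proof (cases "\<beta> n = 0")
      case True
      then have "Q (x n) R = 0" using R by (simp add: x_def v_def Q_def)
      then have "cmod (Q (x n) R) = 0" by simp
      also have "0 \<le> (1 + L k) * e n + sqrt (d n) * (sqrt (Re (H.q R R)) + e n)"
        using L0 e0 dn H.q.nonneg[OF R] by (intro add_nonneg_nonneg mult_nonneg_nonneg real_sqrt_ge_zero) auto
      finally show ?thesis .
    next
      case False
      have "Q (v n) R = Q (v n) (R - y n) + Q (v n) (y n)" using vH R yH by (simp add: Q_simps)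
      also have "Q (v n) (y n) = - inverse (\<beta> n) * of_real (d n) * b (u n) (y n)"
        using Qv[OF yH] Qu y(1) by simp
      finally have "cmod (Q (v n) R) \<le> cmod (Q (v n) (R - y n)) + cmod (inverse (\<beta> n) * of_real (d n) * b (u n) (y n))"
        using norm_triangle_ineq4 by (metis diff_conv_add_uminus mult_minus_left)
      also have "\<dots> \<le> (1 + L k) * (sqrt (Re (H.q (v n) (v n))) * e n)
          + d n / cmod (\<beta> n) * (sqrt (Re (H.q R R)) + e n)"
      proof (rule add_mono)
        show "cmod (Q (v n) (R - y n)) \<le> (1 + L k) * (sqrt (Re (H.q (v n) (v n))) * e n)"
          using Q_bound[OF vH[of n], of "R - y n"] R yH y(3) by simp
        have "cmod (b (u n) (y n)) \<le> sqrt (Re (H.q R R)) + e n"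
          using bound_b[OF uH[of n] yH[of n] R] y(3) bu by simp
        then have "d n / cmod (\<beta> n) * cmod (b (u n) (y n)) \<le> d n / cmod (\<beta> n) * (sqrt (Re (H.q R R)) + e n)"
          using dn by (intro mult_left_mono) auto
        then show "cmod (inverse (\<beta> n) * of_real (d n) * b (u n) (y n)) \<le> d n / cmod (\<beta> n) * (sqrt (Re (H.q R R)) + e n)"
          using dn by (simp add: norm_mult norm_inverse divide_inverse mult_ac)
      qed
      finally have "s n * cmod (Q (v n) R) \<le> s n * ((1 + L k) * (sqrt (Re (H.q (v n) (v n))) * e n)
          + d n / cmod (\<beta> n) * (sqrt (Re (H.q R R)) + e n))"
        using s0 by (rule mult_left_mono)
      also have "\<dots> = (s n * sqrt (Re (H.q (v n) (v n)))) * ((1 + L k) * e n)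
          + (s n * (d n / cmod (\<beta> n))) * (sqrt (Re (H.q R R)) + e n)" by (simp only: algebra_simps)
      also have "\<dots> \<le> 1 * ((1 + L k) * e n) + sqrt (d n) * (sqrt (Re (H.q R R)) + e n)"
      proof (intro add_mono mult_right_mono sq)
        show "0 \<le> (1 + L k) * e n" using L0 e0 by simp
        show "0 \<le> sqrt (Re (H.q R R)) + e n" using e0 H.q.nonneg[OF R] by (intro add_nonneg_nonneg real_sqrt_ge_zero) auto
        \<comment> \<open>The energy identity bounds the scaled shift by the squared norm of the
          defect, so after normalisation one factor \<open>sqrt (d n)\<close> survives, and it tends
          to zero.\<close>
        have "d n / (cmod (\<beta> n))\<^sup>2 \<le> Re (H.q (v n) (v n))"
          using Qvv[OF False] H.b.nonneg[OF vH[of n]] mult_nonneg_nonneg[OF L0 H.b.nonneg[OF vH[of n]]]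
          unfolding plus_complex.sel by linarith
        then have "sqrt (d n / (cmod (\<beta> n))\<^sup>2) \<le> sqrt (Re (H.q (v n) (v n)))" by (rule real_sqrt_le_mono)
        then have "sqrt (d n) * (sqrt (d n) / cmod (\<beta> n)) \<le> sqrt (d n) * sqrt (Re (H.q (v n) (v n)))"
          using dn by (intro mult_left_mono) (simp_all add: real_sqrt_divide)
        then have "d n / cmod (\<beta> n) \<le> sqrt (d n) * sqrt (Re (H.q (v n) (v n)))"
          using dn[of n] by simp
        then have "s n * (d n / cmod (\<beta> n)) \<le> s n * (sqrt (d n) * sqrt (Re (H.q (v n) (v n))))"
          using s0 by (rule mult_left_mono)
        also have "\<dots> = sqrt (d n) * (s n * sqrt (Re (H.q (v n) (v n))))" by (simp only: mult_ac)
        also have "\<dots> \<le> sqrt (d n) * 1" using dn sq by (intro mult_left_mono) auto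
        finally show "s n * (d n / cmod (\<beta> n)) \<le> sqrt (d n)" by simp
      qed
      finally show ?thesis using vH[of n] R s0[of n] by (simp add: x_def Q_simps norm_mult)
    qed
    moreover have "(\<lambda>n. (1 + L k) * e n + sqrt (d n) * (sqrt (Re (H.q R R)) + e n))
        \<longlonglongrightarrow> (1 + L k) * 0 + sqrt 0 * (sqrt (Re (H.q R R)) + 0)"
      by (intro tendsto_intros d0 y(2))
    ultimately show "(\<lambda>n. Q (x n) R) \<longlonglongrightarrow> 0"
      by (rule_tac Lim_null_comparison[OF always_eventually]) auto
  qed
  define \<tau> where "\<tau> n = Re (b (x n) (x n))" for n
  have \<tau>: "\<tau> \<longlonglongrightarrow> 0" using \<open>(\<lambda>n. Re (b (x n) (x n))) \<longlonglongrightarrow> 0\<close> by (simp add: \<tau>_def[abs_def])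
  have b\<tau>: "Re (b (v n) (v n)) = \<tau> n * Re (H.q (v n) (v n))" for n
  proof (cases "Re (H.q (v n) (v n)) = 0")
    case True
    then show ?thesis using H.b_le_q[OF vH[of n]] H.b.nonneg[OF vH[of n]] by simp
  next
    case False
    define g where "g = Re (H.q (v n) (v n))"
    have g: "g > 0" using False qv[of n] unfolding g_def by linarith
    have "s n = 1 / sqrt g" by (simp only: s_def g_def)
    then have sg: "(s n)\<^sup>2 * g = 1" using g by (simp add: power_divide)
    have "\<tau> n = (s n)\<^sup>2 * Re (b (v n) (v n))"
      unfolding \<tau>_def x_def H.b.Re_scale[OF vH] by simp
    then have "\<tau> n * g = ((s n)\<^sup>2 * g) * Re (b (v n) (v n))" by (simp only: mult_ac)
    then show ?thesis unfolding sg g_def[symmetric] by simp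
  qed
  \<comment> \<open>The two identities for \<open>v n\<close> give
    \<open>q = d + (d + L k + 1) b\<close>, and \<open>b = \<tau> q\<close> turns this into
    \<open>(1 - \<sigma>) q = d\<close>.\<close>
  define \<sigma> where "\<sigma> n = (d n + L k + 1) * \<tau> n" for n
  have \<sigma>: "\<sigma> \<longlonglongrightarrow> 0"
  proof -
    have "\<sigma> \<longlonglongrightarrow> (0 + L k + 1) * 0" unfolding \<sigma>_def[abs_def] by (intro tendsto_intros d0 \<tau>)
    then show ?thesis by simp
  qed
  define \<rho> where "\<rho> n = 1 / (1 - \<sigma> n) - 1" for n
  have \<rho>: "\<rho> \<longlonglongrightarrow> 0"
  proof -
    have "\<rho> \<longlonglongrightarrow> 1 / (1 - 0) - 1" unfolding \<rho>_def[abs_def] by (intro tendsto_intros \<sigma>) simp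
    then show ?thesis by simp
  qed
  have qd: "Re (H.q (v n) (v n)) = (1 + \<rho> n) * d n" if "\<beta> n \<noteq> 0" "\<sigma> n < 1" for n
  proof -
    have "Re (a (v n) (v n)) - L k * Re (b (v n) (v n)) = d n * (1 + Re (b (v n) (v n)))"
      using bv[OF that(1)] Qvv[OF that(1)] by simp
    then have "Re (H.q (v n) (v n)) = d n + (d n + L k + 1) * Re (b (v n) (v n))" by (simp add: algebra_simps)
    also have "\<dots> = d n + \<sigma> n * Re (H.q (v n) (v n))" by (simp only: b\<tau> \<sigma>_def mult.assoc)
    finally have "(1 - \<sigma> n) * Re (H.q (v n) (v n)) = d n" by (simp only: left_diff_distrib mult_1_left)
    then show ?thesis using that(2) by (auto simp: \<rho>_def divide_simps algebra_simps simp del: plus_complex.sel)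
  qed
  have test: "d n \<le> (1 + \<rho> n) * Re (a w w)"
    if n: "\<beta> n \<noteq> 0" "\<sigma> n < 1" and w: "w \<in> H" "\<forall>y\<in>H. b w y = 0" "U k - w \<in> W n" for n w
  proof -
    have ubw: "b (u n) w = 0" using w uH[of n] H.b.hermitian[OF w(1) uH[of n]] by simp
    have vbw: "b (v n) w = 0" using w vH[of n] H.b.hermitian[OF w(1) vH[of n]] by simp
    \<comment> \<open>The surface condition on \<open>w\<close> removes all \<open>b\<close>-terms
      from the pairing. Cauchy-Schwarz, with the \<open>q\<close>-norm of \<open>v n\<close> known
      in terms of \<open>d n\<close>, then lets one factor \<open>d n\<close> cancel.\<close>
    have "a (v n) w = Q (v n) w" using vbw by (simp add: Q_def)
    also have "\<dots> = - Q (v n) (U k - w)" using vH w(1) UH by (simp add: Q_simps Q_U_right)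
    also have "\<dots> = inverse (\<beta> n) * (of_real (d n) * b (u n) (U k - w))"
      using w(1) UH by (simp add: Qv Qu[OF w(3)])
    also have "\<dots> = of_real (d n)" using n ubw uH[of n] UH w(1)
      by (simp add: H.b.diff_right \<beta>_def[symmetric])
    finally have "d n = cmod (a (v n) w)" using dn[of n] by simp
    then have "(d n)\<^sup>2 \<le> Re (a (v n) (v n)) * Re (a w w)"
      using H.a.cauchy_schwarz_sq[OF vH w(1), of n] by simp
    also have "\<dots> \<le> Re (H.q (v n) (v n)) * Re (a w w)"
      by (intro mult_right_mono H.a_le_q vH H.a.nonneg w)
    also have "\<dots> = d n * ((1 + \<rho> n) * Re (a w w))" by (simp only: qd[OF n] mult_ac)
    finally have "d n * d n \<le> d n * ((1 + \<rho> n) * Re (a w w))" by (simp only: power2_eq_square)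
    moreover have "0 \<le> (1 + \<rho> n) * Re (a w w)" using n(2) H.a.nonneg[OF w(1)] by (simp add: \<rho>_def)
    ultimately show ?thesis using dn[of n] by (cases "d n = 0") (auto simp: mult_le_cancel_left)
  qed
  have Wmem: "U k - v n \<in> W n" if "\<beta> n \<noteq> 0" for n
  proof -
    interpret W: spectral_pair scale "W n" a b by (rule pairs)
    show ?thesis using that uW by (simp add: v_def)
  qed
  have ev: "\<forall>\<^sub>F n in sequentially. \<beta> n \<noteq> 0 \<and> \<sigma> n < 1"
    using \<beta>0 order_tendstoD(2)[OF \<sigma>, of 1] by (auto intro: eventually_conj)
  show thesis
    by (rule that[OF vH \<rho>], rule eventually_mono[OF ev]) (use qd test Wmem in \<open>auto simp: d_def simp del: plus_complex.sel\<close>)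
qed

end

section \<open>C1 calculus and logarithmic cutoffs\<close>

section \<open>Continuously differentiable functions\<close>

abbreviation pd :: "('a::euclidean_space \<Rightarrow> 'b::real_normed_vector) \<Rightarrow> 'a \<Rightarrow> 'a \<Rightarrow> 'b" where
  "pd f e x \<equiv> frechet_derivative f (at x) e"

lemma C1_iff: "Ck 1 f \<longleftrightarrow> (\<forall>x. f differentiable (at x)) \<and> (\<forall>e\<in>Basis. continuous_on UNIV (pd f e))"
  by simp

declare Ck.simps [simp del]

lemma C1I:
  assumes "\<And>x. (f has_derivative f' x) (at x)" "\<And>e. e \<in> Basis \<Longrightarrow> continuous_on UNIV (\<lambda>x. f' x e)"
  shows "Ck 1 f" and "pd f e x = f' x e"
proof -
  have eq: "frechet_derivative f (at x) = f' x" for x using frechet_derivative_at[OF assms(1)] by (rule sym)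
  show "pd f e x = f' x e" by (simp only: eq)
  show "Ck 1 f" unfolding C1_iff eq differentiable_def
    by (rule conjI) (use assms(1) in blast, use assms(2) in blast)
qed

lemma C1_D:
  assumes "Ck 1 f"
  shows "(f has_derivative frechet_derivative f (at x)) (at x)"
    and "e \<in> Basis \<Longrightarrow> continuous_on UNIV (pd f e)"
  using assms unfolding C1_iff by (blast dest: frechet_derivative_works[THEN iffD1])+

lemma C1_continuous: "Ck 1 f \<Longrightarrow> continuous_on S f"
  by (intro continuous_at_imp_continuous_on ballI has_derivative_continuous[OF C1_D(1)])

lemma C1_measurable: "Ck 1 f \<Longrightarrow> f \<in> borel_measurable borel"
  by (rule borel_measurable_continuous_onI[OF C1_continuous])

lemma pd_measurable: "Ck 1 f \<Longrightarrow> e \<in> Basis \<Longrightarrow> pd f e \<in> borel_measurable borel"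
  by (rule borel_measurable_continuous_onI[OF C1_D(2)])

lemma C1_const: "Ck 1 (\<lambda>_. c)" and pd_const: "pd (\<lambda>_. c) e x = 0"
proof -
  have d: "((\<lambda>_. c) has_derivative (\<lambda>_. 0)) (at x)" for x by (rule has_derivative_const)
  show "Ck 1 (\<lambda>_. c)" "pd (\<lambda>_. c) e x = 0"
    using C1I[OF d continuous_on_const] by blast+
qed

lemma
  assumes "Ck 1 f" "Ck 1 g"
  shows C1_add: "Ck 1 (\<lambda>x. f x + g x)" and pd_add: "pd (\<lambda>x. f x + g x) e x = pd f e x + pd g e x"
proof -
  have d: "((\<lambda>x. f x + g x) has_derivative (\<lambda>h. pd f h x + pd g h x)) (at x)" for x
    by (rule has_derivative_add[OF C1_D(1)[OF assms(1)] C1_D(1)[OF assms(2)]])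
  have c: "continuous_on UNIV (\<lambda>x. pd f e x + pd g e x)" if "e \<in> Basis" for e
    by (intro continuous_on_add C1_D(2)[OF assms(1) that] C1_D(2)[OF assms(2) that])
  show "Ck 1 (\<lambda>x. f x + g x)" "pd (\<lambda>x. f x + g x) e x = pd f e x + pd g e x"
    using C1I[OF d c] by blast+
qed

lemma
  assumes "Ck 1 f" "Ck 1 g"
  shows C1_diff: "Ck 1 (\<lambda>x. f x - g x)" and pd_diff: "pd (\<lambda>x. f x - g x) e x = pd f e x - pd g e x"
proof -
  have d: "((\<lambda>x. f x - g x) has_derivative (\<lambda>h. pd f h x - pd g h x)) (at x)" for x
    by (rule has_derivative_diff[OF C1_D(1)[OF assms(1)] C1_D(1)[OF assms(2)]])
  have c: "continuous_on UNIV (\<lambda>x. pd f e x - pd g e x)" if "e \<in> Basis" for e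
    by (intro continuous_on_diff C1_D(2)[OF assms(1) that] C1_D(2)[OF assms(2) that])
  show "Ck 1 (\<lambda>x. f x - g x)" "pd (\<lambda>x. f x - g x) e x = pd f e x - pd g e x"
    using C1I[OF d c] by blast+
qed

lemma
  fixes f g :: "'a::euclidean_space \<Rightarrow> 'b::real_normed_algebra"
  assumes "Ck 1 f" "Ck 1 g"
  shows C1_mult: "Ck 1 (\<lambda>x. f x * g x)"
    and pd_mult: "pd (\<lambda>x. f x * g x) e x = f x * pd g e x + pd f e x * g x"
proof -
  have d: "((\<lambda>x. f x * g x) has_derivative (\<lambda>h. f x * pd g h x + pd f h x * g x)) (at x)" for x
    by (rule has_derivative_mult[OF C1_D(1)[OF assms(1)] C1_D(1)[OF assms(2)]])
  have c: "continuous_on UNIV (\<lambda>x. f x * pd g e x + pd f e x * g x)" if "e \<in> Basis" for e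
    by (intro continuous_on_add continuous_on_mult C1_continuous[OF assms(1)] C1_continuous[OF assms(2)] C1_D(2)[OF assms(1) that] C1_D(2)[OF assms(2) that])
  show "Ck 1 (\<lambda>x. f x * g x)" "pd (\<lambda>x. f x * g x) e x = f x * pd g e x + pd f e x * g x"
    using C1I[OF d c] by blast+
qed

lemma
  assumes "bounded_linear L" "Ck 1 f"
  shows C1_linear: "Ck 1 (\<lambda>x. L (f x))" and pd_linear: "pd (\<lambda>x. L (f x)) e x = L (pd f e x)"
proof -
  interpret L: bounded_linear L by fact
  have d: "((\<lambda>x. L (f x)) has_derivative (\<lambda>h. L (pd f h x))) (at x)" for x
    by (rule L.has_derivative[OF C1_D(1)[OF assms(2)]])
  have c: "continuous_on UNIV (\<lambda>x. L (pd f e x))" if "e \<in> Basis" for e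
    by (rule L.continuous_on[OF C1_D(2)[OF assms(2) that]])
  show "Ck 1 (\<lambda>x. L (f x))" "pd (\<lambda>x. L (f x)) e x = L (pd f e x)"
    using C1I[OF d c] by blast+
qed

lemmas C1_of_real = C1_linear[OF bounded_linear_of_real]
lemmas pd_of_real = pd_linear[OF bounded_linear_of_real]

lemma
  fixes f :: "'a::euclidean_space \<Rightarrow> real"
  assumes g: "\<And>t. t \<in> range f \<Longrightarrow> (g has_real_derivative g' t) (at t)" "continuous_on (range f) g'" and f: "Ck 1 f"
  shows C1_compose: "Ck 1 (\<lambda>x. g (f x))" and pd_compose: "pd (\<lambda>x. g (f x)) e x = g' (f x) * pd f e x"
proof -
  have "((\<lambda>x. g (f x)) has_derivative (\<lambda>h. g' (f x) * pd f h x)) (at x)" for x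
    using diff_chain_at[OF C1_D(1)[OF f, of x] g(1)[of "f x", unfolded has_field_derivative_def]]
    by (simp add: o_def)
  moreover have "continuous_on UNIV (\<lambda>x. g' (f x) * pd f e x)" if "e \<in> Basis" for e
    using continuous_on_compose2[OF g(2) C1_continuous[OF f, of UNIV]] that
    by (intro continuous_intros C1_D(2)[OF f]) auto
  ultimately show "Ck 1 (\<lambda>x. g (f x))" "pd (\<lambda>x. g (f x)) e x = g' (f x) * pd f e x"
    using C1I[where f="\<lambda>x. g (f x)" and f'="\<lambda>x h. g' (f x) * pd f h x"] by blast+
qed

lemma
  fixes p :: "'a::euclidean_space"
  shows C1_dist_sq: "Ck 1 (\<lambda>x. (norm (x - p))\<^sup>2)"
    and pd_dist_sq: "pd (\<lambda>x. (norm (x - p))\<^sup>2) e x = 2 * ((x - p) \<bullet> e)"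
  unfolding power2_norm_eq_inner
  by (rule C1I[where f'="\<lambda>x h. 2 * ((x - p) \<bullet> h)"];
      auto intro!: derivative_eq_intros continuous_intros simp: inner_commute)+

lemma
  fixes u :: "'a::euclidean_space"
  shows C1_inner: "Ck 1 (\<lambda>x. x \<bullet> u)" and pd_inner: "pd (\<lambda>x. x \<bullet> u) e x = e \<bullet> u"
  by (rule C1I[where f'="\<lambda>x h. h \<bullet> u"]; auto intro!: derivative_eq_intros continuous_intros)+

lemma pd_eq_0_outside:
  assumes "open S" "x \<in> S" "\<And>y. y \<in> S \<Longrightarrow> f y = 0"
  shows "pd f e x = 0"
proof -
  have "(f has_derivative (\<lambda>_. 0)) (at x)"
    by (rule has_derivative_transform_within_open[of "\<lambda>_. 0" _ x UNIV S]) (use assms in auto)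
  then have "frechet_derivative f (at x) = (\<lambda>_. 0)" using frechet_derivative_at by metis
  then show ?thesis by simp
qed

text \<open>A quadratic spline: \<open>2 t^2\<close> up to \<open>1/2\<close>, then
  \<open>1 - 2 (1 - t)^2\<close>. Its derivative \<open>step'\<close> is a tent of height 2, and
  continuity of the derivative is all that \<open>Ck 1\<close> asks for.\<close>

definition step :: "real \<Rightarrow> real" where
  "step t = 2 * ((max 0 t)\<^sup>2 - 2 * (max 0 (t - 1/2))\<^sup>2 + (max 0 (t - 1))\<^sup>2)"

definition step' :: "real \<Rightarrow> real" where
  "step' t = 4 * (max 0 t - 2 * max 0 (t - 1/2) + max 0 (t - 1))"

lemma max_sq_deriv: "((\<lambda>t. (max 0 t)\<^sup>2) has_real_derivative 2 * max 0 t) (at t)" for t :: real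
proof (cases t "0::real" rule: linorder_cases)
  case less
  have "((\<lambda>t::real. 0) has_real_derivative 2 * max 0 t) (at t)" using less by (auto intro!: derivative_eq_intros)
  then show ?thesis
    by (rule has_field_derivative_transform_within_open[of _ _ _ "{..<0}"]) (use less in auto)
next
  case greater
  have "((\<lambda>t::real. t\<^sup>2) has_real_derivative 2 * max 0 t) (at t)" using greater by (auto intro!: derivative_eq_intros)
  then show ?thesis
    by (rule has_field_derivative_transform_within_open[of _ _ _ "{0<..}"]) (use greater in auto)
next
  case equal
  have "((\<lambda>h::real. (max 0 (0 + h))\<^sup>2 / h) \<longlongrightarrow> 0) (at 0)"
  proof (rule Lim_null_comparison)
    show "\<forall>\<^sub>F h::real in at 0. norm ((max 0 (0 + h))\<^sup>2 / h) \<le> \<bar>h\<bar>"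
      by (intro always_eventually) (auto simp: max_def power2_eq_square)
    show "((\<lambda>h::real. \<bar>h\<bar>) \<longlongrightarrow> 0) (at 0)" by (intro tendsto_rabs_zero) auto
  qed
  then show ?thesis using equal by (simp add: DERIV_def)
qed

lemma step_deriv: "(step has_real_derivative step' t) (at t)"
proof -
  have s: "((\<lambda>t. (max 0 (t - c))\<^sup>2) has_real_derivative 2 * max 0 (t - c)) (at t)" for c t :: real
  proof -
    have "((\<lambda>t. t - c) has_real_derivative 1) (at t)" by (auto intro!: derivative_eq_intros)
    from DERIV_chain2[where f="\<lambda>t. (max 0 t)\<^sup>2", OF max_sq_deriv this] show ?thesis by simp
  qed
  have "((\<lambda>t. 2 * ((max 0 (t - 0))\<^sup>2 - 2 * (max 0 (t - 1/2))\<^sup>2 + (max 0 (t - 1))\<^sup>2)) has_real_derivative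
      2 * (2 * max 0 (t - 0) - 2 * (2 * max 0 (t - 1/2)) + 2 * max 0 (t - 1))) (at t)"
    by (rule DERIV_cmult[OF DERIV_add[OF DERIV_diff[OF s DERIV_cmult[OF s]] s]])
  then show ?thesis by (simp add: step_def[abs_def] step'_def algebra_simps)
qed

lemma step'_cont: "continuous_on S step'"
  unfolding step'_def by (intro continuous_intros)

lemma step'_bounds: "0 \<le> step' t" "step' t \<le> 2"
  unfolding step'_def by (auto simp: max_def)

lemma step_0: "t \<le> 0 \<Longrightarrow> step t = 0"
  by (simp add: step_def)

lemma step_1: "t \<ge> 1 \<Longrightarrow> step t = 1"
  by (simp add: step_def power2_eq_square algebra_simps)

lemma step_mono: "s \<le> t \<Longrightarrow> step s \<le> step t"
  by (rule DERIV_nonneg_imp_nondecreasing) (use step_deriv step'_bounds in blast)+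

lemma step_bounds: "0 \<le> step t" "step t \<le> 1"
  using step_mono[of "min 0 t" t] step_mono[of t "max 1 t"] step_0[of "min 0 t"] step_1[of "max 1 t"] by auto

text \<open>The logarithmic cutoff that shows that points have zero capacity. Its transition takes
  length \<open>L\<close> in the logarithm of a regularised squared distance, so the gradient is at
  most \<open>4 / L\<close> over the regularised distance to \<open>p\<close>. The added constant
  removes the singularity at \<open>p\<close> and is the \<open>s^2\<close> of the Hardy weight
  below; \<open>L = 1\<close> gives an ordinary bump of radius \<open>r\<close>.\<close>

definition cut :: "'a::euclidean_space \<Rightarrow> real \<Rightarrow> real \<Rightarrow> 'a \<Rightarrow> real" where
  "cut p r L x = step ((ln (r\<^sup>2) - ln ((norm (x - p))\<^sup>2 + r\<^sup>2 * exp (- L) / 2)) / L)"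

lemma
  assumes r: "r > 0" and L: "L > 0"
  shows C1_cut: "Ck 1 (cut p r L)"
    and cut_eq_1: "(norm (x - p))\<^sup>2 \<le> r\<^sup>2 * exp (- L) / 2 \<Longrightarrow> cut p r L x = 1"
    and cut_eq_0: "norm (x - p) \<ge> r \<Longrightarrow> cut p r L x = 0"
    and cut_grad: "(\<Sum>e\<in>Basis. (pd (cut p r L) e x)\<^sup>2) \<le> (4 / L)\<^sup>2 / ((norm (x - p))\<^sup>2 + r\<^sup>2 * exp (- L) / 2)"
proof -
  define s where "s = r\<^sup>2 * exp (- L) / 2"
  have s: "s > 0" using r by (simp add: s_def)
  define D where "D x = (norm (x - p))\<^sup>2 + s" for x
  have D: "D x > 0" for x using s by (simp add: D_def add_nonneg_pos)
  have C1D: "Ck 1 D" unfolding D_def[abs_def] by (intro C1_add C1_dist_sq C1_const)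
  have pdD: "pd D e x = 2 * ((x - p) \<bullet> e)" for e x
    unfolding D_def[abs_def] by (simp add: pd_add[OF C1_dist_sq C1_const] pd_dist_sq pd_const)
  define g where "g t = step ((ln (r\<^sup>2) - ln t) / L)" for t
  define g' where "g' t = step' ((ln (r\<^sup>2) - ln t) / L) * (- (1 / t) / L)" for t
  have cut_g: "cut p r L = (\<lambda>x. g (D x))" by (simp add: cut_def g_def D_def s_def fun_eq_iff)
  have g: "(g has_real_derivative g' t) (at t)" if "t \<in> range D" for t
  proof -
    have t: "t > 0" using that D by auto
    show ?thesis unfolding g_def[abs_def] g'_def
      by (rule DERIV_chain2[OF step_deriv]) (use t L in \<open>auto intro!: derivative_eq_intros\<close>)
  qed
  have g'c: "continuous_on (range D) g'"
    unfolding g'_def[abs_def] using D L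
    by (intro continuous_intros continuous_on_compose2[OF step'_cont[of UNIV]]) (auto simp: less_imp_neq[OF D, symmetric])
  show "Ck 1 (cut p r L)" unfolding cut_g by (rule C1_compose[OF g g'c C1D])
  have pdc: "pd (cut p r L) e x = g' (D x) * (2 * ((x - p) \<bullet> e))" for e x
    unfolding cut_g using pd_compose[OF g g'c C1D] pdD by simp
  show "cut p r L x = 1" if "(norm (x - p))\<^sup>2 \<le> r\<^sup>2 * exp (- L) / 2"
  proof -
    have "ln (D x) \<le> ln (r\<^sup>2 * exp (- L))"
      using that D r by (subst ln_le_cancel_iff) (auto simp: D_def s_def)
    also have "\<dots> = ln (r\<^sup>2) - L" using r by (simp add: ln_mult)
    finally have "1 \<le> (ln (r\<^sup>2) - ln (D x)) / L" using L by (simp add: field_simps)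
    then show ?thesis by (simp add: cut_g g_def step_1)
  qed
  show "cut p r L x = 0" if "norm (x - p) \<ge> r"
  proof -
    have "r\<^sup>2 \<le> (norm (x - p))\<^sup>2" using that r by (intro power_mono) auto
    then have "r\<^sup>2 \<le> D x" using s unfolding D_def by linarith
    then have "ln (r\<^sup>2) \<le> ln (D x)" using r D[of x] by (subst ln_le_cancel_iff) simp_all
    then have "(ln (r\<^sup>2) - ln (D x)) / L \<le> 0" using L by (simp add: divide_le_0_iff)
    then show ?thesis by (simp add: cut_g g_def step_0)
  qed
  have "(\<Sum>e\<in>Basis. (pd (cut p r L) e x)\<^sup>2) = (2 * g' (D x))\<^sup>2 * (norm (x - p))\<^sup>2"
    unfolding pdc power2_norm_eq_inner euclidean_inner[of "x - p" "x - p"]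
    by (simp add: power_mult_distrib sum_distrib_left power2_eq_square mult_ac)
  also have "\<dots> \<le> (4 / (D x * L))\<^sup>2 * D x"
  proof (intro mult_mono)
    have "\<bar>2 * g' (D x)\<bar> = 2 * step' ((ln (r\<^sup>2) - ln (D x)) / L) / (D x * L)"
      using D[of x] L step'_bounds(1) by (simp add: g'_def abs_mult)
    also have "\<dots> \<le> 4 / (D x * L)" using D[of x] L step'_bounds(2) by (intro divide_right_mono) auto
    finally show "(2 * g' (D x))\<^sup>2 \<le> (4 / (D x * L))\<^sup>2"
      by (metis abs_ge_zero power2_abs power_mono)
    show "(norm (x - p))\<^sup>2 \<le> D x" using s by (simp add: D_def)
  qed auto
  also have "\<dots> = (4 / L)\<^sup>2 / D x" using D[of x] by (simp add: power2_eq_square field_simps)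
  finally show "(\<Sum>e\<in>Basis. (pd (cut p r L) e x)\<^sup>2) \<le> (4 / L)\<^sup>2 / ((norm (x - p))\<^sup>2 + r\<^sup>2 * exp (- L) / 2)"
    by (simp add: D_def s_def)
qed

lemma cut_bounds: "0 \<le> cut p r L x" "cut p r L x \<le> 1"
  unfolding cut_def by (rule step_bounds)+

section \<open>Divergence theorem on a half-space and a Hardy inequality that controls
  traces\<close>

section \<open>Integration by parts and a Hardy inequality with a boundary term\<close>

lemma integrable_bounded_support:
  fixes f :: "'a::euclidean_space \<Rightarrow> 'b::{banach, second_countable_topology}"
  assumes "f \<in> borel_measurable borel" "\<And>x. norm (f x) \<le> M * indicator (cball 0 R) x"
  shows "integrable lborel f"
proof (rule Bochner_Integration.integrable_bound)
  show "integrable lborel (\<lambda>x::'a. M * indicator (cball 0 R) x :: real)"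
    using emeasure_lborel_cball_finite[of "0::'a" R] by (intro integrable_mult_right integrable_real_indicator) auto
  show "AE x in lborel. norm (f x) \<le> norm (M * indicator (cball 0 R) x :: real)"
    using assms(2) by (intro always_eventually allI) (metis abs_ge_self order_trans real_norm_def)
qed (use assms in simp)

lemma C1_compact_support_bound:
  fixes h :: "'a::euclidean_space \<Rightarrow> 'b::real_normed_vector"
  assumes "continuous_on UNIV h" "\<And>x. R \<le> norm x \<Longrightarrow> h x = 0"
  shows "\<exists>M\<ge>0. (\<forall>x. norm (h x) \<le> M) \<and> (\<forall>x. norm (h x) \<le> M * indicator (cball 0 R) x)"
proof -
  have "compact (h ` cball 0 R)"
    using assms(1) by (intro compact_continuous_image continuous_on_subset[OF assms(1)]) auto
  then obtain M where M: "\<forall>y\<in>h ` cball 0 R. norm y \<le> M" using compact_imp_bounded bounded_iff by metis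
  have "norm (h x) \<le> max 0 M * indicator (cball 0 R) x" for x
  proof (cases "norm x \<le> R")
    case True then have "norm (h x) \<le> M" using M by auto
    then show ?thesis using True by simp
  qed (use assms(2)[of x] in simp)
  moreover then have "norm (h x) \<le> max 0 M" for x
    by (rule order_trans) (auto simp: indicator_def)
  ultimately show ?thesis by (intro exI[of _ "max 0 M"]) auto
qed

lemma pd_support:
  assumes "\<And>x. R \<le> norm x \<Longrightarrow> g x = 0" "R < norm x"
  shows "pd g e x = 0"
  by (rule pd_eq_0_outside[of "- cball 0 R"]) (use assms in auto)

lemma integrable_C1_support:
  fixes g :: "'a::euclidean_space \<Rightarrow> 'b::euclidean_space"
  assumes g: "Ck 1 g" "\<And>x. R \<le> norm x \<Longrightarrow> g x = 0" and S: "S \<in> sets borel"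
  shows "integrable lborel (\<lambda>x. indicator S x *\<^sub>R g x)"
    and "e \<in> Basis \<Longrightarrow> integrable lborel (\<lambda>x. indicator S x *\<^sub>R pd g e x)"
proof -
  have *: "integrable lborel (\<lambda>x. indicator S x *\<^sub>R h x)"
    if h: "continuous_on UNIV h" "\<And>x. R + 1 \<le> norm x \<Longrightarrow> h x = 0" for h :: "'a \<Rightarrow> 'b"
  proof -
    obtain M where M: "M \<ge> 0" "\<forall>x. norm (h x) \<le> M * indicator (cball 0 (R + 1)) x"
      using C1_compact_support_bound[OF h] by blast
    show ?thesis
    proof (rule integrable_bounded_support[where M=M and R="R+1"])
      show "(\<lambda>x. indicator S x *\<^sub>R h x) \<in> borel_measurable borel"
        using S borel_measurable_continuous_onI[OF h(1)] by measurable
      fix x show "norm (indicator S x *\<^sub>R h x) \<le> M * indicator (cball 0 (R + 1)) x"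
        using M(2)[rule_format, of x] M(1) by (auto simp: indicator_def split: if_splits)
    qed
  qed
  show "integrable lborel (\<lambda>x. indicator S x *\<^sub>R g x)"
    by (rule *[OF C1_continuous[OF g(1)] g(2)]) simp
  have "pd g e x = 0" if "R + 1 \<le> norm x" for x
    by (rule pd_support[where R=R, OF g(2)]) (use that in linarith)+
  then show "integrable lborel (\<lambda>x. indicator S x *\<^sub>R pd g e x)" if "e \<in> Basis"
    using that by (intro *[OF C1_D(2)[OF g(1)]])
qed

text \<open>Difference quotients along \<open>e\<close> integrate to zero because \<open>S\<close>
  and Lebesgue measure are invariant under the translation; dominated convergence passes to the
  derivative. \<open>S\<close> is the whole space for weak derivatives and a half-space for its
  tangential directions.\<close>

lemma integral_pd_0:
  fixes g :: "'a::euclidean_space \<Rightarrow> 'b::euclidean_space"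
  assumes g: "Ck 1 g" "\<And>x. R \<le> norm x \<Longrightarrow> g x = 0" and S: "S \<in> sets borel"
    and e: "e \<in> Basis" and inv: "\<And>x h. x + h *\<^sub>R e \<in> S \<longleftrightarrow> x \<in> S"
  shows "(\<integral>x. indicator S x *\<^sub>R pd g e x \<partial>lborel) = 0"
proof -
  have pd0: "pd g e x = 0" if "R + 1 \<le> norm x" for x
    by (rule pd_support[where R=R, OF g(2)]) (use that in linarith)+
  obtain M where M0: "M \<ge> 0" and M1: "\<forall>x. norm (pd g e x) \<le> M"
    using C1_compact_support_bound[OF C1_D(2)[OF g(1) e] pd0] by blast
  note M = M0 M1[rule_format]
  \<comment> \<open>Steps of length at most 1 keep the supports of all difference quotients in the
    ball of radius \<open>R + 1\<close>.\<close>
  define h where "h n = 1 / real (Suc n)" for n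
  have h: "h n > 0" "h n \<le> 1" for n by (simp_all add: h_def)
  define D where "D n x = indicator S x *\<^sub>R ((1 / h n) *\<^sub>R (g (x + h n *\<^sub>R e) - g x))" for n x
  have gm: "g \<in> borel_measurable borel" by (rule C1_measurable[OF g(1)])
  have lip: "norm (g (x + t *\<^sub>R e) - g x) \<le> M * t" if "t > 0" for x t
  proof -
    have "norm (g (x + t *\<^sub>R e) - g (x + 0 *\<^sub>R e)) \<le> M * norm (t - 0)"
    proof (rule differentiable_bound[where S="{0..t}" and f="\<lambda>r. g (x + r *\<^sub>R e)" and f'="\<lambda>r u. u *\<^sub>R pd g e (x + r *\<^sub>R e)"])
      fix r assume "r \<in> {0..t}"
      have "((\<lambda>r. x + r *\<^sub>R e) has_derivative (\<lambda>u. u *\<^sub>R e)) (at r)" by (auto intro!: derivative_eq_intros)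
      from diff_chain_at[OF this C1_D(1)[OF g(1), of "x + r *\<^sub>R e"]]
      have "((\<lambda>r. g (x + r *\<^sub>R e)) has_derivative (\<lambda>u. frechet_derivative g (at (x + r *\<^sub>R e)) (u *\<^sub>R e))) (at r)"
        by (simp add: o_def)
      moreover have "frechet_derivative g (at y) (u *\<^sub>R e) = u *\<^sub>R pd g e y" for u y
        using has_derivative_bounded_linear[OF C1_D(1)[OF g(1)]] by (simp add: linear_simps)
      ultimately show "((\<lambda>r. g (x + r *\<^sub>R e)) has_derivative (\<lambda>u. u *\<^sub>R pd g e (x + r *\<^sub>R e))) (at r within {0..t})"
        by (simp add: has_derivative_at_withinI)
      show "onorm (\<lambda>u. u *\<^sub>R pd g e (x + r *\<^sub>R e)) \<le> M"
        by (rule onorm_le) (simp add: mult.commute[of M] mult_left_mono[OF M(2)])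
    qed (use that in auto)
    then show ?thesis using that by simp
  qed
  have zero: "(\<integral>x. D n x \<partial>lborel) = 0" for n
  proof -
    let ?G = "\<lambda>x. indicator S x *\<^sub>R g x"
    have i: "integrable lborel ?G" by (rule integrable_C1_support(1)[OF g S])
    have Gm: "?G \<in> borel_measurable borel" using gm S by measurable
    have eq: "(\<lambda>x. indicator S x *\<^sub>R g (x + h n *\<^sub>R e)) = (\<lambda>x. ?G (h n *\<^sub>R e + x))"
      using inv by (auto simp: fun_eq_iff indicator_def add.commute)
    have "integrable (distr lborel borel ((+) (h n *\<^sub>R e))) ?G" using i by (simp add: lborel_distr_plus)
    then have i2: "integrable lborel (\<lambda>x. ?G (h n *\<^sub>R e + x))"
      using Gm by (subst (asm) integrable_distr_eq) auto
    have "(\<integral>x. ?G (h n *\<^sub>R e + x) \<partial>lborel) = (\<integral>x. ?G x \<partial>distr lborel borel ((+) (h n *\<^sub>R e)))"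
      using Gm by (subst integral_distr) auto
    also have "\<dots> = (\<integral>x. ?G x \<partial>lborel)" by (simp add: lborel_distr_plus)
    finally have "(\<integral>x. ?G (h n *\<^sub>R e + x) - ?G x \<partial>lborel) = 0"
      using i i2 by simp
    moreover have "D n x = (1 / h n) *\<^sub>R (?G (h n *\<^sub>R e + x) - ?G x)" for x
      using fun_cong[OF eq, of x] by (simp add: D_def scaleR_diff_right algebra_simps)
    ultimately show ?thesis by simp
  qed
  have "(\<lambda>n. \<integral>x. D n x \<partial>lborel) \<longlonglongrightarrow> (\<integral>x. indicator S x *\<^sub>R pd g e x \<partial>lborel)"
  proof (rule integral_dominated_convergence[where w="\<lambda>x. M * indicator (cball 0 (R + 1)) x"])
    show "(\<lambda>x. indicator S x *\<^sub>R pd g e x) \<in> borel_measurable lborel"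
      using S pd_measurable[OF g(1) e] by measurable
    show "D n \<in> borel_measurable lborel" for n
    proof -
      have "(\<lambda>x. g (x + h n *\<^sub>R e)) \<in> borel_measurable borel" by (rule measurable_compose[OF _ gm]) simp
      from borel_measurable_scaleR[OF borel_measurable_indicator[OF S]
          borel_measurable_scaleR[OF borel_measurable_const borel_measurable_diff[OF this gm]]]
      show ?thesis unfolding D_def[abs_def] measurable_lborel2 .
    qed
    show "integrable lborel (\<lambda>x::'a. M * indicator (cball 0 (R + 1)) x :: real)"
      by (rule integrable_bounded_support[where M=M and R="R+1"]) (use M(1) in \<open>simp_all add: borel_measurable_times borel_measurable_indicator\<close>)
    show "AE x in lborel. norm (D n x) \<le> M * indicator (cball 0 (R + 1)) x" for n
    proof (intro always_eventually allI)
      fix x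
      show "norm (D n x) \<le> M * indicator (cball 0 (R + 1)) x"
      proof (cases "norm x \<le> R + 1")
        case True
        have "norm (D n x) \<le> (1 / h n) * norm (g (x + h n *\<^sub>R e) - g x)"
          using h(1)[of n] by (auto simp: D_def indicator_def)
        also have "\<dots> \<le> (1 / h n) * (M * h n)" using lip[OF h(1)[of n], of x] h(1)[of n] by (intro mult_left_mono) auto
        finally show ?thesis using True h(1)[of n] by simp
      next
        case False
        have "norm x \<le> norm (x + h n *\<^sub>R e) + norm (h n *\<^sub>R e)" by (metis add_diff_cancel norm_triangle_ineq4)
        also have "norm (h n *\<^sub>R e) \<le> 1" using h[of n] e by simp
        finally have "g (x + h n *\<^sub>R e) = 0" "g x = 0" using False by (auto intro!: g(2))
        then show ?thesis using False by (simp add: D_def)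
      qed
    qed
    show "AE x in lborel. (\<lambda>n. D n x) \<longlonglongrightarrow> indicator S x *\<^sub>R pd g e x"
    proof (intro always_eventually allI)
      fix x
      have h0: "h \<longlonglongrightarrow> 0" unfolding h_def[abs_def] using LIMSEQ_inverse_real_of_nat by (simp add: inverse_eq_divide)
      have "((\<lambda>t. x + t *\<^sub>R e) has_derivative (\<lambda>u. u *\<^sub>R e)) (at (0::real))" by (auto intro!: derivative_eq_intros)
      from diff_chain_at[OF this, of g "frechet_derivative g (at x)"] C1_D(1)[OF g(1), of x]
      have "((\<lambda>t. g (x + t *\<^sub>R e)) has_derivative (\<lambda>u. frechet_derivative g (at x) (u *\<^sub>R e))) (at 0)"
        by (simp add: o_def)
      moreover have "frechet_derivative g (at x) (u *\<^sub>R e) = u *\<^sub>R pd g e x" for u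
        using has_derivative_bounded_linear[OF C1_D(1)[OF g(1)]] by (simp add: linear_simps)
      ultimately have "((\<lambda>t. norm (g (x + t *\<^sub>R e) - g x - t *\<^sub>R pd g e x) / norm t) \<longlongrightarrow> 0) (at 0)"
        by (simp add: has_derivative_at)
      moreover have "norm (g (x + t *\<^sub>R e) - g x - t *\<^sub>R pd g e x) / norm t
          = norm ((1 / t) *\<^sub>R (g (x + t *\<^sub>R e) - g x) - pd g e x)" if "t \<noteq> 0" for t
      proof -
        have "(1 / t) *\<^sub>R (g (x + t *\<^sub>R e) - g x) - pd g e x
            = (1 / t) *\<^sub>R (g (x + t *\<^sub>R e) - g x - t *\<^sub>R pd g e x)"
          using that by (simp add: scaleR_diff_right)
        then show ?thesis by (simp add: divide_inverse mult.commute)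
      qed
      ultimately have "((\<lambda>t. norm ((1 / t) *\<^sub>R (g (x + t *\<^sub>R e) - g x) - pd g e x)) \<longlongrightarrow> 0) (at 0)"
        by (rule_tac Lim_transform_eventually) (auto simp: eventually_at_filter)
      then have "((\<lambda>t. (1 / t) *\<^sub>R (g (x + t *\<^sub>R e) - g x)) \<longlongrightarrow> pd g e x) (at 0)"
        by (rule LIM_zero_cancel[OF tendsto_norm_zero_cancel])
      then have "(\<lambda>n. (1 / h n) *\<^sub>R (g (x + h n *\<^sub>R e) - g x)) \<longlonglongrightarrow> pd g e x"
        by (rule filterlim_compose) (use h0 h(1) in \<open>auto simp: filterlim_at less_imp_neq[symmetric] intro!: always_eventually\<close>)
      then show "(\<lambda>n. D n x) \<longlonglongrightarrow> indicator S x *\<^sub>R pd g e x"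
        unfolding D_def by (intro tendsto_scaleR tendsto_const)
    qed
  qed
  then have "(\<lambda>n. 0) \<longlonglongrightarrow> (\<integral>x. indicator S x *\<^sub>R pd g e x \<partial>lborel)" by (simp only: zero)
  then show ?thesis using LIMSEQ_unique tendsto_const by blast
qed

lemma Basis_point: "(Basis :: point set) = {(1, 0, 0), (0, 1, 0), (0, 0, 1)}"
  by (auto simp: Basis_prod_def zero_prod_def)

text \<open>\<open>\<sigma>\<close> is the first component of the inward unit normal, so that one
  set of estimates serves both walls.\<close>

definition half_space :: "real \<Rightarrow> real \<Rightarrow> point set" where
  "half_space \<sigma> j = {x. \<sigma> * (fst x - j) > 0}"

lemma half_space_borel [measurable]: "half_space \<sigma> j \<in> sets borel"
proof -
  have "open (half_space \<sigma> j)" unfolding half_space_def by (intro open_Collect_less continuous_intros)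
  then show ?thesis by simp
qed

lemma integral_half_line_derivative:
  fixes F F' :: "real \<Rightarrow> 'b::euclidean_space"
  assumes F: "\<And>t. (F has_vector_derivative F' t) (at t)" and c: "continuous_on UNIV F'"
    and 0: "\<And>t. R \<le> \<bar>t\<bar> \<Longrightarrow> F t = 0" "\<And>t. R < \<bar>t\<bar> \<Longrightarrow> F' t = 0" and \<sigma>: "\<sigma> = 1 \<or> \<sigma> = -1"
  shows "(\<integral>t. indicator {t. \<sigma> * (t - j) > 0} t *\<^sub>R F' t \<partial>lborel) = - \<sigma> *\<^sub>R F j"
proof -
  define K where "K = max R \<bar>j\<bar> + 1"
  have FTC: "(\<integral>t. indicator {p..q} t *\<^sub>R F' t \<partial>lborel) = F q - F p" if "p \<le> q" for p q
    by (rule integral_FTC_Icc) (use that F c in \<open>auto intro: has_vector_derivative_at_within continuous_on_subset\<close>)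
  have m: "F' \<in> borel_measurable borel" by (rule borel_measurable_continuous_onI[OF c])
  from \<sigma> show ?thesis
  proof
    assume s: "\<sigma> = 1"
    have "(\<integral>t. indicator {t. \<sigma> * (t - j) > 0} t *\<^sub>R F' t \<partial>lborel) = (\<integral>t. indicator {j..K} t *\<^sub>R F' t \<partial>lborel)"
    proof (rule integral_cong_AE)
      show "AE t in lborel. indicator {t. \<sigma> * (t - j) > 0} t *\<^sub>R F' t = indicator {j..K} t *\<^sub>R F' t"
        using AE_lborel_singleton[of j]
        by eventually_elim (auto simp: indicator_def s K_def intro!: 0)
    qed (use m in measurable)
    also have "\<dots> = F K - F j" by (rule FTC) (simp add: K_def)
    also have "F K = 0" by (rule 0) (simp add: K_def)
    finally show ?thesis by (simp add: s)
  next
    assume s: "\<sigma> = -1"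
    have "(\<integral>t. indicator {t. \<sigma> * (t - j) > 0} t *\<^sub>R F' t \<partial>lborel) = (\<integral>t. indicator {- K..j} t *\<^sub>R F' t \<partial>lborel)"
    proof (rule integral_cong_AE)
      show "AE t in lborel. indicator {t. \<sigma> * (t - j) > 0} t *\<^sub>R F' t = indicator {- K..j} t *\<^sub>R F' t"
        using AE_lborel_singleton[of j]
        by eventually_elim (auto simp: indicator_def s K_def intro!: 0)
    qed (use m in measurable)
    also have "\<dots> = F j - F (- K)" by (rule FTC) (simp add: K_def)
    also have "F (- K) = 0" by (rule 0) (simp add: K_def)
    finally show ?thesis by (simp add: s)
  qed
qed

text \<open>Fubini and the fundamental theorem of calculus on each line normal to the wall; the sign
  is that of the outward normal.\<close>

lemma integral_pd_half_space:
  fixes g :: "point \<Rightarrow> 'b::euclidean_space"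
  assumes g: "Ck 1 g" "\<And>x. R \<le> norm x \<Longrightarrow> g x = 0" and \<sigma>: "\<sigma> = 1 \<or> \<sigma> = -1"
  shows "(\<integral>x. indicator (half_space \<sigma> j) x *\<^sub>R pd g (1, 0, 0) x \<partial>lborel) = - \<sigma> *\<^sub>R (\<integral>y. g (j, y) \<partial>lborel)"
proof -
  let ?e = "(1, 0, 0) :: point"
  let ?f = "\<lambda>x. indicator (half_space \<sigma> j) x *\<^sub>R pd g ?e x"
  have e: "?e \<in> Basis" by (simp add: Basis_point)
  have "integrable lborel ?f" by (rule integrable_C1_support(2)[where R=R, OF g half_space_borel e])
  then have i: "integrable (lborel \<Otimes>\<^sub>M lborel) (\<lambda>(t, y). ?f (t, y))" by (simp add: lborel_prod case_prod_unfold)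
  have "(\<integral>x. ?f x \<partial>lborel) = (\<integral>x. (case x of (t, y) \<Rightarrow> ?f (t, y)) \<partial>(lborel \<Otimes>\<^sub>M lborel))"
    by (simp add: lborel_prod case_prod_unfold)
  also have "\<dots> = (\<integral>y. \<integral>t. ?f (t, y) \<partial>lborel \<partial>lborel)"
    by (rule lborel_pair.integral_snd[symmetric]) (rule i)
  also have "\<dots> = (\<integral>y. - \<sigma> *\<^sub>R g (j, y) \<partial>lborel)"
  proof (rule Bochner_Integration.integral_cong[OF refl])
    fix y :: plane
    have "(\<integral>t. ?f (t, y) \<partial>lborel) = (\<integral>t. indicator {t. \<sigma> * (t - j) > 0} t *\<^sub>R pd g ?e (t, y) \<partial>lborel)"
      by (simp add: half_space_def indicator_def)
    also have "\<dots> = - \<sigma> *\<^sub>R g (j, y)"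
    proof (rule integral_half_line_derivative[where F="\<lambda>t. g (t, y)" and R=R])
      fix t
      have "((\<lambda>t. (t, y)) has_derivative (\<lambda>u. u *\<^sub>R ?e)) (at t)"
        by (auto intro!: derivative_eq_intros simp: zero_prod_def)
      from diff_chain_at[OF this C1_D(1)[OF g(1), of "(t, y)"]]
      have "((\<lambda>t. g (t, y)) has_derivative (\<lambda>u. frechet_derivative g (at (t, y)) (u *\<^sub>R ?e))) (at t)"
        by (simp only: o_def)
      moreover have "frechet_derivative g (at (t, y)) (u *\<^sub>R ?e) = u *\<^sub>R pd g ?e (t, y)" for u
        by (rule linear_simps(5)[OF has_derivative_bounded_linear[OF C1_D(1)[OF g(1)]]])
      then have "(\<lambda>u. frechet_derivative g (at (t, y)) (u *\<^sub>R ?e)) = (\<lambda>u. u *\<^sub>R pd g ?e (t, y))" by (rule ext)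
      ultimately show "((\<lambda>t. g (t, y)) has_vector_derivative pd g ?e (t, y)) (at t)"
        unfolding has_vector_derivative_def by (simp only:)
    next
      show "continuous_on UNIV (\<lambda>t. pd g ?e (t, y))"
        by (rule continuous_on_compose2[OF C1_D(2)[OF g(1) e]]) (auto intro!: continuous_intros)
    next
      fix t :: real
      have n: "\<bar>t\<bar> \<le> norm (t, y)" using norm_fst_le[of t y] by simp
      show "g (t, y) = 0" if "R \<le> \<bar>t\<bar>" by (rule g(2)) (use n that in linarith)
      show "pd g ?e (t, y) = 0" if "R < \<bar>t\<bar>"
        by (rule pd_support[where R=R, OF g(2)]) (use n that in linarith)+
    qed (rule \<sigma>)
    finally show "(\<integral>t. ?f (t, y) \<partial>lborel) = - \<sigma> *\<^sub>R g (j, y)" .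
  qed
  finally show ?thesis by simp
qed

text \<open>The pointwise bound behind \<open>hardy_trace\<close>, with \<open>N\<close> the squared
  distance to \<open>p\<close> and \<open>t\<close> the distance to the wall: the first bracket over
  4 is the divergence of the field \<open>X\<close> used there, the last term is its squared
  length.\<close>

lemma hardy_pointwise:
  fixes N D s t :: real
  assumes "t \<ge> 0" "s > 0" "t\<^sup>2 \<le> N" and D: "D = N + s\<^sup>2"
  shows "1 / (16 * D) \<le> (3 / D - 2 * (N + s * t / 4) / D\<^sup>2) / 4 - (N + s * t / 2 + s\<^sup>2 / 16) / (16 * D\<^sup>2)"
proof -
  have Dp: "D > 0" using assms by (simp add: add_nonneg_pos order_trans[OF zero_le_power2])
  have "0 \<le> 2 * t\<^sup>2 - 5/2 * s * t + 10 * s\<^sup>2"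
  proof -
    have "2 * t\<^sup>2 - 5/2 * s * t + 10 * s\<^sup>2 = 2 * (t - 5/8 * s)\<^sup>2 + (10 - 25/32) * s\<^sup>2"
      by (simp add: power2_eq_square algebra_simps)
    then show ?thesis by simp
  qed
  moreover have "12 * D - 8 * (N + s * t / 4) - (N + s * t / 2 + s\<^sup>2 / 16) - D
      = (2 * t\<^sup>2 - 5/2 * s * t + 10 * s\<^sup>2) + 2 * (N - t\<^sup>2) + 15/16 * s\<^sup>2"
    unfolding D by (simp add: field_simps)
  moreover have "0 \<le> 2 * (N - t\<^sup>2)" "0 \<le> 15/16 * s\<^sup>2" using assms(3) by simp_all
  ultimately have "0 \<le> 12 * D - 8 * (N + s * t / 4) - (N + s * t / 2 + s\<^sup>2 / 16) - D"
    by (metis add_nonneg_nonneg)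
  then have "D \<le> 12 * D - 8 * (N + s * t / 4) - (N + s * t / 2 + s\<^sup>2 / 16)" by (simp only: diff_ge_0_iff_ge)
  then have "D / (16 * D\<^sup>2) \<le> (12 * D - 8 * (N + s * t / 4) - (N + s * t / 2 + s\<^sup>2 / 16)) / (16 * D\<^sup>2)"
    by (rule divide_right_mono) simp
  moreover have "1 / (16 * D) = D / (16 * D\<^sup>2)" using Dp by (simp add: power2_eq_square)
  moreover have "(3 / D - 2 * u / D\<^sup>2) / 4 - w / (16 * D\<^sup>2) = (12 * D - 8 * u - w) / (16 * D\<^sup>2)" for u w
    using Dp by (simp add: field_simps power2_eq_square)
  ultimately show ?thesis by (simp only:)
qed

text \<open>Expand the square of \<open>grad f + X f\<close> for a field \<open>X\<close> and
  integrate by parts: the gradient energy dominates the integral with weight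
  \<open>div X - |X|^2\<close> and, in addition, the flux of \<open>X\<close> through the wall. With
  \<open>s\<close> of the size of an aperture, the flux term controls traces there.\<close>

lemma hardy_trace:
  fixes f :: "point \<Rightarrow> complex" and p :: point
  assumes f: "Ck 1 f" "\<And>x. R \<le> norm x \<Longrightarrow> f x = 0" and s: "s > 0" and \<sigma>: "\<sigma> = 1 \<or> \<sigma> = -1"
  defines "G \<equiv> \<integral>x. indicator (half_space \<sigma> (fst p)) x * (\<Sum>e\<in>Basis. (cmod (pd f e x))\<^sup>2) \<partial>lborel"
  shows "(\<integral>x. indicator (half_space \<sigma> (fst p)) x * ((cmod (f x))\<^sup>2 / ((norm (x - p))\<^sup>2 + s\<^sup>2)) \<partial>lborel) \<le> 16 * G"
    and "(\<integral>y. s / ((norm (y - snd p))\<^sup>2 + s\<^sup>2) * (cmod (f (fst p, y)))\<^sup>2 \<partial>lborel) \<le> 16 * G"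
proof -
  let ?H = "half_space \<sigma> (fst p)" and ?e = "(1, 0, 0) :: point"
  define D where "D x = (norm (x - p))\<^sup>2 + s\<^sup>2" for x
  have D: "D x > 0" for x using s by (simp add: D_def add_nonneg_pos)
  have C1D: "Ck 1 D" and pdD: "pd D e x = 2 * ((x - p) \<bullet> e)" for e x
    unfolding D_def[abs_def] by (intro C1_add C1_dist_sq C1_const)
      (simp add: pd_add[OF C1_dist_sq C1_const] pd_dist_sq pd_const)
  define i where "i x = 1 / D x" for x
  have inv: "((\<lambda>t. 1 / t) has_real_derivative (- (1 / t\<^sup>2))) (at t)" if "t \<in> range D" for t
    using that D by (auto intro!: derivative_eq_intros simp: power2_eq_square less_imp_neq[symmetric])
  have invc: "continuous_on (range D) (\<lambda>t. - (1 / t\<^sup>2))"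
    using D by (intro continuous_intros) (auto simp: less_imp_neq[symmetric])
  have C1i: "Ck 1 i" and pdi: "pd i e x = - (1 / (D x)\<^sup>2) * (2 * ((x - p) \<bullet> e))" for e x
    unfolding i_def[abs_def] using C1_compose[OF inv invc C1D] pd_compose[OF inv invc C1D] pdD by simp_all
  \<comment> \<open>The field \<open>x - p\<close> is tangential to the wall. The added inward
    vector of length \<open>s / 4\<close> gives \<open>X\<close> the flux \<open>s / (16 D)\<close>
    through it, at a cost that the regularised denominator absorbs.\<close>
  define c where "c x = x - p + (\<sigma> * s / 4) *\<^sub>R ?e" for x
  define X where "X e x = (1/4) * ((c x \<bullet> e) * i x)" for e x
  have ce: "(\<lambda>x. c x \<bullet> e) = (\<lambda>x. x \<bullet> e + (\<sigma> * s / 4 * (?e \<bullet> e) - p \<bullet> e))" for e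
    by (simp add: c_def inner_add_left inner_diff_left fun_eq_iff del: scaleR_Pair)
  have C1c: "Ck 1 (\<lambda>x. c x \<bullet> e)" and pdc: "pd (\<lambda>x. c x \<bullet> e) e' x = e' \<bullet> e" for e e' x
    unfolding ce by (intro C1_add C1_inner C1_const) (simp add: pd_add[OF C1_inner C1_const] pd_inner pd_const)
  have C1X: "Ck 1 (X e)" for e unfolding X_def[abs_def] by (intro C1_mult C1_const C1c C1i)
  have pdX: "pd (X e) e x = 1/4 * ((c x \<bullet> e) * (- (1 / (D x)\<^sup>2) * (2 * ((x - p) \<bullet> e))) + (e \<bullet> e) * i x)" for e x
    unfolding X_def[abs_def] pd_mult[OF C1_const C1_mult[OF C1c C1i]] pd_mult[OF C1c C1i] pd_const pdc pdi by simp
  define \<phi> where "\<phi> x = (cmod (f x))\<^sup>2" for x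
  have \<phi>_eq: "\<phi> = (\<lambda>x. Re (f x) * Re (f x) + Im (f x) * Im (f x))"
    by (rule ext, simp only: \<phi>_def cmod_power2, simp only: power2_eq_square)
  note C1R = C1_linear[OF bounded_linear_Re f(1)] and C1I' = C1_linear[OF bounded_linear_Im f(1)]
  have C1\<phi>: "Ck 1 \<phi>" unfolding \<phi>_eq by (intro C1_add C1_mult C1R C1I')
  have pd\<phi>: "pd \<phi> e x = 2 * Re (cnj (f x) * pd f e x)" for e x
    unfolding \<phi>_eq pd_add[OF C1_mult[OF C1R C1R] C1_mult[OF C1I' C1I']] pd_mult[OF C1R C1R] pd_mult[OF C1I' C1I']
      pd_linear[OF bounded_linear_Re f(1)] pd_linear[OF bounded_linear_Im f(1)] by simp
  define g where "g e x = X e x * \<phi> x" for e x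
  have C1g: "Ck 1 (g e)" for e unfolding g_def[abs_def] by (intro C1_mult C1X C1\<phi>)
  have pdg: "pd (g e) e x = X e x * pd \<phi> e x + pd (X e) e x * \<phi> x" for e x
    unfolding g_def[abs_def] by (rule pd_mult[OF C1X C1\<phi>])
  have g0: "g e x = 0" if "R \<le> norm x" for e x using f(2)[OF that] by (simp add: g_def \<phi>_def)
  define P where "P x = (\<Sum>e\<in>Basis. (cmod (pd f e x))\<^sup>2)" for x
  have pw: "\<phi> x / (16 * D x) \<le> P x + (\<Sum>e\<in>Basis. pd (g e) e x)" if x: "x \<in> ?H" for x
  proof -
    have sq: "(\<Sum>e\<in>Basis. (cmod (pd f e x + of_real (X e x) * f x))\<^sup>2)
        = P x + (\<Sum>e\<in>Basis. X e x * pd \<phi> e x) + (\<Sum>e\<in>Basis. (X e x)\<^sup>2) * \<phi> x"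
      unfolding P_def sum_distrib_right sum.distrib[symmetric]
      by (rule sum.cong[OF refl], unfold pd\<phi> \<phi>_def cmod_power2, simp add: power2_eq_square algebra_simps)
    have "0 \<le> (\<Sum>e\<in>Basis. (cmod (pd f e x + of_real (X e x) * f x))\<^sup>2)" by (intro sum_nonneg) simp
    then have 1: "0 \<le> P x + (\<Sum>e\<in>Basis. X e x * pd \<phi> e x) + (\<Sum>e\<in>Basis. (X e x)\<^sup>2) * \<phi> x" unfolding sq .
    obtain a b d where xp: "x - p = (a, b, d)" by (metis prod_cases3)
    define N where "N = a\<^sup>2 + b\<^sup>2 + d\<^sup>2"
    have N: "(norm (x - p))\<^sup>2 = N" unfolding xp N_def power2_norm_eq_inner by (simp add: power2_eq_square)
    have DN: "D x = N + s\<^sup>2" by (simp add: D_def N)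
    have a: "\<sigma> * a > 0" using x arg_cong[OF xp, of fst] by (simp add: half_space_def)
    have \<sigma>2: "\<sigma> * \<sigma> = 1" using \<sigma> by auto
    have divX: "(\<Sum>e\<in>Basis. pd (X e) e x) = (3 / D x - 2 * (N + s * (\<sigma> * a) / 4) / (D x)\<^sup>2) / 4"
      using D[of x] unfolding pdX c_def xp Basis_point N_def i_def
      by (simp add: power2_eq_square field_simps)
    have X2: "(\<Sum>e\<in>Basis. (X e x)\<^sup>2) = (N + s * (\<sigma> * a) / 2 + s\<^sup>2 / 16) / (16 * (D x)\<^sup>2)"
    proof -
      have "(\<sigma> * s)\<^sup>2 = s\<^sup>2" using \<sigma>2 by (simp add: power2_eq_square mult_ac)
      then have "(a + \<sigma> * s / 4)\<^sup>2 = a\<^sup>2 + s * (\<sigma> * a) / 2 + s\<^sup>2 / 16"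
        by (simp add: power2_sum power_divide mult_ac)
      then show ?thesis
        unfolding X_def c_def xp Basis_point N_def i_def
        by (simp add: power_divide power_mult_distrib add_divide_distrib algebra_simps)
    qed
    have "(\<sigma> * a)\<^sup>2 = a\<^sup>2" using \<sigma>2 by (simp add: power2_eq_square mult_ac)
    then have "(\<sigma> * a)\<^sup>2 \<le> N" by (simp add: N_def)
    from hardy_pointwise[OF _ s this DN] a
    have "1 / (16 * D x) \<le> (\<Sum>e\<in>Basis. pd (X e) e x) - (\<Sum>e\<in>Basis. (X e x)\<^sup>2)" unfolding divX X2 by simp
    then have "1 / (16 * D x) * \<phi> x \<le> ((\<Sum>e\<in>Basis. pd (X e) e x) - (\<Sum>e\<in>Basis. (X e x)\<^sup>2)) * \<phi> x"
      by (rule mult_right_mono) (simp add: \<phi>_def)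
    moreover have "(\<Sum>e\<in>Basis. pd (g e) e x) = (\<Sum>e\<in>Basis. X e x * pd \<phi> e x) + (\<Sum>e\<in>Basis. pd (X e) e x) * \<phi> x"
      unfolding pdg sum.distrib sum_distrib_right ..
    ultimately show ?thesis using 1 by (simp add: left_diff_distrib)
  qed
  have iP: "integrable lborel (\<lambda>x. indicator ?H x * P x)"
  proof -
    have "continuous_on UNIV P" unfolding P_def[abs_def] by (intro continuous_intros C1_D(2)[OF f(1)])
    moreover have "P x = 0" if "R + 1 \<le> norm x" for x
      unfolding P_def by (intro sum.neutral ballI) (simp add: pd_support[where R=R, OF f(2)] that less_le_trans[OF _ that])
    ultimately obtain M where M: "M \<ge> 0" "\<forall>x. norm (P x) \<le> M * indicator (cball 0 (R + 1)) x"
      using C1_compact_support_bound[of P "R + 1"] by blast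
    show ?thesis
    proof (rule integrable_bounded_support[where M=M and R="R+1"])
      show "(\<lambda>x. indicator ?H x * P x) \<in> borel_measurable borel"
        using borel_measurable_continuous_onI[OF \<open>continuous_on UNIV P\<close>]
        by (intro borel_measurable_times borel_measurable_indicator half_space_borel)
      show "norm (indicator ?H x * P x) \<le> M * indicator (cball 0 (R + 1)) x" for x
        using M(2)[rule_format, of x] M(1) by (auto simp: indicator_def split: if_splits)
    qed
  qed
  have ig: "integrable lborel (\<lambda>x. indicator ?H x * pd (g e) e x)" if "e \<in> Basis" for e
    using integrable_C1_support(2)[where R=R and g="g e", OF C1g g0 half_space_borel that] by simp
  have "(\<integral>x. indicator ?H x * pd (g e) e x \<partial>lborel) = 0" if "e = (0, 1, 0) \<or> e = (0, 0, 1)" for e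
  proof -
    have "(\<integral>x. indicator ?H x *\<^sub>R pd (g e) e x \<partial>lborel) = 0"
      by (rule integral_pd_0[where R=R, OF C1g g0 half_space_borel])
        (use that in \<open>auto simp: Basis_point half_space_def\<close>)
    then show ?thesis by simp
  qed
  moreover have "(\<integral>x. indicator ?H x * pd (g ?e) ?e x \<partial>lborel)
      = - (1/16) * (\<integral>y. s / ((norm (y - snd p))\<^sup>2 + s\<^sup>2) * (cmod (f (fst p, y)))\<^sup>2 \<partial>lborel)"
  proof -
    have "\<sigma> * g ?e (fst p, y) = 1/16 * (s / ((norm (y - snd p))\<^sup>2 + s\<^sup>2) * (cmod (f (fst p, y)))\<^sup>2)" for y
    proof -
      have "norm ((fst p, y) - p) = norm (y - snd p)" by (cases p) (simp add: norm_Pair)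
      moreover have "c (fst p, y) \<bullet> ?e = \<sigma> * s / 4" by (cases p) (simp add: c_def zero_prod_def[symmetric])
      moreover have "\<sigma> * (1/4 * (\<sigma> * s / 4 * (1 / A)) * F) = (\<sigma> * \<sigma>) * (1/16 * (s / A * F))" for A F by simp
      moreover have "\<sigma> * \<sigma> = 1" using \<sigma> by auto
      ultimately show ?thesis unfolding g_def X_def i_def D_def \<phi>_def by (simp only: mult_1_left)
    qed
    then have eq: "\<sigma> * (\<integral>y. g ?e (fst p, y) \<partial>lborel)
      = 1/16 * (\<integral>y. s / ((norm (y - snd p))\<^sup>2 + s\<^sup>2) * (cmod (f (fst p, y)))\<^sup>2 \<partial>lborel)"
      unfolding integral_mult_right_zero[symmetric] by (rule Bochner_Integration.integral_cong[OF refl])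
    have "(\<integral>x. indicator ?H x * pd (g ?e) ?e x \<partial>lborel) = - (\<sigma> * (\<integral>y. g ?e (fst p, y) \<partial>lborel))"
      using integral_pd_half_space[where R=R and g="g ?e" and j="fst p", OF C1g g0 \<sigma>] by simp
    then show ?thesis unfolding eq by (simp only: mult_minus_left)
  qed
  ultimately have sum: "(\<integral>x. indicator ?H x * (\<Sum>e\<in>Basis. pd (g e) e x) \<partial>lborel)
      = - (1/16) * (\<integral>y. s / ((norm (y - snd p))\<^sup>2 + s\<^sup>2) * (cmod (f (fst p, y)))\<^sup>2 \<partial>lborel)"
    unfolding sum_distrib_left using ig by (subst Bochner_Integration.integral_sum) (auto simp: Basis_point)
  have i1: "integrable lborel (\<lambda>x. indicator ?H x * (P x + (\<Sum>e\<in>Basis. pd (g e) e x)))"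
    unfolding distrib_left sum_distrib_left using iP ig by (intro Bochner_Integration.integrable_add Bochner_Integration.integrable_sum)
  have lhs: "(\<integral>x. indicator ?H x * (P x + (\<Sum>e\<in>Basis. pd (g e) e x)) \<partial>lborel)
     = G - (1/16) * (\<integral>y. s / ((norm (y - snd p))\<^sup>2 + s\<^sup>2) * (cmod (f (fst p, y)))\<^sup>2 \<partial>lborel)"
  proof -
    have i2: "integrable lborel (\<lambda>x. indicator ?H x * (\<Sum>e\<in>Basis. pd (g e) e x))"
      unfolding sum_distrib_left using ig by (intro Bochner_Integration.integrable_sum)
    show ?thesis unfolding distrib_left Bochner_Integration.integral_add[OF iP i2] sum by (simp add: G_def P_def)
  qed
  have pos: "0 \<le> indicator ?H x * (P x + (\<Sum>e\<in>Basis. pd (g e) e x))" for x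
    using order_trans[OF _ pw[of x], of 0] D[of x] by (auto simp: indicator_def \<phi>_def)
  then have "0 \<le> (\<integral>x. indicator ?H x * (P x + (\<Sum>e\<in>Basis. pd (g e) e x)) \<partial>lborel)"
    by (intro Bochner_Integration.integral_nonneg)
  then show "(\<integral>y. s / ((norm (y - snd p))\<^sup>2 + s\<^sup>2) * (cmod (f (fst p, y)))\<^sup>2 \<partial>lborel) \<le> 16 * G" unfolding lhs by simp
  have "(\<integral>x. indicator ?H x * (\<phi> x / (16 * D x)) \<partial>lborel) \<le> (\<integral>x. indicator ?H x * (P x + (\<Sum>e\<in>Basis. pd (g e) e x)) \<partial>lborel)"
  proof (rule integral_mono_AE')
    show "AE x in lborel. indicator ?H x * (\<phi> x / (16 * D x)) \<le> indicator ?H x * (P x + (\<Sum>e\<in>Basis. pd (g e) e x))"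
      using pw by (intro always_eventually allI) (auto simp: indicator_def)
    show "AE x in lborel. 0 \<le> indicator ?H x * (P x + (\<Sum>e\<in>Basis. pd (g e) e x))"
      using pos by simp
  qed (rule i1)
  also have "\<dots> \<le> G"
    unfolding lhs using s by (simp add: add_nonneg_nonneg)
  finally have "(\<integral>x. indicator ?H x * (\<phi> x / (16 * D x)) \<partial>lborel) \<le> G" .
  moreover have "(\<integral>x. indicator ?H x * (\<phi> x / D x) \<partial>lborel) = 16 * (\<integral>x. indicator ?H x * (\<phi> x / (16 * D x)) \<partial>lborel)"
    unfolding integral_mult_right_zero[symmetric] by (rule Bochner_Integration.integral_cong[OF refl]) simp
  ultimately have "(\<integral>x. indicator ?H x * (\<phi> x / D x) \<partial>lborel) \<le> 16 * G" by linarith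
  then show "(\<integral>x. indicator ?H x * ((cmod (f x))\<^sup>2 / ((norm (x - p))\<^sup>2 + s\<^sup>2)) \<partial>lborel) \<le> 16 * G"
    unfolding \<phi>_def D_def .
qed

section \<open>L2 as a space of functions, and its completeness\<close>

section \<open>Square-integrable functions\<close>

definition cscale :: "complex \<Rightarrow> ('a \<Rightarrow> complex) \<Rightarrow> 'a \<Rightarrow> complex" where
  "cscale c f = (\<lambda>x. c * f x)"

lemma vector_space_cscale: "vector_space cscale"
  by unfold_locales (auto simp: cscale_def fun_eq_iff algebra_simps)

lemma subspaceI_fun:
  assumes "(\<lambda>_. 0) \<in> V" "\<And>f g. \<lbrakk>f \<in> V; g \<in> V\<rbrakk> \<Longrightarrow> (\<lambda>x. f x + g x) \<in> V"
    "\<And>c f. f \<in> V \<Longrightarrow> (\<lambda>x. c * f x) \<in> V"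
  shows "module.subspace cscale V"
proof -
  interpret vector_space cscale by (rule vector_space_cscale)
  show ?thesis unfolding subspace_def cscale_def plus_fun_def zero_fun_def
    by (intro conjI ballI allI) (rule assms(1), erule (1) assms(2), erule assms(3))
qed

lemma psd_form_funI:
  assumes "(\<lambda>_. 0) \<in> V" "\<And>f g. \<lbrakk>f \<in> V; g \<in> V\<rbrakk> \<Longrightarrow> (\<lambda>x. f x + g x) \<in> V"
    "\<And>c f. f \<in> V \<Longrightarrow> (\<lambda>x. c * f x) \<in> V"
    and "\<And>f g h. \<lbrakk>f \<in> V; g \<in> V; h \<in> V\<rbrakk> \<Longrightarrow> B (\<lambda>x. f x + g x) h = B f h + B g h"
    and "\<And>c f g. \<lbrakk>f \<in> V; g \<in> V\<rbrakk> \<Longrightarrow> B (\<lambda>x. c * f x) g = c * B f g"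
    and "\<And>f g. \<lbrakk>f \<in> V; g \<in> V\<rbrakk> \<Longrightarrow> B g f = cnj (B f g)"
    and "\<And>f. f \<in> V \<Longrightarrow> 0 \<le> Re (B f f)"
  shows "psd_form cscale V B"
proof -
  have "module.subspace cscale V" by (rule subspaceI_fun) (fact assms)+
  then show ?thesis
    by (intro psd_form.intro psd_form_axioms.intro vector_space_cscale)
      (simp_all only: cscale_def plus_fun_def assms(4,5,7), (rule assms(6); assumption)?)
qed

lemma square_integrable_mult:
  fixes f g :: "'a \<Rightarrow> complex"
  assumes "f \<in> borel_measurable M" "g \<in> borel_measurable M"
    "integrable M (\<lambda>x. (cmod (f x))\<^sup>2)" "integrable M (\<lambda>x. (cmod (g x))\<^sup>2)"
  shows "integrable M (\<lambda>x. f x * g x)"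
proof (rule Bochner_Integration.integrable_bound)
  show "integrable M (\<lambda>x. (cmod (f x))\<^sup>2 + (cmod (g x))\<^sup>2)" using assms by simp
  show "(\<lambda>x. f x * g x) \<in> borel_measurable M" using assms by simp
  have "s * t \<le> s\<^sup>2 + t\<^sup>2" for s t :: real
  proof -
    have "0 \<le> (s - t)\<^sup>2 + s\<^sup>2 + t\<^sup>2" by simp
    then show ?thesis by (simp add: power2_diff)
  qed
  then show "AE x in M. norm (f x * g x) \<le> norm ((cmod (f x))\<^sup>2 + (cmod (g x))\<^sup>2)"
    by (simp add: norm_mult)
qed

lemma cmod_add_sq: "(cmod (w + z))\<^sup>2 \<le> 2 * (cmod w)\<^sup>2 + 2 * (cmod z)\<^sup>2"
proof -
  have "(cmod (w + z))\<^sup>2 \<le> (cmod w + cmod z)\<^sup>2" by (intro power_mono norm_triangle_ineq) simp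
  also have "\<dots> = 2 * (cmod w)\<^sup>2 + 2 * (cmod z)\<^sup>2 - (cmod w - cmod z)\<^sup>2"
    by (simp add: power2_eq_square algebra_simps)
  also have "\<dots> \<le> 2 * (cmod w)\<^sup>2 + 2 * (cmod z)\<^sup>2" by simp
  finally show ?thesis .
qed

lemma L2_D: "f \<in> L2 S \<Longrightarrow> f \<in> borel_measurable (leb S)" "f \<in> L2 S \<Longrightarrow> integrable (leb S) (\<lambda>x. (cmod (f x))\<^sup>2)"
  by (simp_all add: L2_def)

lemma L2_zero: "(\<lambda>_. 0) \<in> L2 S"
  by (simp add: L2_def)

lemma L2_add: "\<lbrakk>f \<in> L2 S; g \<in> L2 S\<rbrakk> \<Longrightarrow> (\<lambda>x. f x + g x) \<in> L2 S"
  unfolding L2_def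
proof (clarify, intro conjI)
  assume a: "f \<in> borel_measurable (leb S)" "integrable (leb S) (\<lambda>x. (cmod (f x))\<^sup>2)"
    "g \<in> borel_measurable (leb S)" "integrable (leb S) (\<lambda>x. (cmod (g x))\<^sup>2)"
  show m: "(\<lambda>x. f x + g x) \<in> borel_measurable (leb S)" using a by simp
  show "integrable (leb S) (\<lambda>x. (cmod (f x + g x))\<^sup>2)"
  proof (rule Bochner_Integration.integrable_bound)
    show "integrable (leb S) (\<lambda>x. 2 * (cmod (f x))\<^sup>2 + 2 * (cmod (g x))\<^sup>2)" using a by simp
    show "(\<lambda>x. (cmod (f x + g x))\<^sup>2) \<in> borel_measurable (leb S)" using m by simp
    show "AE x in leb S. norm ((cmod (f x + g x))\<^sup>2) \<le> norm (2 * (cmod (f x))\<^sup>2 + 2 * (cmod (g x))\<^sup>2)"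
      by (intro always_eventually allI) (simp add: cmod_add_sq)
  qed
qed

lemma L2_mult_bounded:
  assumes u: "u \<in> L2 S" and h: "h \<in> borel_measurable (leb S)" "\<And>x. x \<in> S \<Longrightarrow> cmod (h x) \<le> M"
  shows "(\<lambda>x. h x * u x) \<in> L2 S" and "L2_norm_sq S (\<lambda>x. h x * u x) \<le> M\<^sup>2 * L2_norm_sq S u"
proof -
  have le: "AE x in leb S. (cmod (h x * u x))\<^sup>2 \<le> M\<^sup>2 * (cmod (u x))\<^sup>2"
  proof (rule AE_I2)
    fix x assume "x \<in> space (leb S)"
    then have "cmod (h x) \<le> M" using h(2) by (simp add: space_restrict_space)
    then show "(cmod (h x * u x))\<^sup>2 \<le> M\<^sup>2 * (cmod (u x))\<^sup>2"
      unfolding norm_mult power_mult_distrib by (intro mult_right_mono power_mono) auto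
  qed
  have i: "integrable (leb S) (\<lambda>x. M\<^sup>2 * (cmod (u x))\<^sup>2)" using L2_D(2)[OF u] by simp
  have m: "(\<lambda>x. h x * u x) \<in> borel_measurable (leb S)" using L2_D(1)[OF u] h(1) by simp
  then have m2: "(\<lambda>x. (cmod (h x * u x))\<^sup>2) \<in> borel_measurable (leb S)" by simp
  have j: "integrable (leb S) (\<lambda>x. (cmod (h x * u x))\<^sup>2)"
    by (rule Bochner_Integration.integrable_bound[OF i m2]) (use le in eventually_elim, simp)
  show "(\<lambda>x. h x * u x) \<in> L2 S" using m j by (simp add: L2_def)
  have "L2_norm_sq S (\<lambda>x. h x * u x) \<le> (\<integral>x. M\<^sup>2 * (cmod (u x))\<^sup>2 \<partial>leb S)"
    unfolding L2_norm_sq_def by (rule integral_mono_AE[OF j i le])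
  then show "L2_norm_sq S (\<lambda>x. h x * u x) \<le> M\<^sup>2 * L2_norm_sq S u" by (simp add: L2_norm_sq_def)
qed

lemma L2_scale: "f \<in> L2 S \<Longrightarrow> (\<lambda>x. c * f x) \<in> L2 S"
  by (rule L2_mult_bounded(1)[where M="cmod c"]) auto

lemma L2_diff: "\<lbrakk>f \<in> L2 S; g \<in> L2 S\<rbrakk> \<Longrightarrow> (\<lambda>x. f x - g x) \<in> L2 S"
  using L2_add[of f S "\<lambda>x. (-1) * g x"] L2_scale[of g S "-1"] by simp

lemma L2_cnj: "f \<in> L2 S \<Longrightarrow> (\<lambda>x. cnj (f x)) \<in> L2 S"
  by (auto simp: L2_def intro!: borel_measurable_continuous_on[of cnj] continuous_intros)

lemma L2_inner_integrable:
  assumes "f \<in> L2 S" "g \<in> L2 S"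
  shows "integrable (leb S) (\<lambda>x. f x * cnj (g x))"
  using square_integrable_mult[of f "leb S" "\<lambda>x. cnj (g x)"] L2_D[OF assms(1)] L2_D[OF L2_cnj[OF assms(2)]] by simp

lemma L2_inner_self: "L2_inner S f f = of_real (L2_norm_sq S f)"
  unfolding L2_inner_def L2_norm_sq_def integral_complex_of_real[symmetric] complex_norm_square ..

lemma L2_norm_sq_nonneg: "0 \<le> L2_norm_sq S f"
  by (simp add: L2_norm_sq_def)

lemma Re_L2_inner_self: "Re (L2_inner S f f) = L2_norm_sq S f"
  by (simp add: L2_inner_self)

lemma psd_form_L2: "psd_form cscale (L2 S) (L2_inner S)"
proof (rule psd_form_funI)
  show "L2_inner S (\<lambda>x. f x + g x) h = L2_inner S f h + L2_inner S g h"
    if "f \<in> L2 S" "g \<in> L2 S" "h \<in> L2 S" for f g h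
    unfolding L2_inner_def distrib_right
    by (intro Bochner_Integration.integral_add L2_inner_integrable that)
  show "L2_inner S (\<lambda>x. c * f x) g = c * L2_inner S f g" for c f g
    by (simp add: L2_inner_def mult.assoc)
  show "L2_inner S g f = cnj (L2_inner S f g)" for f g
    unfolding L2_inner_def Bochner_Integration.integral_cnj[symmetric]
    by (simp only: complex_cnj_mult complex_cnj_cnj mult.commute)
  show "0 \<le> Re (L2_inner S f f)" for f by (simp add: Re_L2_inner_self L2_norm_sq_nonneg)
qed (auto intro: L2_zero L2_add L2_scale)

lemma L2_inner_cong:
  assumes "AE x in leb S. f x = f' x" "AE x in leb S. g x = g' x" "f \<in> L2 S" "f' \<in> L2 S" "g \<in> L2 S" "g' \<in> L2 S"
  shows "L2_inner S f g = L2_inner S f' g'"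
  unfolding L2_inner_def
proof (rule integral_cong_AE)
  show "AE x in leb S. f x * cnj (g x) = f' x * cnj (g' x)" using assms(1,2) by eventually_elim simp
qed (rule borel_measurable_integrable[OF L2_inner_integrable]; fact assms)+

lemma L2_norm_sq_cong:
  assumes "AE x in leb S. f x = g x" "f \<in> L2 S" "g \<in> L2 S"
  shows "L2_norm_sq S f = L2_norm_sq S g"
  using L2_inner_cong[OF assms(1,1,2,3,2,3)] Re_L2_inner_self by metis

lemma L2_norm_sq_0: "f \<in> L2 S \<Longrightarrow> L2_norm_sq S f = 0 \<longleftrightarrow> (AE x in leb S. f x = 0)"
  unfolding L2_norm_sq_def
  by (subst integral_nonneg_eq_0_iff_AE) (auto dest: L2_D)

lemma L2_tendsto_imp_Cauchy:
  assumes f: "\<And>n. f n \<in> L2 S" "g \<in> L2 S" "(\<lambda>n. L2_norm_sq S (\<lambda>x. f n x - g x)) \<longlonglongrightarrow> 0" and "e > 0"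
  shows "\<exists>N. \<forall>m\<ge>N. \<forall>n\<ge>N. L2_norm_sq S (\<lambda>x. f m x - f n x) < e"
proof -
  interpret psd_form cscale "L2 S" "L2_inner S" by (rule psd_form_L2)
  have "\<forall>\<^sub>F n in sequentially. L2_norm_sq S (\<lambda>x. f n x - g x) < e / 4"
    using order_tendstoD(2)[OF f(3), of "e/4"] \<open>e > 0\<close> by simp
  then obtain N where N: "\<And>n. n \<ge> N \<Longrightarrow> L2_norm_sq S (\<lambda>x. f n x - g x) < e / 4"
    by (auto simp: eventually_sequentially)
  have "L2_norm_sq S (\<lambda>x. f m x - f n x) < e" if "m \<ge> N" "n \<ge> N" for m n
  proof -
    have "L2_norm_sq S ((f m - g) - (f n - g)) \<le> 2 * L2_norm_sq S (f m - g) + 2 * L2_norm_sq S (f n - g)"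
      using Re_diff_le[of "f m - g" "f n - g"] L2_diff[OF f(1,2)] by (simp add: Re_L2_inner_self fun_diff_def)
    then show ?thesis using N[OF that(1)] N[OF that(2)] by (simp add: fun_diff_def)
  qed
  then show ?thesis by blast
qed

text \<open>Riesz-Fischer: a rapidly convergent subsequence converges almost everywhere, and Fatou's
  lemma shows that its pointwise limit is also the limit in L2.\<close>

lemma L2_complete:
  assumes f: "\<And>n::nat. f n \<in> L2 S"
    and Cauchy: "\<And>e. e > 0 \<Longrightarrow> \<exists>N. \<forall>m\<ge>N. \<forall>n\<ge>N. L2_norm_sq S (\<lambda>x. f m x - f n x) < e"
  shows "\<exists>g\<in>L2 S. (\<lambda>n. L2_norm_sq S (\<lambda>x. f n x - g x)) \<longlonglongrightarrow> 0"
proof -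
  have m [measurable]: "f n \<in> borel_measurable (leb S)" for n using f L2_D by blast
  have nn: "(\<integral>\<^sup>+x. ennreal ((cmod (h x))\<^sup>2) \<partial>leb S) = ennreal (L2_norm_sq S h)" if "h \<in> L2 S" for h
    unfolding L2_norm_sq_def by (rule nn_integral_eq_integral) (use L2_D[OF that] in auto)
  \<comment> \<open>The rate \<open>1/8\<close> beats the weight \<open>4^k\<close> used below:
    \<open>4^k |d k|^2\<close> is almost everywhere summable over \<open>k\<close>, hence bounded,
    and \<open>|d k|\<close> is dominated by a geometric series.\<close>
  have "\<exists>N. \<forall>m\<ge>N. \<forall>n\<ge>N. L2_norm_sq S (\<lambda>x. f m x - f n x) < (1/8)^k" for k :: nat
    by (rule Cauchy) simp
  then obtain N where N: "\<And>k m n. \<lbrakk>m \<ge> N k; n \<ge> N k\<rbrakk> \<Longrightarrow> L2_norm_sq S (\<lambda>x. f m x - f n x) < (1/8)^k"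
    by metis
  \<comment> \<open>Partial sums guarantee \<open>r k \<ge> N j\<close> for all
    \<open>j \<le> k\<close>, not only for \<open>j = k\<close>.\<close>
  define r where "r k = (\<Sum>i\<le>k. N i)" for k
  have rN: "r k \<ge> N k" for k unfolding r_def by (rule member_le_sum) auto
  have rSuc: "r (Suc k) \<ge> N k" for k using rN[of k] by (simp add: r_def)
  define d where "d k x = f (r (Suc k)) x - f (r k) x" for k x
  have dL: "d k \<in> L2 S" for k unfolding d_def[abs_def] by (intro L2_diff f)
  have dn: "L2_norm_sq S (d k) \<le> (1/8)^k" for k
    unfolding d_def[abs_def] by (rule less_imp_le[OF N[OF rSuc rN]])
  have dm [measurable]: "d k \<in> borel_measurable (leb S)" for k using dL L2_D by blast
  have "(\<integral>\<^sup>+x. (\<Sum>k. ennreal (4^k * (cmod (d k x))\<^sup>2)) \<partial>leb S) = (\<Sum>k. \<integral>\<^sup>+x. ennreal (4^k * (cmod (d k x))\<^sup>2) \<partial>leb S)"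
    by (rule nn_integral_suminf) simp
  also have "\<dots> \<le> (\<Sum>k. ennreal ((1/2)^k))"
  proof (rule suminf_le)
    fix k
    have "(\<integral>\<^sup>+x. ennreal (4^k * (cmod (d k x))\<^sup>2) \<partial>leb S) = ennreal (4^k) * ennreal (L2_norm_sq S (d k))"
      by (simp add: ennreal_mult nn_integral_cmult nn[OF dL])
    also have "\<dots> = ennreal (4^k * L2_norm_sq S (d k))" by (simp add: ennreal_mult L2_norm_sq_nonneg)
    also have "\<dots> \<le> ennreal ((1/2)^k)"
    proof (rule ennreal_leI)
      have "4^k * L2_norm_sq S (d k) \<le> 4^k * (1/8)^k" using dn by simp
      also have "\<dots> = (1/2)^k" by (simp flip: power_mult_distrib)
      finally show "4^k * L2_norm_sq S (d k) \<le> (1/2)^k" .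
    qed
    finally show "(\<integral>\<^sup>+x. ennreal (4^k * (cmod (d k x))\<^sup>2) \<partial>leb S) \<le> ennreal ((1/2)^k)" .
  qed auto
  also have "\<dots> = ennreal (\<Sum>k. (1/2)^k)" by (rule suminf_ennreal2) (auto simp: summable_geometric)
  also have "\<dots> < \<infinity>" by simp
  finally have fin: "(\<integral>\<^sup>+x. (\<Sum>k. ennreal (4^k * (cmod (d k x))\<^sup>2)) \<partial>leb S) \<noteq> \<infinity>" by simp
  have "AE x in leb S. (\<Sum>k. ennreal (4^k * (cmod (d k x))\<^sup>2)) \<noteq> \<infinity>"
    by (rule nn_integral_PInf_AE[OF _ fin]) simp
  then have conv: "AE x in leb S. convergent (\<lambda>k. f (r k) x)"
  proof eventually_elim
    fix x assume fin: "(\<Sum>k. ennreal (4^k * (cmod (d k x))\<^sup>2)) \<noteq> \<infinity>"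
    obtain C where C: "C \<ge> 0" "(\<Sum>k. ennreal (4^k * (cmod (d k x))\<^sup>2)) = ennreal C"
    proof
      show "0 \<le> enn2real (\<Sum>k. ennreal (4^k * (cmod (d k x))\<^sup>2))" by (rule enn2real_nonneg)
      show "(\<Sum>k. ennreal (4^k * (cmod (d k x))\<^sup>2)) = ennreal (enn2real (\<Sum>k. ennreal (4^k * (cmod (d k x))\<^sup>2)))"
        by (rule ennreal_enn2real[symmetric]) (use fin in \<open>simp only: infinity_ennreal_def less_top\<close>)
    qed
    have b: "cmod (d k x) \<le> sqrt C * (1/2)^k" for k
    proof -
      have "(\<Sum>j\<in>{k}. ennreal (4^j * (cmod (d j x))\<^sup>2)) \<le> (\<Sum>j. ennreal (4^j * (cmod (d j x))\<^sup>2))"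
        by (rule sum_le_suminf) (simp_all only: summableI finite.intros zero_le)
      then have "ennreal (4^k * (cmod (d k x))\<^sup>2) \<le> ennreal C" unfolding C(2) by simp
      then have "4^k * (cmod (d k x))\<^sup>2 \<le> C" using C(1) by (simp only: ennreal_le_iff)
      moreover have "4^k * (cmod (d k x))\<^sup>2 = (2^k * cmod (d k x))\<^sup>2"
        by (simp add: power_mult_distrib power_mult[symmetric] mult.commute[of k] power_mult)
      ultimately have "2^k * cmod (d k x) \<le> sqrt C" by (simp add: real_le_rsqrt)
      then show ?thesis by (simp add: field_simps)
    qed
    have "summable (\<lambda>k. d k x)"
      by (rule summable_comparison_test'[where g="\<lambda>k. sqrt C * (1/2)^k" and N=0])
        (use b in \<open>auto intro!: summable_mult summable_geometric\<close>)
    then have "convergent (\<lambda>n. \<Sum>k<n. d k x)" by (simp add: summable_iff_convergent)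
    moreover have "(\<Sum>k<n. d k x) = f (r n) x - f (r 0) x" for n
      unfolding d_def by (rule sum_lessThan_telescope)
    ultimately have "convergent (\<lambda>n. f (r n) x - f (r 0) x)" by simp
    then show "convergent (\<lambda>k. f (r k) x)" by (simp add: convergent_diff_const_right_iff)
  qed
  define g where "g x = lim (\<lambda>k. f (r k) x)" for x
  have gm [measurable]: "g \<in> borel_measurable (leb S)" unfolding g_def[abs_def] by measurable
  have lim: "AE x in leb S. (\<lambda>k. f (r k) x) \<longlonglongrightarrow> g x"
    using conv by eventually_elim (simp add: g_def convergent_LIMSEQ_iff)
  have est: "(\<integral>\<^sup>+x. ennreal ((cmod (f n x - g x))\<^sup>2) \<partial>leb S) \<le> ennreal ((1/8)^j)" if n: "n \<ge> N j" for n j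
  proof -
    have "(\<integral>\<^sup>+x. ennreal ((cmod (f n x - g x))\<^sup>2) \<partial>leb S)
        = (\<integral>\<^sup>+x. liminf (\<lambda>k. ennreal ((cmod (f n x - f (r k) x))\<^sup>2)) \<partial>leb S)"
    proof (rule nn_integral_cong_AE, use lim in eventually_elim)
      fix x assume "(\<lambda>k. f (r k) x) \<longlonglongrightarrow> g x"
      then have "(\<lambda>k. ennreal ((cmod (f n x - f (r k) x))\<^sup>2)) \<longlonglongrightarrow> ennreal ((cmod (f n x - g x))\<^sup>2)"
        by (intro tendsto_ennrealI tendsto_intros)
      then show "ennreal ((cmod (f n x - g x))\<^sup>2) = liminf (\<lambda>k. ennreal ((cmod (f n x - f (r k) x))\<^sup>2))"
        by (intro lim_imp_Liminf[symmetric]) simp_all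
    qed
    also have "\<dots> \<le> liminf (\<lambda>k. \<integral>\<^sup>+x. ennreal ((cmod (f n x - f (r k) x))\<^sup>2) \<partial>leb S)"
      by (rule nn_integral_liminf) simp
    also have "\<dots> \<le> limsup (\<lambda>k. \<integral>\<^sup>+x. ennreal ((cmod (f n x - f (r k) x))\<^sup>2) \<partial>leb S)"
      by (rule Liminf_le_Limsup) simp
    also have "\<dots> \<le> ennreal ((1/8)^j)"
    proof (rule Limsup_bounded, rule eventually_sequentiallyI)
      fix k assume k: "k \<ge> j"
      have "r k \<ge> N j" unfolding r_def by (rule member_le_sum) (use k in auto)
      then have "L2_norm_sq S (\<lambda>x. f n x - f (r k) x) \<le> (1/8)^j" using N[OF n] by (simp add: less_imp_le)
      then show "(\<integral>\<^sup>+x. ennreal ((cmod (f n x - f (r k) x))\<^sup>2) \<partial>leb S) \<le> ennreal ((1/8)^j)"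
        using nn[OF L2_diff[OF f f]] by (simp add: ennreal_leI)
    qed
    finally show ?thesis .
  qed
  have dL2: "(\<lambda>x. f n x - g x) \<in> L2 S" if "n \<ge> N 0" for n
  proof -
    have "(\<integral>\<^sup>+x. ennreal ((cmod (f n x - g x))\<^sup>2) \<partial>leb S) < \<infinity>"
      using est[OF that] by (simp add: le_less_trans)
    then have "integrable (leb S) (\<lambda>x. (cmod (f n x - g x))\<^sup>2)" by (intro integrableI_bounded) auto
    then show ?thesis by (simp add: L2_def)
  qed
  have "g \<in> L2 S" using L2_diff[OF f[of "N 0"] dL2[of "N 0"]] by simp
  moreover have "(\<lambda>n. L2_norm_sq S (\<lambda>x. f n x - g x)) \<longlonglongrightarrow> 0"
  proof (rule LIMSEQ_I)
    fix e :: real assume "e > 0"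
    then obtain j where j: "(1/8)^j < e" using real_arch_pow_inv[of e "1/8"] by auto
    have "L2_norm_sq S (\<lambda>x. f n x - g x) \<le> (1/8)^j" if "n \<ge> N j" for n
      using est[OF that] nn[OF L2_diff[OF f \<open>g \<in> L2 S\<close>], of n] by simp
    then show "\<exists>N. \<forall>n\<ge>N. norm (L2_norm_sq S (\<lambda>x. f n x - g x) - 0) < e"
      using j by (intro exI[of _ "N j"]) (auto simp: L2_norm_sq_nonneg intro: le_less_trans)
  qed
  ultimately show ?thesis by blast
qed

section \<open>The fundamental lemma of the calculus of variations\<close>

lemma C1_prod:
  fixes f :: "'i \<Rightarrow> 'a::euclidean_space \<Rightarrow> real"
  shows "\<lbrakk>finite I; \<And>i. i \<in> I \<Longrightarrow> Ck 1 (f i)\<rbrakk> \<Longrightarrow> Ck 1 (\<lambda>x. \<Prod>i\<in>I. f i x)"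
proof (induction I rule: finite_induct)
  case empty
  show ?case using C1_const[of "1::real"] by simp
next
  case (insert i I)
  have "Ck 1 (\<lambda>x. f i x * (\<Prod>i\<in>I. f i x))" by (rule C1_mult) (use insert in auto)
  then show ?case using insert by simp
qed

text \<open>One-dimensional steps of scale \<open>1 / n\<close> in each coordinate: supported in the
  closed box, they tend pointwise to the indicator of the open one.\<close>

definition box_bump :: "'a::euclidean_space \<Rightarrow> 'a \<Rightarrow> nat \<Rightarrow> 'a \<Rightarrow> real" where
  "box_bump a b n x = (\<Prod>i\<in>Basis. step (real n * (x \<bullet> i - a \<bullet> i)) * step (real n * (b \<bullet> i - x \<bullet> i)))"

lemma C1_step_affine:
  fixes i :: "'a::euclidean_space"
  shows "Ck 1 (\<lambda>x. step (c * (x \<bullet> i) + d))"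
  by (rule C1_compose[where g=step and g'=step', OF step_deriv step'_cont])
    (intro C1_add C1_mult C1_const C1_inner)

lemma C1_box_bump: "Ck 1 (box_bump a b n)"
proof -
  have "Ck 1 (\<lambda>x. step (real n * (x \<bullet> i - a \<bullet> i)) * step (real n * (b \<bullet> i - x \<bullet> i)))" for i
    using C1_mult[OF C1_step_affine[of "real n" i "- real n * (a \<bullet> i)"] C1_step_affine[of "- real n" i "real n * (b \<bullet> i)"]]
    by (simp add: algebra_simps)
  then show ?thesis unfolding box_bump_def[abs_def] by (intro C1_prod) auto
qed

lemma box_bump_bounds: "0 \<le> box_bump a b n x" "box_bump a b n x \<le> 1"
  unfolding box_bump_def by (intro prod_nonneg ballI mult_nonneg_nonneg step_bounds,
      intro prod_le_1 conjI mult_nonneg_nonneg mult_le_one step_bounds)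

lemma box_bump_0: "x \<notin> box a b \<Longrightarrow> box_bump a b n x = 0"
proof -
  assume "x \<notin> box a b"
  then obtain i where i: "i \<in> Basis" "x \<bullet> i \<le> a \<bullet> i \<or> b \<bullet> i \<le> x \<bullet> i" by (auto simp: mem_box not_less)
  have "step (real n * (x \<bullet> i - a \<bullet> i)) * step (real n * (b \<bullet> i - x \<bullet> i)) = 0"
    using i(2)
  proof
    assume "x \<bullet> i \<le> a \<bullet> i" then have "real n * (x \<bullet> i - a \<bullet> i) \<le> 0" by (simp add: mult_nonneg_nonpos)
    then show ?thesis by (simp only: step_0 mult_zero_left)
  next
    assume "b \<bullet> i \<le> x \<bullet> i" then have "real n * (b \<bullet> i - x \<bullet> i) \<le> 0" by (simp add: mult_nonneg_nonpos)
    then show ?thesis by (simp only: step_0 mult_zero_right)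
  qed
  then show ?thesis unfolding box_bump_def using i(1) by (intro prod_zero) auto
qed

lemma box_bump_tendsto: "(\<lambda>n. box_bump a b n x) \<longlonglongrightarrow> indicator (box a b) x"
proof (cases "x \<in> box a b")
  case False
  then show ?thesis by (simp add: box_bump_0)
next
  case True
  have ev: "\<forall>\<^sub>F n in sequentially. step (real n * c) = 1" if "c > 0" for c
  proof -
    have "\<forall>\<^sub>F n in sequentially. real n \<ge> 1 / c"
      using filterlim_real_sequentially unfolding filterlim_at_top by blast
    then show ?thesis by eventually_elim (use that in \<open>auto intro!: step_1 simp: field_simps\<close>)
  qed
  have "\<forall>\<^sub>F n in sequentially. \<forall>i\<in>Basis. step (real n * (x \<bullet> i - a \<bullet> i)) * step (real n * (b \<bullet> i - x \<bullet> i)) = 1"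
    unfolding eventually_ball_finite_distrib[OF finite_Basis]
  proof
    fix i :: 'a assume "i \<in> Basis"
    then have "x \<bullet> i - a \<bullet> i > 0" "b \<bullet> i - x \<bullet> i > 0" using True by (auto simp: mem_box)
    from ev[OF this(1)] ev[OF this(2)]
    show "\<forall>\<^sub>F n in sequentially. step (real n * (x \<bullet> i - a \<bullet> i)) * step (real n * (b \<bullet> i - x \<bullet> i)) = 1"
      by eventually_elim simp
  qed
  then have "\<forall>\<^sub>F n in sequentially. box_bump a b n x = indicator (box a b) x"
    by eventually_elim (use True in \<open>simp add: box_bump_def\<close>)
  then show ?thesis by (rule tendsto_eventually)
qed

lemma test_function_box_bump:
  assumes \<psi>: "Ck 1 \<psi>" and sub: "cbox a b \<subseteq> \<Omega>"
  shows "test_function \<Omega> (\<lambda>x. \<psi> x * box_bump a b n x)"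
proof -
  have "closure {x. \<psi> x * box_bump a b n x \<noteq> 0} \<subseteq> cbox a b"
  proof (rule closure_minimal)
    show "{x. \<psi> x * box_bump a b n x \<noteq> 0} \<subseteq> cbox a b"
      using box_bump_0[of _ a b n] box_subset_cbox[of a b] by force
  qed (rule closed_cbox)
  moreover then have "compact (closure {x. \<psi> x * box_bump a b n x \<noteq> 0})"
    using compact_Int_closed[OF compact_cbox closed_closure, of a b "{x. \<psi> x * box_bump a b n x \<noteq> 0}"] by (simp add: Int_absorb1)
  ultimately show ?thesis
    using C1_mult[OF \<psi> C1_box_bump] sub unfolding test_function_def by blast
qed

lemma AE_box_cbox: "AE x in lborel. x \<in> cbox a b \<longrightarrow> x \<in> box a (b::'a::euclidean_space)"
proof (rule AE_I[where N="cbox a b - box a b"])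
  have "emeasure lborel (cbox a b - box a b) = emeasure lborel (cbox a b) - emeasure lborel (box a b)"
    by (rule emeasure_Diff) (use box_subset_cbox[of a b] emeasure_lborel_box_finite[of a b] in auto)
  then show "emeasure lborel (cbox a b - box a b) = 0"
    by (simp add: emeasure_lborel_box_eq emeasure_lborel_cbox_eq)
qed auto

text \<open>On a box inside \<open>\<Omega>\<close>, the Borel sets over which \<open>f\<close>
  integrates to zero form a Dynkin system. It contains the intersection-stable system
  \<open>E\<close>, which generates the Borel sets, so \<open>f\<close> vanishes almost everywhere
  on the box; countably many boxes cover \<open>\<Omega>\<close>.\<close>

lemma fundamental_lemma:
  fixes f :: "'a::euclidean_space \<Rightarrow> complex"
  assumes f: "integrable lborel f" and \<Omega>: "open \<Omega>"
    and 0: "\<And>\<phi>. test_function \<Omega> \<phi> \<Longrightarrow> (\<integral>x. f x * of_real (\<phi> x) \<partial>lborel) = 0"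
  shows "AE x in lborel. x \<in> \<Omega> \<longrightarrow> f x = 0"
proof -
  have fm [measurable]: "f \<in> borel_measurable borel" using f by simp
  have box: "AE x in lborel. x \<in> cbox a b \<longrightarrow> f x = 0" if sub: "cbox a b \<subseteq> \<Omega>" for a b
  proof -
    define h where "h x = indicator (box a b) x *\<^sub>R f x" for x
    have h: "integrable lborel h" unfolding h_def[abs_def] using f by (intro integrable_mult_indicator) auto
    \<comment> \<open>With bounded limits of C1 functions as the defining property, intersections
      correspond to products. Compact support is not asked of these functions; the factor
      \<open>box_bump\<close> below provides it.\<close>
    define E :: "'a set set" where "E = {A. \<exists>\<phi>. (\<forall>n. Ck 1 (\<phi> n)) \<and> (\<forall>n x. 0 \<le> \<phi> n x \<and> \<phi> n x \<le> 1) \<and>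
        (\<forall>x. (\<lambda>n::nat. \<phi> n x) \<longlonglongrightarrow> (indicator A x :: real))}"
    have E0: "(\<integral>x. indicator A x *\<^sub>R h x \<partial>lborel) = 0" if A: "A \<in> E" for A
    proof -
      obtain \<phi> where \<phi>: "\<forall>n. Ck 1 (\<phi> n)" "\<forall>n x. 0 \<le> \<phi> n x \<and> \<phi> n x \<le> 1"
          "\<forall>x. (\<lambda>n::nat. \<phi> n x) \<longlonglongrightarrow> (indicator A x :: real)" using A unfolding E_def by blast
      have lim: "(\<lambda>n. f x * of_real (\<phi> n x * box_bump a b n x)) \<longlonglongrightarrow> indicator A x *\<^sub>R h x" for x
      proof -
        have "(\<lambda>n. f x * of_real (\<phi> n x * box_bump a b n x)) \<longlonglongrightarrow> f x * of_real (indicator A x * indicator (box a b) x)"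
          by (intro tendsto_intros box_bump_tendsto \<phi>(3)[rule_format])
        then show ?thesis by (simp add: h_def scaleR_conv_of_real mult_ac)
      qed
      have m: "(\<lambda>x. f x * of_real (\<phi> n x * box_bump a b n x)) \<in> borel_measurable borel" for n
        using C1_measurable[OF \<phi>(1)[rule_format]] C1_measurable[OF C1_box_bump] by measurable
      have "(\<lambda>n. \<integral>x. f x * of_real (\<phi> n x * box_bump a b n x) \<partial>lborel) \<longlonglongrightarrow> (\<integral>x. indicator A x *\<^sub>R h x \<partial>lborel)"
      proof (rule integral_dominated_convergence[where w="\<lambda>x. cmod (f x)"])
        have "(\<lambda>x. indicator A x *\<^sub>R h x) \<in> borel_measurable borel"
          by (rule borel_measurable_LIMSEQ_metric[OF m lim])
        then show "(\<lambda>x. indicator A x *\<^sub>R h x) \<in> borel_measurable lborel" by simp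
        show "(\<lambda>x. f x * of_real (\<phi> n x * box_bump a b n x)) \<in> borel_measurable lborel" for n using m by simp
        show "integrable lborel (\<lambda>x. cmod (f x))" using f by simp
        show "AE x in lborel. (\<lambda>n. f x * of_real (\<phi> n x * box_bump a b n x)) \<longlonglongrightarrow> indicator A x *\<^sub>R h x"
          by (intro always_eventually allI lim)
        show "AE x in lborel. norm (f x * of_real (\<phi> n x * box_bump a b n x)) \<le> cmod (f x)" for n
        proof (intro always_eventually allI)
          fix x
          have "\<bar>\<phi> n x * box_bump a b n x\<bar> \<le> 1"
            using \<phi>(2)[rule_format, of n x] box_bump_bounds[of a b n x] by (simp add: abs_mult mult_le_one)
          then show "norm (f x * of_real (\<phi> n x * box_bump a b n x)) \<le> cmod (f x)"
            unfolding norm_mult norm_of_real by (rule mult_left_le) simp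
        qed
      qed
      moreover have "(\<integral>x. f x * of_real (\<phi> n x * box_bump a b n x) \<partial>lborel) = 0" for n
        by (rule 0[OF test_function_box_bump[OF _ sub]]) (rule \<phi>(1)[rule_format])
      ultimately have "(\<lambda>n::nat. 0) \<longlonglongrightarrow> (\<integral>x. indicator A x *\<^sub>R h x \<partial>lborel)" by (simp only:)
      then show ?thesis using LIMSEQ_unique tendsto_const by blast
    qed
    have UE: "UNIV \<in> E" unfolding E_def
      by (rule CollectI, rule exI[of _ "\<lambda>_ _. 1"], intro conjI allI C1_const) simp_all
    have IntE: "Int_stable E"
    proof (rule Int_stableI)
      fix A B assume "A \<in> E" "B \<in> E"
      then obtain \<phi> \<psi> where \<phi>: "\<forall>n. Ck 1 (\<phi> n)" "\<forall>n x. 0 \<le> \<phi> n x \<and> \<phi> n x \<le> 1"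
          "\<forall>x. (\<lambda>n::nat. \<phi> n x) \<longlonglongrightarrow> (indicator A x :: real)"
        and \<psi>: "\<forall>n. Ck 1 (\<psi> n)" "\<forall>n x. 0 \<le> \<psi> n x \<and> \<psi> n x \<le> 1"
          "\<forall>x. (\<lambda>n::nat. \<psi> n x) \<longlonglongrightarrow> (indicator B x :: real)" unfolding E_def by blast
      show "A \<inter> B \<in> E" unfolding E_def
      proof (rule CollectI, rule exI[of _ "\<lambda>n x. \<phi> n x * \<psi> n x"], intro conjI allI)
        show "Ck 1 (\<lambda>x. \<phi> n x * \<psi> n x)" for n by (intro C1_mult \<phi>(1)[rule_format] \<psi>(1)[rule_format])
        show "0 \<le> \<phi> n x * \<psi> n x" "\<phi> n x * \<psi> n x \<le> 1" for n x
          using \<phi>(2)[rule_format, of n x] \<psi>(2)[rule_format, of n x] by (auto intro: mult_le_one)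
        show "(\<lambda>n. \<phi> n x * \<psi> n x) \<longlonglongrightarrow> indicator (A \<inter> B) x" for x
          unfolding indicator_inter_arith by (intro tendsto_mult \<phi>(3)[rule_format] \<psi>(3)[rule_format])
      qed
    qed
    have boxE: "box c d \<in> E" for c d unfolding E_def
      by (rule CollectI, rule exI[of _ "box_bump c d"],
          intro conjI allI C1_box_bump box_bump_bounds box_bump_tendsto)
    have Eb: "E \<subseteq> sets borel"
    proof
      fix A assume "A \<in> E"
      then obtain \<phi> where \<phi>: "\<forall>n. Ck 1 (\<phi> n)" "\<forall>x. (\<lambda>n::nat. \<phi> n x) \<longlonglongrightarrow> (indicator A x :: real)"
        unfolding E_def by blast
      have "(\<lambda>x. indicator A x :: real) \<in> borel_measurable borel"
        by (rule borel_measurable_LIMSEQ_metric[OF C1_measurable[OF \<phi>(1)[rule_format]] \<phi>(2)[rule_format]])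
      then show "A \<in> sets borel" by (simp add: borel_measurable_indicator_iff)
    qed
    have Esub: "sigma_sets UNIV E \<subseteq> sets borel"
      using sets.sigma_sets_subset[OF Eb] by simp
    have "sigma_sets UNIV (range (\<lambda>(c, d). box c d :: 'a set)) \<subseteq> sigma_sets UNIV E"
      by (rule sigma_sets_mono') (use boxE in auto)
    then have bE: "sets borel \<subseteq> sigma_sets UNIV E"
      unfolding borel_eq_box by (simp add: sets_measure_of)
    have sh: "set_integrable lborel A h" if "A \<in> sets borel" for A
      using integrable_mult_indicator[of A lborel h] h that by (simp add: set_integrable_def)
    have all: "(LINT x:A|lborel. h x) = 0" if "A \<in> sigma_sets UNIV E" for A
      using IntE subset_UNIV[of E, unfolded Pow_UNIV[symmetric]] that
    proof (induction A rule: sigma_sets_induct_disjoint)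
      case (basic A)
      then show ?case using E0 by (simp add: set_lebesgue_integral_def)
    next
      case empty
      then show ?case by (simp add: set_lebesgue_integral_def)
    next
      case (compl A)
      then have A: "A \<in> sets borel" using Esub by blast
      have "(LINT x:UNIV|lborel. h x) = (LINT x:A|lborel. h x) + (LINT x:UNIV - A|lborel. h x)"
        using set_integral_Un[of A "UNIV - A" lborel h] sh A by simp
      moreover have "(LINT x:UNIV|lborel. h x) = 0" using E0[OF UE] by (simp add: set_lebesgue_integral_def)
      ultimately show ?case using compl by simp
    next
      case (union A)
      then have A: "A i \<in> sets borel" for i using Esub by blast
      have "(LINT x:(\<Union>i. A i)|lborel. h x) = (\<Sum>i. (LINT x:A i|lborel. h x))"
        by (rule lebesgue_integral_countable_add)
          (use A union(1) sh[of "\<Union>i. A i"] in \<open>auto simp: disjoint_family_on_def\<close>)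
      then show ?case using union by simp
    qed
    have "AE x in lborel. h x = 0"
      by (rule sigma_finite_measure.density_zero[OF sigma_finite_lborel h]) (use all bE in auto)
    with AE_box_cbox[of a b] show ?thesis
      by eventually_elim (auto simp: h_def)
  qed
  obtain \<D> where \<D>: "countable \<D>" "\<D> \<subseteq> Pow \<Omega>" "\<And>X. X \<in> \<D> \<Longrightarrow> \<exists>a b. X = cbox a b" "\<Union>\<D> = \<Omega>"
    using open_countable_Union_open_cbox[OF \<Omega>] by metis
  have "AE x in lborel. \<forall>X\<in>\<D>. x \<in> X \<longrightarrow> f x = 0"
    unfolding AE_ball_countable[OF \<D>(1)]
  proof
    fix X assume X: "X \<in> \<D>"
    then obtain a b where "X = cbox a b" using \<D>(3) by blast
    then show "AE x in lborel. x \<in> X \<longrightarrow> f x = 0" using box[of a b] X \<D>(2) by auto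
  qed
  then show ?thesis by eventually_elim (use \<D>(4) in blast)
qed

section \<open>Calculus of weak gradients; completeness of H1\<close>

section \<open>Sobolev functions on a bounded open set\<close>

lemma borel_leb: "h \<in> borel_measurable borel \<Longrightarrow> h \<in> borel_measurable (leb S)"
  by (rule measurable_restrict_space1) simp

lemma continuous_bounded_on:
  fixes h :: "'a::euclidean_space \<Rightarrow> 'b::real_normed_vector"
  assumes "continuous_on UNIV h" "bounded S"
  shows "\<exists>M\<ge>0. \<forall>x\<in>S. norm (h x) \<le> M"
proof -
  have "compact (h ` closure S)"
    using assms by (intro compact_continuous_image continuous_on_subset[OF assms(1)]) auto
  then have "bounded (h ` closure S)" by (rule compact_imp_bounded)
  then obtain M where "M > 0" "\<forall>y\<in>h ` closure S. norm y \<le> M" unfolding bounded_pos by blast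
  then show ?thesis using closure_subset[of S] by (intro exI[of _ M]) auto
qed

lemma finite_measure_leb:
  assumes "bounded S" "S \<in> sets borel"
  shows "finite_measure (leb S)"
proof
  have "emeasure (leb S) (space (leb S)) = emeasure lborel S"
    using assms(2) by (simp add: emeasure_restrict_space space_restrict_space)
  also have "\<dots> < \<infinity>" by (rule emeasure_bounded_finite[OF assms(1)])
  finally show "emeasure (leb S) (space (leb S)) \<noteq> \<infinity>" by simp
qed

lemma continuous_L2:
  fixes h :: "'a::euclidean_space \<Rightarrow> complex"
  assumes "continuous_on UNIV h" "bounded S" "S \<in> sets borel"
  shows "h \<in> L2 S"
proof -
  interpret finite_measure "leb S" by (rule finite_measure_leb[OF assms(2,3)])
  obtain M where M: "\<forall>x\<in>S. cmod (h x) \<le> M" using continuous_bounded_on[OF assms(1,2)] by blast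
  have 1: "(\<lambda>_. 1) \<in> L2 S" unfolding L2_def by simp
  have "h \<in> borel_measurable (leb S)" by (rule borel_leb[OF borel_measurable_continuous_onI[OF assms(1)]])
  from L2_mult_bounded(1)[OF 1 this, of M] M show ?thesis by simp
qed

lemma L2_mult_continuous:
  assumes "u \<in> L2 S" "continuous_on UNIV h" "bounded S"
  shows "(\<lambda>x. h x * u x) \<in> L2 S"
proof -
  obtain M where M: "\<forall>x\<in>S. cmod (h x) \<le> M" using continuous_bounded_on[OF assms(2,3)] by blast
  show ?thesis by (rule L2_mult_bounded(1)[OF assms(1) borel_leb[OF borel_measurable_continuous_onI[OF assms(2)]]])
    (use M in blast)
qed

lemma test_function_continuous:
  assumes "test_function \<Omega> \<phi>"
  shows "continuous_on UNIV (\<lambda>x. complex_of_real (\<phi> x))"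
    and "e \<in> Basis \<Longrightarrow> continuous_on UNIV (\<lambda>x. complex_of_real (pd \<phi> e x))"
proof -
  have "Ck 1 \<phi>" using assms unfolding test_function_def by blast
  then show "continuous_on UNIV (\<lambda>x. complex_of_real (\<phi> x))"
    and "e \<in> Basis \<Longrightarrow> continuous_on UNIV (\<lambda>x. complex_of_real (pd \<phi> e x))"
    by (rule continuous_on_of_real[OF C1_continuous], rule_tac continuous_on_of_real[OF C1_D(2)])
qed

lemma weak_deriv_inner:
  "weak_deriv \<Omega> e u g \<longleftrightarrow> (\<forall>\<phi>. test_function \<Omega> \<phi> \<longrightarrow>
     L2_inner \<Omega> u (\<lambda>x. of_real (pd \<phi> e x)) = - L2_inner \<Omega> g (\<lambda>x. of_real (\<phi> x)))"
  by (simp add: weak_deriv_def L2_inner_def)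

lemma support_zero: "x \<notin> closure {x. \<psi> x \<noteq> 0} \<Longrightarrow> \<psi> x = 0 \<and> pd \<psi> e x = 0"
proof
  assume x: "x \<notin> closure {x. \<psi> x \<noteq> 0}"
  show "\<psi> x = 0" using x closure_subset[of "{x. \<psi> x \<noteq> 0}"] by blast
  show "pd \<psi> e x = 0"
    by (rule pd_eq_0_outside[of "- closure {x. \<psi> x \<noteq> 0}"])
      (use x closure_subset[of "{x. \<psi> x \<noteq> 0}"] in \<open>auto simp: open_Compl\<close>)
qed

lemma Cauchy_le:
  fixes f g :: "nat \<Rightarrow> nat \<Rightarrow> real"
  assumes "\<And>m n. f m n \<le> g m n" "\<exists>N. \<forall>m\<ge>N. \<forall>n\<ge>N. g m n < e"
  shows "\<exists>N. \<forall>m\<ge>N. \<forall>n\<ge>N. f m n < e"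
  using assms by (meson le_less_trans)

locale bounded_open =
  fixes \<Omega> :: "'a::euclidean_space set"
  assumes open_\<Omega>: "open \<Omega>" and bounded_\<Omega>: "bounded \<Omega>"
begin

sublocale L2: psd_form cscale "L2 \<Omega>" "L2_inner \<Omega>" by (rule psd_form_L2)

lemma \<Omega>_borel: "\<Omega> \<in> sets borel"
  using open_\<Omega> by simp

lemmas cont_L2 = continuous_L2[OF _ bounded_\<Omega> \<Omega>_borel]
lemmas test_L2 = cont_L2[OF test_function_continuous(1)] cont_L2[OF test_function_continuous(2)]

text \<open>A relation with an explicit gradient. \<open>wgrad\<close> is an arbitrary choice and
  obeys algebraic rules only almost everywhere; computations are made with \<open>has_wgrad\<close>
  and carried to the norms by \<open>grad_inner_eq\<close>.\<close>

definition has_wgrad :: "('a \<Rightarrow> complex) \<Rightarrow> ('a \<Rightarrow> 'a \<Rightarrow> complex) \<Rightarrow> bool" where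
  "has_wgrad u G \<longleftrightarrow> u \<in> L2 \<Omega> \<and> (\<forall>e\<in>Basis. G e \<in> L2 \<Omega> \<and> weak_deriv \<Omega> e u (G e))"

lemma integral_leb: "(\<integral>x. f x \<partial>leb \<Omega>) = (\<integral>x. indicator \<Omega> x *\<^sub>R f x \<partial>lborel)"
  for f :: "'a \<Rightarrow> 'b::{banach, second_countable_topology}"
  by (rule integral_restrict_space) (simp add: \<Omega>_borel)

lemma AE_leb: "(AE x in leb \<Omega>. P x) \<longleftrightarrow> (AE x in lborel. x \<in> \<Omega> \<longrightarrow> P x)"
  by (rule AE_restrict_space_iff) (simp add: \<Omega>_borel)

lemma L2_integrable: "u \<in> L2 \<Omega> \<Longrightarrow> integrable (leb \<Omega>) u"
  using L2_inner_integrable[of u \<Omega> "\<lambda>_. 1"] cont_L2[of "\<lambda>_. 1"] by simp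

lemma weak_deriv_unique:
  assumes e: "e \<in> Basis" and g: "g \<in> L2 \<Omega>" "h \<in> L2 \<Omega>" and w: "weak_deriv \<Omega> e u g" "weak_deriv \<Omega> e u h"
  shows "AE x in leb \<Omega>. g x = h x"
proof -
  define d where "d x = g x - h x" for x
  have d: "d \<in> L2 \<Omega>" unfolding d_def[abs_def] by (rule L2_diff[OF g])
  have i: "integrable lborel (\<lambda>x. indicator \<Omega> x *\<^sub>R d x)"
    using L2_integrable[OF d] by (subst (asm) integrable_restrict_space) (simp_all add: \<Omega>_borel)
  have z: "(\<integral>x. indicator \<Omega> x *\<^sub>R d x * of_real (\<phi> x) \<partial>lborel) = 0" if \<phi>: "test_function \<Omega> \<phi>" for \<phi>
  proof -
    have "L2_inner \<Omega> (g - h) (\<lambda>x. of_real (\<phi> x)) = 0"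
      using w \<phi> unfolding weak_deriv_inner L2.diff_left[OF g test_L2(1)[OF \<phi>]] by simp
    then show ?thesis by (simp add: L2_inner_def integral_leb d_def fun_diff_def)
  qed
  have "AE x in lborel. x \<in> \<Omega> \<longrightarrow> indicator \<Omega> x *\<^sub>R d x = 0"
    by (rule fundamental_lemma[OF i open_\<Omega> z])
  then have "AE x in lborel. x \<in> \<Omega> \<longrightarrow> g x = h x" by eventually_elim (auto simp: d_def)
  then show ?thesis unfolding AE_leb .
qed

lemma weak_deriv_add:
  assumes "e \<in> Basis" "u \<in> L2 \<Omega>" "v \<in> L2 \<Omega>" "g \<in> L2 \<Omega>" "h \<in> L2 \<Omega>" "weak_deriv \<Omega> e u g" "weak_deriv \<Omega> e v h"
  shows "weak_deriv \<Omega> e (\<lambda>x. u x + v x) (\<lambda>x. g x + h x)"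
proof -
  have "weak_deriv \<Omega> e (u + v) (g + h)"
    unfolding weak_deriv_inner
  proof (intro allI impI)
    fix \<phi> assume \<phi>: "test_function \<Omega> \<phi>"
    show "L2_inner \<Omega> (u + v) (\<lambda>x. of_real (pd \<phi> e x)) = - L2_inner \<Omega> (g + h) (\<lambda>x. of_real (\<phi> x))"
      using assms(6,7) \<phi>
      unfolding L2.add_left[OF assms(2,3) test_L2(2)[OF \<phi> assms(1)]] L2.add_left[OF assms(4,5) test_L2(1)[OF \<phi>]]
        weak_deriv_inner by simp
  qed
  then show ?thesis by (simp only: plus_fun_def)
qed

lemma weak_deriv_scale:
  assumes "weak_deriv \<Omega> e u g"
  shows "weak_deriv \<Omega> e (\<lambda>x. c * u x) (\<lambda>x. c * g x)"
  using assms unfolding weak_deriv_def by (simp add: mult.assoc)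

lemma has_wgrad_add: "\<lbrakk>has_wgrad u G; has_wgrad v K\<rbrakk> \<Longrightarrow> has_wgrad (\<lambda>x. u x + v x) (\<lambda>e x. G e x + K e x)"
  unfolding has_wgrad_def by (blast intro: L2_add weak_deriv_add)

lemma has_wgrad_scale: "has_wgrad u G \<Longrightarrow> has_wgrad (\<lambda>x. c * u x) (\<lambda>e x. c * G e x)"
  unfolding has_wgrad_def by (blast intro: L2_scale weak_deriv_scale)

lemma has_wgrad_diff:
  assumes "has_wgrad u G" "has_wgrad v K"
  shows "has_wgrad (\<lambda>x. u x - v x) (\<lambda>e x. G e x - K e x)"
  using has_wgrad_add[OF assms(1) has_wgrad_scale[OF assms(2), of "-1"]] by simp

lemma has_wgrad_zero: "has_wgrad (\<lambda>_. 0) (\<lambda>_ _. 0)"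
  by (simp add: has_wgrad_def L2_zero weak_deriv_def)

lemma H1_has_wgrad: "u \<in> H1 \<Omega> \<Longrightarrow> has_wgrad u (wgrad \<Omega> u)"
proof -
  assume u: "u \<in> H1 \<Omega>"
  have "wgrad \<Omega> u e \<in> L2 \<Omega> \<and> weak_deriv \<Omega> e u (wgrad \<Omega> u e)" if "e \<in> Basis" for e
  proof -
    have "\<exists>g. g \<in> L2 \<Omega> \<and> weak_deriv \<Omega> e u g" using u that unfolding H1_def by blast
    from someI_ex[OF this] show ?thesis unfolding wgrad_def .
  qed
  then show ?thesis using u by (auto simp: has_wgrad_def H1_def)
qed

lemma has_wgrad_H1: "has_wgrad u G \<Longrightarrow> u \<in> H1 \<Omega>"
  by (auto simp: has_wgrad_def H1_def)

lemma H1_L2: "u \<in> H1 \<Omega> \<Longrightarrow> u \<in> L2 \<Omega>"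
  by (simp add: H1_def)

lemma has_wgrad_unique:
  "\<lbrakk>has_wgrad u G; has_wgrad u K; e \<in> Basis\<rbrakk> \<Longrightarrow> AE x in leb \<Omega>. G e x = K e x"
  unfolding has_wgrad_def by (blast intro: weak_deriv_unique)

lemma grad_inner_eq:
  assumes "has_wgrad u G" "has_wgrad v K"
  shows "grad_inner \<Omega> u v = (\<Sum>e\<in>Basis. L2_inner \<Omega> (G e) (K e))"
  unfolding grad_inner_def
proof (rule sum.cong[OF refl])
  fix e :: 'a assume e: "e \<in> Basis"
  note w = H1_has_wgrad[OF has_wgrad_H1[OF assms(1)]] H1_has_wgrad[OF has_wgrad_H1[OF assms(2)]]
  show "L2_inner \<Omega> (wgrad \<Omega> u e) (wgrad \<Omega> v e) = L2_inner \<Omega> (G e) (K e)"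
    by (rule L2_inner_cong[OF has_wgrad_unique[OF w(1) assms(1) e] has_wgrad_unique[OF w(2) assms(2) e]])
      (use assms w e in \<open>auto simp: has_wgrad_def\<close>)
qed

lemma Re_grad_inner: "Re (grad_inner \<Omega> u u) = grad_norm_sq \<Omega> u"
  by (simp add: grad_inner_def grad_norm_sq_def Re_L2_inner_self)

lemma grad_norm_sq_eq: "has_wgrad u G \<Longrightarrow> grad_norm_sq \<Omega> u = (\<Sum>e\<in>Basis. L2_norm_sq \<Omega> (G e))"
  unfolding Re_grad_inner[symmetric] by (simp add: grad_inner_eq Re_L2_inner_self)

lemma grad_norm_sq_nonneg: "0 \<le> grad_norm_sq \<Omega> u"
  unfolding grad_norm_sq_def by (intro sum_nonneg L2_norm_sq_nonneg)

lemma H1_zero: "(\<lambda>_. 0) \<in> H1 \<Omega>"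
  by (rule has_wgrad_H1[OF has_wgrad_zero])

lemma H1_add: "\<lbrakk>u \<in> H1 \<Omega>; v \<in> H1 \<Omega>\<rbrakk> \<Longrightarrow> (\<lambda>x. u x + v x) \<in> H1 \<Omega>"
  by (rule has_wgrad_H1[OF has_wgrad_add[OF H1_has_wgrad H1_has_wgrad]])

lemma H1_scale: "u \<in> H1 \<Omega> \<Longrightarrow> (\<lambda>x. c * u x) \<in> H1 \<Omega>"
  by (rule has_wgrad_H1[OF has_wgrad_scale[OF H1_has_wgrad]])

lemma H1_diff: "\<lbrakk>u \<in> H1 \<Omega>; v \<in> H1 \<Omega>\<rbrakk> \<Longrightarrow> (\<lambda>x. u x - v x) \<in> H1 \<Omega>"
  by (rule has_wgrad_H1[OF has_wgrad_diff[OF H1_has_wgrad H1_has_wgrad]])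

lemma psd_form_grad: "psd_form cscale (H1 \<Omega>) (grad_inner \<Omega>)"
proof (rule psd_form_funI[OF H1_zero H1_add H1_scale])
  fix u v w assume "u \<in> H1 \<Omega>" "v \<in> H1 \<Omega>" "w \<in> H1 \<Omega>"
  note G = this[THEN H1_has_wgrad]
  have L: "wgrad \<Omega> u e \<in> L2 \<Omega>" "wgrad \<Omega> v e \<in> L2 \<Omega>" "wgrad \<Omega> w e \<in> L2 \<Omega>" if "e \<in> Basis" for e
    using G that by (auto simp: has_wgrad_def)
  show "grad_inner \<Omega> (\<lambda>x. u x + v x) w = grad_inner \<Omega> u w + grad_inner \<Omega> v w"
    unfolding grad_inner_eq[OF has_wgrad_add[OF G(1,2)] G(3)] grad_inner_eq[OF G(1,3)] grad_inner_eq[OF G(2,3)]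
      sum.distrib[symmetric]
    by (rule sum.cong[OF refl]) (use L2.add_left L in \<open>simp add: plus_fun_def\<close>)
next
  fix c u v assume "u \<in> H1 \<Omega>" "v \<in> H1 \<Omega>"
  note G = this[THEN H1_has_wgrad]
  show "grad_inner \<Omega> (\<lambda>x. c * u x) v = c * grad_inner \<Omega> u v"
    unfolding grad_inner_eq[OF has_wgrad_scale[OF G(1)] G(2)] grad_inner_eq[OF G] sum_distrib_left
    by (rule sum.cong[OF refl]) (simp add: L2_inner_def mult.assoc)
next
  fix u v
  show "grad_inner \<Omega> v u = cnj (grad_inner \<Omega> u v)"
    unfolding grad_inner_def cnj_sum L2_inner_def Bochner_Integration.integral_cnj[symmetric]
    by (simp only: complex_cnj_mult complex_cnj_cnj mult.commute)
next
  fix u show "0 \<le> Re (grad_inner \<Omega> u u)" by (simp add: Re_grad_inner grad_norm_sq_nonneg)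
qed

text \<open>The product of \<open>f\<close> with a test function has compact support, so the
  integral of its derivative over the whole space is zero.\<close>

lemma C1_has_wgrad:
  fixes f :: "'a \<Rightarrow> complex"
  assumes f: "Ck 1 f"
  shows "has_wgrad f (pd f)"
  unfolding has_wgrad_def
proof (intro conjI ballI)
  show "f \<in> L2 \<Omega>" by (rule cont_L2[OF C1_continuous[OF f]])
  fix e :: 'a assume e: "e \<in> Basis"
  show "pd f e \<in> L2 \<Omega>" by (rule cont_L2[OF C1_D(2)[OF f e]])
  show "weak_deriv \<Omega> e f (pd f e)"
    unfolding weak_deriv_def
  proof (intro allI impI)
    fix \<phi> assume \<phi>: "test_function \<Omega> \<phi>"
    let ?\<phi> = "\<lambda>x. complex_of_real (\<phi> x)"
    have C1: "Ck 1 \<phi>" and K: "compact (closure {x. \<phi> x \<noteq> 0})" "closure {x. \<phi> x \<noteq> 0} \<subseteq> \<Omega>"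
      using \<phi> unfolding test_function_def by auto
    have C1c: "Ck 1 ?\<phi>" by (rule C1_of_real[OF C1])
    have out: "\<phi> x = 0" "pd \<phi> e x = 0" if "x \<notin> \<Omega>" for x
      using support_zero[of x \<phi> e] K(2) that by blast+
    obtain R where R: "\<And>x. x \<in> closure {x. \<phi> x \<noteq> 0} \<Longrightarrow> norm x < R"
      using compact_imp_bounded[OF K(1)] unfolding bounded_pos_less by blast
    have z: "f x * ?\<phi> x = 0" if "R \<le> norm x" for x
      using R[of x] support_zero[of x \<phi> e] that by (cases "x \<in> closure {x. \<phi> x \<noteq> 0}") auto
    have "(\<integral>x. indicator UNIV x *\<^sub>R pd (\<lambda>x. f x * ?\<phi> x) e x \<partial>lborel) = 0"
      by (rule integral_pd_0[where R=R, OF C1_mult[OF f C1c] z _ e]) simp_all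
    moreover have "pd (\<lambda>x. f x * ?\<phi> x) e x = f x * of_real (pd \<phi> e x) + pd f e x * ?\<phi> x" for x
      by (simp only: pd_mult[OF f C1c] pd_of_real[OF C1])
    ultimately have "(\<integral>x. indicator \<Omega> x *\<^sub>R (f x * of_real (pd \<phi> e x)) + indicator \<Omega> x *\<^sub>R (pd f e x * ?\<phi> x) \<partial>lborel) = 0"
      using out by (subst Bochner_Integration.integral_cong[OF refl, where g="\<lambda>x. indicator UNIV x *\<^sub>R pd (\<lambda>x. f x * ?\<phi> x) e x"])
        (auto simp: indicator_def)
    moreover have "integrable lborel (\<lambda>x. indicator \<Omega> x *\<^sub>R (f x * of_real (pd \<phi> e x)))"
       "integrable lborel (\<lambda>x. indicator \<Omega> x *\<^sub>R (pd f e x * ?\<phi> x))"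
      using L2_integrable[OF cont_L2[OF continuous_on_mult[OF C1_continuous[OF f] test_function_continuous(2)[OF \<phi> e]]]]
        L2_integrable[OF cont_L2[OF continuous_on_mult[OF C1_D(2)[OF f e] test_function_continuous(1)[OF \<phi>]]]]
      by (simp_all add: integrable_restrict_space \<Omega>_borel)
    ultimately show "(\<integral>x. f x * of_real (pd \<phi> e x) \<partial>leb \<Omega>) = - (\<integral>x. pd f e x * of_real (\<phi> x) \<partial>leb \<Omega>)"
      unfolding integral_leb by (simp add: eq_neg_iff_add_eq_0)
  qed
qed

text \<open>Test functions are real by definition, but the product rule below tests with a complex
  multiplier times a test function; real and imaginary parts are tested separately.\<close>

lemma weak_deriv_complex:
  fixes \<psi> :: "'a \<Rightarrow> complex"
  assumes w: "weak_deriv \<Omega> e u g" and e: "e \<in> Basis" and L: "u \<in> L2 \<Omega>" "g \<in> L2 \<Omega>"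
    and \<psi>: "Ck 1 \<psi>" and K: "compact (closure {x. \<psi> x \<noteq> 0})" "closure {x. \<psi> x \<noteq> 0} \<subseteq> \<Omega>"
  shows "(\<integral>x. u x * pd \<psi> e x \<partial>leb \<Omega>) = - (\<integral>x. g x * \<psi> x \<partial>leb \<Omega>)"
proof -
  have t: "test_function \<Omega> (\<lambda>x. F (\<psi> x))" if F: "bounded_linear F" for F :: "complex \<Rightarrow> real"
  proof -
    have "F 0 = 0" using F by (simp add: linear_simps)
    then have sub: "closure {x. F (\<psi> x) \<noteq> 0} \<subseteq> closure {x. \<psi> x \<noteq> 0}" by (intro closure_mono) auto
    then have "compact (closure {x. F (\<psi> x) \<noteq> 0})"
      using compact_Int_closed[OF K(1) closed_closure, of "{x. F (\<psi> x) \<noteq> 0}"] by (simp add: Int_absorb1)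
    then show ?thesis using C1_linear[OF F \<psi>] sub K(2) unfolding test_function_def by blast
  qed
  note R = t[OF bounded_linear_Re] and I = t[OF bounded_linear_Im]
  note wR = w[unfolded weak_deriv_def, rule_format, OF R] and wI = w[unfolded weak_deriv_def, rule_format, OF I]
  have dec: "pd \<psi> e x = of_real (pd (\<lambda>x. Re (\<psi> x)) e x) + \<i> * of_real (pd (\<lambda>x. Im (\<psi> x)) e x)"
    "\<psi> x = of_real (Re (\<psi> x)) + \<i> * of_real (Im (\<psi> x))" for x
    by (simp_all add: pd_linear[OF bounded_linear_Re \<psi>] pd_linear[OF bounded_linear_Im \<psi>] complex_eq_iff)
  have i: "integrable (leb \<Omega>) (\<lambda>x. v x * of_real (k x))" if "v \<in> L2 \<Omega>" "continuous_on UNIV (\<lambda>x. complex_of_real (k x))" for v k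
    using L2_integrable[OF L2_mult_continuous[OF that(1,2) bounded_\<Omega>]] by (simp add: mult.commute)
  have "(\<integral>x. u x * pd \<psi> e x \<partial>leb \<Omega>) = (\<integral>x. u x * of_real (pd (\<lambda>x. Re (\<psi> x)) e x)
      + \<i> * (u x * of_real (pd (\<lambda>x. Im (\<psi> x)) e x)) \<partial>leb \<Omega>)"
    by (rule Bochner_Integration.integral_cong[OF refl]) (subst dec(1), simp add: algebra_simps)
  also have "\<dots> = (\<integral>x. u x * of_real (pd (\<lambda>x. Re (\<psi> x)) e x) \<partial>leb \<Omega>) + \<i> * (\<integral>x. u x * of_real (pd (\<lambda>x. Im (\<psi> x)) e x) \<partial>leb \<Omega>)"
    using i[OF L(1) test_function_continuous(2)[OF R e]] i[OF L(1) test_function_continuous(2)[OF I e]] by simp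
  also have "\<dots> = - ((\<integral>x. g x * of_real (Re (\<psi> x)) \<partial>leb \<Omega>) + \<i> * (\<integral>x. g x * of_real (Im (\<psi> x)) \<partial>leb \<Omega>))"
    unfolding wR wI by simp
  also have "(\<integral>x. g x * of_real (Re (\<psi> x)) \<partial>leb \<Omega>) + \<i> * (\<integral>x. g x * of_real (Im (\<psi> x)) \<partial>leb \<Omega>)
      = (\<integral>x. g x * of_real (Re (\<psi> x)) + \<i> * (g x * of_real (Im (\<psi> x))) \<partial>leb \<Omega>)"
    using i[OF L(2) test_function_continuous(1)[OF R]] i[OF L(2) test_function_continuous(1)[OF I]] by simp
  also have "\<dots> = (\<integral>x. g x * \<psi> x \<partial>leb \<Omega>)"
    by (rule Bochner_Integration.integral_cong[OF refl]) (subst (3) dec(2), simp add: algebra_simps)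
  finally show ?thesis .
qed

text \<open>The product of the multiplier and a test function serves as a test function for
  \<open>u\<close>. Multipliers are complex because of the phase factor in
  \<open>gauge\<close>.\<close>

lemma has_wgrad_mult:
  fixes \<zeta> :: "'a \<Rightarrow> complex"
  assumes u: "has_wgrad u G" and \<zeta>: "Ck 1 \<zeta>"
  shows "has_wgrad (\<lambda>x. \<zeta> x * u x) (\<lambda>e x. \<zeta> x * G e x + pd \<zeta> e x * u x)"
  unfolding has_wgrad_def
proof (intro conjI ballI)
  have uL: "u \<in> L2 \<Omega>" using u by (simp add: has_wgrad_def)
  show "(\<lambda>x. \<zeta> x * u x) \<in> L2 \<Omega>" by (rule L2_mult_continuous[OF uL C1_continuous[OF \<zeta>] bounded_\<Omega>])
  fix e :: 'a assume e: "e \<in> Basis"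
  have GL: "G e \<in> L2 \<Omega>" and w: "weak_deriv \<Omega> e u (G e)" using u e by (auto simp: has_wgrad_def)
  have L1: "(\<lambda>x. \<zeta> x * G e x) \<in> L2 \<Omega>" by (rule L2_mult_continuous[OF GL C1_continuous[OF \<zeta>] bounded_\<Omega>])
  have L2': "(\<lambda>x. pd \<zeta> e x * u x) \<in> L2 \<Omega>" by (rule L2_mult_continuous[OF uL C1_D(2)[OF \<zeta> e] bounded_\<Omega>])
  show "(\<lambda>x. \<zeta> x * G e x + pd \<zeta> e x * u x) \<in> L2 \<Omega>" by (rule L2_add[OF L1 L2'])
  show "weak_deriv \<Omega> e (\<lambda>x. \<zeta> x * u x) (\<lambda>x. \<zeta> x * G e x + pd \<zeta> e x * u x)"
    unfolding weak_deriv_def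
  proof (intro allI impI)
    fix \<phi> assume \<phi>: "test_function \<Omega> \<phi>"
    let ?\<phi> = "\<lambda>x. complex_of_real (\<phi> x)"
    have C1: "Ck 1 \<phi>" and K: "compact (closure {x. \<phi> x \<noteq> 0})" "closure {x. \<phi> x \<noteq> 0} \<subseteq> \<Omega>"
      using \<phi> unfolding test_function_def by auto
    have C1c: "Ck 1 ?\<phi>" by (rule C1_of_real[OF C1])
    have sub: "closure {x. \<zeta> x * ?\<phi> x \<noteq> 0} \<subseteq> closure {x. \<phi> x \<noteq> 0}" by (intro closure_mono) auto
    then have "compact (closure {x. \<zeta> x * ?\<phi> x \<noteq> 0})"
      using compact_Int_closed[OF K(1) closed_closure, of "{x. \<zeta> x * ?\<phi> x \<noteq> 0}"] by (simp add: Int_absorb1)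
    note eq = weak_deriv_complex[OF w e uL GL C1_mult[OF \<zeta> C1c] this order_trans[OF sub K(2)]]
    have i: "integrable (leb \<Omega>) (\<lambda>x. v x * k x)" if "v \<in> L2 \<Omega>" "continuous_on UNIV k" for v k
      using L2_integrable[OF L2_mult_continuous[OF that(1,2) bounded_\<Omega>]] by (simp add: mult.commute)
    have i1: "integrable (leb \<Omega>) (\<lambda>x. \<zeta> x * u x * of_real (pd \<phi> e x))"
      by (rule i[OF \<open>(\<lambda>x. \<zeta> x * u x) \<in> L2 \<Omega>\<close> test_function_continuous(2)[OF \<phi> e]])
    have i2: "integrable (leb \<Omega>) (\<lambda>x. pd \<zeta> e x * u x * ?\<phi> x)"
      by (rule i[OF L2' test_function_continuous(1)[OF \<phi>]])
    have i3: "integrable (leb \<Omega>) (\<lambda>x. \<zeta> x * G e x * ?\<phi> x)"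
      by (rule i[OF L1 test_function_continuous(1)[OF \<phi>]])
    have "(\<integral>x. u x * pd (\<lambda>x. \<zeta> x * ?\<phi> x) e x \<partial>leb \<Omega>)
        = (\<integral>x. \<zeta> x * u x * of_real (pd \<phi> e x) + pd \<zeta> e x * u x * ?\<phi> x \<partial>leb \<Omega>)"
      by (rule Bochner_Integration.integral_cong[OF refl])
        (simp add: pd_mult[OF \<zeta> C1c] pd_of_real[OF C1] algebra_simps)
    also have "\<dots> = (\<integral>x. \<zeta> x * u x * of_real (pd \<phi> e x) \<partial>leb \<Omega>) + (\<integral>x. pd \<zeta> e x * u x * ?\<phi> x \<partial>leb \<Omega>)"
      by (rule Bochner_Integration.integral_add[OF i1 i2])
    finally have "(\<integral>x. \<zeta> x * u x * of_real (pd \<phi> e x) \<partial>leb \<Omega>)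
        = - ((\<integral>x. \<zeta> x * G e x * ?\<phi> x \<partial>leb \<Omega>) + (\<integral>x. pd \<zeta> e x * u x * ?\<phi> x \<partial>leb \<Omega>))"
      using eq by (simp add: mult_ac eq_neg_iff_add_eq_0 algebra_simps)
    also have "(\<integral>x. \<zeta> x * G e x * ?\<phi> x \<partial>leb \<Omega>) + (\<integral>x. pd \<zeta> e x * u x * ?\<phi> x \<partial>leb \<Omega>)
        = (\<integral>x. (\<zeta> x * G e x + pd \<zeta> e x * u x) * ?\<phi> x \<partial>leb \<Omega>)"
      unfolding distrib_right by (rule Bochner_Integration.integral_add[OF i3 i2, symmetric])
    finally show "(\<integral>x. \<zeta> x * u x * of_real (pd \<phi> e x) \<partial>leb \<Omega>)
        = - (\<integral>x. (\<zeta> x * G e x + pd \<zeta> e x * u x) * of_real (\<phi> x) \<partial>leb \<Omega>)" .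
  qed
qed

lemma L2_inner_tendsto:
  assumes f: "\<And>n. f n \<in> L2 \<Omega>" "g \<in> L2 \<Omega>" "h \<in> L2 \<Omega>" and lim: "(\<lambda>n. L2_norm_sq \<Omega> (\<lambda>x. f n x - g x)) \<longlonglongrightarrow> 0"
  shows "(\<lambda>n. L2_inner \<Omega> (f n) h) \<longlonglongrightarrow> L2_inner \<Omega> g h"
proof -
  have "cmod (L2_inner \<Omega> (f n) h - L2_inner \<Omega> g h) \<le> sqrt (L2_norm_sq \<Omega> (\<lambda>x. f n x - g x)) * sqrt (L2_norm_sq \<Omega> h)" for n
    using L2.cauchy_schwarz[OF L2.closed_ops(3)[OF f(1,2)] f(3), of n] f
    by (simp only: L2.diff_left[OF f] Re_L2_inner_self) (simp only: fun_diff_def)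
  moreover have "(\<lambda>n. sqrt (L2_norm_sq \<Omega> (\<lambda>x. f n x - g x)) * sqrt (L2_norm_sq \<Omega> h)) \<longlonglongrightarrow> sqrt 0 * sqrt (L2_norm_sq \<Omega> h)"
    by (intro tendsto_mult tendsto_real_sqrt lim tendsto_const)
  ultimately have "(\<lambda>n. L2_inner \<Omega> (f n) h - L2_inner \<Omega> g h) \<longlonglongrightarrow> 0"
    by (rule_tac Lim_null_comparison[OF always_eventually]) auto
  then show ?thesis by (simp add: LIM_zero_iff)
qed

text \<open>The identity that defines weak derivatives is continuous in L2, so the limit of the
  gradients is the gradient of the limit.\<close>

lemma H1_complete:
  assumes u: "\<And>n::nat. u n \<in> H1 \<Omega>"
    and C: "\<And>e. e > 0 \<Longrightarrow> \<exists>N. \<forall>m\<ge>N. \<forall>n\<ge>N. H1_norm_sq \<Omega> (\<lambda>x. u m x - u n x) < e"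
  shows "\<exists>l\<in>H1 \<Omega>. (\<lambda>n. H1_norm_sq \<Omega> (\<lambda>x. u n x - l x)) \<longlonglongrightarrow> 0"
proof -
  note G = H1_has_wgrad[OF u]
  have GL: "wgrad \<Omega> (u n) e \<in> L2 \<Omega>" if "e \<in> Basis" for n e using G[of n] that by (simp add: has_wgrad_def)
  have split: "H1_norm_sq \<Omega> (\<lambda>x. u m x - u n x) = L2_norm_sq \<Omega> (\<lambda>x. u m x - u n x)
      + (\<Sum>e\<in>Basis. L2_norm_sq \<Omega> (\<lambda>x. wgrad \<Omega> (u m) e x - wgrad \<Omega> (u n) e x))" for m n
    unfolding H1_norm_sq_def grad_norm_sq_eq[OF has_wgrad_diff[OF G G]] ..
  have le0: "L2_norm_sq \<Omega> (\<lambda>x. u m x - u n x) \<le> H1_norm_sq \<Omega> (\<lambda>x. u m x - u n x)" for m n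
    unfolding H1_norm_sq_def using grad_norm_sq_nonneg by simp
  have le1: "L2_norm_sq \<Omega> (\<lambda>x. wgrad \<Omega> (u m) e x - wgrad \<Omega> (u n) e x) \<le> H1_norm_sq \<Omega> (\<lambda>x. u m x - u n x)"
    if "e \<in> Basis" for m n e
  proof -
    have "L2_norm_sq \<Omega> (\<lambda>x. wgrad \<Omega> (u m) e x - wgrad \<Omega> (u n) e x)
        \<le> (\<Sum>e\<in>Basis. L2_norm_sq \<Omega> (\<lambda>x. wgrad \<Omega> (u m) e x - wgrad \<Omega> (u n) e x))"
      by (rule member_le_sum[OF that]) (simp_all add: L2_norm_sq_nonneg)
    then show ?thesis unfolding split using L2_norm_sq_nonneg[of \<Omega> "\<lambda>x. u m x - u n x"] by linarith
  qed
  have "\<exists>l\<in>L2 \<Omega>. (\<lambda>n. L2_norm_sq \<Omega> (\<lambda>x. u n x - l x)) \<longlonglongrightarrow> 0"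
    by (rule L2_complete[OF H1_L2[OF u]]) (rule Cauchy_le[OF le0 C])
  then obtain l where l: "l \<in> L2 \<Omega>" "(\<lambda>n. L2_norm_sq \<Omega> (\<lambda>x. u n x - l x)) \<longlonglongrightarrow> 0" by blast
  have "\<exists>k\<in>L2 \<Omega>. (\<lambda>n. L2_norm_sq \<Omega> (\<lambda>x. wgrad \<Omega> (u n) e x - k x)) \<longlonglongrightarrow> 0" if "e \<in> Basis" for e
    by (rule L2_complete[OF GL[OF that]]) (rule Cauchy_le[OF le1[OF that] C])
  then have "\<forall>e. \<exists>k. e \<in> Basis \<longrightarrow> k \<in> L2 \<Omega> \<and> (\<lambda>n. L2_norm_sq \<Omega> (\<lambda>x. wgrad \<Omega> (u n) e x - k x)) \<longlonglongrightarrow> 0" by blast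
  from choice[OF this] obtain K where K': "\<forall>e. e \<in> Basis \<longrightarrow> K e \<in> L2 \<Omega> \<and>
      (\<lambda>n. L2_norm_sq \<Omega> (\<lambda>x. wgrad \<Omega> (u n) e x - K e x)) \<longlonglongrightarrow> 0" ..
  have KL: "K e \<in> L2 \<Omega>" and Kl: "(\<lambda>n. L2_norm_sq \<Omega> (\<lambda>x. wgrad \<Omega> (u n) e x - K e x)) \<longlonglongrightarrow> 0" if "e \<in> Basis" for e
    using K' that by blast+
  have lK: "has_wgrad l K"
    unfolding has_wgrad_def
  proof (intro conjI ballI l(1) KL)
    fix e :: 'a assume e: "e \<in> Basis"
    show "weak_deriv \<Omega> e l (K e)" unfolding weak_deriv_inner
    proof (intro allI impI)
      fix \<phi> assume \<phi>: "test_function \<Omega> \<phi>"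
      have "(\<lambda>n. L2_inner \<Omega> (u n) (\<lambda>x. of_real (pd \<phi> e x))) \<longlonglongrightarrow> L2_inner \<Omega> l (\<lambda>x. of_real (pd \<phi> e x))"
        by (rule L2_inner_tendsto[OF H1_L2[OF u] l(1) test_L2(2)[OF \<phi> e] l(2)])
      moreover have "L2_inner \<Omega> (u n) (\<lambda>x. of_real (pd \<phi> e x)) = - L2_inner \<Omega> (wgrad \<Omega> (u n) e) (\<lambda>x. of_real (\<phi> x))" for n
        using G[of n] e \<phi> unfolding has_wgrad_def weak_deriv_inner by blast
      moreover have "(\<lambda>n. - L2_inner \<Omega> (wgrad \<Omega> (u n) e) (\<lambda>x. of_real (\<phi> x))) \<longlonglongrightarrow> - L2_inner \<Omega> (K e) (\<lambda>x. of_real (\<phi> x))"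
        by (intro tendsto_minus L2_inner_tendsto[OF GL[OF e] KL[OF e] test_L2(1)[OF \<phi>] Kl[OF e]])
      ultimately show "L2_inner \<Omega> l (\<lambda>x. of_real (pd \<phi> e x)) = - L2_inner \<Omega> (K e) (\<lambda>x. of_real (\<phi> x))"
        using LIMSEQ_unique by (simp only:)
    qed
  qed
  have eq: "H1_norm_sq \<Omega> (\<lambda>x. u n x - l x) = L2_norm_sq \<Omega> (\<lambda>x. u n x - l x)
      + (\<Sum>e\<in>Basis. L2_norm_sq \<Omega> (\<lambda>x. wgrad \<Omega> (u n) e x - K e x))" for n
    unfolding H1_norm_sq_def grad_norm_sq_eq[OF has_wgrad_diff[OF G lK]] ..
  have "(\<lambda>n. L2_norm_sq \<Omega> (\<lambda>x. u n x - l x)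
      + (\<Sum>e\<in>Basis. L2_norm_sq \<Omega> (\<lambda>x. wgrad \<Omega> (u n) e x - K e x))) \<longlonglongrightarrow> 0 + (\<Sum>e\<in>(Basis::'a set). 0)"
    by (intro tendsto_add l(2) tendsto_sum Kl)
  then have "(\<lambda>n. H1_norm_sq \<Omega> (\<lambda>x. u n x - l x)) \<longlonglongrightarrow> 0" unfolding eq by simp
  then show ?thesis using has_wgrad_H1[OF lK] by (intro bexI[of _ l])
qed

end

section \<open>Traces obtained from an estimate for C1 functions and their density\<close>

section \<open>Traces on flat boundary pieces\<close>

context psd_form
begin

lemma tendsto_norm_sq:
  assumes "\<And>n::nat. x n \<in> V" "l \<in> V" "(\<lambda>n. Re (f (x n - l) (x n - l))) \<longlonglongrightarrow> 0"
  shows "(\<lambda>n. Re (f (x n) (x n))) \<longlonglongrightarrow> Re (f l l)"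
proof -
  have "\<bar>sqrt (Re (f (x n) (x n))) - sqrt (Re (f l l))\<bar> \<le> sqrt (Re (f (x n - l) (x n - l)))" for n
    using triangle[of "x n - l" l] triangle_diff[of "x n" "x n - l"] assms(1,2) by simp
  moreover have "(\<lambda>n. sqrt (Re (f (x n - l) (x n - l)))) \<longlonglongrightarrow> 0"
    using tendsto_real_sqrt[OF assms(3)] by simp
  ultimately have "(\<lambda>n. sqrt (Re (f (x n) (x n))) - sqrt (Re (f l l))) \<longlonglongrightarrow> 0"
    by (rule_tac Lim_null_comparison[OF always_eventually]) auto
  then have "(\<lambda>n. sqrt (Re (f (x n) (x n)))) \<longlonglongrightarrow> sqrt (Re (f l l))" by (simp only: LIM_zero_iff)
  from tendsto_power[OF this, of 2] show ?thesis using nonneg assms(1,2) by simp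
qed

lemma tendsto_null_add:
  assumes "\<And>n::nat. x n \<in> V" "\<And>n. y n \<in> V" "(\<lambda>n. Re (f (x n) (x n))) \<longlonglongrightarrow> 0" "(\<lambda>n. Re (f (y n) (y n))) \<longlonglongrightarrow> 0"
  shows "(\<lambda>n. Re (f (x n + y n) (x n + y n))) \<longlonglongrightarrow> 0"
proof (rule tendsto_sandwich[OF always_eventually always_eventually tendsto_const])
  show "\<forall>n. 0 \<le> Re (f (x n + y n) (x n + y n))" using assms(1,2) nonneg by simp
  show "\<forall>n. Re (f (x n + y n) (x n + y n)) \<le> 2 * Re (f (x n) (x n)) + 2 * Re (f (y n) (y n))"
    using assms(1,2) by (intro allI Re_add_le)
  have "(\<lambda>n. 2 * Re (f (x n) (x n)) + 2 * Re (f (y n) (y n))) \<longlonglongrightarrow> 2 * 0 + 2 * 0"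
    by (intro tendsto_add tendsto_mult tendsto_const assms(3,4))
  then show "(\<lambda>n. 2 * Re (f (x n) (x n)) + 2 * Re (f (y n) (y n))) \<longlonglongrightarrow> 0" by simp
qed

end

lemma L2_norm_sq_tendsto:
  assumes "\<And>n::nat. f n \<in> L2 S" "g \<in> L2 S" "(\<lambda>n. L2_norm_sq S (\<lambda>x. f n x - g x)) \<longlonglongrightarrow> 0"
  shows "(\<lambda>n. L2_norm_sq S (f n)) \<longlonglongrightarrow> L2_norm_sq S g"
  using psd_form.tendsto_norm_sq[OF psd_form_L2 assms(1,2)] assms(3)
  unfolding Re_L2_inner_self fun_diff_def .

lemma L2_norm_sq_scale: "L2_norm_sq S (\<lambda>x. c * f x) = (cmod c)\<^sup>2 * L2_norm_sq S f"
  by (simp add: L2_norm_sq_def norm_mult power_mult_distrib)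

context bounded_open
begin

sublocale H: form_pair cscale "H1 \<Omega>" "grad_inner \<Omega>" "L2_inner \<Omega>"
proof -
  interpret g: psd_form cscale "H1 \<Omega>" "grad_inner \<Omega>" by (rule psd_form_grad)
  show "form_pair cscale (H1 \<Omega>) (grad_inner \<Omega>) (L2_inner \<Omega>)"
    by (intro form_pair.intro psd_form_grad L2.mono_subspace g.subspace_V) (auto simp: H1_def)
qed

lemma H1_norm_sq_q: "H1_norm_sq \<Omega> u = Re (H.q u u)"
  by (simp add: H1_norm_sq_def Re_grad_inner Re_L2_inner_self)

lemma H1_norm_sq_nonneg: "0 \<le> H1_norm_sq \<Omega> u"
  unfolding H1_norm_sq_def using L2_norm_sq_nonneg grad_norm_sq_nonneg by (intro add_nonneg_nonneg)

lemma H1_norm_sq_scale: "u \<in> H1 \<Omega> \<Longrightarrow> H1_norm_sq \<Omega> (\<lambda>x. c * u x) = (cmod c)\<^sup>2 * H1_norm_sq \<Omega> u"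
  using H.q.Re_scale[of u c] unfolding H1_norm_sq_q cscale_def .

lemma H1_norm_sq_tendsto:
  assumes "\<And>n::nat. f n \<in> H1 \<Omega>" "g \<in> H1 \<Omega>" "(\<lambda>n. H1_norm_sq \<Omega> (\<lambda>x. f n x - g x)) \<longlonglongrightarrow> 0"
  shows "(\<lambda>n. H1_norm_sq \<Omega> (f n)) \<longlonglongrightarrow> H1_norm_sq \<Omega> g"
  using H.q.tendsto_norm_sq[OF assms(1,2)] assms(3)
  unfolding H1_norm_sq_q fun_diff_def .

lemma C1_H1: "Ck 1 f \<Longrightarrow> f \<in> H1 \<Omega>" for f :: "'a \<Rightarrow> complex"
  by (rule has_wgrad_H1[OF C1_has_wgrad])

lemma H1_mult: "\<lbrakk>u \<in> H1 \<Omega>; Ck 1 \<zeta>\<rbrakk> \<Longrightarrow> (\<lambda>x. \<zeta> x * u x) \<in> H1 \<Omega>"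
  by (rule has_wgrad_H1[OF has_wgrad_mult[OF H1_has_wgrad]])

lemma H1_mult_bound:
  fixes \<zeta> :: "'a \<Rightarrow> complex"
  assumes \<zeta>: "Ck 1 \<zeta>"
  shows "\<exists>C\<ge>0. \<forall>u\<in>H1 \<Omega>. H1_norm_sq \<Omega> (\<lambda>x. \<zeta> x * u x) \<le> C * H1_norm_sq \<Omega> u"
proof -
  obtain M where M: "M \<ge> 0" "\<forall>x\<in>\<Omega>. cmod (\<zeta> x) \<le> M"
    using continuous_bounded_on[OF C1_continuous[OF \<zeta>] bounded_\<Omega>] by blast
  have "\<forall>e. \<exists>K. e \<in> Basis \<longrightarrow> K \<ge> 0 \<and> (\<forall>x\<in>\<Omega>. cmod (pd \<zeta> e x) \<le> K)"
    using continuous_bounded_on[OF C1_D(2)[OF \<zeta>] bounded_\<Omega>] by blast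
  from choice[OF this] obtain K where K': "\<forall>e. e \<in> Basis \<longrightarrow> K e \<ge> 0 \<and> (\<forall>x\<in>\<Omega>. cmod (pd \<zeta> e x) \<le> K e)" ..
  define C where "C = M\<^sup>2 + 2 * M\<^sup>2 + 2 * (\<Sum>e\<in>Basis. (K e)\<^sup>2)"
  have "H1_norm_sq \<Omega> (\<lambda>x. \<zeta> x * u x) \<le> C * H1_norm_sq \<Omega> u" if u: "u \<in> H1 \<Omega>" for u
  proof -
    note G = H1_has_wgrad[OF u]
    have uL: "u \<in> L2 \<Omega>" and GL: "\<And>e. e \<in> Basis \<Longrightarrow> wgrad \<Omega> u e \<in> L2 \<Omega>" using G by (auto simp: has_wgrad_def)
    have \<zeta>m: "\<zeta> \<in> borel_measurable (leb \<Omega>)" by (rule borel_leb[OF C1_measurable[OF \<zeta>]])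
    have 1: "L2_norm_sq \<Omega> (\<lambda>x. \<zeta> x * u x) \<le> M\<^sup>2 * L2_norm_sq \<Omega> u"
      by (rule L2_mult_bounded(2)[OF uL \<zeta>m]) (use M in blast)
    have 2: "L2_norm_sq \<Omega> (\<lambda>x. \<zeta> x * wgrad \<Omega> u e x + pd \<zeta> e x * u x)
        \<le> 2 * (M\<^sup>2 * L2_norm_sq \<Omega> (wgrad \<Omega> u e)) + 2 * ((K e)\<^sup>2 * L2_norm_sq \<Omega> u)" if e: "e \<in> Basis" for e
    proof -
      have pm: "pd \<zeta> e \<in> borel_measurable (leb \<Omega>)" by (rule borel_leb[OF pd_measurable[OF \<zeta> e]])
      have b1: "(\<lambda>x. \<zeta> x * wgrad \<Omega> u e x) \<in> L2 \<Omega>" "L2_norm_sq \<Omega> (\<lambda>x. \<zeta> x * wgrad \<Omega> u e x) \<le> M\<^sup>2 * L2_norm_sq \<Omega> (wgrad \<Omega> u e)"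
        by (rule L2_mult_bounded[OF GL[OF e] \<zeta>m]; use M in blast)+
      have b2: "(\<lambda>x. pd \<zeta> e x * u x) \<in> L2 \<Omega>" "L2_norm_sq \<Omega> (\<lambda>x. pd \<zeta> e x * u x) \<le> (K e)\<^sup>2 * L2_norm_sq \<Omega> u"
        by (rule L2_mult_bounded[OF uL pm]; use K' e in blast)+
      have "L2_norm_sq \<Omega> (\<lambda>x. \<zeta> x * wgrad \<Omega> u e x + pd \<zeta> e x * u x)
          \<le> 2 * L2_norm_sq \<Omega> (\<lambda>x. \<zeta> x * wgrad \<Omega> u e x) + 2 * L2_norm_sq \<Omega> (\<lambda>x. pd \<zeta> e x * u x)"
        using L2.Re_add_le[OF b1(1) b2(1)] unfolding Re_L2_inner_self plus_fun_def .
      then show ?thesis using b1(2) b2(2) by linarith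
    qed
    have "grad_norm_sq \<Omega> (\<lambda>x. \<zeta> x * u x)
        \<le> (\<Sum>e\<in>Basis. 2 * (M\<^sup>2 * L2_norm_sq \<Omega> (wgrad \<Omega> u e)) + 2 * ((K e)\<^sup>2 * L2_norm_sq \<Omega> u))"
      unfolding grad_norm_sq_eq[OF has_wgrad_mult[OF G \<zeta>]] by (rule sum_mono[OF 2])
    also have "\<dots> = 2 * M\<^sup>2 * grad_norm_sq \<Omega> u + 2 * (\<Sum>e\<in>Basis. (K e)\<^sup>2) * L2_norm_sq \<Omega> u"
      by (simp add: sum.distrib grad_norm_sq_def sum_distrib_left sum_distrib_right mult.assoc)
    finally have "H1_norm_sq \<Omega> (\<lambda>x. \<zeta> x * u x)
        \<le> M\<^sup>2 * L2_norm_sq \<Omega> u + 2 * M\<^sup>2 * grad_norm_sq \<Omega> u + 2 * (\<Sum>e\<in>Basis. (K e)\<^sup>2) * L2_norm_sq \<Omega> u"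
      unfolding H1_norm_sq_def using 1 by linarith
    also have "\<dots> \<le> C * L2_norm_sq \<Omega> u + C * grad_norm_sq \<Omega> u"
    proof -
      have nn: "0 \<le> M\<^sup>2" "0 \<le> (\<Sum>e\<in>Basis. (K e)\<^sup>2)" by (auto intro: sum_nonneg)
      have "2 * M\<^sup>2 * grad_norm_sq \<Omega> u \<le> C * grad_norm_sq \<Omega> u"
        using nn grad_norm_sq_nonneg by (intro mult_right_mono) (auto simp: C_def)
      moreover have "(M\<^sup>2 + 2 * (\<Sum>e\<in>Basis. (K e)\<^sup>2)) * L2_norm_sq \<Omega> u \<le> C * L2_norm_sq \<Omega> u"
        using nn L2_norm_sq_nonneg by (intro mult_right_mono) (auto simp: C_def)
      ultimately show ?thesis by (simp add: distrib_right)
    qed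
    finally show ?thesis unfolding H1_norm_sq_def by (simp add: distrib_left)
  qed
  moreover have "C \<ge> 0" unfolding C_def by (intro add_nonneg_nonneg mult_nonneg_nonneg sum_nonneg) auto
  ultimately show ?thesis by blast
qed

end

lemma C1_has_trace:
  fixes f :: "point \<Rightarrow> complex"
  assumes "bounded_open \<Omega>" "Ck 1 f" "(\<lambda>y. f (\<iota> y)) \<in> L2 S"
  shows "has_trace \<Omega> \<iota> S f (\<lambda>y. f (\<iota> y))"
proof -
  interpret bounded_open \<Omega> by fact
  have "grad_norm_sq \<Omega> (\<lambda>_. 0) = 0" unfolding grad_norm_sq_eq[OF has_wgrad_zero] by (simp add: L2_norm_sq_def)
  then have "(\<lambda>n::nat. H1_norm_sq \<Omega> (\<lambda>x. f x - f x)) \<longlonglongrightarrow> 0"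
    "(\<lambda>n::nat. L2_norm_sq S (\<lambda>y. f (\<iota> y) - f (\<iota> y))) \<longlonglongrightarrow> 0"
    by (simp_all add: H1_norm_sq_def L2_norm_sq_def)
  then show ?thesis
    unfolding has_trace_def by (intro conjI C1_H1 assms exI[of _ "\<lambda>_. f"] allI)
qed

text \<open>The constant \<open>C\<close> is a parameter because its size matters: it is fixed for
  the free surface and proportional to \<epsilon> for the apertures. Density together with the bound
  for C1 functions makes the trace the continuous extension of restriction.\<close>

locale traced = bounded_open \<Omega> for \<Omega> :: "point set" +
  fixes \<iota> :: "plane \<Rightarrow> point" and S :: "plane set" and C :: real
  assumes \<iota>_continuous: "continuous_on UNIV \<iota>" and S_borel: "S \<in> sets borel" and S_bounded: "bounded S"
    and C_nonneg: "C \<ge> 0"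
    and trace_bound_C1: "\<And>f. Ck 1 f \<Longrightarrow> L2_norm_sq S (\<lambda>y. f (\<iota> y)) \<le> C * H1_norm_sq \<Omega> f"
    and C1_dense: "\<And>u. u \<in> H1 \<Omega> \<Longrightarrow> \<exists>f :: nat \<Rightarrow> point \<Rightarrow> complex.
          (\<forall>n. Ck 1 (f n)) \<and> (\<lambda>n. H1_norm_sq \<Omega> (\<lambda>x. f n x - u x)) \<longlonglongrightarrow> 0"
begin

abbreviation tr where "tr \<equiv> trace \<Omega> \<iota> S"

sublocale S: psd_form cscale "L2 S" "L2_inner S" by (rule psd_form_L2)

lemma restriction_L2: "Ck 1 f \<Longrightarrow> (\<lambda>y. f (\<iota> y)) \<in> L2 S" for f :: "point \<Rightarrow> complex"
  by (rule continuous_L2[OF continuous_on_compose2[OF C1_continuous \<iota>_continuous] S_bounded S_borel]) auto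

lemma has_traceD:
  "has_trace \<Omega> \<iota> S u g \<Longrightarrow> u \<in> H1 \<Omega>" "has_trace \<Omega> \<iota> S u g \<Longrightarrow> g \<in> L2 S"
  by (simp_all add: has_trace_def)

lemma has_trace_C1: "Ck 1 f \<Longrightarrow> has_trace \<Omega> \<iota> S f (\<lambda>y. f (\<iota> y))" for f :: "point \<Rightarrow> complex"
  by (rule C1_has_trace[OF bounded_open_axioms _ restriction_L2])

text \<open>The bound makes the restrictions of an approximating sequence Cauchy in
  \<open>L2 S\<close>.\<close>

lemma has_trace_exists:
  assumes u: "u \<in> H1 \<Omega>"
  shows "\<exists>g. has_trace \<Omega> \<iota> S u g"
proof -
  obtain f :: "nat \<Rightarrow> point \<Rightarrow> complex" where f: "\<forall>n. Ck 1 (f n)" "(\<lambda>n. H1_norm_sq \<Omega> (\<lambda>x. f n x - u x)) \<longlonglongrightarrow> 0"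
    using C1_dense[OF u] by blast
  have fH: "f n \<in> H1 \<Omega>" for n by (rule C1_H1[OF f(1)[rule_format]])
  have "\<exists>g\<in>L2 S. (\<lambda>n. L2_norm_sq S (\<lambda>y. f n (\<iota> y) - g y)) \<longlonglongrightarrow> 0"
  proof (rule L2_complete)
    show "(\<lambda>y. f n (\<iota> y)) \<in> L2 S" for n by (rule restriction_L2[OF f(1)[rule_format]])
    fix e :: real assume e: "e > 0"
    define d where "d = e / (4 * (C + 1))"
    have d: "d > 0" using e C_nonneg by (simp add: d_def)
    have "\<forall>\<^sub>F n in sequentially. H1_norm_sq \<Omega> (\<lambda>x. f n x - u x) < d" by (rule order_tendstoD(2)[OF f(2) d])
    then obtain N where N: "\<forall>n\<ge>N. H1_norm_sq \<Omega> (\<lambda>x. f n x - u x) < d" unfolding eventually_sequentially by blast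
    show "\<exists>N. \<forall>m\<ge>N. \<forall>n\<ge>N. L2_norm_sq S (\<lambda>y. f m (\<iota> y) - f n (\<iota> y)) < e"
    proof (intro exI[of _ N] allI impI)
      fix m n assume mn: "N \<le> m" "N \<le> n"
      have "L2_norm_sq S (\<lambda>y. f m (\<iota> y) - f n (\<iota> y)) \<le> C * H1_norm_sq \<Omega> (\<lambda>x. f m x - f n x)"
        by (rule trace_bound_C1[OF C1_diff]) (use f(1) in blast)+
      also have "H1_norm_sq \<Omega> (\<lambda>x. f m x - f n x) = Re (H.q ((f m - u) - (f n - u)) ((f m - u) - (f n - u)))"
        unfolding H1_norm_sq_q by (simp add: fun_diff_def)
      also have "\<dots> \<le> 2 * Re (H.q (f m - u) (f m - u)) + 2 * Re (H.q (f n - u) (f n - u))"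
        by (rule H.q.Re_diff_le) (use fH u in simp_all)
      also have "\<dots> \<le> 2 * d + 2 * d"
        using N[rule_format, OF mn(1)] N[rule_format, OF mn(2)] unfolding H1_norm_sq_q fun_diff_def by linarith
      finally have "L2_norm_sq S (\<lambda>y. f m (\<iota> y) - f n (\<iota> y)) \<le> C * (2 * d + 2 * d)"
        using C_nonneg by (simp add: mult_left_mono)
      also have "\<dots> < (C + 1) * (4 * d)" using d by (simp add: distrib_right)
      also have "\<dots> = e"
      proof -
        have "C + 1 \<noteq> 0" using C_nonneg by linarith
        then show ?thesis by (simp add: d_def field_simps)
      qed
      finally show "L2_norm_sq S (\<lambda>y. f m (\<iota> y) - f n (\<iota> y)) < e" .
    qed
  qed
  then show ?thesis using u f unfolding has_trace_def by blast
qed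

lemma has_trace_bound:
  assumes "has_trace \<Omega> \<iota> S u g"
  shows "L2_norm_sq S g \<le> C * H1_norm_sq \<Omega> u"
proof -
  obtain f :: "nat \<Rightarrow> point \<Rightarrow> complex" where f: "\<forall>n. Ck 1 (f n)" "(\<lambda>n. H1_norm_sq \<Omega> (\<lambda>x. f n x - u x)) \<longlonglongrightarrow> 0"
    "(\<lambda>n. L2_norm_sq S (\<lambda>y. f n (\<iota> y) - g y)) \<longlonglongrightarrow> 0" using assms unfolding has_trace_def by blast
  note uH = has_traceD(1)[OF assms] and gL = has_traceD(2)[OF assms]
  have "(\<lambda>n. L2_norm_sq S (\<lambda>y. f n (\<iota> y))) \<longlonglongrightarrow> L2_norm_sq S g"
    by (rule L2_norm_sq_tendsto[OF restriction_L2[OF f(1)[rule_format]] gL f(3)])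
  moreover have "(\<lambda>n. C * H1_norm_sq \<Omega> (f n)) \<longlonglongrightarrow> C * H1_norm_sq \<Omega> u"
    by (intro tendsto_mult tendsto_const H1_norm_sq_tendsto[OF C1_H1[OF f(1)[rule_format]] uH f(2)])
  ultimately show ?thesis by (rule LIMSEQ_le) (use trace_bound_C1[OF f(1)[rule_format]] in blast)
qed

lemma has_trace_add:
  assumes "has_trace \<Omega> \<iota> S u g" "has_trace \<Omega> \<iota> S v h"
  shows "has_trace \<Omega> \<iota> S (\<lambda>x. u x + v x) (\<lambda>y. g y + h y)"
proof -
  obtain f :: "nat \<Rightarrow> point \<Rightarrow> complex" where f: "\<forall>n. Ck 1 (f n)" "(\<lambda>n. H1_norm_sq \<Omega> (\<lambda>x. f n x - u x)) \<longlonglongrightarrow> 0"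
    "(\<lambda>n. L2_norm_sq S (\<lambda>y. f n (\<iota> y) - g y)) \<longlonglongrightarrow> 0" using assms(1) unfolding has_trace_def by blast
  obtain k :: "nat \<Rightarrow> point \<Rightarrow> complex" where k: "\<forall>n. Ck 1 (k n)" "(\<lambda>n. H1_norm_sq \<Omega> (\<lambda>x. k n x - v x)) \<longlonglongrightarrow> 0"
    "(\<lambda>n. L2_norm_sq S (\<lambda>y. k n (\<iota> y) - h y)) \<longlonglongrightarrow> 0" using assms(2) unfolding has_trace_def by blast
  note H = has_traceD[OF assms(1)] has_traceD[OF assms(2)]
  have fH: "f n \<in> H1 \<Omega>" and kH: "k n \<in> H1 \<Omega>" for n using C1_H1 f(1) k(1) by blast+
  have fS: "(\<lambda>y. f n (\<iota> y)) \<in> L2 S" and kS: "(\<lambda>y. k n (\<iota> y)) \<in> L2 S" for n using restriction_L2 f(1) k(1) by blast+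
  have 1: "(\<lambda>n. H1_norm_sq \<Omega> ((f n - u) + (k n - v))) \<longlonglongrightarrow> 0"
    unfolding H1_norm_sq_q
    by (rule H.q.tendsto_null_add) (use fH kH H f(2) k(2) in \<open>simp_all add: H1_norm_sq_q fun_diff_def H1_diff\<close>)
  have 2: "(\<lambda>n. L2_norm_sq S (((\<lambda>y. f n (\<iota> y)) - g) + ((\<lambda>y. k n (\<iota> y)) - h))) \<longlonglongrightarrow> 0"
    unfolding Re_L2_inner_self[symmetric]
    by (rule S.tendsto_null_add) (use fS kS H f(3) k(3) in \<open>simp_all add: Re_L2_inner_self fun_diff_def L2_diff\<close>)
  show ?thesis
    unfolding has_trace_def
  proof (intro conjI exI[of _ "\<lambda>n x. f n x + k n x"] allI)
    show "Ck 1 (\<lambda>x. f n x + k n x)" for n by (intro C1_add f(1)[rule_format] k(1)[rule_format])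
    show "(\<lambda>n. H1_norm_sq \<Omega> (\<lambda>x. f n x + k n x - (u x + v x))) \<longlonglongrightarrow> 0"
      using 1 by (simp add: plus_fun_def fun_diff_def add_diff_add)
    show "(\<lambda>n. L2_norm_sq S (\<lambda>y. f n (\<iota> y) + k n (\<iota> y) - (g y + h y))) \<longlonglongrightarrow> 0"
      using 2 by (simp add: plus_fun_def fun_diff_def add_diff_add)
  qed (use H H1_add L2_add in blast)+
qed

lemma has_trace_mult:
  fixes \<zeta> :: "point \<Rightarrow> complex"
  assumes "has_trace \<Omega> \<iota> S u g" and \<zeta>: "Ck 1 \<zeta>"
  shows "has_trace \<Omega> \<iota> S (\<lambda>x. \<zeta> x * u x) (\<lambda>y. \<zeta> (\<iota> y) * g y)"
proof -
  obtain f :: "nat \<Rightarrow> point \<Rightarrow> complex" where f: "\<forall>n. Ck 1 (f n)" "(\<lambda>n. H1_norm_sq \<Omega> (\<lambda>x. f n x - u x)) \<longlonglongrightarrow> 0"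
    "(\<lambda>n. L2_norm_sq S (\<lambda>y. f n (\<iota> y) - g y)) \<longlonglongrightarrow> 0" using assms(1) unfolding has_trace_def by blast
  note uH = has_traceD(1)[OF assms(1)] and gL = has_traceD(2)[OF assms(1)]
  have fH: "f n \<in> H1 \<Omega>" for n using C1_H1 f(1) by blast
  have fS: "(\<lambda>y. f n (\<iota> y)) \<in> L2 S" for n using restriction_L2 f(1) by blast
  obtain K where K: "K \<ge> 0" "\<forall>u\<in>H1 \<Omega>. H1_norm_sq \<Omega> (\<lambda>x. \<zeta> x * u x) \<le> K * H1_norm_sq \<Omega> u"
    using H1_mult_bound[OF \<zeta>] by blast
  have \<zeta>c: "continuous_on UNIV (\<lambda>y. \<zeta> (\<iota> y))"
    by (rule continuous_on_compose2[OF C1_continuous[OF \<zeta>] \<iota>_continuous]) auto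
  obtain M where M: "\<forall>y\<in>S. cmod (\<zeta> (\<iota> y)) \<le> M" using continuous_bounded_on[OF \<zeta>c S_bounded] by blast
  have \<zeta>m: "(\<lambda>y. \<zeta> (\<iota> y)) \<in> borel_measurable (leb S)" by (rule borel_leb[OF borel_measurable_continuous_onI[OF \<zeta>c]])
  show ?thesis
    unfolding has_trace_def
  proof (intro conjI exI[of _ "\<lambda>n x. \<zeta> x * f n x"] allI)
    show "(\<lambda>x. \<zeta> x * u x) \<in> H1 \<Omega>" by (rule H1_mult[OF uH \<zeta>])
    show "(\<lambda>y. \<zeta> (\<iota> y) * g y) \<in> L2 S" by (rule L2_mult_continuous[OF gL \<zeta>c S_bounded])
    show "Ck 1 (\<lambda>x. \<zeta> x * f n x)" for n by (rule C1_mult[OF \<zeta> f(1)[rule_format]])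
    show "(\<lambda>n. H1_norm_sq \<Omega> (\<lambda>x. \<zeta> x * f n x - \<zeta> x * u x)) \<longlonglongrightarrow> 0"
    proof (rule tendsto_sandwich[OF always_eventually always_eventually tendsto_const])
      show "\<forall>n. 0 \<le> H1_norm_sq \<Omega> (\<lambda>x. \<zeta> x * f n x - \<zeta> x * u x)" using H1_norm_sq_nonneg by blast
      show "\<forall>n. H1_norm_sq \<Omega> (\<lambda>x. \<zeta> x * f n x - \<zeta> x * u x) \<le> K * H1_norm_sq \<Omega> (\<lambda>x. f n x - u x)"
        using K(2)[rule_format, OF H1_diff[OF fH uH]] by (simp add: right_diff_distrib)
      show "(\<lambda>n. K * H1_norm_sq \<Omega> (\<lambda>x. f n x - u x)) \<longlonglongrightarrow> 0" using tendsto_mult_right_zero[OF f(2)] .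
    qed
    show "(\<lambda>n. L2_norm_sq S (\<lambda>y. \<zeta> (\<iota> y) * f n (\<iota> y) - \<zeta> (\<iota> y) * g y)) \<longlonglongrightarrow> 0"
    proof (rule tendsto_sandwich[OF always_eventually always_eventually tendsto_const])
      show "\<forall>n. 0 \<le> L2_norm_sq S (\<lambda>y. \<zeta> (\<iota> y) * f n (\<iota> y) - \<zeta> (\<iota> y) * g y)" using L2_norm_sq_nonneg by blast
      show "\<forall>n. L2_norm_sq S (\<lambda>y. \<zeta> (\<iota> y) * f n (\<iota> y) - \<zeta> (\<iota> y) * g y) \<le> M\<^sup>2 * L2_norm_sq S (\<lambda>y. f n (\<iota> y) - g y)"
        unfolding right_diff_distrib[symmetric]
        by (intro allI L2_mult_bounded(2)[OF L2_diff[OF fS gL] \<zeta>m]) (use M in blast)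
      show "(\<lambda>n. M\<^sup>2 * L2_norm_sq S (\<lambda>y. f n (\<iota> y) - g y)) \<longlonglongrightarrow> 0" using tendsto_mult_right_zero[OF f(3)] .
    qed
  qed
qed

lemma has_trace_scale: "has_trace \<Omega> \<iota> S u g \<Longrightarrow> has_trace \<Omega> \<iota> S (\<lambda>x. c * u x) (\<lambda>y. c * g y)"
  using has_trace_mult[OF _ C1_const] .

lemma has_trace_diff:
  assumes "has_trace \<Omega> \<iota> S u g" "has_trace \<Omega> \<iota> S v h"
  shows "has_trace \<Omega> \<iota> S (\<lambda>x. u x - v x) (\<lambda>y. g y - h y)"
  using has_trace_add[OF assms(1) has_trace_scale[OF assms(2), of "-1"]] by simp

text \<open>The difference of two traces is a trace of \<open>u - u\<close>, whose norm is
  zero.\<close>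

lemma has_trace_unique:
  assumes "has_trace \<Omega> \<iota> S u g" "has_trace \<Omega> \<iota> S u h"
  shows "AE y in leb S. g y = h y"
proof -
  have "L2_norm_sq S (\<lambda>y. g y - h y) \<le> C * H1_norm_sq \<Omega> (\<lambda>x. u x - u x)"
    by (rule has_trace_bound[OF has_trace_diff[OF assms]])
  also have "H1_norm_sq \<Omega> (\<lambda>x. u x - u x) = 0"
    using H1_norm_sq_scale[OF has_traceD(1)[OF assms(1)], of 0] by simp
  finally have "L2_norm_sq S (\<lambda>y. g y - h y) = 0" using L2_norm_sq_nonneg[of S "\<lambda>y. g y - h y"] by simp
  then show ?thesis using L2_norm_sq_0[OF L2_diff[OF has_traceD(2)[OF assms(1)] has_traceD(2)[OF assms(2)]]] by simp
qed

lemma has_trace_tr: "u \<in> H1 \<Omega> \<Longrightarrow> has_trace \<Omega> \<iota> S u (tr u)"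
  unfolding trace_def by (rule someI_ex[OF has_trace_exists])

lemma tr_L2: "u \<in> H1 \<Omega> \<Longrightarrow> tr u \<in> L2 S"
  by (rule has_traceD(2)[OF has_trace_tr])

lemma tr_eq: "has_trace \<Omega> \<iota> S u g \<Longrightarrow> AE y in leb S. tr u y = g y"
  by (rule has_trace_unique[OF has_trace_tr[OF has_traceD(1)]])

lemma tr_inner_eq:
  assumes "has_trace \<Omega> \<iota> S u g" "has_trace \<Omega> \<iota> S v h"
  shows "L2_inner S (tr u) (tr v) = L2_inner S g h"
  by (rule L2_inner_cong[OF tr_eq[OF assms(1)] tr_eq[OF assms(2)]
        tr_L2[OF has_traceD(1)[OF assms(1)]] has_traceD(2)[OF assms(1)]
        tr_L2[OF has_traceD(1)[OF assms(2)]] has_traceD(2)[OF assms(2)]])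

lemma psd_form_tr: "psd_form cscale (H1 \<Omega>) (\<lambda>u v. L2_inner S (tr u) (tr v))"
proof (rule psd_form_funI[OF H1_zero H1_add H1_scale])
  fix u v w assume "u \<in> H1 \<Omega>" "v \<in> H1 \<Omega>" "w \<in> H1 \<Omega>"
  note T = this[THEN has_trace_tr]
  show "L2_inner S (tr (\<lambda>x. u x + v x)) (tr w) = L2_inner S (tr u) (tr w) + L2_inner S (tr v) (tr w)"
    unfolding tr_inner_eq[OF has_trace_add[OF T(1,2)] T(3)]
    using S.add_left[OF T[THEN has_traceD(2)]] by (simp add: plus_fun_def)
next
  fix c u v assume "u \<in> H1 \<Omega>" "v \<in> H1 \<Omega>"
  note T = this[THEN has_trace_tr]
  show "L2_inner S (tr (\<lambda>x. c * u x)) (tr v) = c * L2_inner S (tr u) (tr v)"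
    unfolding tr_inner_eq[OF has_trace_scale[OF T(1)] T(2)]
    by (simp add: L2_inner_def mult.assoc)
next
  fix u v assume "u \<in> H1 \<Omega>" "v \<in> H1 \<Omega>"
  then show "L2_inner S (tr v) (tr u) = cnj (L2_inner S (tr u) (tr v))"
    by (intro S.hermitian tr_L2)
next
  fix u show "0 \<le> Re (L2_inner S (tr u) (tr u))" by (simp add: Re_L2_inner_self L2_norm_sq_nonneg)
qed

end

section \<open>The spectral problem on the cell as an instance of the abstract theory\<close>

section \<open>The cell and its free surface\<close>

lemma sum_fun_apply: "(\<Sum>i\<in>I. f i) x = (\<Sum>i\<in>I. f i x)"
  by (induction I rule: infinite_finite_induct) (simp_all add: zero_fun_def plus_fun_def)

lemma lborel_vertical_line: "emeasure (lborel :: plane measure) {y. fst y = t} = 0"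
proof -
  have "{y :: plane. fst y = t} = {t} \<times> UNIV" by auto
  moreover have "emeasure (lborel \<Otimes>\<^sub>M lborel) ({t} \<times> (UNIV :: real set)) = emeasure lborel {t} * emeasure lborel (UNIV :: real set)"
    by (rule lborel.emeasure_pair_measure_Times) auto
  ultimately show ?thesis by (simp add: lborel_prod)
qed

text \<open>A nonzero polynomial has finitely many roots, so its zero set in the plane lies in
  finitely many lines, which form a null set.\<close>

lemma AE_polynomial_eq_0:
  fixes c :: "nat \<Rightarrow> complex" and S :: "plane set"
  assumes S: "S \<in> sets borel" "measure lborel S > 0"
    and ae: "AE y in leb S. (\<Sum>j\<le>n. c j * of_real (fst y) ^ j) = 0"
  shows "j \<le> n \<Longrightarrow> c j = 0"
proof (rule ccontr)
  assume j: "j \<le> n" "c j \<noteq> 0"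
  define Z where "Z = {z. (\<Sum>j\<le>n. c j * z ^ j) = 0}"
  have Z: "finite Z" unfolding Z_def using polyfun_finite_roots[of c n] j by blast
  define T where "T = (\<lambda>t. of_real t :: complex) -` Z"
  have T: "finite T" unfolding T_def by (rule finite_vimageI[OF Z]) (simp add: inj_on_def)
  have "AE y in lborel. \<forall>t\<in>T. fst (y :: plane) \<noteq> t"
    unfolding AE_finite_all[OF T]
  proof
    fix t
    have "closed {y :: plane. fst y = t}" by (intro closed_Collect_eq continuous_intros)
    then have "{y :: plane. fst y = t} \<in> null_sets lborel" using lborel_vertical_line by (intro null_setsI) auto
    from AE_not_in[OF this] show "AE y in lborel. fst (y :: plane) \<noteq> t" by simp
  qed
  moreover have "AE y in lborel. y \<in> S \<longrightarrow> (\<Sum>j\<le>n. c j * of_real (fst y) ^ j) = 0"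
    using ae S by (subst (asm) AE_restrict_space_iff) auto
  ultimately have "AE y in lborel. y \<notin> S" by eventually_elim (auto simp: T_def Z_def)
  then have "emeasure lborel S = 0" using S by (subst (asm) AE_iff_measurable[of S]) auto
  then show False using S(2) by (simp add: measure_def)
qed

context periodic_channel
begin

abbreviation \<Omega> where "\<Omega> \<equiv> cell B"
abbreviation \<Gamma> where "\<Gamma> \<equiv> free_surface B"

lemma cell_bounded_open: "bounded_open \<Omega>"
proof
  have "\<Omega> = B \<inter> {x. snd (snd x) < 0} \<inter> {x. 0 < fst x} \<inter> {x. fst x < 1}" by (auto simp: cell_def)
  moreover have "open {x::point. snd (snd x) < 0}" "open {x::point. 0 < fst x}" "open {x::point. fst x < 1}"
    by (intro open_Collect_less continuous_intros)+
  ultimately show "open \<Omega>" using B_domain(1) by (simp add: open_Int)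
  have "bounded B" using compact_imp_bounded[OF B_domain(3)] closure_subset bounded_subset by blast
  then show "bounded \<Omega>" by (rule bounded_subset) (auto simp: cell_def)
qed

sublocale bounded_open \<Omega> by (rule cell_bounded_open)

lemma surface_pt_continuous: "continuous_on A surface_pt"
  unfolding surface_pt_def by (intro continuous_intros)

lemma free_surface_closed: "closed \<Gamma>"
proof -
  have "\<Gamma> = surface_pt -` frontier \<Omega>" by (auto simp: free_surface_def)
  then show ?thesis using closed_vimage[OF frontier_closed surface_pt_continuous] by simp
qed

lemma free_surface_borel: "\<Gamma> \<in> sets borel"
  using free_surface_closed by simp

lemma free_surface_bounded: "bounded \<Gamma>"
proof -
  have "bounded (closure \<Omega>)" using bounded_\<Omega> by (rule bounded_closure)
  then obtain M where M: "\<forall>x\<in>closure \<Omega>. norm x \<le> M" unfolding bounded_iff by blast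
  have "norm y \<le> M" if "y \<in> \<Gamma>" for y
  proof -
    have "surface_pt y \<in> closure \<Omega>" using that by (auto simp: free_surface_def frontier_def)
    then have "norm (surface_pt y) \<le> M" using M by blast
    moreover have "norm y = norm (surface_pt y)" by (cases y) (simp add: surface_pt_def norm_Pair)
    ultimately show ?thesis by simp
  qed
  then show ?thesis unfolding bounded_iff by blast
qed

text \<open>The definition of \<open>has_trace\<close> contains an approximating sequence of C1
  functions, so the standing fact on traces yields density even though the cell may have
  cusps.\<close>

lemma C1_dense_H1:
  assumes "u \<in> H1 \<Omega>"
  shows "\<exists>f :: nat \<Rightarrow> point \<Rightarrow> complex. (\<forall>n. Ck 1 (f n)) \<and> (\<lambda>n. H1_norm_sq \<Omega> (\<lambda>x. f n x - u x)) \<longlonglongrightarrow> 0"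
  using trace_exists[OF assms] unfolding has_trace_def by blast

definition C_\<gamma> where "C_\<gamma> = (SOME C. C \<ge> 0 \<and> (\<forall>u g. has_trace \<Omega> surface_pt \<Gamma> u g \<longrightarrow>
  grad_norm_sq \<Omega> u + L2_norm_sq \<Gamma> g \<le> C * H1_norm_sq \<Omega> u))"

lemma C_\<gamma>: "C_\<gamma> \<ge> 0 \<and> (\<forall>u g. has_trace \<Omega> surface_pt \<Gamma> u g \<longrightarrow>
  grad_norm_sq \<Omega> u + L2_norm_sq \<Gamma> g \<le> C_\<gamma> * H1_norm_sq \<Omega> u)"
proof -
  obtain C where C: "\<And>u g. has_trace \<Omega> surface_pt \<Gamma> u g \<Longrightarrow>
      grad_norm_sq \<Omega> u + L2_norm_sq \<Gamma> g \<le> C * H1_norm_sq \<Omega> u"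
    using norm_equivalence by blast
  have "grad_norm_sq \<Omega> u + L2_norm_sq \<Gamma> g \<le> max 0 C * H1_norm_sq \<Omega> u" if "has_trace \<Omega> surface_pt \<Gamma> u g" for u g
    using C[OF that] mult_right_mono[OF max.cobounded2[of C 0] H1_norm_sq_nonneg[of u]] by linarith
  then have "\<exists>C. C \<ge> 0 \<and> (\<forall>u g. has_trace \<Omega> surface_pt \<Gamma> u g \<longrightarrow>
      grad_norm_sq \<Omega> u + L2_norm_sq \<Gamma> g \<le> C * H1_norm_sq \<Omega> u)"
    by (intro exI[of _ "max 0 C"]) auto
  from someI_ex[OF this] show ?thesis unfolding C_\<gamma>_def .
qed

sublocale \<gamma>: traced \<Omega> surface_pt \<Gamma> C_\<gamma>
proof (unfold_locales)
  fix f :: "point \<Rightarrow> complex" assume f: "Ck 1 f"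
  have "(\<lambda>y. f (surface_pt y)) \<in> L2 \<Gamma>"
    by (rule continuous_L2[OF continuous_on_compose2[OF C1_continuous[OF f] surface_pt_continuous]
          free_surface_bounded free_surface_borel]) auto
  from C_\<gamma>[THEN conjunct2, rule_format, OF C1_has_trace[OF cell_bounded_open f this]]
  show "L2_norm_sq \<Gamma> (\<lambda>y. f (surface_pt y)) \<le> C_\<gamma> * H1_norm_sq \<Omega> f"
    using grad_norm_sq_nonneg[of f] by linarith
qed (use surface_pt_continuous free_surface_borel free_surface_bounded C_\<gamma> C1_dense_H1 in blast)+

lemma surface_inner_tr: "surface_inner B = (\<lambda>u v. L2_inner \<Gamma> (\<gamma>.tr u) (\<gamma>.tr v))"
  by (simp add: surface_inner_def fun_eq_iff)

lemma psd_form_surface: "psd_form cscale (H1 \<Omega>) (surface_inner B)"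
  unfolding surface_inner_tr by (rule \<gamma>.psd_form_tr)

text \<open>Two pairs share the gradient form: \<open>H\<close> adds the inner product of the cell
  and gives the Sobolev norm, \<open>Q\<close> adds the inner product of the free surface and gives
  the spectral problem.\<close>

sublocale Q: form_pair cscale "H1 \<Omega>" "grad_inner \<Omega>" "surface_inner B"
  by (intro form_pair.intro psd_form_grad psd_form_surface)

lemma Re_surface_inner: "Re (surface_inner B u u) = L2_norm_sq \<Gamma> (\<gamma>.tr u)"
  by (simp add: surface_inner_def Re_L2_inner_self)

lemma norm_equiv:
  obtains c where "c > 0" "\<And>u. u \<in> H1 \<Omega> \<Longrightarrow> H1_norm_sq \<Omega> u \<le> c * Re (Q.q u u)"
    "\<And>u. u \<in> H1 \<Omega> \<Longrightarrow> Re (Q.q u u) \<le> c * H1_norm_sq \<Omega> u"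
proof -
  obtain c C where c: "c > 0" and
    1: "\<forall>u g. has_trace \<Omega> surface_pt \<Gamma> u g \<longrightarrow> c * H1_norm_sq \<Omega> u \<le> grad_norm_sq \<Omega> u + L2_norm_sq \<Gamma> g \<and>
       grad_norm_sq \<Omega> u + L2_norm_sq \<Gamma> g \<le> C * H1_norm_sq \<Omega> u"
    using norm_equivalence by blast
  have q: "Re (Q.q u u) = grad_norm_sq \<Omega> u + L2_norm_sq \<Gamma> (\<gamma>.tr u)" for u
    by (simp add: Re_grad_inner Re_surface_inner)
  show thesis
  proof (rule that[of "max (1 / c) C"])
    show "max (1 / c) C > 0" using c by (simp add: less_max_iff_disj)
    fix u assume u: "u \<in> H1 \<Omega>"
    from 1[rule_format, OF \<gamma>.has_trace_tr[OF u]]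
    have 2: "c * H1_norm_sq \<Omega> u \<le> Re (Q.q u u)" "Re (Q.q u u) \<le> C * H1_norm_sq \<Omega> u" unfolding q by auto
    have "H1_norm_sq \<Omega> u \<le> 1 / c * Re (Q.q u u)" using 2(1) c by (simp add: field_simps)
    also have "\<dots> \<le> max (1 / c) C * Re (Q.q u u)" by (rule mult_right_mono[OF max.cobounded1 Q.q.nonneg[OF u]])
    finally show "H1_norm_sq \<Omega> u \<le> max (1 / c) C * Re (Q.q u u)" .
    have "C * H1_norm_sq \<Omega> u \<le> max (1 / c) C * H1_norm_sq \<Omega> u" by (rule mult_right_mono[OF max.cobounded2 H1_norm_sq_nonneg])
    then show "Re (Q.q u u) \<le> max (1 / c) C * H1_norm_sq \<Omega> u" using 2(2) by linarith
  qed
qed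

text \<open>A power of the first coordinate on the free surface, cut off so that it vanishes below
  the height \<open>snd P / 2\<close>. Small apertures lie there, so it belongs to every
  quasi-periodic space.\<close>

definition surface_monomial :: "nat \<Rightarrow> point \<Rightarrow> complex" where
  "surface_monomial i x = of_real (step (1 + (2 / - snd P) * snd (snd x))) * of_real (fst x) ^ i"

lemma C1_power: "Ck 1 f \<Longrightarrow> Ck 1 (\<lambda>x. f x ^ n)" for f :: "'a::euclidean_space \<Rightarrow> 'b::real_normed_field"
proof (induction n)
  case 0
  show ?case using C1_const[of "1::'b"] by simp
next
  case (Suc n)
  show ?case using C1_mult[OF Suc.prems Suc.IH[OF Suc.prems]] by simp
qed

lemma C1_surface_monomial: "Ck 1 (surface_monomial i)"
proof -
  have "Ck 1 (\<lambda>x::point. x \<bullet> (0, 0, 1))" "Ck 1 (\<lambda>x::point. x \<bullet> (1, 0, 0))" by (rule C1_inner)+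
  then have "Ck 1 (\<lambda>x::point. snd (snd x))" "Ck 1 (\<lambda>x::point. fst x)"
    by (simp_all add: inner_prod_def)
  then have "Ck 1 (\<lambda>x::point. step (1 + (2 / - snd P) * snd (snd x)))" "Ck 1 (\<lambda>x::point. fst x)"
    using C1_compose[where g=step and g'=step', OF step_deriv step'_cont C1_add[OF C1_const C1_mult[OF C1_const]]] by blast+
  then show ?thesis unfolding surface_monomial_def[abs_def] by (intro C1_mult C1_of_real C1_power)
qed

lemma surface_monomial_surface: "surface_monomial i (surface_pt y) = of_real (fst y) ^ i"
  by (simp add: surface_monomial_def surface_pt_def step_1)

lemma surface_monomial_below: "snd (snd x) \<le> snd P / 2 \<Longrightarrow> surface_monomial i x = 0"
proof -
  assume "snd (snd x) \<le> snd P / 2"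
  then have "1 + (2 / - snd P) * snd (snd x) \<le> 0" using P_below by (simp add: field_simps)
  then show ?thesis by (simp add: surface_monomial_def step_0)
qed

text \<open>Completeness comes from the equivalence of norms and closedness of \<open>V\<close>,
  compactness from the compact trace, and infinite rank from the monomials, which are linearly
  independent on a surface of positive area.\<close>

lemma spectral_pair_closed:
  assumes V: "module.subspace cscale V" "V \<subseteq> H1 \<Omega>"
    and cl: "\<And>u l. \<lbrakk>\<And>n::nat. u n \<in> V; l \<in> H1 \<Omega>; (\<lambda>n. H1_norm_sq \<Omega> (\<lambda>x. u n x - l x)) \<longlonglongrightarrow> 0\<rbrakk> \<Longrightarrow> l \<in> V"
    and mon: "\<And>i. surface_monomial i \<in> V"
  shows "spectral_pair cscale V (grad_inner \<Omega>) (surface_inner B)"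
proof -
  obtain c where c: "c > 0" "\<And>u. u \<in> H1 \<Omega> \<Longrightarrow> H1_norm_sq \<Omega> u \<le> c * Re (Q.q u u)"
    "\<And>u. u \<in> H1 \<Omega> \<Longrightarrow> Re (Q.q u u) \<le> c * H1_norm_sq \<Omega> u" using norm_equiv by blast
  interpret V: form_pair cscale V "grad_inner \<Omega>" "surface_inner B"
    by (intro form_pair.intro H.a.mono_subspace Q.b.mono_subspace V)
  have VH: "u \<in> H1 \<Omega>" if "u \<in> V" for u using V(2) that by blast
  show ?thesis
  proof
    fix u :: "nat \<Rightarrow> point \<Rightarrow> complex"
    assume u: "\<And>n. u n \<in> V" and C: "\<And>e. e > 0 \<Longrightarrow> \<exists>N. \<forall>m\<ge>N. \<forall>n\<ge>N. Re (Q.q (u m - u n) (u m - u n)) < e"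
    have "\<exists>l\<in>H1 \<Omega>. (\<lambda>n. H1_norm_sq \<Omega> (\<lambda>x. u n x - l x)) \<longlonglongrightarrow> 0"
    proof (rule H1_complete[OF VH[OF u]])
      fix e :: real assume e: "e > 0"
      obtain N where N: "\<forall>m\<ge>N. \<forall>n\<ge>N. Re (Q.q (u m - u n) (u m - u n)) < e / c" using C[of "e / c"] e c(1) by auto
      have "H1_norm_sq \<Omega> (\<lambda>x. u m x - u n x) < e" if "m \<ge> N" "n \<ge> N" for m n
      proof -
        have "H1_norm_sq \<Omega> (u m - u n) \<le> c * Re (Q.q (u m - u n) (u m - u n))" by (rule c(2)) (use VH[OF u] in blast)
        also have "\<dots> < c * (e / c)" using N that c(1) by (intro mult_strict_left_mono) auto
        finally show ?thesis using c(1) by (simp add: fun_diff_def)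
      qed
      then show "\<exists>N. \<forall>m\<ge>N. \<forall>n\<ge>N. H1_norm_sq \<Omega> (\<lambda>x. u m x - u n x) < e" by blast
    qed
    then obtain l where l: "l \<in> H1 \<Omega>" "(\<lambda>n. H1_norm_sq \<Omega> (\<lambda>x. u n x - l x)) \<longlonglongrightarrow> 0" by blast
    have "l \<in> V" by (rule cl[OF u l])
    moreover have "(\<lambda>n. Re (Q.q (u n - l) (u n - l))) \<longlonglongrightarrow> 0"
    proof (rule tendsto_sandwich[OF always_eventually always_eventually tendsto_const])
      show "\<forall>n. 0 \<le> Re (Q.q (u n - l) (u n - l))" using Q.q.nonneg VH[OF u] l(1) by blast
      show "\<forall>n. Re (Q.q (u n - l) (u n - l)) \<le> c * H1_norm_sq \<Omega> (\<lambda>x. u n x - l x)"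
        using c(3)[OF H.a.closed_ops(3)[OF VH[OF u] l(1)]] by (simp only: fun_diff_def) blast
      show "(\<lambda>n. c * H1_norm_sq \<Omega> (\<lambda>x. u n x - l x)) \<longlonglongrightarrow> 0" by (rule tendsto_mult_right_zero[OF l(2)])
    qed
    ultimately show "\<exists>l\<in>V. (\<lambda>n. Re (Q.q (u n - l) (u n - l))) \<longlonglongrightarrow> 0" by blast
  next
    fix u :: "nat \<Rightarrow> point \<Rightarrow> complex" and M
    assume u: "\<And>n. u n \<in> V" and M: "\<And>n. Re (Q.q (u n) (u n)) \<le> M"
    have cM: "H1_norm_sq \<Omega> (u n) \<le> c * M" for n
      using c(2)[OF VH[OF u], of n] mult_left_mono[OF M[of n], of c] c(1) by linarith
    have "\<exists>r h. strict_mono (r::nat\<Rightarrow>nat) \<and> h \<in> L2 \<Gamma> \<and> (\<lambda>n. L2_norm_sq \<Gamma> (\<lambda>y. \<gamma>.tr (u (r n)) y - h y)) \<longlonglongrightarrow> 0"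
      by (rule trace_compact[where u=u and g="\<lambda>n. \<gamma>.tr (u n)" and M="c * M", OF \<gamma>.has_trace_tr[OF VH[OF u]] cM])
    then obtain r :: "nat \<Rightarrow> nat" and h where
      r: "strict_mono r" "h \<in> L2 \<Gamma>" "(\<lambda>n. L2_norm_sq \<Gamma> (\<lambda>y. \<gamma>.tr (u (r n)) y - h y)) \<longlonglongrightarrow> 0" by blast
    have "\<exists>N. \<forall>m\<ge>N. \<forall>n\<ge>N. Re (surface_inner B (u (r m) - u (r n)) (u (r m) - u (r n))) < e" if e: "e > 0" for e
    proof -
      obtain N where N: "\<forall>m\<ge>N. \<forall>n\<ge>N. L2_norm_sq \<Gamma> (\<lambda>y. \<gamma>.tr (u (r m)) y - \<gamma>.tr (u (r n)) y) < e"
        using L2_tendsto_imp_Cauchy[where f="\<lambda>n. \<gamma>.tr (u (r n))", OF \<gamma>.tr_L2[OF VH[OF u]] r(2,3) e] by blast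
      have "Re (surface_inner B (u (r m) - u (r n)) (u (r m) - u (r n))) = L2_norm_sq \<Gamma> (\<lambda>y. \<gamma>.tr (u (r m)) y - \<gamma>.tr (u (r n)) y)" for m n
      proof -
        note T = \<gamma>.has_trace_diff[OF \<gamma>.has_trace_tr[OF VH[OF u[of "r m"]]] \<gamma>.has_trace_tr[OF VH[OF u[of "r n"]]]]
        show ?thesis unfolding fun_diff_def surface_inner_def \<gamma>.tr_inner_eq[OF T T] by (rule Re_L2_inner_self)
      qed
      with N show ?thesis by (intro exI[of _ N]) simp
    qed
    with r(1) show "\<exists>r::nat\<Rightarrow>nat. strict_mono r \<and>
        (\<forall>e>0. \<exists>N. \<forall>m\<ge>N. \<forall>n\<ge>N. Re (surface_inner B (u (r m) - u (r n)) (u (r m) - u (r n))) < e)" by blast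
  next
    fix U :: "nat \<Rightarrow> point \<Rightarrow> complex" and n :: nat
    assume U: "\<And>i. U i \<in> V"
    \<comment> \<open>There are \<open>n + 1\<close> monomials against \<open>n\<close>
      orthogonality conditions.\<close>
    obtain d where d: "\<exists>j\<in>{..n}. d j \<noteq> 0" "\<forall>i\<in>{..<n}. (\<Sum>j\<in>{..n}. d j * surface_inner B (surface_monomial j) (U i)) = 0"
      using nontrivial_solution[of "{..<n}" "{..n}" "\<lambda>i j. surface_inner B (surface_monomial j) (U i)"] by auto
    define x where "x = (\<Sum>j\<le>n. cscale (d j) (surface_monomial j))"
    have dm: "cscale (d j) (surface_monomial j) \<in> V" for j using mon by blast
    have xV: "x \<in> V" unfolding x_def by (rule V.a.sum_closed[OF dm])
    have "surface_inner B x (U i) = 0" if "i < n" for i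
    proof -
      have "surface_inner B x (U i) = (\<Sum>j\<le>n. surface_inner B (cscale (d j) (surface_monomial j)) (U i))"
        unfolding x_def by (rule V.b.sum_left[OF dm U])
      also have "\<dots> = 0" using d(2) that by (simp add: V.b.scale_left[OF mon U])
      finally show ?thesis .
    qed
    moreover have "Re (surface_inner B x x) \<noteq> 0"
    proof
      assume 0: "Re (surface_inner B x x) = 0"
      have xe: "x = (\<lambda>z. \<Sum>j\<le>n. d j * surface_monomial j z)"
        unfolding x_def by (rule ext) (simp add: cscale_def sum_fun_apply)
      have sums: "Ck 1 (\<lambda>z. \<Sum>j\<in>J. d j * surface_monomial j z)" if "finite J" for J
        using that
      proof induction
        case empty show ?case using C1_const[of "0::complex"] by simp
      next
        case (insert j J)
        then show ?case using C1_add[OF C1_mult[OF C1_const C1_surface_monomial] insert.IH, of "d j" j] by simp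
      qed
      then have C1x: "Ck 1 x" unfolding xe by simp
      note T = \<gamma>.has_trace_C1[OF C1x]
      have "L2_norm_sq \<Gamma> (\<lambda>y. x (surface_pt y)) = 0"
        using 0 unfolding surface_inner_def \<gamma>.tr_inner_eq[OF T T] Re_L2_inner_self .
      then have "AE y in leb \<Gamma>. (\<Sum>j\<le>n. d j * of_real (fst y) ^ j) = 0"
        using L2_norm_sq_0[OF \<gamma>.has_traceD(2)[OF T]] unfolding xe surface_monomial_surface by blast
      from AE_polynomial_eq_0[OF free_surface_borel surface_area this] d(1) show False by blast
    qed
    ultimately show "\<exists>x\<in>V. Re (surface_inner B x x) \<noteq> 0 \<and> (\<forall>i<n. surface_inner B x (U i) = 0)" using xV by blast
  qed
qed

lemma spectral_pair_H1: "spectral_pair cscale (H1 \<Omega>) (grad_inner \<Omega>) (surface_inner B)"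
  by (rule spectral_pair_closed[OF H.a.subspace_V subset_refl]) (use C1_H1[OF C1_surface_monomial] in blast)+

text \<open>The equivalence of norms reduces this to the Sobolev norm, and a function that vanishes
  almost everywhere has zero as a weak gradient. It is the bridge between the abstract eigenvectors
  and eigenfunctions.\<close>

lemma null_iff:
  assumes "u \<in> H1 \<Omega>"
  shows "Re (Q.q u u) = 0 \<longleftrightarrow> (AE x in leb \<Omega>. u x = 0)"
proof -
  obtain c where c: "c > 0" "\<And>u. u \<in> H1 \<Omega> \<Longrightarrow> H1_norm_sq \<Omega> u \<le> c * Re (Q.q u u)"
    "\<And>u. u \<in> H1 \<Omega> \<Longrightarrow> Re (Q.q u u) \<le> c * H1_norm_sq \<Omega> u" using norm_equiv by blast
  have uL: "u \<in> L2 \<Omega>" by (rule H1_L2[OF assms])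
  show ?thesis
  proof
    assume "Re (Q.q u u) = 0"
    then have "H1_norm_sq \<Omega> u \<le> 0" using c(2)[OF assms] by simp
    then have "L2_norm_sq \<Omega> u = 0"
      using grad_norm_sq_nonneg[of u] L2_norm_sq_nonneg[of \<Omega> u] unfolding H1_norm_sq_def by linarith
    then show "AE x in leb \<Omega>. u x = 0" using L2_norm_sq_0[OF uL] by simp
  next
    assume z: "AE x in leb \<Omega>. u x = 0"
    have "weak_deriv \<Omega> e u (\<lambda>_. 0)" for e
      unfolding weak_deriv_inner
    proof (intro allI impI)
      fix \<phi> assume \<phi>: "test_function \<Omega> \<phi>"
      have "AE x in leb \<Omega>. u x * cnj (of_real (pd \<phi> e x)) = 0" using z by eventually_elim simp
      then have "L2_inner \<Omega> u (\<lambda>x. of_real (pd \<phi> e x)) = 0" unfolding L2_inner_def by (rule integral_eq_zero_AE)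
      then show "L2_inner \<Omega> u (\<lambda>x. of_real (pd \<phi> e x)) = - L2_inner \<Omega> (\<lambda>_. 0) (\<lambda>x. of_real (\<phi> x))"
        by (simp add: L2_inner_def)
    qed
    then have "has_wgrad u (\<lambda>_ _. 0)" using uL by (simp add: has_wgrad_def L2_zero)
    then have "grad_norm_sq \<Omega> u = 0" by (simp add: grad_norm_sq_eq L2_norm_sq_def)
    moreover have "L2_norm_sq \<Omega> u = 0" using L2_norm_sq_0[OF uL] z by simp
    ultimately have "Re (Q.q u u) \<le> 0" using c(3)[OF assms] by (simp add: H1_norm_sq_def)
    then show "Re (Q.q u u) = 0" using Q.q.nonneg[OF assms] by linarith
  qed
qed

lemma eigenfunction_iff:
  assumes "spectral_pair cscale V (grad_inner \<Omega>) (surface_inner B)" "V \<subseteq> H1 \<Omega>"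
  shows "eigenfunction B V \<mu> U \<longleftrightarrow> form_pair.eigenvector V (grad_inner \<Omega>) (surface_inner B) \<mu> U"
proof -
  interpret V: spectral_pair cscale V "grad_inner \<Omega>" "surface_inner B" by fact
  show ?thesis unfolding eigenfunction_def V.eigenvector_def using null_iff assms(2) by blast
qed

lemma eigenvalue_sequence_iff:
  assumes "spectral_pair cscale V (grad_inner \<Omega>) (surface_inner B)" "V \<subseteq> H1 \<Omega>"
  shows "eigenvalue_sequence B V L U \<longleftrightarrow> form_pair.eigen_sequence cscale V (grad_inner \<Omega>) (surface_inner B) L U"
proof -
  interpret V: spectral_pair cscale V "grad_inner \<Omega>" "surface_inner B" by fact
  have "(AE x in leb \<Omega>. v x = (\<Sum>k | k \<ge> 1 \<and> L k = m. c k * U k x)) \<longleftrightarrow>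
     (let y = v - (\<Sum>k | k \<ge> 1 \<and> L k = m. cscale (c k) (U k)) in Re (Q.q y y) = 0)"
    if "V.eigenvector m v" "\<forall>k\<ge>1. V.eigenvector (L k) (U k)" for m v c
  proof -
    have "(\<Sum>k | k \<ge> 1 \<and> L k = m. cscale (c k) (U k)) \<in> V"
      by (rule V.a.sum_closed) (use that(2) in \<open>auto simp: V.eigenvector_def\<close>)
    then have y: "v - (\<Sum>k | k \<ge> 1 \<and> L k = m. cscale (c k) (U k)) \<in> H1 \<Omega>"
      using that(1) assms(2) by (auto simp: V.eigenvector_def)
    show ?thesis unfolding Let_def null_iff[OF y] by (simp add: cscale_def sum_fun_apply)
  qed
  then show ?thesis
    unfolding eigenvalue_sequence_def V.eigen_sequence_def eigenfunction_iff[OF assms] by blast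
qed

end

section \<open>Hardy and trace estimates localised at a flat wall\<close>

section \<open>Estimates near a flat wall\<close>

locale flat_wall = bounded_open \<Omega> for \<Omega> :: "point set" +
  fixes p :: point and \<sigma> r0 :: real
  assumes \<sigma>: "\<sigma> = 1 \<or> \<sigma> = -1" and r0: "r0 > 0"
    and flat: "\<And>x. norm (x - p) < r0 \<Longrightarrow> x \<in> \<Omega> \<longleftrightarrow> x \<in> half_space \<sigma> (fst p)"
    and dense: "\<And>u. u \<in> H1 \<Omega> \<Longrightarrow> \<exists>f :: nat \<Rightarrow> point \<Rightarrow> complex.
          (\<forall>n. Ck 1 (f n)) \<and> (\<lambda>n. H1_norm_sq \<Omega> (\<lambda>x. f n x - u x)) \<longlonglongrightarrow> 0"
begin

definition loc :: "point \<Rightarrow> real" where "loc = cut p (r0 / 2) 1"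

text \<open>The radius of the plateau of \<open>loc\<close>, read off from \<open>cut_eq_1\<close>
  with \<open>L = 1\<close>.\<close>

definition r1 :: real where "r1 = r0 / 2 * sqrt (exp (- 1) / 2)"

lemma C1_loc: "Ck 1 loc"
  unfolding loc_def by (rule C1_cut) (use r0 in simp_all)

lemma r1: "r1 > 0" "r1\<^sup>2 = (r0 / 2)\<^sup>2 * exp (- 1) / 2"
  using r0 unfolding r1_def power_mult_distrib by simp_all

lemma loc_1: "norm (x - p) \<le> r1 \<Longrightarrow> loc x = 1"
proof -
  assume "norm (x - p) \<le> r1"
  then have "(norm (x - p))\<^sup>2 \<le> r1\<^sup>2" by (intro power_mono) auto
  then show ?thesis unfolding loc_def r1(2) by (intro cut_eq_1) (use r0 in simp_all)
qed

lemma loc_0: "norm (x - p) \<ge> r0 / 2 \<Longrightarrow> loc x = 0"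
  unfolding loc_def by (rule cut_eq_0) (use r0 in simp_all)

lemma C1_loc_mult: "Ck 1 f \<Longrightarrow> Ck 1 (\<lambda>x. of_real (loc x) * f x)" for f :: "point \<Rightarrow> complex"
  by (intro C1_mult C1_of_real C1_loc)

lemma loc_far:
  assumes "norm (x - p) > r0 / 2"
  shows "pd (\<lambda>x. of_real (loc x) * f x) e x = (0::complex)"
proof (rule pd_eq_0_outside)
  show "open {x. norm (x - p) > r0 / 2}" by (intro open_Collect_less continuous_intros)
qed (use assms loc_0 in auto)

text \<open>After multiplication by \<open>loc\<close>, the function and its gradient vanish
  wherever the half-space and \<open>\<Omega>\<close> may differ, so the half-space inequality
  applies. The constant does not depend on \<open>s\<close>, which makes it usable for shrinking
  apertures.\<close>

lemma hardy_loc: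
  "\<exists>K\<ge>0. \<forall>s>0. \<forall>f :: point \<Rightarrow> complex. Ck 1 f \<longrightarrow>
     L2_norm_sq \<Omega> (\<lambda>x. of_real (loc x / sqrt ((norm (x - p))\<^sup>2 + s\<^sup>2)) * f x) \<le> K * H1_norm_sq \<Omega> f \<and>
     (\<integral>y. s / ((norm (y - snd p))\<^sup>2 + s\<^sup>2) * (cmod (of_real (loc (fst p, y)) * f (fst p, y)))\<^sup>2 \<partial>lborel) \<le> K * H1_norm_sq \<Omega> f"
proof -
  obtain K where K: "K \<ge> 0" "\<forall>u\<in>H1 \<Omega>. H1_norm_sq \<Omega> (\<lambda>x. of_real (loc x) * u x) \<le> K * H1_norm_sq \<Omega> u"
    using H1_mult_bound[OF C1_of_real[OF C1_loc]] by blast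
  show ?thesis
  proof (intro exI[of _ "16 * K"] conjI allI impI)
    show "16 * K \<ge> 0" using K(1) by simp
    fix s :: real and f :: "point \<Rightarrow> complex" assume s: "s > 0" and f: "Ck 1 f"
    define F where "F x = of_real (loc x) * f x" for x
    have F: "Ck 1 F" unfolding F_def[abs_def] by (rule C1_loc_mult[OF f])
    have far: "F x = 0" if "norm (x - p) \<ge> r0 / 2" for x using loc_0[OF that] by (simp add: F_def)
    have F0: "F x = 0" if "norm p + r0 \<le> norm x" for x
      using norm_triangle_ineq2[of x p] that r0 by (intro far) linarith
    have ind: "indicator (half_space \<sigma> (fst p)) x * h = indicator \<Omega> x * h" if "norm (x - p) > r0 / 2 \<Longrightarrow> h = 0" for x and h :: real
      using flat[of x] that r0 by (cases "norm (x - p) > r0 / 2") (auto simp: indicator_def)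
    have pdF0: "pd F e x = 0" if "norm (x - p) > r0 / 2" for e x unfolding F_def[abs_def] by (rule loc_far[OF that])
    have L2F: "pd F e \<in> L2 \<Omega>" if "e \<in> Basis" for e by (rule cont_L2[OF C1_D(2)[OF F that]])
    have "(\<integral>x. indicator (half_space \<sigma> (fst p)) x * (\<Sum>e\<in>Basis. (cmod (pd F e x))\<^sup>2) \<partial>lborel)
        = (\<integral>x. indicator \<Omega> x * (\<Sum>e\<in>Basis. (cmod (pd F e x))\<^sup>2) \<partial>lborel)"
      by (rule Bochner_Integration.integral_cong[OF refl], rule ind) (simp add: pdF0)
    also have "\<dots> = (\<integral>x. (\<Sum>e\<in>Basis. (cmod (pd F e x))\<^sup>2) \<partial>leb \<Omega>)" by (simp add: integral_leb)
    also have "\<dots> = (\<Sum>e\<in>Basis. L2_norm_sq \<Omega> (pd F e))"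
      unfolding L2_norm_sq_def by (rule Bochner_Integration.integral_sum) (rule L2_D(2)[OF L2F])
    also have "\<dots> = grad_norm_sq \<Omega> F" by (rule grad_norm_sq_eq[OF C1_has_wgrad[OF F], symmetric])
    also have "\<dots> \<le> H1_norm_sq \<Omega> F" by (simp add: H1_norm_sq_def L2_norm_sq_nonneg)
    also have "\<dots> \<le> K * H1_norm_sq \<Omega> f" unfolding F_def[abs_def] using K(2) C1_H1[OF f] by blast
    finally have G: "16 * (\<integral>x. indicator (half_space \<sigma> (fst p)) x * (\<Sum>e\<in>Basis. (cmod (pd F e x))\<^sup>2) \<partial>lborel)
        \<le> 16 * K * H1_norm_sq \<Omega> f" by simp
    note h = hardy_trace[where R="norm p + r0" and p=p, OF F F0 s \<sigma>]
    from h(2) G show "(\<integral>y. s / ((norm (y - snd p))\<^sup>2 + s\<^sup>2) * (cmod (of_real (loc (fst p, y)) * f (fst p, y)))\<^sup>2 \<partial>lborel) \<le> 16 * K * H1_norm_sq \<Omega> f"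
      unfolding F_def by linarith
    have "L2_norm_sq \<Omega> (\<lambda>x. of_real (loc x / sqrt ((norm (x - p))\<^sup>2 + s\<^sup>2)) * f x)
        = (\<integral>x. indicator \<Omega> x * ((cmod (F x))\<^sup>2 / ((norm (x - p))\<^sup>2 + s\<^sup>2)) \<partial>lborel)"
      unfolding L2_norm_sq_def integral_leb
      by (rule Bochner_Integration.integral_cong[OF refl])
        (simp add: F_def norm_mult norm_divide power_mult_distrib power_divide)
    also have "\<dots> = (\<integral>x. indicator (half_space \<sigma> (fst p)) x * ((cmod (F x))\<^sup>2 / ((norm (x - p))\<^sup>2 + s\<^sup>2)) \<partial>lborel)"
      by (rule Bochner_Integration.integral_cong[OF refl], rule ind[symmetric]) (simp add: far)
    finally show "L2_norm_sq \<Omega> (\<lambda>x. of_real (loc x / sqrt ((norm (x - p))\<^sup>2 + s\<^sup>2)) * f x) \<le> 16 * K * H1_norm_sq \<Omega> f"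
      using h(1) G by linarith
  qed
qed

definition K\<^sub>w :: real where
  "K\<^sub>w = (SOME K. K \<ge> 0 \<and> (\<forall>s>0. \<forall>f :: point \<Rightarrow> complex. Ck 1 f \<longrightarrow>
     L2_norm_sq \<Omega> (\<lambda>x. of_real (loc x / sqrt ((norm (x - p))\<^sup>2 + s\<^sup>2)) * f x) \<le> K * H1_norm_sq \<Omega> f \<and>
     (\<integral>y. s / ((norm (y - snd p))\<^sup>2 + s\<^sup>2) * (cmod (of_real (loc (fst p, y)) * f (fst p, y)))\<^sup>2 \<partial>lborel) \<le> K * H1_norm_sq \<Omega> f))"

lemma K\<^sub>w: "K\<^sub>w \<ge> 0"
    "\<lbrakk>s > 0; Ck 1 f\<rbrakk> \<Longrightarrow> L2_norm_sq \<Omega> (\<lambda>x. of_real (loc x / sqrt ((norm (x - p))\<^sup>2 + s\<^sup>2)) * f x) \<le> K\<^sub>w * H1_norm_sq \<Omega> f"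
    "\<lbrakk>s > 0; Ck 1 f\<rbrakk> \<Longrightarrow> (\<integral>y. s / ((norm (y - snd p))\<^sup>2 + s\<^sup>2) * (cmod (of_real (loc (fst p, y)) * f (fst p, y)))\<^sup>2 \<partial>lborel)
        \<le> K\<^sub>w * H1_norm_sq \<Omega> f"
  using someI_ex[OF hardy_loc] unfolding K\<^sub>w_def by blast+

text \<open>For fixed \<open>s\<close> the weight is bounded, so both sides are continuous along an
  approximating sequence of C1 functions.\<close>

lemma hardy_H1:
  assumes u: "u \<in> H1 \<Omega>" and s: "s > 0"
  shows "L2_norm_sq \<Omega> (\<lambda>x. of_real (loc x / sqrt ((norm (x - p))\<^sup>2 + s\<^sup>2)) * u x) \<le> K\<^sub>w * H1_norm_sq \<Omega> u"
proof -
  define m where "m x = complex_of_real (loc x / sqrt ((norm (x - p))\<^sup>2 + s\<^sup>2))" for x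
  have "sqrt ((norm (x - p))\<^sup>2 + s\<^sup>2) \<noteq> 0" for x
    using s by (simp add: add_nonneg_eq_0_iff)
  then have mc: "continuous_on UNIV m" unfolding m_def[abs_def]
    by (intro continuous_intros C1_continuous[OF C1_loc]) auto
  obtain M where M: "\<forall>x\<in>\<Omega>. cmod (m x) \<le> M" using continuous_bounded_on[OF mc bounded_\<Omega>] by blast
  have mm: "m \<in> borel_measurable (leb \<Omega>)" by (rule borel_leb[OF borel_measurable_continuous_onI[OF mc]])
  obtain f :: "nat \<Rightarrow> point \<Rightarrow> complex" where f: "\<forall>n. Ck 1 (f n)" "(\<lambda>n. H1_norm_sq \<Omega> (\<lambda>x. f n x - u x)) \<longlonglongrightarrow> 0"
    using dense[OF u] by blast
  have fH: "f n \<in> H1 \<Omega>" for n using C1_H1 f(1) by blast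
  note L = H1_L2[OF fH] and uL = H1_L2[OF u]
  have "(\<lambda>n. L2_norm_sq \<Omega> (\<lambda>x. m x * f n x)) \<longlonglongrightarrow> L2_norm_sq \<Omega> (\<lambda>x. m x * u x)"
  proof (rule L2_norm_sq_tendsto)
    show "(\<lambda>x. m x * f n x) \<in> L2 \<Omega>" for n by (rule L2_mult_continuous[OF L mc bounded_\<Omega>])
    show "(\<lambda>x. m x * u x) \<in> L2 \<Omega>" by (rule L2_mult_continuous[OF uL mc bounded_\<Omega>])
    show "(\<lambda>n. L2_norm_sq \<Omega> (\<lambda>x. m x * f n x - m x * u x)) \<longlonglongrightarrow> 0"
    proof (rule tendsto_sandwich[OF always_eventually always_eventually tendsto_const])
      show "\<forall>n. 0 \<le> L2_norm_sq \<Omega> (\<lambda>x. m x * f n x - m x * u x)" using L2_norm_sq_nonneg by blast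
      show "\<forall>n. L2_norm_sq \<Omega> (\<lambda>x. m x * f n x - m x * u x) \<le> M\<^sup>2 * H1_norm_sq \<Omega> (\<lambda>x. f n x - u x)"
      proof
        fix n
        have "L2_norm_sq \<Omega> (\<lambda>x. m x * (f n x - u x)) \<le> M\<^sup>2 * L2_norm_sq \<Omega> (\<lambda>x. f n x - u x)"
          by (rule L2_mult_bounded(2)[OF L2_diff[OF L uL] mm]) (use M in blast)
        also have "\<dots> \<le> M\<^sup>2 * H1_norm_sq \<Omega> (\<lambda>x. f n x - u x)"
          by (intro mult_left_mono) (simp_all add: H1_norm_sq_def grad_norm_sq_nonneg)
        finally show "L2_norm_sq \<Omega> (\<lambda>x. m x * f n x - m x * u x) \<le> M\<^sup>2 * H1_norm_sq \<Omega> (\<lambda>x. f n x - u x)"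
          by (simp add: right_diff_distrib)
      qed
      show "(\<lambda>n. M\<^sup>2 * H1_norm_sq \<Omega> (\<lambda>x. f n x - u x)) \<longlonglongrightarrow> 0" by (rule tendsto_mult_right_zero[OF f(2)])
    qed
  qed
  moreover have "(\<lambda>n. K\<^sub>w * H1_norm_sq \<Omega> (f n)) \<longlonglongrightarrow> K\<^sub>w * H1_norm_sq \<Omega> u"
    by (intro tendsto_mult tendsto_const H1_norm_sq_tendsto[OF fH u f(2)])
  moreover have "L2_norm_sq \<Omega> (\<lambda>x. m x * f n x) \<le> K\<^sub>w * H1_norm_sq \<Omega> (f n)" for n
    unfolding m_def by (rule K\<^sub>w(2)[OF s f(1)[rule_format]])
  ultimately show ?thesis unfolding m_def by (rule_tac LIMSEQ_le) blast+
qed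

text \<open>The gradient of \<open>cut\<close> is at most \<open>4 / L\<close> times the square root
  of the Hardy weight with the matching \<open>s\<close>. Cutting off therefore costs a fraction of
  order \<open>1 / L^2\<close> of the squared Sobolev norm, uniformly in \<open>r\<close>.\<close>

lemma cut_gradient_bound:
  assumes u: "u \<in> H1 \<Omega>" and r: "0 < r" "r \<le> r1" and L: "L > 0"
  shows "(\<Sum>e\<in>Basis. L2_norm_sq \<Omega> (\<lambda>x. of_real (pd (cut p r L) e x) * u x)) \<le> (4 / L)\<^sup>2 * (K\<^sub>w * H1_norm_sq \<Omega> u)"
proof -
  define s where "s = r * sqrt (exp (- L) / 2)"
  have s: "s > 0" "s\<^sup>2 = r\<^sup>2 * exp (- L) / 2" using r by (simp_all add: s_def power_mult_distrib)
  note C1 = C1_cut[OF r(1) L, of p]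
  have uL: "u \<in> L2 \<Omega>" by (rule H1_L2[OF u])
  have L2e: "(\<lambda>x. of_real (pd (cut p r L) e x) * u x) \<in> L2 \<Omega>" if "e \<in> Basis" for e
    by (rule L2_mult_continuous[OF uL continuous_on_of_real[OF C1_D(2)[OF C1 that]] bounded_\<Omega>])
  have mc: "continuous_on UNIV (\<lambda>x. complex_of_real (loc x / sqrt ((norm (x - p))\<^sup>2 + s\<^sup>2)))"
    using s(1) by (intro continuous_intros C1_continuous[OF C1_loc]) (simp add: add_nonneg_eq_0_iff)
  have L2m: "(\<lambda>x. of_real (loc x / sqrt ((norm (x - p))\<^sup>2 + s\<^sup>2)) * u x) \<in> L2 \<Omega>"
    by (rule L2_mult_continuous[OF uL mc bounded_\<Omega>])
  have pw: "(\<Sum>e\<in>Basis. (cmod (of_real (pd (cut p r L) e x) * u x))\<^sup>2)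
      \<le> (4 / L)\<^sup>2 * (cmod (of_real (loc x / sqrt ((norm (x - p))\<^sup>2 + s\<^sup>2)) * u x))\<^sup>2" for x
  proof (cases "norm (x - p) \<le> r")
    case True
    then have 1: "loc x = 1" using r(2) by (intro loc_1) linarith
    have D: "(norm (x - p))\<^sup>2 + s\<^sup>2 > 0" using s(1) by (simp add: add_nonneg_pos)
    have "(\<Sum>e\<in>Basis. (cmod (of_real (pd (cut p r L) e x) * u x))\<^sup>2) = (\<Sum>e\<in>Basis. (pd (cut p r L) e x)\<^sup>2) * (cmod (u x))\<^sup>2"
      by (simp add: norm_mult power_mult_distrib sum_distrib_right)
    also have "\<dots> \<le> (4 / L)\<^sup>2 / ((norm (x - p))\<^sup>2 + s\<^sup>2) * (cmod (u x))\<^sup>2"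
      unfolding s(2) by (intro mult_right_mono cut_grad r(1) L) simp
    also have "\<dots> = (4 / L)\<^sup>2 * (cmod (of_real (loc x / sqrt ((norm (x - p))\<^sup>2 + s\<^sup>2)) * u x))\<^sup>2"
      using D by (simp add: 1 norm_mult norm_divide power_mult_distrib power_divide)
    finally show ?thesis .
  next
    case False
    have "pd (cut p r L) e x = 0" for e
    proof (rule pd_eq_0_outside)
      show "open {x. norm (x - p) > r}" by (intro open_Collect_less continuous_intros)
      show "x \<in> {x. norm (x - p) > r}" using False by simp
      show "cut p r L y = 0" if "y \<in> {x. norm (x - p) > r}" for y
        by (rule cut_eq_0[OF r(1) L]) (use that in simp)
    qed
    then show ?thesis by simp
  qed
  have "(\<Sum>e\<in>Basis. L2_norm_sq \<Omega> (\<lambda>x. of_real (pd (cut p r L) e x) * u x))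
      = (\<integral>x. (\<Sum>e\<in>Basis. (cmod (of_real (pd (cut p r L) e x) * u x))\<^sup>2) \<partial>leb \<Omega>)"
    unfolding L2_norm_sq_def by (rule Bochner_Integration.integral_sum[symmetric]) (rule L2_D(2)[OF L2e])
  also have "\<dots> \<le> (\<integral>x. (4 / L)\<^sup>2 * (cmod (of_real (loc x / sqrt ((norm (x - p))\<^sup>2 + s\<^sup>2)) * u x))\<^sup>2 \<partial>leb \<Omega>)"
  proof (rule integral_mono)
    show "integrable (leb \<Omega>) (\<lambda>x. \<Sum>e\<in>Basis. (cmod (of_real (pd (cut p r L) e x) * u x))\<^sup>2)"
      by (rule Bochner_Integration.integrable_sum) (rule L2_D(2)[OF L2e])
    show "integrable (leb \<Omega>) (\<lambda>x. (4 / L)\<^sup>2 * (cmod (of_real (loc x / sqrt ((norm (x - p))\<^sup>2 + s\<^sup>2)) * u x))\<^sup>2)"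
      by (rule integrable_mult_right) (rule L2_D(2)[OF L2m])
  qed (rule pw)
  also have "\<dots> = (4 / L)\<^sup>2 * L2_norm_sq \<Omega> (\<lambda>x. of_real (loc x / sqrt ((norm (x - p))\<^sup>2 + s\<^sup>2)) * u x)"
    unfolding L2_norm_sq_def by (rule integral_mult_right_zero)
  also have "\<dots> \<le> (4 / L)\<^sup>2 * (K\<^sub>w * H1_norm_sq \<Omega> u)"
    by (intro mult_left_mono hardy_H1[OF u s(1)]) simp
  finally show ?thesis .
qed

text \<open>On a piece of size \<open>m * s\<close> the weight in the Hardy boundary term is at
  least \<open>1 / ((1 + m^2) s)\<close>; dividing by it leaves a trace constant proportional to
  \<open>s\<close>.\<close>

lemma traced_wall:
  assumes s: "s > 0" and S: "S \<in> sets borel" and sub: "S \<subseteq> cball (snd p) (m * s)" "S \<subseteq> cball (snd p) r1"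
  shows "traced \<Omega> (Pair (fst p)) S ((1 + m\<^sup>2) * s * K\<^sub>w)"
proof unfold_locales
  show "continuous_on UNIV (Pair (fst p) :: plane \<Rightarrow> point)" by (intro continuous_intros)
  show "bounded S" using sub(1) bounded_cball bounded_subset by blast
  show "0 \<le> (1 + m\<^sup>2) * s * K\<^sub>w" using s K\<^sub>w(1) by simp
  fix f :: "point \<Rightarrow> complex" assume f: "Ck 1 f"
  define g where "g y = s / ((norm (y - snd p))\<^sup>2 + s\<^sup>2) * (cmod (of_real (loc (fst p, y)) * f (fst p, y)))\<^sup>2" for y
  have D: "(norm (y - snd p))\<^sup>2 + s\<^sup>2 > 0" for y :: plane using s by (simp add: add_nonneg_pos)
  have np: "norm ((fst p, y) - p) = norm (y - snd p)" for y by (cases p) (simp add: norm_Pair)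
  have gc: "continuous_on UNIV g" unfolding g_def[abs_def]
    by (intro continuous_intros continuous_on_compose2[OF C1_continuous[OF f, of UNIV]]
        continuous_on_compose2[OF C1_continuous[OF C1_loc, of UNIV]]) (use s in auto)
  have g0: "g y = 0" if "norm (snd p) + r0 \<le> norm y" for y
  proof -
    have "norm ((fst p, y) - p) \<ge> r0 / 2" unfolding np using norm_triangle_ineq2[of y "snd p"] that r0 by linarith
    then show ?thesis by (simp add: g_def loc_0)
  qed
  obtain M where M: "\<forall>y. norm (g y) \<le> M * indicator (cball 0 (norm (snd p) + r0)) y"
    using C1_compact_support_bound[OF gc g0] by blast
  have gi: "integrable lborel g"
    by (rule integrable_bounded_support[OF borel_measurable_continuous_onI[OF gc]]) (use M in blast)
  have gn: "g y \<ge> 0" for y using s D[of y] by (simp add: g_def)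
  have "L2_norm_sq S (\<lambda>y. f (fst p, y)) = (\<integral>y. indicator S y * (cmod (f (fst p, y)))\<^sup>2 \<partial>lborel)"
    unfolding L2_norm_sq_def by (subst integral_restrict_space) (simp_all add: S)
  also have "\<dots> \<le> (\<integral>y. (1 + m\<^sup>2) * s * g y \<partial>lborel)"
  proof (rule integral_mono_AE')
    show "integrable lborel (\<lambda>y. (1 + m\<^sup>2) * s * g y)" using gi by simp
    show "AE y in lborel. 0 \<le> (1 + m\<^sup>2) * s * g y" using gn s by simp
    show "AE y in lborel. indicator S y * (cmod (f (fst p, y)))\<^sup>2 \<le> (1 + m\<^sup>2) * s * g y"
    proof (intro always_eventually allI)
      fix y
      show "indicator S y * (cmod (f (fst p, y)))\<^sup>2 \<le> (1 + m\<^sup>2) * s * g y"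
      proof (cases "y \<in> S")
        case True
        have y1: "norm (y - snd p) \<le> m * s" and y2: "norm (y - snd p) \<le> r1"
          using subsetD[OF sub(1) True] subsetD[OF sub(2) True]
          by (simp_all add: dist_norm norm_minus_commute)
        have l1: "loc (fst p, y) = 1" by (rule loc_1) (simp only: np y2)
        have "(norm (y - snd p))\<^sup>2 \<le> (m * s)\<^sup>2" using y1 by (intro power_mono) auto
        then have "(norm (y - snd p))\<^sup>2 + s\<^sup>2 \<le> (1 + m\<^sup>2) * s * s"
          by (simp add: power_mult_distrib power2_eq_square algebra_simps)
        then have "1 \<le> (1 + m\<^sup>2) * s * (s / ((norm (y - snd p))\<^sup>2 + s\<^sup>2))" using D[of y] by simp
        then have "1 * (cmod (f (fst p, y)))\<^sup>2 \<le> (1 + m\<^sup>2) * s * (s / ((norm (y - snd p))\<^sup>2 + s\<^sup>2)) * (cmod (f (fst p, y)))\<^sup>2"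
          by (rule mult_right_mono) simp
        then show ?thesis using True by (simp only: g_def l1 indicator_simps mult.assoc of_real_1 mult_1_left)
      next
        case False
        then show ?thesis using gn[of y] s by simp
      qed
    qed
  qed
  also have "\<dots> = (1 + m\<^sup>2) * s * (\<integral>y. g y \<partial>lborel)" by (rule integral_mult_right_zero)
  also have "\<dots> \<le> (1 + m\<^sup>2) * s * (K\<^sub>w * H1_norm_sq \<Omega> f)"
    using K\<^sub>w(3)[OF s f] s unfolding g_def by (intro mult_left_mono) auto
  finally show "L2_norm_sq S (\<lambda>y. f (fst p, y)) \<le> (1 + m\<^sup>2) * s * K\<^sub>w * H1_norm_sq \<Omega> f" by (simp only: mult.assoc)
qed (use S dense in blast)+

end

context bounded_open
begin

text \<open>Minkowski's inequality over the components keeps the coefficient 1 in front of the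
  energy norm of \<open>u\<close>; a cruder bound with a factor 2 would ruin the comparison of the
  two shifts.\<close>

lemma grad_mult_le:
  fixes \<zeta> :: "'a \<Rightarrow> complex"
  assumes u: "u \<in> H1 \<Omega>" and \<zeta>: "Ck 1 \<zeta>" "\<And>x. cmod (\<zeta> x) \<le> 1"
  shows "sqrt (grad_norm_sq \<Omega> (\<lambda>x. \<zeta> x * u x))
    \<le> sqrt (grad_norm_sq \<Omega> u) + sqrt (\<Sum>e\<in>Basis. L2_norm_sq \<Omega> (\<lambda>x. pd \<zeta> e x * u x))"
proof -
  note G = H1_has_wgrad[OF u]
  have uL: "u \<in> L2 \<Omega>" and GL: "\<And>e. e \<in> Basis \<Longrightarrow> wgrad \<Omega> u e \<in> L2 \<Omega>" using G by (auto simp: has_wgrad_def)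
  let ?N = "\<lambda>f. sqrt (L2_norm_sq \<Omega> f)"
  have le: "?N (\<lambda>x. \<zeta> x * wgrad \<Omega> u e x + pd \<zeta> e x * u x) \<le> ?N (wgrad \<Omega> u e) + ?N (\<lambda>x. pd \<zeta> e x * u x)" if e: "e \<in> Basis" for e
  proof -
    have \<zeta>m: "\<zeta> \<in> borel_measurable (leb \<Omega>)" by (rule borel_leb[OF C1_measurable[OF \<zeta>(1)]])
    have 1: "(\<lambda>x. \<zeta> x * wgrad \<Omega> u e x) \<in> L2 \<Omega>" "L2_norm_sq \<Omega> (\<lambda>x. \<zeta> x * wgrad \<Omega> u e x) \<le> 1\<^sup>2 * L2_norm_sq \<Omega> (wgrad \<Omega> u e)"
      by (rule L2_mult_bounded[OF GL[OF e] \<zeta>m \<zeta>(2)])+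
    have 2: "(\<lambda>x. pd \<zeta> e x * u x) \<in> L2 \<Omega>" by (rule L2_mult_continuous[OF uL C1_D(2)[OF \<zeta>(1) e] bounded_\<Omega>])
    have "?N (\<lambda>x. \<zeta> x * wgrad \<Omega> u e x + pd \<zeta> e x * u x) \<le> ?N (\<lambda>x. \<zeta> x * wgrad \<Omega> u e x) + ?N (\<lambda>x. pd \<zeta> e x * u x)"
      using L2.triangle[OF 1(1) 2] unfolding Re_L2_inner_self plus_fun_def .
    moreover have "?N (\<lambda>x. \<zeta> x * wgrad \<Omega> u e x) \<le> ?N (wgrad \<Omega> u e)" using 1(2) by simp
    ultimately show ?thesis by linarith
  qed
  have "sqrt (grad_norm_sq \<Omega> (\<lambda>x. \<zeta> x * u x)) = L2_set (\<lambda>e. ?N (\<lambda>x. \<zeta> x * wgrad \<Omega> u e x + pd \<zeta> e x * u x)) Basis"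
    unfolding grad_norm_sq_eq[OF has_wgrad_mult[OF G \<zeta>(1)]] L2_set_def by (simp add: L2_norm_sq_nonneg)
  also have "\<dots> \<le> L2_set (\<lambda>e. ?N (wgrad \<Omega> u e) + ?N (\<lambda>x. pd \<zeta> e x * u x)) Basis"
    by (rule L2_set_mono[OF le]) (simp_all add: L2_norm_sq_nonneg)
  also have "\<dots> \<le> L2_set (\<lambda>e. ?N (wgrad \<Omega> u e)) Basis + L2_set (\<lambda>e. ?N (\<lambda>x. pd \<zeta> e x * u x)) Basis"
    by (rule L2_set_triangle_ineq)
  also have "\<dots> = sqrt (grad_norm_sq \<Omega> u) + sqrt (\<Sum>e\<in>Basis. L2_norm_sq \<Omega> (\<lambda>x. pd \<zeta> e x * u x))"
    by (simp add: L2_set_def grad_norm_sq_def L2_norm_sq_nonneg)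
  finally show ?thesis .
qed

end

section \<open>Quasi-periodic spaces as closed subspaces of H1\<close>

section \<open>Quasi-periodic spaces\<close>

lemma (in periodic_channel) kth_eigenvalue_eq:
  assumes "spectral_pair cscale V (grad_inner \<Omega>) (surface_inner B)" "V \<subseteq> H1 \<Omega>"
    "form_pair.eigen_sequence cscale V (grad_inner \<Omega>) (surface_inner B) L U" "k \<ge> 1"
  shows "kth_eigenvalue B V k = L k"
  unfolding kth_eigenvalue_def eigenvalue_sequence_iff[OF assms(1,2)]
  by (rule the_equality) (use spectral_pair.eigen_sequence_unique[OF assms(1)] assms(3,4) in blast)+

text \<open>The bound \<open>1/2\<close> separates the two walls from each other, and
  \<open>- snd P / 2\<close> separates their neighbourhoods from the free surface.\<close>

lemma (in periodic_channel) walls_exist: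
  "\<exists>R>0. R \<le> 1/2 \<and> R \<le> - snd P / 2 \<and> flat_wall \<Omega> (0, P) 1 R \<and> flat_wall \<Omega> (1, P) (- 1) R"
proof -
  have 0: "0 \<in> closure \<theta>" using \<theta>_domain(4) closure_subset by blast
  obtain N0 where N0: "open N0" "(\<lambda>y. (0, y + P)) ` closure \<theta> \<subseteq> N0" "N0 \<inter> {x. fst x > 0} \<subseteq> \<Omega>"
    using flat_0 by blast
  obtain N1 where N1: "open N1" "(\<lambda>y. (1, y + P)) ` closure \<theta> \<subseteq> N1" "N1 \<inter> {x. fst x < 1} \<subseteq> \<Omega>"
    using flat_1 by blast
  have "(0, P) \<in> N0" "(1, P) \<in> N1" using N0(2) N1(2) 0 by force+
  then obtain s0 s1 where s: "s0 > 0" "ball (0, P) s0 \<subseteq> N0" "s1 > 0" "ball (1, P) s1 \<subseteq> N1"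
    using N0(1) N1(1) open_contains_ball by metis
  define R where "R = Min {s0, s1, 1/2, - snd P / 2}"
  have R: "R > 0" "R \<le> s0" "R \<le> s1" "R \<le> 1/2" "R \<le> - snd P / 2" using s P_below by (auto simp: R_def)
  have "flat_wall \<Omega> (0, P) 1 R"
  proof unfold_locales
    fix x :: point assume x: "norm (x - (0, P)) < R"
    then have "x \<in> ball (0, P) s0" using R(2) by (simp add: dist_norm norm_minus_commute)
    then have "x \<in> N0" using s(2) by blast
    then show "x \<in> \<Omega> \<longleftrightarrow> x \<in> half_space 1 (fst (0, P))"
      using N0(3) by (auto simp: half_space_def cell_def)
  qed (use R(1) C1_dense_H1 in auto)
  moreover have "flat_wall \<Omega> (1, P) (- 1) R"
  proof unfold_locales
    fix x :: point assume x: "norm (x - (1, P)) < R"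
    then have "x \<in> ball (1, P) s1" using R(3) by (simp add: dist_norm norm_minus_commute)
    then have "x \<in> N1" using s(4) by blast
    then show "x \<in> \<Omega> \<longleftrightarrow> x \<in> half_space (- 1) (fst (1, P))"
      using N1(3) by (auto simp: half_space_def cell_def)
  qed (use R(1) C1_dense_H1 in auto)
  ultimately show ?thesis using R by blast
qed

locale channel_walls = periodic_channel +
  fixes R m :: real
  assumes R: "R > 0" "R \<le> 1/2" "R \<le> - snd P / 2"
    and wall0: "flat_wall \<Omega> (0, P) 1 R" and wall1: "flat_wall \<Omega> (1, P) (- 1) R"
    and m: "m > 0" "\<theta> \<subseteq> cball 0 m"
begin

sublocale w0: flat_wall \<Omega> "(0, P)" 1 R by (rule wall0)
sublocale w1: flat_wall \<Omega> "(1, P)" "- 1" R by (rule wall1)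

lemma r1_le: "w0.r1 \<le> R / 2"
proof -
  have "exp (- 1) \<le> exp (0::real)" by (subst exp_le_cancel_iff) simp
  then have "exp (- 1) / 2 \<le> (1::real)" unfolding exp_zero by linarith
  then have "sqrt (exp (- 1) / 2) \<le> (1::real)" by (simp only: real_sqrt_le_1_iff)
  then show ?thesis unfolding w0.r1_def using R by (simp add: mult_left_le)
qed

abbreviation A where "A \<epsilon> \<equiv> aperture P \<theta> \<epsilon>"

lemma A_subset:
  assumes "\<epsilon> > 0" shows "A \<epsilon> \<subseteq> cball P (m * \<epsilon>)"
proof
  fix y assume "y \<in> A \<epsilon>"
  then have "norm ((1 / \<epsilon>) *\<^sub>R (y - P)) \<le> m" using m(2) by (auto simp: aperture_def)
  then have "norm (y - P) / \<epsilon> \<le> m" unfolding norm_scaleR using assms by simp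
  then have "norm (y - P) \<le> m * \<epsilon>" using assms by (simp only: pos_divide_le_eq)
  then show "y \<in> cball P (m * \<epsilon>)" by (simp add: dist_norm norm_minus_commute)
qed

lemma A_borel: "A \<epsilon> \<in> sets borel"
proof -
  have "A \<epsilon> = (\<lambda>y. (1 / \<epsilon>) *\<^sub>R (y - P)) -` \<theta>" by (auto simp: aperture_def)
  moreover have "open ((\<lambda>y. (1 / \<epsilon>) *\<^sub>R (y - P)) -` \<theta>)"
    by (intro open_vimage \<theta>_domain(1) continuous_intros)
  ultimately show ?thesis by simp
qed

text \<open>Apertures lie within \<open>m \<epsilon>\<close> of \<open>P\<close>. The radius
  \<open>3 m \<epsilon>\<close> is that of the bumps, whose plateau contains the aperture since
  \<open>9 exp (- 1) / 2 \<ge> 1\<close>.\<close>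

definition small :: "real \<Rightarrow> bool" where "small \<epsilon> \<longleftrightarrow> \<epsilon> > 0 \<and> 3 * m * \<epsilon> \<le> w0.r1"

lemma A_subset_r1:
  assumes "small \<epsilon>" shows "A \<epsilon> \<subseteq> cball P w0.r1"
proof -
  have "m * \<epsilon> > 0" using assms m(1) by (simp add: small_def)
  then have "cball P (m * \<epsilon>) \<subseteq> cball P w0.r1" using assms by (intro subset_cball) (auto simp: small_def)
  moreover have "A \<epsilon> \<subseteq> cball P (m * \<epsilon>)" by (rule A_subset) (use assms in \<open>simp add: small_def\<close>)
  ultimately show ?thesis by (rule_tac order_trans)
qed

lemma traced0: "small \<epsilon> \<Longrightarrow> traced \<Omega> (Pair 0) (A \<epsilon>) ((1 + m\<^sup>2) * \<epsilon> * w0.K\<^sub>w)"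
proof -
  assume \<epsilon>: "small \<epsilon>"
  then have "\<epsilon> > 0" by (simp add: small_def)
  from w0.traced_wall[OF this A_borel, unfolded snd_conv fst_conv, OF A_subset[OF this] A_subset_r1[OF \<epsilon>]]
  show ?thesis .
qed

lemma traced1: "small \<epsilon> \<Longrightarrow> traced \<Omega> (Pair 1) (A \<epsilon>) ((1 + m\<^sup>2) * \<epsilon> * w1.K\<^sub>w)"
proof -
  assume \<epsilon>: "small \<epsilon>"
  then have "\<epsilon> > 0" by (simp add: small_def)
  from w1.traced_wall[OF this A_borel, unfolded snd_conv fst_conv, OF A_subset[OF this] A_subset_r1[OF \<epsilon>]]
  show ?thesis .
qed

abbreviation W where "W \<epsilon> \<eta> \<equiv> H1_quasiperiodic B P \<theta> \<epsilon> \<eta>"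

lemma W_H1: "W \<epsilon> \<eta> \<subseteq> H1 \<Omega>"
  by (auto simp: H1_quasiperiodic_def)

text \<open>The quasi-periodic space is defined through the chosen \<open>trace\<close>. This lemma
  and \<open>W_elim\<close> admit any trace functions, so that membership becomes a pointwise
  computation.\<close>

lemma W_intro:
  assumes \<epsilon>: "small \<epsilon>" and t: "has_trace \<Omega> (Pair 0) (A \<epsilon>) u g" "has_trace \<Omega> (Pair 1) (A \<epsilon>) u h"
    and ae: "AE y in leb (A \<epsilon>). g y = exp (- \<i> * of_real \<eta>) * h y"
  shows "u \<in> W \<epsilon> \<eta>"
proof -
  interpret t0: traced \<Omega> "Pair 0" "A \<epsilon>" "(1 + m\<^sup>2) * \<epsilon> * w0.K\<^sub>w" by (rule traced0[OF \<epsilon>])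
  interpret t1: traced \<Omega> "Pair 1" "A \<epsilon>" "(1 + m\<^sup>2) * \<epsilon> * w1.K\<^sub>w" by (rule traced1[OF \<epsilon>])
  have "AE y in leb (A \<epsilon>). t0.tr u y = exp (- \<i> * of_real \<eta>) * t1.tr u y"
    using t0.tr_eq[OF t(1)] t1.tr_eq[OF t(2)] ae by eventually_elim simp
  then show ?thesis using t0.has_traceD(1)[OF t(1)] by (simp add: H1_quasiperiodic_def)
qed

lemma W_elim:
  assumes \<epsilon>: "small \<epsilon>" and u: "u \<in> W \<epsilon> \<eta>"
    and t: "has_trace \<Omega> (Pair 0) (A \<epsilon>) u g" "has_trace \<Omega> (Pair 1) (A \<epsilon>) u h"
  shows "AE y in leb (A \<epsilon>). g y = exp (- \<i> * of_real \<eta>) * h y"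
proof -
  interpret t0: traced \<Omega> "Pair 0" "A \<epsilon>" "(1 + m\<^sup>2) * \<epsilon> * w0.K\<^sub>w" by (rule traced0[OF \<epsilon>])
  interpret t1: traced \<Omega> "Pair 1" "A \<epsilon>" "(1 + m\<^sup>2) * \<epsilon> * w1.K\<^sub>w" by (rule traced1[OF \<epsilon>])
  have "AE y in leb (A \<epsilon>). t0.tr u y = exp (- \<i> * of_real \<eta>) * t1.tr u y"
    using u by (simp add: H1_quasiperiodic_def)
  then show ?thesis using t0.tr_eq[OF t(1)] t1.tr_eq[OF t(2)] by eventually_elim simp
qed

lemma traces:
  assumes "small \<epsilon>" "u \<in> H1 \<Omega>"
  shows "\<exists>g h. has_trace \<Omega> (Pair 0) (A \<epsilon>) u g \<and> has_trace \<Omega> (Pair 1) (A \<epsilon>) u h"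
  using traced.has_trace_exists[OF traced0[OF assms(1)] assms(2)]
    traced.has_trace_exists[OF traced1[OF assms(1)] assms(2)] by blast

lemma W_subspace:
  assumes \<epsilon>: "small \<epsilon>" shows "module.subspace cscale (W \<epsilon> \<eta>)"
proof (rule subspaceI_fun)
  note T0 = traced0[OF \<epsilon>] and T1 = traced1[OF \<epsilon>]
  show "(\<lambda>_. 0) \<in> W \<epsilon> \<eta>"
    by (rule W_intro[OF \<epsilon> traced.has_trace_C1[OF T0 C1_const[of 0]] traced.has_trace_C1[OF T1 C1_const[of 0]]]) simp
next
  note T0 = traced0[OF \<epsilon>] and T1 = traced1[OF \<epsilon>]
  fix u v assume u: "u \<in> W \<epsilon> \<eta>" and v: "v \<in> W \<epsilon> \<eta>"
  obtain g h where g: "has_trace \<Omega> (Pair 0) (A \<epsilon>) u g" "has_trace \<Omega> (Pair 1) (A \<epsilon>) u h"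
    using traces[OF \<epsilon> subsetD[OF W_H1 u]] by blast
  obtain g' h' where g': "has_trace \<Omega> (Pair 0) (A \<epsilon>) v g'" "has_trace \<Omega> (Pair 1) (A \<epsilon>) v h'"
    using traces[OF \<epsilon> subsetD[OF W_H1 v]] by blast
  have ae: "AE y in leb (A \<epsilon>). g y + g' y = exp (- \<i> * of_real \<eta>) * (h y + h' y)"
    using W_elim[OF \<epsilon> u g] W_elim[OF \<epsilon> v g'] by eventually_elim (simp add: distrib_left)
  show "(\<lambda>x. u x + v x) \<in> W \<epsilon> \<eta>"
    by (rule W_intro[OF \<epsilon> traced.has_trace_add[OF T0 g(1) g'(1)] traced.has_trace_add[OF T1 g(2) g'(2)] ae])
next
  note T0 = traced0[OF \<epsilon>] and T1 = traced1[OF \<epsilon>]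
  fix c u assume u: "u \<in> W \<epsilon> \<eta>"
  obtain g h where g: "has_trace \<Omega> (Pair 0) (A \<epsilon>) u g" "has_trace \<Omega> (Pair 1) (A \<epsilon>) u h"
    using traces[OF \<epsilon> subsetD[OF W_H1 u]] by blast
  have ae: "AE y in leb (A \<epsilon>). c * g y = exp (- \<i> * of_real \<eta>) * (c * h y)"
    using W_elim[OF \<epsilon> u g] by eventually_elim simp
  show "(\<lambda>x. c * u x) \<in> W \<epsilon> \<eta>"
    by (rule W_intro[OF \<epsilon> traced.has_trace_scale[OF T0 g(1)] traced.has_trace_scale[OF T1 g(2)] ae])
qed

text \<open>Since \<open>u n\<close> has no mismatch between its traces, the mismatch
  \<open>d\<close> of \<open>l\<close> is bounded by the distance from \<open>u n\<close> to
  \<open>l\<close>.\<close>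

lemma W_closed:
  assumes \<epsilon>: "small \<epsilon>" and u: "\<And>n::nat. u n \<in> W \<epsilon> \<eta>" and l: "l \<in> H1 \<Omega>"
    and lim: "(\<lambda>n. H1_norm_sq \<Omega> (\<lambda>x. u n x - l x)) \<longlonglongrightarrow> 0"
  shows "l \<in> W \<epsilon> \<eta>"
proof -
  define e where "e = exp (- \<i> * complex_of_real \<eta>)"
  have e1: "cmod e = 1" by (simp add: e_def)
  interpret t0: traced \<Omega> "Pair 0" "A \<epsilon>" "(1 + m\<^sup>2) * \<epsilon> * w0.K\<^sub>w" by (rule traced0[OF \<epsilon>])
  interpret t1: traced \<Omega> "Pair 1" "A \<epsilon>" "(1 + m\<^sup>2) * \<epsilon> * w1.K\<^sub>w" by (rule traced1[OF \<epsilon>])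
  define C where "C = 2 * ((1 + m\<^sup>2) * \<epsilon> * w0.K\<^sub>w) + 2 * ((1 + m\<^sup>2) * \<epsilon> * w1.K\<^sub>w)"
  define d where "d y = t0.tr l y - e * t1.tr l y" for y
  have uH: "u n \<in> H1 \<Omega>" for n using subsetD[OF W_H1 u] .
  have dL: "d \<in> L2 (A \<epsilon>)" unfolding d_def[abs_def] by (intro L2_diff L2_scale t0.tr_L2 t1.tr_L2 l)
  have "L2_norm_sq (A \<epsilon>) d \<le> C * H1_norm_sq \<Omega> (\<lambda>x. u n x - l x)" for n
  proof -
    note D0 = t0.has_trace_diff[OF t0.has_trace_tr[OF uH[of n]] t0.has_trace_tr[OF l]]
    note D1 = t1.has_trace_diff[OF t1.has_trace_tr[OF uH[of n]] t1.has_trace_tr[OF l]]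
    let ?d0 = "\<lambda>y. t0.tr (u n) y - t0.tr l y" and ?d1 = "\<lambda>y. t1.tr (u n) y - t1.tr l y"
    have L: "?d0 \<in> L2 (A \<epsilon>)" "(\<lambda>y. e * ?d1 y) \<in> L2 (A \<epsilon>)"
      using t0.has_traceD(2)[OF D0] L2_scale[OF t1.has_traceD(2)[OF D1]] by auto
    have "AE y in leb (A \<epsilon>). t0.tr (u n) y = e * t1.tr (u n) y"
      unfolding e_def by (rule W_elim[OF \<epsilon> u t0.has_trace_tr[OF uH] t1.has_trace_tr[OF uH]])
    then have "AE y in leb (A \<epsilon>). d y = e * ?d1 y - ?d0 y"
      by eventually_elim (simp add: d_def algebra_simps)
    then have "L2_norm_sq (A \<epsilon>) d = L2_norm_sq (A \<epsilon>) (\<lambda>y. e * ?d1 y - ?d0 y)"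
      by (rule L2_norm_sq_cong[OF _ dL L2_diff[OF L(2,1)]])
    also have "\<dots> \<le> 2 * L2_norm_sq (A \<epsilon>) (\<lambda>y. e * ?d1 y) + 2 * L2_norm_sq (A \<epsilon>) ?d0"
      using t0.S.Re_diff_le[OF L(2,1)] unfolding Re_L2_inner_self fun_diff_def .
    also have "L2_norm_sq (A \<epsilon>) (\<lambda>y. e * ?d1 y) = L2_norm_sq (A \<epsilon>) ?d1" by (simp only: L2_norm_sq_scale e1) simp
    finally have "L2_norm_sq (A \<epsilon>) d \<le> 2 * L2_norm_sq (A \<epsilon>) ?d1 + 2 * L2_norm_sq (A \<epsilon>) ?d0" .
    moreover have "C * h = 2 * ((1 + m\<^sup>2) * \<epsilon> * w0.K\<^sub>w * h) + 2 * ((1 + m\<^sup>2) * \<epsilon> * w1.K\<^sub>w * h)" for h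
      by (simp add: C_def algebra_simps)
    ultimately show ?thesis using t0.has_trace_bound[OF D0] t1.has_trace_bound[OF D1] by (simp only:)
  qed
  moreover have "(\<lambda>n. C * H1_norm_sq \<Omega> (\<lambda>x. u n x - l x)) \<longlonglongrightarrow> 0" by (rule tendsto_mult_right_zero[OF lim])
  ultimately have "L2_norm_sq (A \<epsilon>) d \<le> 0" by (intro LIMSEQ_le_const) auto
  then have "L2_norm_sq (A \<epsilon>) d = 0" using L2_norm_sq_nonneg[of "A \<epsilon>" d] by linarith
  then have "AE y in leb (A \<epsilon>). d y = 0" using L2_norm_sq_0[OF dL] by blast
  then have "AE y in leb (A \<epsilon>). t0.tr l y = e * t1.tr l y" by eventually_elim (simp add: d_def)
  then show ?thesis unfolding e_def by (rule W_intro[OF \<epsilon> t0.has_trace_tr[OF l] t1.has_trace_tr[OF l]])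
qed

lemma below: "\<lbrakk>small \<epsilon>; y \<in> A \<epsilon>\<rbrakk> \<Longrightarrow> snd y \<le> snd P / 2"
proof -
  assume \<epsilon>: "small \<epsilon>" and y: "y \<in> A \<epsilon>"
  have "norm (y - P) \<le> w0.r1" using subsetD[OF A_subset_r1[OF \<epsilon>] y] by (simp add: dist_norm norm_minus_commute)
  moreover have "\<bar>snd y - snd P\<bar> \<le> norm (y - P)"
  proof -
    have "y - P = (fst y - fst P, snd y - snd P)" by (simp add: prod_eq_iff)
    then show ?thesis using norm_snd_le[of "snd y - snd P" "fst y - fst P"] by (simp only: real_norm_def)
  qed
  ultimately show ?thesis using r1_le R by linarith
qed

lemma W_monomial: "small \<epsilon> \<Longrightarrow> surface_monomial i \<in> W \<epsilon> \<eta>"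
proof -
  assume \<epsilon>: "small \<epsilon>"
  have "surface_monomial i (j, y) = 0" if "y \<in> A \<epsilon>" for j y
    by (rule surface_monomial_below) (use below[OF \<epsilon> that] in simp)
  then have ae: "AE y in leb (A \<epsilon>). surface_monomial i (0, y) = exp (- \<i> * of_real \<eta>) * surface_monomial i (1, y)"
    by (intro AE_I2) (simp add: space_restrict_space)
  show ?thesis
    by (rule W_intro[OF \<epsilon> traced.has_trace_C1[OF traced0[OF \<epsilon>] C1_surface_monomial]
          traced.has_trace_C1[OF traced1[OF \<epsilon>] C1_surface_monomial] ae])
qed

lemma spectral_pair_W: "small \<epsilon> \<Longrightarrow> spectral_pair cscale (W \<epsilon> \<eta>) (grad_inner \<Omega>) (surface_inner B)"
  by (rule spectral_pair_closed[OF W_subspace W_H1 W_closed W_monomial])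

end

section \<open>Changing the quasi-momentum by a phase factor\<close>

section \<open>Continuity of the band functions\<close>

text \<open>The phase factor raises the quasi-momentum by \<open>s\<close>, as the two walls are at
  distance 1. Having modulus one, it leaves the surface norm unchanged.\<close>

definition gauge :: "real \<Rightarrow> (point \<Rightarrow> complex) \<Rightarrow> point \<Rightarrow> complex" where
  "gauge s u = (\<lambda>x. cis (s * fst x) * u x)"

lemma
  fixes s :: real
  shows C1_cis: "Ck 1 (\<lambda>x::point. cis (s * fst x))"
    and cmod_pd_cis: "cmod (pd (\<lambda>x::point. cis (s * fst x)) e x) = \<bar>s * (e \<bullet> (1, 0, 0))\<bar>"
proof -
  define \<phi> where "\<phi> x = s * (x \<bullet> (1, 0, 0))" for x :: point
  have \<phi>: "Ck 1 \<phi>" and pd\<phi>: "pd \<phi> e x = s * (e \<bullet> (1, 0, 0))" for e x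
    unfolding \<phi>_def[abs_def] by (intro C1_mult C1_const C1_inner)
      (simp add: pd_mult[OF C1_const C1_inner] pd_const pd_inner)
  have cos: "Ck 1 (\<lambda>x. cos (\<phi> x))" "pd (\<lambda>x. cos (\<phi> x)) e x = - sin (\<phi> x) * pd \<phi> e x" for e x
    by (rule C1_compose[where g=cos and g'="\<lambda>t. - sin t", OF DERIV_cos _ \<phi>] pd_compose[where g=cos and g'="\<lambda>t. - sin t", OF DERIV_cos _ \<phi>],
        intro continuous_intros)+
  have sin: "Ck 1 (\<lambda>x. sin (\<phi> x))" "pd (\<lambda>x. sin (\<phi> x)) e x = cos (\<phi> x) * pd \<phi> e x" for e x
    by (rule C1_compose[where g=sin and g'=cos, OF DERIV_sin _ \<phi>] pd_compose[where g=sin and g'=cos, OF DERIV_sin _ \<phi>],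
        intro continuous_intros)+
  have eq: "(\<lambda>x::point. cis (s * fst x)) = (\<lambda>x. of_real (cos (\<phi> x)) + \<i> * of_real (sin (\<phi> x)))"
    by (rule ext) (simp add: \<phi>_def inner_prod_def complex_eq_iff)
  note C = C1_of_real[OF cos(1)] C1_mult[OF C1_const C1_of_real[OF sin(1)], of \<i>]
  show "Ck 1 (\<lambda>x::point. cis (s * fst x))" unfolding eq by (intro C1_add C)
  have "pd (\<lambda>x. of_real (cos (\<phi> x)) + \<i> * of_real (sin (\<phi> x))) e x = of_real (pd \<phi> e x) * (\<i> * cis (\<phi> x))"
    unfolding pd_add[OF C] pd_mult[OF C1_const C1_of_real[OF sin(1)]] pd_const pd_of_real[OF cos(1)] pd_of_real[OF sin(1)] cos(2) sin(2)
    by (simp add: complex_eq_iff)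
  then show "cmod (pd (\<lambda>x::point. cis (s * fst x)) e x) = \<bar>s * (e \<bullet> (1, 0, 0))\<bar>"
    unfolding eq pd\<phi> by (simp only: norm_mult norm_of_real norm_cis norm_ii mult_1_right)
qed

context channel_walls
begin

lemma gauge_W:
  assumes \<epsilon>: "small \<epsilon>" and u: "u \<in> W \<epsilon> \<eta>"
  shows "gauge s u \<in> W \<epsilon> (\<eta> + s)"
proof -
  obtain g h where g: "has_trace \<Omega> (Pair 0) (A \<epsilon>) u g" "has_trace \<Omega> (Pair 1) (A \<epsilon>) u h"
    using traces[OF \<epsilon> subsetD[OF W_H1 u]] by blast
  note t = traced.has_trace_mult[OF traced0[OF \<epsilon>] g(1) C1_cis[of s]] traced.has_trace_mult[OF traced1[OF \<epsilon>] g(2) C1_cis[of s]]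
  have "exp (- \<i> * complex_of_real (\<eta> + s)) * cis s = exp (- \<i> * complex_of_real \<eta>)"
    unfolding cis_conv_exp exp_add[symmetric] by (simp add: algebra_simps)
  then have "AE y in leb (A \<epsilon>). cis (s * fst (0::real, y)) * g y = exp (- \<i> * of_real (\<eta> + s)) * (cis (s * fst (1::real, y)) * h y)"
    using W_elim[OF \<epsilon> u g] by (simp add: mult.assoc[symmetric])
  then show ?thesis unfolding gauge_def by (rule W_intro[OF \<epsilon> t])
qed

lemma gauge_surface:
  assumes u: "u \<in> H1 \<Omega>"
  shows "Re (surface_inner B (gauge s u) (gauge s u)) = Re (surface_inner B u u)"
proof -
  note T = \<gamma>.has_trace_mult[OF \<gamma>.has_trace_tr[OF u] C1_cis[of s]]
  show ?thesis
    unfolding gauge_def surface_inner_def \<gamma>.tr_inner_eq[OF T T] Re_L2_inner_self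
    by (simp add: L2_norm_sq_def norm_mult)
qed

text \<open>The phase factor has a gradient of length \<open>|s|\<close>, so the energy norm grows
  by at most \<open>|s|\<close> times the L2-norm, which the energy norm controls.\<close>

lemma gauge_bound: "\<exists>C\<ge>0. \<forall>s. \<forall>u\<in>H1 \<Omega>. Re (Q.q (gauge s u) (gauge s u)) \<le> (1 + \<bar>s\<bar> * C)\<^sup>2 * Re (Q.q u u)"
proof -
  obtain c where c: "c > 0" "\<And>u. u \<in> H1 \<Omega> \<Longrightarrow> H1_norm_sq \<Omega> u \<le> c * Re (Q.q u u)"
    "\<And>u. u \<in> H1 \<Omega> \<Longrightarrow> Re (Q.q u u) \<le> c * H1_norm_sq \<Omega> u" using norm_equiv by blast
  have "Re (Q.q (gauge s u) (gauge s u)) \<le> (1 + \<bar>s\<bar> * sqrt c)\<^sup>2 * Re (Q.q u u)" if u: "u \<in> H1 \<Omega>" for s u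
  proof -
    define \<alpha> where "\<alpha> = sqrt (grad_norm_sq \<Omega> u)"
    define \<beta> where "\<beta> = Re (surface_inner B u u)"
    define t where "t = sqrt (Re (Q.q u u))"
    have \<beta>: "\<beta> \<ge> 0" and \<alpha>0: "\<alpha> \<ge> 0" and t0: "t \<ge> 0"
      unfolding \<beta>_def \<alpha>_def t_def using Q.b.nonneg[OF u] grad_norm_sq_nonneg Q.q.nonneg[OF u] by auto
    have \<alpha>2: "\<alpha>\<^sup>2 = grad_norm_sq \<Omega> u" unfolding \<alpha>_def by (rule real_sqrt_pow2[OF grad_norm_sq_nonneg])
    have t2: "t\<^sup>2 = \<alpha>\<^sup>2 + \<beta>" unfolding t_def \<alpha>2 \<beta>_def using Q.q.nonneg[OF u] by (simp add: Re_grad_inner)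
    have \<alpha>t: "\<alpha> \<le> t" by (rule power2_le_imp_le[OF _ t0]) (simp only: t2 le_add_same_cancel1 \<beta>)
    have uL: "u \<in> L2 \<Omega>" by (rule H1_L2[OF u])
    have "(\<Sum>e\<in>Basis. L2_norm_sq \<Omega> (\<lambda>x. pd (\<lambda>x. cis (s * fst x)) e x * u x)) = (\<Sum>e\<in>(Basis::point set). (s * (e \<bullet> (1, 0, 0)))\<^sup>2 * L2_norm_sq \<Omega> u)"
    proof (rule sum.cong[OF refl])
      fix e :: point
      show "L2_norm_sq \<Omega> (\<lambda>x. pd (\<lambda>x. cis (s * fst x)) e x * u x) = (s * (e \<bullet> (1, 0, 0)))\<^sup>2 * L2_norm_sq \<Omega> u"
        unfolding L2_norm_sq_def norm_mult cmod_pd_cis power_mult_distrib[of "\<bar>_\<bar>"] power2_abs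
        by (rule integral_mult_right_zero)
    qed
    also have "\<dots> = s\<^sup>2 * L2_norm_sq \<Omega> u" by (simp add: Basis_point)
    also have "\<dots> \<le> s\<^sup>2 * (c * t\<^sup>2)"
    proof (rule mult_left_mono)
      have "L2_norm_sq \<Omega> u \<le> H1_norm_sq \<Omega> u" by (simp add: H1_norm_sq_def grad_norm_sq_nonneg)
      also have "\<dots> \<le> c * t\<^sup>2" using c(2)[OF u] unfolding t_def real_sqrt_pow2[OF Q.q.nonneg[OF u]] .
      finally show "L2_norm_sq \<Omega> u \<le> c * t\<^sup>2" .
    qed simp
    finally have "sqrt (\<Sum>e\<in>Basis. L2_norm_sq \<Omega> (\<lambda>x. pd (\<lambda>x. cis (s * fst x)) e x * u x)) \<le> sqrt (s\<^sup>2 * (c * t\<^sup>2))"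
      by (rule real_sqrt_le_mono)
    also have "\<dots> = \<bar>s\<bar> * sqrt c * t" using t0 by (simp add: real_sqrt_mult)
    finally have "sqrt (grad_norm_sq \<Omega> (gauge s u)) \<le> \<alpha> + \<bar>s\<bar> * sqrt c * t"
      unfolding gauge_def \<alpha>_def using grad_mult_le[OF u C1_cis[of s]] by (simp add: norm_cis)
    then have "(sqrt (grad_norm_sq \<Omega> (gauge s u)))\<^sup>2 \<le> (\<alpha> + \<bar>s\<bar> * sqrt c * t)\<^sup>2"
      by (intro power_mono real_sqrt_ge_zero grad_norm_sq_nonneg)
    then have "Re (Q.q (gauge s u) (gauge s u)) \<le> (\<alpha> + \<bar>s\<bar> * sqrt c * t)\<^sup>2 + \<beta>"
      unfolding real_sqrt_pow2[OF grad_norm_sq_nonneg] by (simp add: Re_grad_inner gauge_surface[OF u] \<beta>_def)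
    also have "\<dots> = t\<^sup>2 + 2 * \<alpha> * (\<bar>s\<bar> * sqrt c * t) + (\<bar>s\<bar> * sqrt c * t)\<^sup>2" unfolding t2 power2_sum by simp
    also have "\<dots> \<le> t\<^sup>2 + 2 * t * (\<bar>s\<bar> * sqrt c * t) + (\<bar>s\<bar> * sqrt c * t)\<^sup>2"
      using \<alpha>t t0 c(1) by (intro add_mono mult_right_mono order_refl) auto
    also have "\<dots> = (1 + \<bar>s\<bar> * sqrt c)\<^sup>2 * t\<^sup>2" by (simp add: power2_eq_square algebra_simps)
    finally show ?thesis unfolding t_def real_sqrt_pow2[OF Q.q.nonneg[OF u]] .
  qed
  then show ?thesis using c(1) by (intro exI[of _ "sqrt c"]) auto
qed

definition ev :: "real \<Rightarrow> nat \<Rightarrow> real \<Rightarrow> real" where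
  "ev \<epsilon> k \<eta> = kth_eigenvalue B (W \<epsilon> \<eta>) k"

lemma ev_sequence:
  assumes \<epsilon>: "small \<epsilon>"
  shows "\<exists>L U. form_pair.eigen_sequence cscale (W \<epsilon> \<eta>) (grad_inner \<Omega>) (surface_inner B) L U \<and> (\<forall>k\<ge>1. ev \<epsilon> k \<eta> = L k)"
proof -
  note sp = spectral_pair_W[OF \<epsilon>, of \<eta>]
  obtain L U where "form_pair.eigen_sequence cscale (W \<epsilon> \<eta>) (grad_inner \<Omega>) (surface_inner B) L U"
    using spectral_pair.eigen_sequence_exists[OF sp] by blast
  then show ?thesis using kth_eigenvalue_eq[OF sp W_H1] unfolding ev_def by blast
qed

text \<open>The gauged first \<open>k\<close> eigenvectors are trial vectors. The eigenvalues enter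
  increased by 1 because the bound is for the sum of the two forms, while the surface norm is
  invariant.\<close>

lemma ev_gauge:
  assumes \<epsilon>: "small \<epsilon>" and k: "k \<ge> 1"
    and C: "\<And>s u. u \<in> H1 \<Omega> \<Longrightarrow> Re (Q.q (gauge s u) (gauge s u)) \<le> (1 + \<bar>s\<bar> * C)\<^sup>2 * Re (Q.q u u)"
  shows "ev \<epsilon> k (\<eta> + s) + 1 \<le> (1 + \<bar>s\<bar> * C)\<^sup>2 * (ev \<epsilon> k \<eta> + 1)"
proof -
  obtain L U where LU: "form_pair.eigen_sequence cscale (W \<epsilon> \<eta>) (grad_inner \<Omega>) (surface_inner B) L U" "ev \<epsilon> k \<eta> = L k"
    using ev_sequence[OF \<epsilon>] k by blast
  obtain L' U' where LU': "form_pair.eigen_sequence cscale (W \<epsilon> (\<eta> + s)) (grad_inner \<Omega>) (surface_inner B) L' U'" "ev \<epsilon> k (\<eta> + s) = L' k"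
    using ev_sequence[OF \<epsilon>] k by blast
  interpret S: spectral_pair cscale "W \<epsilon> \<eta>" "grad_inner \<Omega>" "surface_inner B" by (rule spectral_pair_W[OF \<epsilon>])
  interpret S': spectral_pair cscale "W \<epsilon> (\<eta> + s)" "grad_inner \<Omega>" "surface_inner B" by (rule spectral_pair_W[OF \<epsilon>])
  note D = S.eigen_sequenceD[OF LU(1)]
  define K where "K = (1 + \<bar>s\<bar> * C)\<^sup>2 * (L k + 1) - 1"
  have "L' k \<le> K"
  proof (rule S'.eigenvalue_le[OF LU'(1) k])
    show "gauge s (U i) \<in> W \<epsilon> (\<eta> + s)" if "i \<in> {1..k}" for i
      by (rule gauge_W[OF \<epsilon> D(2)]) (use that in simp)
    fix c :: "nat \<Rightarrow> complex" assume c: "\<exists>j\<in>{1..k}. c j \<noteq> 0"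
    let ?v = "\<Sum>i\<in>{1..k}. cscale (c i) (U i)"
    have x: "(\<Sum>i\<in>{1..k}. cscale (c i) (gauge s (U i))) = gauge s ?v"
      by (rule ext) (simp add: sum_fun_apply cscale_def gauge_def sum_distrib_left mult.left_commute)
    have vW: "?v \<in> W \<epsilon> \<eta>" by (rule S.a.sum_closed) (simp add: D(2))
    then have vH: "?v \<in> H1 \<Omega>" by (rule subsetD[OF W_H1])
    define b where "b = Re (surface_inner B ?v ?v)"
    have a: "Re (grad_inner \<Omega> ?v ?v) = (\<Sum>i\<in>{1..k}. L i * (cmod (c i))\<^sup>2)"
      by (rule S.eigen_sum_a) (simp_all add: D(1,3))
    have b: "b = (\<Sum>i\<in>{1..k}. (cmod (c i))\<^sup>2)"
      unfolding b_def by (rule S.orthonormal_sum(2)) (simp_all add: D(2,3))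
    have ab: "Re (grad_inner \<Omega> ?v ?v) \<le> L k * b"
      unfolding a b sum_distrib_left by (intro sum_mono mult_right_mono D(4)) auto
    have bp: "b > 0" unfolding b using c by (intro sum_cmod_sq_pos) auto
    have "Re (grad_inner \<Omega> (gauge s ?v) (gauge s ?v)) + b \<le> (1 + \<bar>s\<bar> * C)\<^sup>2 * (Re (grad_inner \<Omega> ?v ?v) + b)"
      using C[OF vH, of s] unfolding plus_complex.sel gauge_surface[OF vH] b_def .
    also have "\<dots> \<le> (1 + \<bar>s\<bar> * C)\<^sup>2 * (L k * b + b)" using ab by (intro mult_left_mono) auto
    finally have "Re (grad_inner \<Omega> (gauge s ?v) (gauge s ?v)) \<le> K * b" by (simp add: K_def algebra_simps)
    then show "let x = \<Sum>i\<in>{1..k}. cscale (c i) (gauge s (U i)) in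
        Re (grad_inner \<Omega> x x) \<le> K * Re (surface_inner B x x) \<and> 0 < Re (surface_inner B x x)"
      unfolding x Let_def gauge_surface[OF vH] b_def[symmetric] using bp by blast
  qed
  then show ?thesis unfolding LU(2) LU'(2) K_def by linarith
qed

text \<open>The gauge estimate is used from \<open>\<eta>\<close> to \<open>\<eta> + s\<close> and
  back; its factor tends to 1 with \<open>s\<close>.\<close>

lemma ev_continuous:
  assumes \<epsilon>: "small \<epsilon>" and k: "k \<ge> 1"
  shows "continuous_on S (ev \<epsilon> k)"
proof -
  obtain C where C0: "C \<ge> 0" and C: "\<And>s u. u \<in> H1 \<Omega> \<Longrightarrow> Re (Q.q (gauge s u) (gauge s u)) \<le> (1 + \<bar>s\<bar> * C)\<^sup>2 * Re (Q.q u u)"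
    using gauge_bound by blast
  note G = ev_gauge[OF \<epsilon> k C]
  have "isCont (ev \<epsilon> k) \<eta>" for \<eta>
    unfolding isCont_iff
  proof (rule tendsto_sandwich)
    have pos: "(1 + \<bar>s\<bar> * C)\<^sup>2 > 0" for s
    proof -
      have "1 + \<bar>s\<bar> * C > 0" using C0 by (simp add: add_pos_nonneg)
      then show ?thesis by simp
    qed
    show "\<forall>\<^sub>F s in at 0. (ev \<epsilon> k \<eta> + 1) / (1 + \<bar>s\<bar> * C)\<^sup>2 - 1 \<le> ev \<epsilon> k (\<eta> + s)"
    proof (intro always_eventually allI)
      fix s
      have "ev \<epsilon> k \<eta> + 1 \<le> (1 + \<bar>s\<bar> * C)\<^sup>2 * (ev \<epsilon> k (\<eta> + s) + 1)" using G[of "\<eta> + s" "- s"] by simp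
      then have "(ev \<epsilon> k \<eta> + 1) / (1 + \<bar>s\<bar> * C)\<^sup>2 \<le> ev \<epsilon> k (\<eta> + s) + 1" using pos[of s] by (simp add: pos_divide_le_eq mult.commute)
      then show "(ev \<epsilon> k \<eta> + 1) / (1 + \<bar>s\<bar> * C)\<^sup>2 - 1 \<le> ev \<epsilon> k (\<eta> + s)" by linarith
    qed
    show "\<forall>\<^sub>F s in at 0. ev \<epsilon> k (\<eta> + s) \<le> (1 + \<bar>s\<bar> * C)\<^sup>2 * (ev \<epsilon> k \<eta> + 1) - 1"
      by (intro always_eventually allI) (use G in \<open>simp add: le_diff_eq\<close>)
    have "((\<lambda>s. (ev \<epsilon> k \<eta> + 1) / (1 + \<bar>s\<bar> * C)\<^sup>2 - 1) \<longlongrightarrow> (ev \<epsilon> k \<eta> + 1) / (1 + \<bar>0\<bar> * C)\<^sup>2 - 1) (at 0)"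
      by (intro tendsto_intros) simp
    then show "((\<lambda>s. (ev \<epsilon> k \<eta> + 1) / (1 + \<bar>s\<bar> * C)\<^sup>2 - 1) \<longlongrightarrow> ev \<epsilon> k \<eta>) (at 0)" by simp
    have "((\<lambda>s. (1 + \<bar>s\<bar> * C)\<^sup>2 * (ev \<epsilon> k \<eta> + 1) - 1) \<longlongrightarrow> (1 + \<bar>0\<bar> * C)\<^sup>2 * (ev \<epsilon> k \<eta> + 1) - 1) (at 0)"
      by (intro tendsto_intros)
    then show "((\<lambda>s. (1 + \<bar>s\<bar> * C)\<^sup>2 * (ev \<epsilon> k \<eta> + 1) - 1) \<longlongrightarrow> ev \<epsilon> k \<eta>) (at 0)" by simp
  qed
  then show ?thesis by (intro continuous_at_imp_continuous_on ballI)
qed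

lemma ev_periodic: "ev \<epsilon> k (2 * pi) = ev \<epsilon> k 0"
proof -
  have "exp (- \<i> * complex_of_real (2 * pi)) = 1"
    using exp_two_pi_i by (simp add: exp_minus mult.commute mult.left_commute)
  then have "W \<epsilon> (2 * pi) = W \<epsilon> 0" unfolding H1_quasiperiodic_def by simp
  then show ?thesis by (simp add: ev_def)
qed

text \<open>Periodicity replaces the half-open range of quasi-momenta by a compact interval, whose
  continuous image is a compact interval.\<close>

lemma band_interval:
  assumes \<epsilon>: "small \<epsilon>" and k: "k \<ge> 1"
    and ne: "\<eta> \<in> {0..<2 * pi}" "\<eta>' \<in> {0..<2 * pi}" "ev \<epsilon> k \<eta> \<noteq> ev \<epsilon> k \<eta>'"
  shows "\<exists>a b. a < b \<and> spectral_band B P \<theta> \<epsilon> k = {a..b}"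
proof -
  have "spectral_band B P \<theta> \<epsilon> k = ev \<epsilon> k ` {0..<2 * pi}" by (simp add: spectral_band_def ev_def)
  also have "\<dots> = ev \<epsilon> k ` {0..2 * pi}"
  proof
    show "ev \<epsilon> k ` {0..2 * pi} \<subseteq> ev \<epsilon> k ` {0..<2 * pi}"
    proof
      fix z assume "z \<in> ev \<epsilon> k ` {0..2 * pi}"
      then obtain t where t: "t \<in> {0..2 * pi}" "z = ev \<epsilon> k t" by blast
      show "z \<in> ev \<epsilon> k ` {0..<2 * pi}"
        using t ev_periodic[of \<epsilon> k] by (cases "t = 2 * pi") (auto intro!: image_eqI[of _ _ 0] image_eqI[of _ _ t])
    qed
  qed auto
  finally have eq: "spectral_band B P \<theta> \<epsilon> k = ev \<epsilon> k ` {0..2 * pi}" .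
  obtain a b where ab: "ev \<epsilon> k ` {0..2 * pi} = {a..b}" "a \<le> b"
    using continuous_image_closed_interval[OF _ ev_continuous[OF \<epsilon> k], of 0 "2 * pi"] by auto
  have "ev \<epsilon> k \<eta> \<in> {a..b}" "ev \<epsilon> k \<eta>' \<in> {a..b}" unfolding ab(1)[symmetric] using ne by auto
  then have "a < b" using ne(3) by auto
  then show ?thesis using eq ab(1) by auto
qed

end

section \<open>Energy of bumps at the apertures; the spaces \<open>W\<close> exhaust H1\<close>

section \<open>Small cutoffs at the apertures\<close>

context flat_wall
begin

definition V3 :: real where "V3 = unit_ball_vol 3"

lemma V3: "V3 \<ge> 0"
  by (simp add: V3_def unit_ball_vol_nonneg)

lemma ball_integral:
  assumes "AE x in leb \<Omega>. h x \<le> M * indicator (cball p r) x" "M \<ge> 0" "r \<ge> 0"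
  shows "(\<integral>x. h x \<partial>leb \<Omega>) \<le> M * (V3 * r ^ 3)"
proof -
  interpret finite_measure "leb \<Omega>" by (rule finite_measure_leb[OF bounded_\<Omega> \<Omega>_borel])
  have "(\<integral>x. h x \<partial>leb \<Omega>) \<le> (\<integral>x. M * indicator (cball p r) x \<partial>leb \<Omega>)"
  proof (rule integral_mono_AE')
    show "integrable (leb \<Omega>) (\<lambda>x. M * indicator (cball p r) x)"
      by (rule integrable_const_bound[where B=M]) (use assms(2) in \<open>auto intro!: AE_I2 borel_leb simp: indicator_def\<close>)
  qed (use assms(1,2) in auto)
  also have "\<dots> = (\<integral>x. indicator \<Omega> x * (M * indicator (cball p r) x) \<partial>lborel)" unfolding integral_leb by simp
  also have "\<dots> \<le> (\<integral>x. M * indicator (cball p r) x \<partial>lborel)"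
  proof (rule integral_mono_AE')
    show "integrable lborel (\<lambda>x. M * indicator (cball p r) x)"
      using emeasure_lborel_cball_finite[of p r] by (intro integrable_mult_right integrable_real_indicator) auto
  qed (use assms(2) in \<open>auto simp: indicator_def\<close>)
  also have "\<dots> = M * measure lborel (cball p r)" by simp
  also have "measure lborel (cball p r) = V3 * r ^ 3"
    using content_cball[OF assms(3), of p] by (simp add: V3_def power3_eq_cube)
  finally show ?thesis .
qed

lemma cut_far_grad:
  assumes "r > 0" "L > 0" "norm (x - q) > r" shows "pd (cut q r L) e x = 0"
proof (rule pd_eq_0_outside)
  show "open {x. norm (x - q) > r}" by (intro open_Collect_less continuous_intros)
  show "x \<in> {x. norm (x - q) > r}" using assms(3) by simp
  show "cut q r L y = 0" if "y \<in> {x. norm (x - q) > r}" for y by (rule cut_eq_0[OF assms(1,2)]) (use that in simp)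
qed

text \<open>A gradient of order \<open>1 / r\<close> on a ball of volume of order \<open>r^3\<close>
  has energy of order \<open>r\<close>. The constant 96 is 16 times 6: since
  \<open>exp (- 1) \<ge> 1/3\<close>, the denominator in \<open>cut_grad\<close> is at least
  \<open>r^2 / 6\<close>.\<close>

lemma bump_energy:
  assumes r: "r > 0" and F: "F \<in> L2 \<Omega>" and ae: "AE x in leb \<Omega>. norm (x - p) \<le> r \<longrightarrow> cmod (F x) \<le> \<tau>" and \<tau>: "\<tau> \<ge> 0"
  shows "(\<Sum>e\<in>Basis. L2_norm_sq \<Omega> (\<lambda>x. of_real (pd (cut p r 1) e x) * F x)) \<le> 96 * V3 * \<tau>\<^sup>2 * r"
proof -
  note C1 = C1_cut[OF r zero_less_one, of p]
  have L2e: "(\<lambda>x. of_real (pd (cut p r 1) e x) * F x) \<in> L2 \<Omega>" if "e \<in> Basis" for e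
    by (rule L2_mult_continuous[OF F continuous_on_of_real[OF C1_D(2)[OF C1 that]] bounded_\<Omega>])
  have "(\<Sum>e\<in>Basis. L2_norm_sq \<Omega> (\<lambda>x. of_real (pd (cut p r 1) e x) * F x))
      = (\<integral>x. (\<Sum>e\<in>Basis. (cmod (of_real (pd (cut p r 1) e x) * F x))\<^sup>2) \<partial>leb \<Omega>)"
    unfolding L2_norm_sq_def by (rule Bochner_Integration.integral_sum[symmetric]) (rule L2_D(2)[OF L2e])
  also have "\<dots> \<le> 96 / r\<^sup>2 * \<tau>\<^sup>2 * (V3 * r ^ 3)"
  proof (rule ball_integral)
    show "AE x in leb \<Omega>. (\<Sum>e\<in>Basis. (cmod (of_real (pd (cut p r 1) e x) * F x))\<^sup>2) \<le> 96 / r\<^sup>2 * \<tau>\<^sup>2 * indicator (cball p r) x"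
      using ae
    proof eventually_elim
      fix x assume x: "norm (x - p) \<le> r \<longrightarrow> cmod (F x) \<le> \<tau>"
      show "(\<Sum>e\<in>Basis. (cmod (of_real (pd (cut p r 1) e x) * F x))\<^sup>2) \<le> 96 / r\<^sup>2 * \<tau>\<^sup>2 * indicator (cball p r) x"
      proof (cases "norm (x - p) \<le> r")
        case True
        have "(\<Sum>e\<in>Basis. (pd (cut p r 1) e x)\<^sup>2) \<le> (4 / 1)\<^sup>2 / ((norm (x - p))\<^sup>2 + r\<^sup>2 * exp (- 1) / 2)"
          by (rule cut_grad[OF r]) simp
        also have "\<dots> \<le> (4 / 1)\<^sup>2 / (r\<^sup>2 / 6)"
        proof (rule divide_left_mono)
          have "1 / 3 \<le> exp (- 1 :: real)" using exp_le by (simp add: exp_minus field_simps)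
          then have "r\<^sup>2 / 6 \<le> r\<^sup>2 * exp (- 1) / 2" using mult_left_mono[of "1/3" "exp (- 1)" "r\<^sup>2"] by simp
          then show "r\<^sup>2 / 6 \<le> (norm (x - p))\<^sup>2 + r\<^sup>2 * exp (- 1) / 2" using zero_le_power2[of "norm (x - p)"] by linarith
          then show "0 < ((norm (x - p))\<^sup>2 + r\<^sup>2 * exp (- 1) / 2) * (r\<^sup>2 / 6)"
            using r by (intro mult_pos_pos) (auto simp: add_nonneg_pos)
        qed simp
        finally have g: "(\<Sum>e\<in>Basis. (pd (cut p r 1) e x)\<^sup>2) \<le> 96 / r\<^sup>2" by simp
        have "(cmod (F x))\<^sup>2 \<le> \<tau>\<^sup>2" using x True by (intro power_mono) auto
        then have "(\<Sum>e\<in>Basis. (pd (cut p r 1) e x)\<^sup>2) * (cmod (F x))\<^sup>2 \<le> 96 / r\<^sup>2 * \<tau>\<^sup>2"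
          using g by (intro mult_mono) auto
        then show ?thesis using True
          by (simp add: norm_mult power_mult_distrib sum_distrib_right dist_norm norm_minus_commute)
      next
        case False
        then show ?thesis by (simp add: cut_far_grad[OF r] indicator_def)
      qed
    qed
  qed (use r in simp_all)
  also have "\<dots> = 96 * V3 * \<tau>\<^sup>2 * r" using r by (simp add: power2_eq_square power3_eq_cube)
  finally show ?thesis .
qed

text \<open>Zero capacity of points without a logarithm: in three dimensions all terms are of order
  \<open>r\<close> or smaller when \<open>f\<close> and its gradient are bounded on the
  cell.\<close>

lemma bump_mass:
  fixes f :: "point \<Rightarrow> complex"
  assumes f: "Ck 1 f" and r: "\<And>n::nat. r n > 0" "r \<longlonglongrightarrow> 0"
  shows "(\<lambda>n. H1_norm_sq \<Omega> (\<lambda>x. of_real (cut p (r n) 1 x) * f x)) \<longlonglongrightarrow> 0"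
proof -
  have bdd: "\<exists>M\<ge>0. \<forall>x\<in>\<Omega>. cmod (h x) \<le> M" if "continuous_on UNIV h" for h :: "point \<Rightarrow> complex"
    using continuous_bounded_on[OF that bounded_\<Omega>] by blast
  obtain M where M: "M \<ge> 0" "\<forall>x\<in>\<Omega>. cmod (f x) \<le> M" using bdd[OF C1_continuous[OF f]] by blast
  have "\<forall>e. \<exists>K. e \<in> Basis \<longrightarrow> K \<ge> 0 \<and> (\<forall>x\<in>\<Omega>. cmod (pd f e x) \<le> K)" using bdd[OF C1_D(2)[OF f]] by blast
  from choice[OF this] obtain K where K: "\<forall>e. e \<in> Basis \<longrightarrow> K e \<ge> 0 \<and> (\<forall>x\<in>\<Omega>. cmod (pd f e x) \<le> K e)" ..
  have mass: "L2_norm_sq \<Omega> (\<lambda>x. of_real (cut p (r n) 1 x) * h x) \<le> N\<^sup>2 * (V3 * r n ^ 3)"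
    if N: "N \<ge> 0" "\<forall>x\<in>\<Omega>. cmod (h x) \<le> N" for h :: "point \<Rightarrow> complex" and N n
    unfolding L2_norm_sq_def
  proof (rule ball_integral, rule AE_I2)
    fix x assume "x \<in> space (leb \<Omega>)"
    then have h: "cmod (h x) \<le> N" using N by (simp add: space_restrict_space)
    show "(cmod (of_real (cut p (r n) 1 x) * h x))\<^sup>2 \<le> N\<^sup>2 * indicator (cball p (r n)) x"
    proof (cases "norm (x - p) \<le> r n")
      case True
      have "cmod (of_real (cut p (r n) 1 x) * h x) \<le> 1 * N"
        unfolding norm_mult using cut_bounds[of p "r n" 1 x] h by (intro mult_mono) auto
      then have "(cmod (of_real (cut p (r n) 1 x) * h x))\<^sup>2 \<le> N\<^sup>2" by (intro power_mono) auto
      then show ?thesis using True by (simp add: dist_norm norm_minus_commute)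
    next
      case False
      then show ?thesis using cut_eq_0[OF r(1) zero_less_one, of n x p] by simp
    qed
  qed (use r(1) less_imp_le in auto)
  define Z where "Z n = M\<^sup>2 * (V3 * r n ^ 3) + (\<Sum>e\<in>Basis. 2 * ((K e)\<^sup>2 * (V3 * r n ^ 3))) + 2 * (96 * V3 * M\<^sup>2 * r n)" for n
  have "H1_norm_sq \<Omega> (\<lambda>x. of_real (cut p (r n) 1 x) * f x) \<le> Z n" for n
  proof -
    note C1 = C1_cut[OF r(1)[of n] zero_less_one, of p]
    note C1c = C1_of_real[OF C1]
    have fL: "f \<in> L2 \<Omega>" by (rule cont_L2[OF C1_continuous[OF f]])
    have le: "L2_norm_sq \<Omega> (\<lambda>x. of_real (cut p (r n) 1 x) * pd f e x + pd (\<lambda>x. of_real (cut p (r n) 1 x)) e x * f x)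
       \<le> 2 * ((K e)\<^sup>2 * (V3 * r n ^ 3)) + 2 * L2_norm_sq \<Omega> (\<lambda>x. of_real (pd (cut p (r n) 1) e x) * f x)" if e: "e \<in> Basis" for e
    proof -
      have 1: "(\<lambda>x. of_real (cut p (r n) 1 x) * pd f e x) \<in> L2 \<Omega>"
        by (rule L2_mult_continuous[OF cont_L2[OF C1_D(2)[OF f e]] C1_continuous[OF C1c] bounded_\<Omega>])
      have 2: "(\<lambda>x. of_real (pd (cut p (r n) 1) e x) * f x) \<in> L2 \<Omega>"
        by (rule L2_mult_continuous[OF fL continuous_on_of_real[OF C1_D(2)[OF C1 e]] bounded_\<Omega>])
      have "L2_norm_sq \<Omega> (\<lambda>x. of_real (cut p (r n) 1 x) * pd f e x + of_real (pd (cut p (r n) 1) e x) * f x)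
         \<le> 2 * L2_norm_sq \<Omega> (\<lambda>x. of_real (cut p (r n) 1 x) * pd f e x) + 2 * L2_norm_sq \<Omega> (\<lambda>x. of_real (pd (cut p (r n) 1) e x) * f x)"
        using L2.Re_add_le[OF 1 2] unfolding Re_L2_inner_self plus_fun_def .
      moreover have "L2_norm_sq \<Omega> (\<lambda>x. of_real (cut p (r n) 1 x) * pd f e x) \<le> (K e)\<^sup>2 * (V3 * r n ^ 3)"
        using mass[of "K e" "pd f e" n] K e by blast
      ultimately show ?thesis unfolding pd_of_real[OF C1] by linarith
    qed
    have "grad_norm_sq \<Omega> (\<lambda>x. of_real (cut p (r n) 1 x) * f x)
        \<le> (\<Sum>e\<in>Basis. 2 * ((K e)\<^sup>2 * (V3 * r n ^ 3)) + 2 * L2_norm_sq \<Omega> (\<lambda>x. of_real (pd (cut p (r n) 1) e x) * f x))"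
      unfolding grad_norm_sq_eq[OF has_wgrad_mult[OF C1_has_wgrad[OF f] C1c]] by (rule sum_mono[OF le])
    also have "\<dots> = (\<Sum>e\<in>Basis. 2 * ((K e)\<^sup>2 * (V3 * r n ^ 3))) + 2 * (\<Sum>e\<in>Basis. L2_norm_sq \<Omega> (\<lambda>x. of_real (pd (cut p (r n) 1) e x) * f x))"
      by (simp add: sum.distrib sum_distrib_left)
    also have "(\<Sum>e\<in>Basis. L2_norm_sq \<Omega> (\<lambda>x. of_real (pd (cut p (r n) 1) e x) * f x)) \<le> 96 * V3 * M\<^sup>2 * r n"
      by (rule bump_energy[OF r(1) fL]) (use M in \<open>auto intro!: AE_I2 simp: space_restrict_space\<close>)
    finally show ?thesis using mass[OF M, of n] unfolding H1_norm_sq_def Z_def by linarith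
  qed
  moreover have "Z \<longlonglongrightarrow> M\<^sup>2 * (V3 * 0 ^ 3) + (\<Sum>e\<in>(Basis :: point set). 2 * ((K e)\<^sup>2 * (V3 * 0 ^ 3))) + 2 * (96 * V3 * M\<^sup>2 * 0)"
    unfolding Z_def[abs_def] by (intro tendsto_intros r(2))
  ultimately show ?thesis
    by (rule_tac tendsto_sandwich[OF always_eventually always_eventually tendsto_const, where h=Z])
      (simp_all add: H1_norm_sq_nonneg)
qed

end

context periodic_channel
begin

lemma surface_null:
  assumes w: "has_trace \<Omega> surface_pt \<Gamma> w g" "\<And>y. y \<in> \<Gamma> \<Longrightarrow> g y = 0" and v: "v \<in> H1 \<Omega>"
  shows "surface_inner B w v = 0" "surface_inner B v w = 0"
proof -
  have "L2_inner \<Gamma> g (\<gamma>.tr v) = 0"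
    unfolding L2_inner_def by (rule integral_eq_zero_AE, rule AE_I2) (simp add: space_restrict_space w(2))
  then show "surface_inner B w v = 0"
    unfolding surface_inner_def \<gamma>.tr_inner_eq[OF w(1) \<gamma>.has_trace_tr[OF v]] .
  then show "surface_inner B v w = 0"
    using Q.b.hermitian[OF \<gamma>.has_traceD(1)[OF w(1)] v] by simp
qed

text \<open>
  Since \<open>U - a\<close> is weakly harmonic away from the free surface, testing with \<open>\<psi>\<^sup>2 (U - a)\<close> removes the
  gradient of \<open>U\<close> from the energy of \<open>\<psi> (U - a)\<close>.
\<close>

lemma harmonic_cutoff:
  assumes U: "U \<in> H1 \<Omega>" "\<And>V. V \<in> H1 \<Omega> \<Longrightarrow> grad_inner \<Omega> U V = of_real \<mu> * surface_inner B U V"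
    and \<psi>: "Ck 1 \<psi>" "\<And>y. \<psi> (surface_pt y) = 0"
  shows "grad_norm_sq \<Omega> (\<lambda>x. of_real (\<psi> x) * (U x - a)) = (\<Sum>e\<in>Basis. L2_norm_sq \<Omega> (\<lambda>x. of_real (pd \<psi> e x) * (U x - a)))"
proof -
  define F where "F x = U x - a" for x
  define G where "G = wgrad \<Omega> U"
  note C1c = C1_of_real[OF \<psi>(1)]
  have GU: "has_wgrad U G" unfolding G_def by (rule H1_has_wgrad[OF U(1)])
  have GF: "has_wgrad F G"
    using has_wgrad_diff[OF GU C1_has_wgrad[OF C1_const[of a]]] by (simp add: F_def[abs_def] pd_const)
  define X where "X e x = of_real (\<psi> x) * G e x + of_real (pd \<psi> e x) * F x" for e x
  define Y where "Y e x = of_real (pd \<psi> e x) * F x" for e x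
  have G1: "has_wgrad (\<lambda>x. of_real (\<psi> x) * F x) X"
    using has_wgrad_mult[OF GF C1c] by (simp add: X_def[abs_def] pd_of_real[OF \<psi>(1)])
  have G2: "has_wgrad (\<lambda>x. of_real (\<psi> x) * (of_real (\<psi> x) * F x)) (\<lambda>e x. of_real (\<psi> x) * X e x + of_real (pd \<psi> e x) * (of_real (\<psi> x) * F x))"
    using has_wgrad_mult[OF G1 C1c] by (simp add: pd_of_real[OF \<psi>(1)])
  have FL: "F \<in> L2 \<Omega>" and XL: "\<And>e. e \<in> Basis \<Longrightarrow> X e \<in> L2 \<Omega>" using GF G1 by (auto simp: has_wgrad_def)
  have YL: "Y e \<in> L2 \<Omega>" if "e \<in> Basis" for e
    unfolding Y_def[abs_def] by (rule L2_mult_continuous[OF FL continuous_on_of_real[OF C1_D(2)[OF \<psi>(1) that]] bounded_\<Omega>])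
  note H2 = has_wgrad_H1[OF G2]
  have "surface_inner B U (\<lambda>x. of_real (\<psi> x) * (of_real (\<psi> x) * F x)) = 0"
    by (rule surface_null(2)[OF \<gamma>.has_trace_mult[OF \<gamma>.has_trace_tr[OF has_wgrad_H1[OF G1]] C1c] _ U(1)]) (simp add: \<psi>(2))
  then have "0 = Re (grad_inner \<Omega> U (\<lambda>x. of_real (\<psi> x) * (of_real (\<psi> x) * F x)))" using U(2)[OF H2] by simp
  also have "\<dots> = (\<Sum>e\<in>Basis. Re (L2_inner \<Omega> (G e) (\<lambda>x. of_real (\<psi> x) * X e x + of_real (pd \<psi> e x) * (of_real (\<psi> x) * F x))))"
    by (simp add: grad_inner_eq[OF GU G2])
  also have "\<dots> = (\<Sum>e\<in>Basis. L2_norm_sq \<Omega> (X e) - L2_norm_sq \<Omega> (Y e))"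
  proof (rule sum.cong[OF refl])
    fix e :: point assume e: "e \<in> Basis"
    \<comment> \<open>With \<open>X = \<psi> G + Y\<close> and \<open>\<psi>\<close> real, the
      integrand is \<open>(X - Y) * cnj (X + Y)\<close>; the mixed terms are purely imaginary, which
      leaves a difference of squares.\<close>
    have "L2_inner \<Omega> (G e) (\<lambda>x. of_real (\<psi> x) * X e x + of_real (pd \<psi> e x) * (of_real (\<psi> x) * F x)) = L2_inner \<Omega> (X e - Y e) (X e + Y e)"
      unfolding L2_inner_def fun_diff_def plus_fun_def
      by (rule Bochner_Integration.integral_cong[OF refl]) (simp add: X_def Y_def algebra_simps)
    also have "\<dots> = L2_inner \<Omega> (X e) (X e) - L2_inner \<Omega> (Y e) (Y e) + (L2_inner \<Omega> (X e) (Y e) - cnj (L2_inner \<Omega> (X e) (Y e)))"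
      using XL[OF e] YL[OF e] by (simp add: L2.diff_left L2.add_right L2.hermitian[OF XL[OF e] YL[OF e]])
    finally show "Re (L2_inner \<Omega> (G e) (\<lambda>x. of_real (\<psi> x) * X e x + of_real (pd \<psi> e x) * (of_real (\<psi> x) * F x)))
        = L2_norm_sq \<Omega> (X e) - L2_norm_sq \<Omega> (Y e)" by (simp add: Re_L2_inner_self)
  qed
  also have "\<dots> = grad_norm_sq \<Omega> (\<lambda>x. of_real (\<psi> x) * F x) - (\<Sum>e\<in>Basis. L2_norm_sq \<Omega> (Y e))"
    unfolding grad_norm_sq_eq[OF G1] by (rule sum_subtractf)
  finally show ?thesis unfolding Y_def F_def by simp
qed

end

context channel_walls
begin

lemma A_near: "\<lbrakk>\<epsilon> > 0; y \<in> A \<epsilon>\<rbrakk> \<Longrightarrow> norm ((j :: real, y) - (j, P)) \<le> m * \<epsilon>"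
  using subsetD[OF A_subset, of \<epsilon> y] by (simp add: dist_norm norm_minus_commute norm_Pair)

lemma A_far: "norm ((0 :: real, y) - (1, P)) \<ge> 1" "norm ((1 :: real, y) - (0, P)) \<ge> 1"
  using norm_fst_le[of "0 - 1 :: real" "y - P"] norm_fst_le[of "1 - 0 :: real" "y - P"] by simp_all

lemma surface_far: "norm (surface_pt y - (j, P)) \<ge> R"
proof -
  have "surface_pt y - (j, P) = (fst y - j, snd y - fst P, - snd P)" by (simp add: surface_pt_def prod_eq_iff)
  moreover have "\<bar>- snd P\<bar> \<le> norm (snd y - fst P, - snd P)" using norm_snd_le[of "- snd P" "snd y - fst P"] by simp
  moreover have "norm (snd y - fst P, - snd P) \<le> norm (fst y - j, snd y - fst P, - snd P)" by (rule norm_snd_le)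
  ultimately show ?thesis using R by simp
qed

lemma small_r: "small \<epsilon> \<Longrightarrow> 0 < 3 * m * \<epsilon> \<and> 3 * m * \<epsilon> \<le> R \<and> 3 * m * \<epsilon> \<le> 1"
  using m(1) R r1_le by (auto simp: small_def)

lemma bump_values:
  assumes \<epsilon>: "small \<epsilon>" and y: "y \<in> A \<epsilon>"
  shows "cut (0 :: real, P) (3 * m * \<epsilon>) 1 (0, y) = 1" "cut (1 :: real, P) (3 * m * \<epsilon>) 1 (1, y) = 1"
    "cut (0 :: real, P) (3 * m * \<epsilon>) 1 (1, y) = 0" "cut (1 :: real, P) (3 * m * \<epsilon>) 1 (0, y) = 0"
proof -
  have r: "3 * m * \<epsilon> > 0" "3 * m * \<epsilon> \<le> 1" and \<epsilon>0: "\<epsilon> > 0" using small_r[OF \<epsilon>] \<epsilon> by (auto simp: small_def)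
  have le: "(norm ((j :: real, y) - (j, P)))\<^sup>2 \<le> (3 * m * \<epsilon>)\<^sup>2 * exp (- 1) / 2" for j
  proof -
    have "(norm ((j, y) - (j, P)))\<^sup>2 \<le> (m * \<epsilon>)\<^sup>2" using A_near[OF \<epsilon>0 y, of j] by (intro power_mono) auto
    also have "\<dots> \<le> (m * \<epsilon>)\<^sup>2 * (9 * exp (- 1) / 2)"
    proof -
      have "1 / 3 \<le> exp (- 1 :: real)" using exp_le by (simp add: exp_minus field_simps)
      then have "1 \<le> 9 * exp (- 1 :: real) / 2" by linarith
      then show ?thesis using mult_left_mono[of 1 "9 * exp (- 1) / 2" "(m * \<epsilon>)\<^sup>2"] by simp
    qed
    finally show ?thesis by (simp add: power_mult_distrib)
  qed
  show "cut (0 :: real, P) (3 * m * \<epsilon>) 1 (0, y) = 1" "cut (1 :: real, P) (3 * m * \<epsilon>) 1 (1, y) = 1"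
    by (rule cut_eq_1[OF r(1) zero_less_one le])+
  show "cut (0 :: real, P) (3 * m * \<epsilon>) 1 (1, y) = 0" "cut (1 :: real, P) (3 * m * \<epsilon>) 1 (0, y) = 0"
    by (rule cut_eq_0[OF r(1) zero_less_one order_trans[OF r(2) A_far(2)]],
        rule cut_eq_0[OF r(1) zero_less_one order_trans[OF r(2) A_far(1)]])
qed

lemma cut_surface: "\<lbrakk>0 < r; r \<le> R; 0 < L\<rbrakk> \<Longrightarrow> cut (j, P) r L (surface_pt y) = 0"
  by (rule cut_eq_0) (use surface_far[of y j] in auto)

text \<open>Approximate by a C1 function and remove it near both apertures with bumps of small
  energy; a function that vanishes on both apertures satisfies the condition for every
  quasi-momentum.\<close>

lemma W_approximable:
  assumes \<epsilon>: "\<And>n::nat. small (\<epsilon> n)" "\<epsilon> \<longlonglongrightarrow> 0" and u: "u \<in> H1 \<Omega>"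
  shows "\<exists>y. (\<forall>n. y n \<in> W (\<epsilon> n) \<eta>) \<and> (\<lambda>n. Re (Q.q (u - y n) (u - y n))) \<longlonglongrightarrow> 0"
proof -
  obtain c where c: "c > 0" "\<And>u. u \<in> H1 \<Omega> \<Longrightarrow> H1_norm_sq \<Omega> u \<le> c * Re (Q.q u u)"
    "\<And>u. u \<in> H1 \<Omega> \<Longrightarrow> Re (Q.q u u) \<le> c * H1_norm_sq \<Omega> u" using norm_equiv by blast
  have ev: "\<forall>\<^sub>F n in sequentially. \<exists>z\<in>W (\<epsilon> n) \<eta>. Re (Q.q (u - z) (u - z)) < d" if d: "d > 0" for d
  proof -
    obtain f :: "nat \<Rightarrow> point \<Rightarrow> complex" where f: "\<forall>n. Ck 1 (f n)" "(\<lambda>n. H1_norm_sq \<Omega> (\<lambda>x. f n x - u x)) \<longlonglongrightarrow> 0"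
      using C1_dense_H1[OF u] by blast
    have "\<forall>\<^sub>F n in sequentially. H1_norm_sq \<Omega> (\<lambda>x. f n x - u x) < d / (4 * c)"
      by (rule order_tendstoD(2)[OF f(2)]) (use c(1) d in simp)
    then obtain N where N: "H1_norm_sq \<Omega> (\<lambda>x. f N x - u x) < d / (4 * c)"
      unfolding eventually_sequentially by blast
    define F where "F = f N"
    have F: "Ck 1 F" using f(1) by (simp add: F_def)
    have FH: "F \<in> H1 \<Omega>" by (rule C1_H1[OF F])
    have "Re (Q.q (F - u) (F - u)) \<le> c * H1_norm_sq \<Omega> (F - u)" by (rule c(3)) (use FH u in blast)
    also have "\<dots> < c * (d / (4 * c))" using N c(1) by (intro mult_strict_left_mono) (auto simp: F_def fun_diff_def)
    finally have 1: "Re (Q.q (F - u) (F - u)) < d / 4" using c(1) by simp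
    define b0 where "b0 n x = complex_of_real (cut (0, P) (3 * m * \<epsilon> n) 1 x) * F x" for n x
    define b1 where "b1 n x = complex_of_real (cut (1, P) (3 * m * \<epsilon> n) 1 x) * F x" for n x
    have r: "3 * m * \<epsilon> n > 0" for n using small_r[OF \<epsilon>(1)] by blast
    have r0: "(\<lambda>n. 3 * m * \<epsilon> n) \<longlonglongrightarrow> 0" by (rule tendsto_mult_right_zero[OF \<epsilon>(2)])
    have C1b: "Ck 1 (b0 n)" "Ck 1 (b1 n)" for n unfolding b0_def[abs_def] b1_def[abs_def]
      by (intro C1_mult C1_of_real C1_cut F r zero_less_one)+
    have bH: "b0 n \<in> H1 \<Omega>" "b1 n \<in> H1 \<Omega>" for n using C1_H1[OF C1b(1)] C1_H1[OF C1b(2)] by auto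
    have "(\<lambda>n. c * (2 * H1_norm_sq \<Omega> (b0 n) + 2 * H1_norm_sq \<Omega> (b1 n))) \<longlonglongrightarrow> c * (2 * 0 + 2 * 0)"
      unfolding b0_def[abs_def] b1_def[abs_def]
      by (intro tendsto_mult tendsto_add tendsto_const w0.bump_mass[OF F r r0] w1.bump_mass[OF F r r0])
    then have "\<forall>\<^sub>F n in sequentially. c * (2 * H1_norm_sq \<Omega> (b0 n) + 2 * H1_norm_sq \<Omega> (b1 n)) < d / 4"
      by (rule order_tendstoD(2)) (use d in simp)
    then show ?thesis
    proof eventually_elim
      fix n assume n: "c * (2 * H1_norm_sq \<Omega> (b0 n) + 2 * H1_norm_sq \<Omega> (b1 n)) < d / 4"
      define z where "z = F - (b0 n + b1 n)"
      have zC: "Ck 1 z" unfolding z_def fun_diff_def plus_fun_def by (intro C1_diff C1_add F C1b)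
      have z0: "z (0, y) = 0" "z (1, y) = 0" if "y \<in> A (\<epsilon> n)" for y
        using bump_values[OF \<epsilon>(1) that] by (simp_all add: z_def b0_def b1_def)
      have zW: "z \<in> W (\<epsilon> n) \<eta>"
        by (rule W_intro[OF \<epsilon>(1) traced.has_trace_C1[OF traced0[OF \<epsilon>(1)] zC] traced.has_trace_C1[OF traced1[OF \<epsilon>(1)] zC]], rule AE_I2)
          (simp add: space_restrict_space z0)
      have "Re (Q.q (b0 n + b1 n) (b0 n + b1 n)) \<le> c * H1_norm_sq \<Omega> (b0 n + b1 n)" by (rule c(3)) (use bH in blast)
      also have "\<dots> \<le> c * (2 * H1_norm_sq \<Omega> (b0 n) + 2 * H1_norm_sq \<Omega> (b1 n))"
        unfolding H1_norm_sq_q using c(1) by (intro mult_left_mono H.q.Re_add_le bH) simp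
      finally have 2: "Re (Q.q (b0 n + b1 n) (b0 n + b1 n)) < d / 4" using n by linarith
      have uz: "u - z = (b0 n + b1 n) - (F - u)" unfolding z_def by simp
      have "Re (Q.q (u - z) (u - z)) \<le> 2 * Re (Q.q (b0 n + b1 n) (b0 n + b1 n)) + 2 * Re (Q.q (F - u) (F - u))"
        unfolding uz by (rule Q.q.Re_diff_le) (use bH FH u in blast)+
      then have "Re (Q.q (u - z) (u - z)) < d" using 1 2 by linarith
      then show "\<exists>z\<in>W (\<epsilon> n) \<eta>. Re (Q.q (u - z) (u - z)) < d" using zW by blast
    qed
  qed
  \<comment> \<open>The approximating C1 function depends on the tolerance, so it gives no single
    sequence; near-minimisers of the distance to the \<open>n\<close>-th space do.\<close>
  define S where "S n = (\<lambda>z. Re (Q.q (u - z) (u - z))) ` W (\<epsilon> n) \<eta>" for n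
  have S0: "0 \<le> s" if s: "s \<in> S n" for s n
  proof -
    obtain z where z: "z \<in> W (\<epsilon> n) \<eta>" "s = Re (Q.q (u - z) (u - z))" using s unfolding S_def by blast
    have "u - z \<in> H1 \<Omega>" using u subsetD[OF W_H1 z(1)] by blast
    then show ?thesis unfolding z(2) by (rule Q.q.nonneg)
  qed
  have Sne: "S n \<noteq> {}" for n
    using W_monomial[OF \<epsilon>(1)] unfolding S_def by blast
  have bdd: "bdd_below (S n)" for n by (rule bdd_belowI[of _ 0]) (rule S0)
  have "\<exists>z. z \<in> W (\<epsilon> n) \<eta> \<and> Re (Q.q (u - z) (u - z)) < Inf (S n) + 1 / real (Suc n)" for n
  proof -
    have "\<exists>s\<in>S n. s < Inf (S n) + 1 / real (Suc n)"
      by (rule cInf_lessD[OF Sne]) simp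
    then show ?thesis unfolding S_def by blast
  qed
  then have "\<forall>n. \<exists>z. z \<in> W (\<epsilon> n) \<eta> \<and> Re (Q.q (u - z) (u - z)) < Inf (S n) + 1 / real (Suc n)" by blast
  from choice[OF this] obtain y where y: "\<forall>n. y n \<in> W (\<epsilon> n) \<eta> \<and> Re (Q.q (u - y n) (u - y n)) < Inf (S n) + 1 / real (Suc n)" ..
  have "(\<lambda>n. Re (Q.q (u - y n) (u - y n))) \<longlonglongrightarrow> 0"
  proof (rule order_tendstoI)
    fix d :: real assume d: "0 < d"
    have "\<forall>\<^sub>F n in sequentially. 1 / real (Suc n) < d / 2"
      using order_tendstoD(2)[OF LIMSEQ_inverse_real_of_nat, of "d/2"] d by (simp add: inverse_eq_divide)
    with ev[of "d / 2"] d show "\<forall>\<^sub>F n in sequentially. Re (Q.q (u - y n) (u - y n)) < d"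
    proof (elim eventually_elim2[rotated 1])
      show "\<forall>\<^sub>F n in sequentially. \<exists>z\<in>W (\<epsilon> n) \<eta>. Re (Q.q (u - z) (u - z)) < d / 2" by (rule ev) (use d in simp)
      fix n assume "1 / real (Suc n) < d / 2" "\<exists>z\<in>W (\<epsilon> n) \<eta>. Re (Q.q (u - z) (u - z)) < d / 2"
      then obtain z where z: "z \<in> W (\<epsilon> n) \<eta>" "Re (Q.q (u - z) (u - z)) < d / 2" by blast
      have "Inf (S n) \<le> Re (Q.q (u - z) (u - z))" by (rule cInf_lower[OF _ bdd]) (use z(1) in \<open>simp add: S_def\<close>)
      then show "Re (Q.q (u - y n) (u - y n)) < d"
        using y[rule_format, of n] z(2) \<open>1 / real (Suc n) < d / 2\<close> by linarith
    qed
  next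
    fix d :: real assume d: "d < 0"
    have "0 \<le> Re (Q.q (u - y n) (u - y n))" for n
      by (rule S0[of _ n]) (use y in \<open>simp add: S_def\<close>)
    then show "\<forall>\<^sub>F n in sequentially. d < Re (Q.q (u - y n) (u - y n))"
      using d by (intro always_eventually allI) (rule less_le_trans)
  qed
  then show ?thesis using y by blast
qed

end

section \<open>Lower bound for the defect, the competitor, and the contradiction\<close>

section \<open>Comparison of two quasi-momenta\<close>

text \<open>Continuity at \<open>p\<close> makes \<open>U - a\<close> as small as desired on the
  shrinking balls, so the order \<open>r\<close> of \<open>bump_energy\<close> improves to
  \<open>o(r)\<close>.\<close>

lemma (in flat_wall) bump_energy_vanishes:
  assumes U: "U \<in> L2 \<Omega>" and bv: "has_boundary_value \<Omega> U p a" and r: "\<And>n::nat. r n > 0" "r \<longlonglongrightarrow> 0"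
    and \<delta>: "\<delta> > 0"
  shows "\<forall>\<^sub>F n in sequentially.
    (\<Sum>e\<in>Basis. L2_norm_sq \<Omega> (\<lambda>x. of_real (pd (cut p (r n) 1) e x) * (U x - a))) \<le> \<delta> * r n"
proof -
  \<comment> \<open>Chosen so that \<open>96 V3 \<tau>^2 \<le> \<delta>\<close>; with
    \<open>V3 + 1\<close> the denominator is positive because \<open>V3\<close> is
    nonnegative.\<close>
  define \<tau> where "\<tau> = sqrt (\<delta> / (96 * (V3 + 1)))"
  have \<tau>2: "\<tau>\<^sup>2 = \<delta> / (96 * (V3 + 1))" and \<tau>: "\<tau> > 0"
    using \<delta> V3 unfolding \<tau>_def by (simp_all add: add_nonneg_pos)
  have \<tau>\<delta>: "96 * V3 * \<tau>\<^sup>2 \<le> \<delta>" unfolding \<tau>2 using \<delta> V3 by (simp add: field_simps)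
  obtain w where w: "AE x in leb \<Omega>. w x = U x" "(w \<longlongrightarrow> a) (at p within \<Omega>)"
    using bv unfolding has_boundary_value_def by blast
  obtain d where d: "d > 0" "\<And>x. \<lbrakk>x \<in> \<Omega>; x \<noteq> p; dist x p < d\<rbrakk> \<Longrightarrow> dist (w x) a < \<tau>"
    using tendstoD[OF w(2) \<tau>] unfolding eventually_at by auto
  have p: "p \<notin> \<Omega>" using flat[of p] r0 by (simp add: half_space_def)
  have FL: "(\<lambda>x. U x - a) \<in> L2 \<Omega>" by (rule L2_diff[OF U cont_L2[OF continuous_on_const]])
  have "\<forall>\<^sub>F n in sequentially. r n < d" by (rule order_tendstoD(2)[OF r(2) d(1)])
  then show ?thesis
  proof eventually_elim
    fix n assume n: "r n < d"
    have "AE x in leb \<Omega>. norm (x - p) \<le> r n \<longrightarrow> cmod (U x - a) \<le> \<tau>"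
      using w(1) AE_space
    proof eventually_elim
      fix x assume x: "w x = U x" "x \<in> space (leb \<Omega>)"
      have x\<Omega>: "x \<in> \<Omega>" using x(2) by (simp add: space_restrict_space)
      then have "x \<noteq> p" using p by blast
      then show "norm (x - p) \<le> r n \<longrightarrow> cmod (U x - a) \<le> \<tau>"
        using d(2)[OF x\<Omega>] n x(1) by (fastforce simp: dist_norm)
    qed
    from bump_energy[OF r(1) FL this less_imp_le[OF \<tau>]]
    have "(\<Sum>e\<in>Basis. L2_norm_sq \<Omega> (\<lambda>x. of_real (pd (cut p (r n) 1) e x) * (U x - a))) \<le> 96 * V3 * \<tau>\<^sup>2 * r n" .
    also have "\<dots> \<le> \<delta> * r n" by (rule mult_right_mono[OF \<tau>\<delta> less_imp_le[OF r(1)]])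
    finally show "(\<Sum>e\<in>Basis. L2_norm_sq \<Omega> (\<lambda>x. of_real (pd (cut p (r n) 1) e x) * (U x - a))) \<le> \<delta> * r n" .
  qed
qed

context channel_walls
begin

lemma aperture_area:
  "\<exists>\<beta>>0. \<forall>\<epsilon>>0. \<beta> * \<epsilon>\<^sup>2 \<le> measure lborel (A \<epsilon>)"
proof -
  obtain \<rho> where \<rho>: "\<rho> > 0" "ball 0 \<rho> \<subseteq> \<theta>" using \<theta>_domain(1,4) open_contains_ball by blast
  show ?thesis
  proof (intro exI[of _ "unit_ball_vol 2 * \<rho>\<^sup>2"] conjI allI impI)
    show "unit_ball_vol 2 * \<rho>\<^sup>2 > 0" using \<rho>(1) by simp
    fix \<epsilon> :: real assume \<epsilon>: "\<epsilon> > 0"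
    have "ball P (\<rho> * \<epsilon>) \<subseteq> A \<epsilon>"
    proof
      fix y assume "y \<in> ball P (\<rho> * \<epsilon>)"
      then have "norm (y - P) / \<epsilon> < \<rho>" using \<epsilon> by (simp add: dist_norm norm_minus_commute pos_divide_less_eq)
      then have "norm ((1 / \<epsilon>) *\<^sub>R (y - P)) < \<rho>" unfolding norm_scaleR using \<epsilon> by simp
      then show "y \<in> A \<epsilon>" using \<rho>(2) by (auto simp: aperture_def)
    qed
    moreover have "A \<epsilon> \<in> fmeasurable lborel"
      by (rule fmeasurableI2[OF fmeasurableI A_subset[OF \<epsilon>]])
        (use A_borel emeasure_lborel_cball_finite[of P "m * \<epsilon>"] in auto)
    ultimately have "measure lborel (ball P (\<rho> * \<epsilon>)) \<le> measure lborel (A \<epsilon>)"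
      by (intro measure_mono_fmeasurable) auto
    then show "unit_ball_vol 2 * \<rho>\<^sup>2 * \<epsilon>\<^sup>2 \<le> measure lborel (A \<epsilon>)"
      using content_ball[of "\<rho> * \<epsilon>" P] \<rho>(1) \<epsilon> by (simp add: power2_eq_square mult_ac)
  qed
qed

text \<open>A constant \<open>d\<close> has norm of order \<open>|d| \<epsilon>\<close> on an
  aperture, whereas traces there are bounded by \<open>sqrt \<epsilon>\<close> times the energy
  norm. Hence a prescribed constant sum of traces costs energy of order at least
  \<open>|d|^2 \<epsilon>\<close>, the scale at which all remainders are measured.\<close>

lemma aperture_bound:
  obtains K where "K > 0"
    "\<And>\<epsilon> x y g h d. \<lbrakk>small \<epsilon>; has_trace \<Omega> (Pair 0) (A \<epsilon>) x g; has_trace \<Omega> (Pair 1) (A \<epsilon>) y h;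
        AE z in leb (A \<epsilon>). g z + h z = d\<rbrakk>
      \<Longrightarrow> cmod d * sqrt \<epsilon> \<le> K * (sqrt (Re (Q.q x x)) + sqrt (Re (Q.q y y)))"
proof -
  obtain \<beta> where \<beta>: "\<beta> > 0" "\<And>\<epsilon>. \<epsilon> > 0 \<Longrightarrow> \<beta> * \<epsilon>\<^sup>2 \<le> measure lborel (A \<epsilon>)"
    using aperture_area by blast
  obtain c where c: "c > 0" "\<And>u. u \<in> H1 \<Omega> \<Longrightarrow> H1_norm_sq \<Omega> u \<le> c * Re (Q.q u u)"
    "\<And>u. u \<in> H1 \<Omega> \<Longrightarrow> Re (Q.q u u) \<le> c * H1_norm_sq \<Omega> u" using norm_equiv by blast
  define C where "C = (1 + m\<^sup>2) * (w0.K\<^sub>w + w1.K\<^sub>w) * c"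
  have C: "C \<ge> 0" "(1 + m\<^sup>2) * w0.K\<^sub>w * c \<le> C" "(1 + m\<^sup>2) * w1.K\<^sub>w * c \<le> C"
    unfolding C_def using w0.K\<^sub>w(1) w1.K\<^sub>w(1) c(1) by (auto intro!: mult_right_mono mult_left_mono)
  have tr: "sqrt (L2_norm_sq S g) \<le> sqrt (C * \<epsilon>) * sqrt (Re (Q.q x x))"
    if "traced \<Omega> \<iota> S ((1 + m\<^sup>2) * \<epsilon> * K)" "(1 + m\<^sup>2) * K * c \<le> C" "K \<ge> 0" "\<epsilon> > 0" "has_trace \<Omega> \<iota> S x g"
    for \<iota> S \<epsilon> K x g
  proof -
    have xH: "x \<in> H1 \<Omega>" using that(5) by (simp add: has_trace_def)
    have "L2_norm_sq S g \<le> (1 + m\<^sup>2) * \<epsilon> * K * H1_norm_sq \<Omega> x" by (rule traced.has_trace_bound[OF that(1,5)])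
    also have "\<dots> \<le> (1 + m\<^sup>2) * \<epsilon> * K * (c * Re (Q.q x x))"
      by (rule mult_left_mono[OF c(2)[OF xH]]) (use that(3,4) in simp)
    also have "\<dots> = (1 + m\<^sup>2) * K * c * (\<epsilon> * Re (Q.q x x))" by (simp only: mult_ac)
    also have "\<dots> \<le> C * (\<epsilon> * Re (Q.q x x))"
      by (rule mult_right_mono[OF that(2)]) (use that(4) Q.q.nonneg[OF xH] in simp)
    finally have "sqrt (L2_norm_sq S g) \<le> sqrt (C * \<epsilon> * Re (Q.q x x))" by (simp only: real_sqrt_le_iff mult.assoc)
    then show ?thesis by (simp only: real_sqrt_mult)
  qed
  show thesis
  proof (rule that[of "sqrt C / sqrt \<beta> + 1"])
    show "sqrt C / sqrt \<beta> + 1 > 0" using C(1) \<beta>(1) by (simp add: add_nonneg_pos)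
    fix \<epsilon> x y g h d
    assume \<epsilon>: "small \<epsilon>" and x: "has_trace \<Omega> (Pair 0) (A \<epsilon>) x g" and y: "has_trace \<Omega> (Pair 1) (A \<epsilon>) y h"
      and ae: "AE z in leb (A \<epsilon>). g z + h z = d"
    let ?q = "sqrt (Re (Q.q x x)) + sqrt (Re (Q.q y y))"
    have \<epsilon>0: "\<epsilon> > 0" using \<epsilon> by (simp add: small_def)
    interpret t0: traced \<Omega> "Pair 0" "A \<epsilon>" "(1 + m\<^sup>2) * \<epsilon> * w0.K\<^sub>w" by (rule traced0[OF \<epsilon>])
    have gL: "g \<in> L2 (A \<epsilon>)" "h \<in> L2 (A \<epsilon>)" using x y by (simp_all add: has_trace_def)
    have ghL: "(\<lambda>z. g z + h z) \<in> L2 (A \<epsilon>)" by (rule L2_add[OF gL])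
    have dL: "(\<lambda>_. d) \<in> L2 (A \<epsilon>)" by (rule continuous_L2[OF continuous_on_const t0.S_bounded A_borel])
    have xH: "x \<in> H1 \<Omega>" "y \<in> H1 \<Omega>" using x y by (simp_all add: has_trace_def)
    have q0: "?q \<ge> 0" using Q.q.nonneg[OF xH(1)] Q.q.nonneg[OF xH(2)] by simp
    have "measure (leb (A \<epsilon>)) (space (leb (A \<epsilon>))) = measure lborel (A \<epsilon>)"
      using A_borel by (simp add: measure_restrict_space space_restrict_space)
    then have "L2_norm_sq (A \<epsilon>) (\<lambda>_. d) = (cmod d)\<^sup>2 * measure lborel (A \<epsilon>)"
      by (simp add: L2_norm_sq_def mult.commute)
    then have "(cmod d)\<^sup>2 * (\<beta> * \<epsilon>\<^sup>2) \<le> L2_norm_sq (A \<epsilon>) (\<lambda>_. d)"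
      using mult_left_mono[OF \<beta>(2)[OF \<epsilon>0], of "(cmod d)\<^sup>2"] by simp
    then have "sqrt ((cmod d)\<^sup>2 * (\<beta> * \<epsilon>\<^sup>2)) \<le> sqrt (L2_norm_sq (A \<epsilon>) (\<lambda>_. d))" by (rule real_sqrt_le_mono)
    then have "cmod d * (sqrt \<beta> * \<epsilon>) \<le> sqrt (L2_norm_sq (A \<epsilon>) (\<lambda>_. d))"
      using \<epsilon>0 by (simp add: real_sqrt_mult)
    also have "L2_norm_sq (A \<epsilon>) (\<lambda>_. d) = L2_norm_sq (A \<epsilon>) (\<lambda>z. g z + h z)"
      by (rule L2_norm_sq_cong[OF _ dL ghL]) (use ae in \<open>simp add: eq_commute\<close>)
    also have "sqrt (L2_norm_sq (A \<epsilon>) (\<lambda>z. g z + h z)) \<le> sqrt (L2_norm_sq (A \<epsilon>) g) + sqrt (L2_norm_sq (A \<epsilon>) h)"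
      using t0.S.triangle[OF gL] unfolding Re_L2_inner_self plus_fun_def .
    also have "\<dots> \<le> sqrt (C * \<epsilon>) * ?q"
      using tr[OF traced0[OF \<epsilon>] C(2) w0.K\<^sub>w(1) \<epsilon>0 x] tr[OF traced1[OF \<epsilon>] C(3) w1.K\<^sub>w(1) \<epsilon>0 y]
      by (simp only: distrib_left)
    finally have 1: "cmod d * (sqrt \<beta> * \<epsilon>) \<le> sqrt C * sqrt \<epsilon> * ?q" by (simp only: real_sqrt_mult)
    have "cmod d * sqrt \<epsilon> * (sqrt \<beta> * sqrt \<epsilon>) = cmod d * (sqrt \<beta> * \<epsilon>)" using \<epsilon>0 by simp
    also have "\<dots> \<le> (sqrt C / sqrt \<beta> * ?q) * (sqrt \<beta> * sqrt \<epsilon>)"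
    proof -
      have "(sqrt C / sqrt \<beta> * ?q) * (sqrt \<beta> * sqrt \<epsilon>) = sqrt C * sqrt \<epsilon> * ?q" using \<beta>(1) by simp
      then show ?thesis using 1 by linarith
    qed
    finally have "cmod d * sqrt \<epsilon> \<le> sqrt C / sqrt \<beta> * ?q"
      using \<beta>(1) \<epsilon>0 by (simp only: mult_le_cancel_right_pos mult_pos_pos real_sqrt_gt_zero)
    also have "\<dots> \<le> (sqrt C / sqrt \<beta> + 1) * ?q" using q0 by (simp add: distrib_right)
    finally show "cmod d * sqrt \<epsilon> \<le> (sqrt C / sqrt \<beta> + 1) * ?q" .
  qed
qed

text \<open>
  The cutoff distinguishes the two walls; that its gradient costs only a small multiple of the energy
  is the logarithmic capacity argument behind \<open>cut\<close>.
\<close>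

lemma wall_cutoff:
  assumes \<kappa>: "\<kappa> > 0"
  obtains \<zeta> :: "point \<Rightarrow> complex" and \<delta> where "Ck 1 \<zeta>" "\<And>y. \<zeta> (surface_pt y) = 0" "\<delta> > 0"
    "\<And>y. norm (y - P) \<le> \<delta> \<Longrightarrow> \<zeta> (0, y) = 1 \<and> \<zeta> (1, y) = - 1"
    "\<And>u. u \<in> H1 \<Omega> \<Longrightarrow> sqrt (grad_norm_sq \<Omega> (\<lambda>x. \<zeta> x * u x)) \<le> (1 + \<kappa>) * sqrt (Re (Q.q u u))"
proof -
  obtain c where c: "c > 0" "\<And>u. u \<in> H1 \<Omega> \<Longrightarrow> H1_norm_sq \<Omega> u \<le> c * Re (Q.q u u)"
    "\<And>u. u \<in> H1 \<Omega> \<Longrightarrow> Re (Q.q u u) \<le> c * H1_norm_sq \<Omega> u" using norm_equiv by blast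
  define M where "M = 2 * (w0.K\<^sub>w + w1.K\<^sub>w) * c"
  have M: "M \<ge> 0" unfolding M_def using w0.K\<^sub>w(1) w1.K\<^sub>w(1) c(1) by simp
  \<comment> \<open>Makes the cost \<open>(4 / L)^2 M\<close> of the two cutoffs at most
    \<open>\<kappa>^2\<close>; \<open>M\<close> collects both Hardy constants, the norm equivalence
    and the factor 2 from splitting a square.\<close>
  define L where "L = 4 * (sqrt M + 1) / \<kappa>"
  have L: "L > 0" unfolding L_def using M \<kappa> by (simp add: add_nonneg_pos)
  have LM: "(4 / L)\<^sup>2 * M \<le> \<kappa>\<^sup>2"
  proof -
    have "4 * sqrt M \<le> \<kappa> * L" unfolding L_def using \<kappa> by simp
    then have "4 / L * sqrt M \<le> \<kappa>" using L by (simp add: pos_divide_le_eq)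
    then have "(4 / L * sqrt M)\<^sup>2 \<le> \<kappa>\<^sup>2" using L M by (intro power_mono) auto
    then show ?thesis unfolding power_mult_distrib using M by simp
  qed
  let ?r = "w0.r1"
  have r: "?r > 0" "?r \<le> R" "?r \<le> 1" using w0.r1(1) r1_le R by auto
  have r1: "?r \<le> w1.r1" by (simp add: w0.r1_def w1.r1_def)
  define \<xi> where "\<xi> j = cut (j, P) ?r L" for j :: real
  have C1\<xi>: "Ck 1 (\<xi> j)" for j unfolding \<xi>_def by (rule C1_cut[OF r(1) L])
  define z where "z x = \<xi> 0 x - \<xi> 1 x" for x
  have C1z: "Ck 1 z" unfolding z_def[abs_def] by (rule C1_diff[OF C1\<xi> C1\<xi>])
  define \<delta> where "\<delta> = sqrt (?r\<^sup>2 * exp (- L) / 2)"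
  have one: "\<xi> j (j, y) = 1" and zero: "\<bar>i - j\<bar> \<ge> 1 \<Longrightarrow> \<xi> i (j, y) = 0" if y: "norm (y - P) \<le> \<delta>" for i j y
  proof -
    have "(norm (y - P))\<^sup>2 \<le> \<delta>\<^sup>2" using y by (intro power_mono) auto
    then have "(norm ((j, y) - (j, P)))\<^sup>2 \<le> ?r\<^sup>2 * exp (- L) / 2" by (simp add: norm_Pair \<delta>_def)
    then show "\<xi> j (j, y) = 1" unfolding \<xi>_def by (rule cut_eq_1[OF r(1) L])
    assume "\<bar>i - j\<bar> \<ge> 1"
    then have "?r \<le> norm ((j, y) - (i, P))" using norm_fst_le[of "j - i" "y - P"] r(3) by simp
    then show "\<xi> i (j, y) = 0" unfolding \<xi>_def by (rule cut_eq_0[OF r(1) L])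
  qed
  show thesis
  proof (rule that[of "\<lambda>x. of_real (z x)" \<delta>])
    show "Ck 1 (\<lambda>x. complex_of_real (z x))" by (rule C1_of_real[OF C1z])
    have b: "cmod (of_real (z x)) \<le> 1" for x
      using cut_bounds[of "(0, P)" ?r L x] cut_bounds[of "(1, P)" ?r L x]
      unfolding norm_of_real z_def \<xi>_def abs_le_iff by linarith
    show "complex_of_real (z (surface_pt y)) = 0" for y
      by (simp add: z_def \<xi>_def cut_surface[OF r(1,2) L])
    show "\<delta> > 0" unfolding \<delta>_def using r(1) by simp
    show "complex_of_real (z (0, y)) = 1 \<and> complex_of_real (z (1, y)) = - 1" if "norm (y - P) \<le> \<delta>" for y
      using one[OF that] zero[OF that, of 0 1] zero[OF that, of 1 0] by (simp add: z_def)
    fix u assume u: "u \<in> H1 \<Omega>"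
    have uL: "u \<in> L2 \<Omega>" by (rule H1_L2[OF u])
    have q0: "Re (Q.q u u) \<ge> 0" by (rule Q.q.nonneg[OF u])
    have "(\<Sum>e\<in>Basis. L2_norm_sq \<Omega> (\<lambda>x. pd (\<lambda>x. complex_of_real (z x)) e x * u x))
       \<le> (\<Sum>e\<in>Basis. 2 * L2_norm_sq \<Omega> (\<lambda>x. of_real (pd (\<xi> 0) e x) * u x) + 2 * L2_norm_sq \<Omega> (\<lambda>x. of_real (pd (\<xi> 1) e x) * u x))"
    proof (rule sum_mono)
      fix e :: point assume e: "e \<in> Basis"
      have \<xi>L: "(\<lambda>x. of_real (pd (\<xi> j) e x) * u x) \<in> L2 \<Omega>" for j
        by (rule L2_mult_continuous[OF uL continuous_on_of_real[OF C1_D(2)[OF C1\<xi> e]] bounded_\<Omega>])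
      have "(\<lambda>x. pd (\<lambda>x. complex_of_real (z x)) e x * u x) = (\<lambda>x. of_real (pd (\<xi> 0) e x) * u x) - (\<lambda>x. of_real (pd (\<xi> 1) e x) * u x)"
        unfolding pd_of_real[OF C1z] by (simp add: z_def[abs_def] pd_diff[OF C1\<xi> C1\<xi>] fun_diff_def left_diff_distrib)
      then show "L2_norm_sq \<Omega> (\<lambda>x. pd (\<lambda>x. complex_of_real (z x)) e x * u x)
         \<le> 2 * L2_norm_sq \<Omega> (\<lambda>x. of_real (pd (\<xi> 0) e x) * u x) + 2 * L2_norm_sq \<Omega> (\<lambda>x. of_real (pd (\<xi> 1) e x) * u x)"
        using L2.Re_diff_le[OF \<xi>L \<xi>L, of 0 1] unfolding Re_L2_inner_self by simp
    qed
    also have "\<dots> = 2 * (\<Sum>e\<in>Basis. L2_norm_sq \<Omega> (\<lambda>x. of_real (pd (\<xi> 0) e x) * u x)) + 2 * (\<Sum>e\<in>Basis. L2_norm_sq \<Omega> (\<lambda>x. of_real (pd (\<xi> 1) e x) * u x))"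
      by (simp only: sum.distrib sum_distrib_left)
    also have "\<dots> \<le> 2 * ((4 / L)\<^sup>2 * (w0.K\<^sub>w * H1_norm_sq \<Omega> u)) + 2 * ((4 / L)\<^sup>2 * (w1.K\<^sub>w * H1_norm_sq \<Omega> u))"
      unfolding \<xi>_def by (intro add_mono mult_left_mono w0.cut_gradient_bound[OF u r(1) order_refl L]
          w1.cut_gradient_bound[OF u r(1) r1 L]) simp_all
    also have "\<dots> = (4 / L)\<^sup>2 * (2 * (w0.K\<^sub>w + w1.K\<^sub>w)) * H1_norm_sq \<Omega> u" by (simp add: algebra_simps)
    also have "\<dots> \<le> (4 / L)\<^sup>2 * (2 * (w0.K\<^sub>w + w1.K\<^sub>w)) * (c * Re (Q.q u u))"
      by (rule mult_left_mono[OF c(2)[OF u]]) (use w0.K\<^sub>w(1) w1.K\<^sub>w(1) in simp)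
    also have "\<dots> = (4 / L)\<^sup>2 * M * Re (Q.q u u)" unfolding M_def by (simp only: mult_ac)
    also have "\<dots> \<le> \<kappa>\<^sup>2 * Re (Q.q u u)" by (rule mult_right_mono[OF LM q0])
    finally have "sqrt (\<Sum>e\<in>Basis. L2_norm_sq \<Omega> (\<lambda>x. pd (\<lambda>x. complex_of_real (z x)) e x * u x)) \<le> sqrt (\<kappa>\<^sup>2 * Re (Q.q u u))"
      by (rule real_sqrt_le_mono)
    also have "\<dots> = \<kappa> * sqrt (Re (Q.q u u))" using \<kappa> by (simp add: real_sqrt_mult)
    finally have "sqrt (grad_norm_sq \<Omega> (\<lambda>x. of_real (z x) * u x)) \<le> sqrt (grad_norm_sq \<Omega> u) + \<kappa> * sqrt (Re (Q.q u u))"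
      using grad_mult_le[OF u C1_of_real[OF C1z] b] by linarith
    moreover have "sqrt (grad_norm_sq \<Omega> u) \<le> sqrt (Re (Q.q u u))"
      using Q.b.nonneg[OF u] by (simp add: Re_grad_inner)
    ultimately show "sqrt (grad_norm_sq \<Omega> (\<lambda>x. of_real (z x) * u x)) \<le> (1 + \<kappa>) * sqrt (Re (Q.q u u))"
      by (simp only: distrib_right mult_1_left)
  qed
qed

text \<open>On the plateau of the cutoff this is \<open>u - a\<close>, so subtracting it from
  \<open>u\<close> leaves the constant \<open>a\<close> on the aperture; at the other aperture and
  on the free surface it has zero trace.\<close>

definition bump :: "(point \<Rightarrow> complex) \<Rightarrow> real \<Rightarrow> complex \<Rightarrow> real \<Rightarrow> point \<Rightarrow> complex" where
  "bump u j a \<epsilon> x = of_real (cut (j, P) (3 * m * \<epsilon>) 1 x) * (u x - a)"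

lemma C1_bump_cut: "small \<epsilon> \<Longrightarrow> Ck 1 (\<lambda>x. complex_of_real (cut (j :: real, P) (3 * m * \<epsilon>) 1 x))"
  using small_r by (intro C1_of_real C1_cut) auto

lemma bump_trace:
  assumes \<epsilon>: "small \<epsilon>" and t: "traced \<Omega> \<iota> S C" and u: "has_trace \<Omega> \<iota> S u g"
  shows "has_trace \<Omega> \<iota> S (bump u j a \<epsilon>) (\<lambda>y. of_real (cut (j, P) (3 * m * \<epsilon>) 1 (\<iota> y)) * (g y - a))"
  unfolding bump_def[abs_def]
  by (rule traced.has_trace_mult[OF t traced.has_trace_diff[OF t u traced.has_trace_C1[OF t C1_const]] C1_bump_cut[OF \<epsilon>]])

lemma bump_H1: "\<lbrakk>small \<epsilon>; u \<in> H1 \<Omega>\<rbrakk> \<Longrightarrow> bump u j a \<epsilon> \<in> H1 \<Omega>"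
  using \<gamma>.has_traceD(1)[OF bump_trace[OF _ \<gamma>.traced_axioms \<gamma>.has_trace_tr]] by blast

lemma bump_surface:
  assumes \<epsilon>: "small \<epsilon>" and u: "u \<in> H1 \<Omega>" and v: "v \<in> H1 \<Omega>"
  shows "surface_inner B (bump u j a \<epsilon>) v = 0"
  by (rule surface_null(1)[OF bump_trace[OF \<epsilon> \<gamma>.traced_axioms \<gamma>.has_trace_tr[OF u]] _ v])
    (use small_r[OF \<epsilon>] in \<open>simp add: cut_surface\<close>)

text \<open>Harmonicity removes the gradient of \<open>U\<close>, and continuity makes the rest
  \<open>o(\<epsilon>)\<close>. Square roots appear because energies are combined by the triangle
  inequality later.\<close>

lemma bump_energy_small:
  assumes \<epsilon>: "\<And>n::nat. small (\<epsilon> n)" "\<epsilon> \<longlonglongrightarrow> 0"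
    and U: "U \<in> H1 \<Omega>" "\<forall>V\<in>H1 \<Omega>. grad_inner \<Omega> U V = of_real \<mu> * surface_inner B U V"
    and j: "j = 0 \<or> j = 1" and bv: "has_boundary_value \<Omega> U (j, P) a" and \<delta>: "\<delta> > 0"
  shows "\<forall>\<^sub>F n in sequentially. sqrt (grad_norm_sq \<Omega> (bump U j a (\<epsilon> n))) \<le> \<delta> * sqrt (\<epsilon> n)"
proof -
  have r: "3 * m * \<epsilon> n > 0" for n using small_r[OF \<epsilon>(1)] by blast
  have r0: "(\<lambda>n. 3 * m * \<epsilon> n) \<longlonglongrightarrow> 0" by (rule tendsto_mult_right_zero[OF \<epsilon>(2)])
  have UL: "U \<in> L2 \<Omega>" by (rule H1_L2[OF U(1)])
  have d: "\<delta>\<^sup>2 / (3 * m) > 0" using \<delta> m(1) by simp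
  have "\<forall>\<^sub>F n in sequentially. (\<Sum>e\<in>Basis. L2_norm_sq \<Omega> (\<lambda>x. of_real (pd (cut (j, P) (3 * m * \<epsilon> n) 1) e x) * (U x - a)))
     \<le> \<delta>\<^sup>2 / (3 * m) * (3 * m * \<epsilon> n)"
    using j bv w0.bump_energy_vanishes[OF UL _ r r0 d, of a] w1.bump_energy_vanishes[OF UL _ r r0 d, of a] by blast
  then show ?thesis
  proof eventually_elim
    fix n
    assume n: "(\<Sum>e\<in>Basis. L2_norm_sq \<Omega> (\<lambda>x. of_real (pd (cut (j, P) (3 * m * \<epsilon> n) 1) e x) * (U x - a)))
     \<le> \<delta>\<^sup>2 / (3 * m) * (3 * m * \<epsilon> n)"
    have "grad_norm_sq \<Omega> (bump U j a (\<epsilon> n)) = (\<Sum>e\<in>Basis. L2_norm_sq \<Omega> (\<lambda>x. of_real (pd (cut (j, P) (3 * m * \<epsilon> n) 1) e x) * (U x - a)))"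
      unfolding bump_def[abs_def]
      by (rule harmonic_cutoff[OF U(1) U(2)[rule_format] C1_cut]) (use small_r[OF \<epsilon>(1)] in \<open>simp_all add: cut_surface\<close>)
    then have "grad_norm_sq \<Omega> (bump U j a (\<epsilon> n)) \<le> \<delta>\<^sup>2 * \<epsilon> n" using n m(1) by simp
    then have "sqrt (grad_norm_sq \<Omega> (bump U j a (\<epsilon> n))) \<le> sqrt (\<delta>\<^sup>2 * \<epsilon> n)" by (rule real_sqrt_le_mono)
    then show "sqrt (grad_norm_sq \<Omega> (bump U j a (\<epsilon> n))) \<le> \<delta> * sqrt (\<epsilon> n)" using \<delta> by (simp add: real_sqrt_mult)
  qed
qed

end

context channel_walls
begin

text \<open>The abstract \<open>perturbation\<close> for the quasi-periodic spaces. The existential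
  form hides the locale instance, so that two quasi-momenta can be treated side by side.\<close>

lemma defect:
  assumes \<epsilon>: "\<And>n::nat. small (\<epsilon> n)" "\<epsilon> \<longlonglongrightarrow> 0"
    and seq: "Q.eigen_sequence \<Lambda> U" and k: "k \<ge> 1" and simple: "\<forall>j\<ge>1. \<Lambda> j = \<Lambda> k \<longrightarrow> j = k"
  shows "\<exists>v \<rho>. (\<forall>n. v n \<in> H1 \<Omega>) \<and> \<rho> \<longlonglongrightarrow> 0 \<and> (\<forall>\<^sub>F n in sequentially. U k - v n \<in> W (\<epsilon> n) \<eta> \<and>
       Re (Q.q (v n) (v n)) \<le> (1 + \<rho> n) * (ev (\<epsilon> n) k \<eta> - \<Lambda> k) \<and>
       (\<forall>w\<in>H1 \<Omega>. (\<forall>y\<in>H1 \<Omega>. surface_inner B w y = 0) \<longrightarrow> U k - w \<in> W (\<epsilon> n) \<eta> \<longrightarrow>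
          ev (\<epsilon> n) k \<eta> - \<Lambda> k \<le> (1 + \<rho> n) * Re (grad_inner \<Omega> w w)))"
proof -
  have "\<forall>n. \<exists>LV. form_pair.eigen_sequence cscale (W (\<epsilon> n) \<eta>) (grad_inner \<Omega>) (surface_inner B) (fst LV) (snd LV) \<and>
      (\<forall>k\<ge>1. ev (\<epsilon> n) k \<eta> = fst LV k)"
    using ev_sequence[OF \<epsilon>(1)] by fastforce
  from choice[OF this] obtain LV where
    LV: "\<And>n. form_pair.eigen_sequence cscale (W (\<epsilon> n) \<eta>) (grad_inner \<Omega>) (surface_inner B) (fst (LV n)) (snd (LV n))"
      "\<And>n. ev (\<epsilon> n) k \<eta> = fst (LV n) k" using k by blast
  interpret sp: spectral_pair cscale "H1 \<Omega>" "grad_inner \<Omega>" "surface_inner B" by (rule spectral_pair_H1)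
  interpret constrained_pairs cscale "H1 \<Omega>" "grad_inner \<Omega>" "surface_inner B" "\<lambda>n. W (\<epsilon> n) \<eta>" \<Lambda> U k "\<lambda>n. fst (LV n)" "\<lambda>n. snd (LV n)"
    by (rule constrained_pairs.intro[OF spectral_pair_H1 constrained_pairs_axioms.intro]) (fact spectral_pair_W[OF \<epsilon>(1)] W_H1 W_approximable[OF \<epsilon>] seq k simple[rule_format] LV(1))+
  show ?thesis
  proof (rule perturbation)
    fix v \<rho>
    assume v: "\<And>n. v n \<in> H1 \<Omega>" "\<rho> \<longlonglongrightarrow> 0"
      "\<forall>\<^sub>F n in sequentially. U k - v n \<in> W (\<epsilon> n) \<eta> \<and>
       Re (Q.q (v n) (v n)) \<le> (1 + \<rho> n) * (fst (LV n) k - \<Lambda> k) \<and>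
       (\<forall>w\<in>H1 \<Omega>. (\<forall>y\<in>H1 \<Omega>. surface_inner B w y = 0) \<longrightarrow> U k - w \<in> W (\<epsilon> n) \<eta> \<longrightarrow>
          fst (LV n) k - \<Lambda> k \<le> (1 + \<rho> n) * Re (grad_inner \<Omega> w w))"
    show ?thesis unfolding LV(2) using v by blast
  qed
qed

lemma Re_q_bump:
  assumes "small \<epsilon>" "u \<in> H1 \<Omega>" shows "Re (Q.q (bump u j a \<epsilon>) (bump u j a \<epsilon>)) = grad_norm_sq \<Omega> (bump u j a \<epsilon>)"
  by (simp add: Re_grad_inner bump_surface[OF assms bump_H1[OF assms]])

text \<open>Quasi-periodicity of \<open>u - v\<close> with phase \<open>- e\<close> says that the
  trace at 0 plus \<open>e\<close> times the trace at 1 is the same for \<open>v\<close> as for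
  \<open>u\<close>. After the bumps are subtracted, the constant \<open>a0 + e * a1\<close> remains,
  and \<open>aperture_bound\<close> applies.\<close>

lemma defect_lower_bound:
  assumes e: "cmod e = 1" "exp (- \<i> * of_real \<eta>) = - e"
  obtains K where "K > 0"
    "\<And>\<epsilon> u v a0 a1. \<lbrakk>small \<epsilon>; u \<in> H1 \<Omega>; v \<in> H1 \<Omega>; u - v \<in> W \<epsilon> \<eta>\<rbrakk>
      \<Longrightarrow> cmod (a0 + e * a1) * sqrt \<epsilon> \<le> K * (2 * sqrt (Re (Q.q v v))
         + sqrt (grad_norm_sq \<Omega> (bump u 0 a0 \<epsilon>)) + sqrt (grad_norm_sq \<Omega> (bump u 1 a1 \<epsilon>)))"
proof (rule aperture_bound)
  fix K assume K: "K > 0" and bound: "\<And>\<epsilon> x y g h d. \<lbrakk>small \<epsilon>; has_trace \<Omega> (Pair 0) (A \<epsilon>) x g; has_trace \<Omega> (Pair 1) (A \<epsilon>) y h;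
        AE z in leb (A \<epsilon>). g z + h z = d\<rbrakk>
      \<Longrightarrow> cmod d * sqrt \<epsilon> \<le> K * (sqrt (Re (Q.q x x)) + sqrt (Re (Q.q y y)))"
  show thesis
  proof (rule that[OF K])
    fix \<epsilon> u v a0 a1 assume \<epsilon>: "small \<epsilon>" and uv: "u \<in> H1 \<Omega>" "v \<in> H1 \<Omega>" "u - v \<in> W \<epsilon> \<eta>"
    note T0 = traced0[OF \<epsilon>] and T1 = traced1[OF \<epsilon>]
    obtain gu hu where u: "has_trace \<Omega> (Pair 0) (A \<epsilon>) u gu" "has_trace \<Omega> (Pair 1) (A \<epsilon>) u hu"
      using traces[OF \<epsilon> uv(1)] by blast
    obtain gv hv where v: "has_trace \<Omega> (Pair 0) (A \<epsilon>) v gv" "has_trace \<Omega> (Pair 1) (A \<epsilon>) v hv"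
      using traces[OF \<epsilon> uv(2)] by blast
    have uve: "u - v = (\<lambda>x. u x - v x)" by (rule fun_diff_def)
    have W: "AE y in leb (A \<epsilon>). gu y - gv y = - e * (hu y - hv y)"
      using W_elim[OF \<epsilon> uv(3)[unfolded uve] traced.has_trace_diff[OF T0 u(1) v(1)] traced.has_trace_diff[OF T1 u(2) v(2)]]
      unfolding e(2) .
    note t0 = traced.has_trace_diff[OF T0 v(1) bump_trace[OF \<epsilon> T0 u(1)], of 0 a0]
    note t1 = traced.has_trace_scale[OF T1 traced.has_trace_diff[OF T1 v(2) bump_trace[OF \<epsilon> T1 u(2)]], of e 1 a1]
    have ae: "AE y in leb (A \<epsilon>). (gv y - of_real (cut (0 :: real, P) (3 * m * \<epsilon>) 1 (0, y)) * (gu y - a0))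
        + e * (hv y - of_real (cut (1 :: real, P) (3 * m * \<epsilon>) 1 (1, y)) * (hu y - a1)) = a0 + e * a1"
      using W AE_space
    proof eventually_elim
      fix y assume y: "gu y - gv y = - e * (hu y - hv y)" "y \<in> space (leb (A \<epsilon>))"
      then have yA: "y \<in> A \<epsilon>" by (simp add: space_restrict_space)
      have "gu y = gv y - e * (hu y - hv y)" using y(1) by (simp add: algebra_simps)
      then show "(gv y - of_real (cut (0 :: real, P) (3 * m * \<epsilon>) 1 (0, y)) * (gu y - a0))
        + e * (hv y - of_real (cut (1 :: real, P) (3 * m * \<epsilon>) 1 (1, y)) * (hu y - a1)) = a0 + e * a1"
        unfolding bump_values[OF \<epsilon> yA] by (simp add: algebra_simps)
    qed
    let ?x = "v - bump u 0 a0 \<epsilon>" and ?y = "v - bump u 1 a1 \<epsilon>"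
    have b: "bump u 0 a0 \<epsilon> \<in> H1 \<Omega>" "bump u 1 a1 \<epsilon> \<in> H1 \<Omega>" by (rule bump_H1[OF \<epsilon> uv(1)])+
    have x: "(\<lambda>x. v x - bump u 0 a0 \<epsilon> x) = ?x" by (rule fun_diff_def[symmetric])
    have y: "(\<lambda>x. e * (v x - bump u 1 a1 \<epsilon> x)) = cscale e ?y" by (simp add: cscale_def fun_diff_def)
    have "cmod (a0 + e * a1) * sqrt \<epsilon> \<le> K * (sqrt (Re (Q.q ?x ?x)) + sqrt (Re (Q.q (cscale e ?y) (cscale e ?y))))"
      using bound[OF \<epsilon> t0 t1 ae] unfolding y x .
    also have "sqrt (Re (Q.q (cscale e ?y) (cscale e ?y))) = cmod e * sqrt (Re (Q.q ?y ?y))"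
      by (rule Q.q.sqrt_scale) (use uv(2) b in blast)
    also have "K * (sqrt (Re (Q.q ?x ?x)) + cmod e * sqrt (Re (Q.q ?y ?y))) \<le> K * (2 * sqrt (Re (Q.q v v))
         + sqrt (grad_norm_sq \<Omega> (bump u 0 a0 \<epsilon>)) + sqrt (grad_norm_sq \<Omega> (bump u 1 a1 \<epsilon>)))"
      using Q.q.triangle_diff[OF uv(2) b(1)] Q.q.triangle_diff[OF uv(2) b(2)] K e(1)
      unfolding Re_q_bump[OF \<epsilon> uv(1)] by (intro mult_left_mono) auto
    finally show "cmod (a0 + e * a1) * sqrt \<epsilon> \<le> K * (2 * sqrt (Re (Q.q v v))
         + sqrt (grad_norm_sq \<Omega> (bump u 0 a0 \<epsilon>)) + sqrt (grad_norm_sq \<Omega> (bump u 1 a1 \<epsilon>)))" .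
  qed
qed

text \<open>
  If \<open>u - v\<close> has quasi-momentum \<open>\<eta>'\<close>, flipping the sign of \<open>v\<close> at one of the two walls and correcting by the
  bumps gives a competitor for the opposite quasi-momentum \<open>\<eta>\<close>.
\<close>

lemma competitor:
  fixes c :: real and e a0 a1 :: complex
  assumes \<epsilon>: "small \<epsilon>" and uv: "u \<in> H1 \<Omega>" "v \<in> H1 \<Omega>" "u - v \<in> W \<epsilon> \<eta>'"
    and e: "exp (- \<i> * of_real \<eta>) = e" "exp (- \<i> * of_real \<eta>') = - e"
    and c: "(1 - c) * a0 = (1 + c) * (e * a1)" "\<bar>c\<bar> \<le> 1"
    and \<zeta>: "Ck 1 \<zeta>" "\<And>y. \<zeta> (surface_pt y) = 0" "\<And>y. y \<in> A \<epsilon> \<Longrightarrow> \<zeta> (0, y) = 1 \<and> \<zeta> (1, y) = - 1"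
  shows "\<exists>w\<in>H1 \<Omega>. (\<forall>y\<in>H1 \<Omega>. surface_inner B w y = 0) \<and> u - w \<in> W \<epsilon> \<eta> \<and>
     sqrt (Re (grad_inner \<Omega> w w)) \<le> \<bar>c\<bar> * sqrt (grad_norm_sq \<Omega> (\<lambda>x. \<zeta> x * v x))
        + 2 * sqrt (grad_norm_sq \<Omega> (bump u 0 a0 \<epsilon>)) + 2 * sqrt (grad_norm_sq \<Omega> (bump u 1 a1 \<epsilon>))"
proof -
  note T0 = traced0[OF \<epsilon>] and T1 = traced1[OF \<epsilon>]
  obtain gu hu where u: "has_trace \<Omega> (Pair 0) (A \<epsilon>) u gu" "has_trace \<Omega> (Pair 1) (A \<epsilon>) u hu"
    using traces[OF \<epsilon> uv(1)] by blast
  obtain gv hv where v: "has_trace \<Omega> (Pair 0) (A \<epsilon>) v gv" "has_trace \<Omega> (Pair 1) (A \<epsilon>) v hv"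
    using traces[OF \<epsilon> uv(2)] by blast
  have uve: "u - v = (\<lambda>x. u x - v x)" by (rule fun_diff_def)
  have W: "AE y in leb (A \<epsilon>). gu y - gv y = - e * (hu y - hv y)"
    using W_elim[OF \<epsilon> uv(3)[unfolded uve] traced.has_trace_diff[OF T0 u(1) v(1)] traced.has_trace_diff[OF T1 u(2) v(2)]]
    unfolding e(2) .
  let ?z = "\<lambda>x. \<zeta> x * v x" and ?b0 = "bump u 0 a0 \<epsilon>" and ?b1 = "bump u 1 a1 \<epsilon>"
  have H: "?z \<in> H1 \<Omega>" "?b0 \<in> H1 \<Omega>" "?b1 \<in> H1 \<Omega>" by (rule H1_mult[OF uv(2) \<zeta>(1)] bump_H1[OF \<epsilon> uv(1)])+
  \<comment> \<open>With the weights \<open>1 - c\<close> and \<open>1 + c\<close> the traces of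
    \<open>u - w\<close> become \<open>c (u - v) + (1 - c) a0\<close> at the wall 0 and
    \<open>- c (u - v) + (1 + c) a1\<close> at the wall 1.\<close>
  define w where "w = cscale (of_real c) ?z + (cscale (of_real (1 - c)) ?b0 + cscale (of_real (1 + c)) ?b1)"
  have wH: "w \<in> H1 \<Omega>" unfolding w_def using H by blast
  have "surface_inner B w y = 0" if y: "y \<in> H1 \<Omega>" for y
  proof -
    have "surface_inner B ?z y = 0"
      by (rule surface_null(1)[OF \<gamma>.has_trace_mult[OF \<gamma>.has_trace_tr[OF uv(2)] \<zeta>(1)] _ y]) (simp add: \<zeta>(2))
    then show ?thesis unfolding w_def using H y
      by (simp add: Q.b.add_left Q.b.scale_left bump_surface[OF \<epsilon> uv(1)])
  qed
  moreover have "u - w \<in> W \<epsilon> \<eta>"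
  proof -
    have we: "u - w = (\<lambda>x. u x - (of_real c * (\<zeta> x * v x) + (of_real (1 - c) * ?b0 x + of_real (1 + c) * ?b1 x)))"
      by (simp add: w_def cscale_def fun_diff_def plus_fun_def)
    note B0 = bump_trace[OF \<epsilon> T0 u(1)] and B1 = bump_trace[OF \<epsilon> T1 u(2)]
    note t0 = traced.has_trace_diff[OF T0 u(1) traced.has_trace_add[OF T0 traced.has_trace_scale[OF T0 traced.has_trace_mult[OF T0 v(1) \<zeta>(1)]]
        traced.has_trace_add[OF T0 traced.has_trace_scale[OF T0 B0] traced.has_trace_scale[OF T0 B0]]]]
    note t1 = traced.has_trace_diff[OF T1 u(2) traced.has_trace_add[OF T1 traced.has_trace_scale[OF T1 traced.has_trace_mult[OF T1 v(2) \<zeta>(1)]]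
        traced.has_trace_add[OF T1 traced.has_trace_scale[OF T1 B1] traced.has_trace_scale[OF T1 B1]]]]
    show ?thesis unfolding we
    proof (rule W_intro[OF \<epsilon> t0 t1])
      show "AE y in leb (A \<epsilon>).
          gu y - (of_real c * (\<zeta> (0, y) * gv y) + (of_real (1 - c) * (of_real (cut (0 :: real, P) (3 * m * \<epsilon>) 1 (0, y)) * (gu y - a0))
             + of_real (1 + c) * (of_real (cut (1 :: real, P) (3 * m * \<epsilon>) 1 (0, y)) * (gu y - a1))))
        = exp (- \<i> * of_real \<eta>) * (hu y - (of_real c * (\<zeta> (1, y) * hv y) + (of_real (1 - c) * (of_real (cut (0 :: real, P) (3 * m * \<epsilon>) 1 (1, y)) * (hu y - a0))
             + of_real (1 + c) * (of_real (cut (1 :: real, P) (3 * m * \<epsilon>) 1 (1, y)) * (hu y - a1)))))"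
        using W AE_space
      proof eventually_elim
        fix y assume y: "gu y - gv y = - e * (hu y - hv y)" "y \<in> space (leb (A \<epsilon>))"
        then have yA: "y \<in> A \<epsilon>" by (simp add: space_restrict_space)
        \<comment> \<open>The condition for \<open>\<eta>'\<close> matches the terms with
          \<open>u - v\<close>, the equation for \<open>c\<close> matches the constants.\<close>
        have "of_real c * (gu y - gv y) + (1 - c) * a0 = e * (- of_real c * (hu y - hv y) + (1 + c) * a1)"
          unfolding y(1) c(1) by (simp add: algebra_simps)
        then show "gu y - (of_real c * (\<zeta> (0, y) * gv y) + (of_real (1 - c) * (of_real (cut (0 :: real, P) (3 * m * \<epsilon>) 1 (0, y)) * (gu y - a0))
             + of_real (1 + c) * (of_real (cut (1 :: real, P) (3 * m * \<epsilon>) 1 (0, y)) * (gu y - a1))))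
        = exp (- \<i> * of_real \<eta>) * (hu y - (of_real c * (\<zeta> (1, y) * hv y) + (of_real (1 - c) * (of_real (cut (0 :: real, P) (3 * m * \<epsilon>) 1 (1, y)) * (hu y - a0))
             + of_real (1 + c) * (of_real (cut (1 :: real, P) (3 * m * \<epsilon>) 1 (1, y)) * (hu y - a1)))))"
          unfolding bump_values[OF \<epsilon> yA] e(1) using \<zeta>(3)[OF yA] by (simp add: algebra_simps)
      qed
    qed
  qed
  moreover have "sqrt (Re (grad_inner \<Omega> w w)) \<le> \<bar>c\<bar> * sqrt (grad_norm_sq \<Omega> ?z) + 2 * sqrt (grad_norm_sq \<Omega> ?b0) + 2 * sqrt (grad_norm_sq \<Omega> ?b1)"
  proof -
    let ?N = "\<lambda>u. sqrt (Re (grad_inner \<Omega> u u))"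
    have "?N w \<le> ?N (cscale (of_real c) ?z) + ?N (cscale (of_real (1 - c)) ?b0 + cscale (of_real (1 + c)) ?b1)"
      unfolding w_def by (rule H.a.triangle) (use H in blast)+
    also have "?N (cscale (of_real (1 - c)) ?b0 + cscale (of_real (1 + c)) ?b1)
        \<le> ?N (cscale (of_real (1 - c)) ?b0) + ?N (cscale (of_real (1 + c)) ?b1)"
      by (rule H.a.triangle) (use H in blast)+
    finally have "?N w \<le> \<bar>c\<bar> * ?N ?z + (\<bar>1 - c\<bar> * ?N ?b0 + \<bar>1 + c\<bar> * ?N ?b1)"
      unfolding H.a.sqrt_scale[OF H(1)] H.a.sqrt_scale[OF H(2)] H.a.sqrt_scale[OF H(3)] norm_of_real by linarith
    moreover have "\<bar>1 - c\<bar> * ?N ?b0 \<le> 2 * ?N ?b0" "\<bar>1 + c\<bar> * ?N ?b1 \<le> 2 * ?N ?b1"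
      using c(2) H.a.nonneg[OF H(2)] H.a.nonneg[OF H(3)] by (intro mult_right_mono; simp)+
    ultimately show ?thesis unfolding Re_grad_inner by linarith
  qed
  ultimately show ?thesis using wH by blast
qed

end

text \<open>Polar form of the conjugate, because the phase carries a minus sign; the angle lies in
  the half-open range of the band.\<close>

lemma unimodular_exp:
  assumes "cmod z = 1"
  obtains \<eta> where "\<eta> \<in> {0..<2 * pi}" "exp (- \<i> * of_real \<eta>) = z"
proof -
  obtain t where t: "0 \<le> t" "t < 2 * pi" "cnj z = Complex (cos t) (sin t)"
    by (rule complex_unimodular_polar[of "cnj z"]) (simp_all add: assms)
  have "cnj z = exp (\<i> * of_real t)" unfolding t(3) by (simp add: cis_conv_exp[symmetric] complex_eq_iff)
  then have "z = cnj (exp (\<i> * of_real t))" using complex_cnj_cnj[of z] by simp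
  then have "exp (- \<i> * of_real t) = z" by (simp add: exp_cnj)
  then show thesis using t(1,2) by (intro that[of t]) simp_all
qed

context channel_walls
begin

text \<open>Along a sequence of degenerate bands both quasi-momenta have the same shift. The
  estimates from both sides then bound the energy of the defect by a smaller multiple of itself,
  although it is positive.\<close>

lemma band_nondegenerate:
  assumes seq: "Q.eigen_sequence \<Lambda> U" and k: "k \<ge> 1" and simple: "\<forall>j\<ge>1. \<Lambda> j = \<Lambda> k \<longrightarrow> j = k"
    and a0: "has_boundary_value \<Omega> (U k) (0, P) a0" "a0 \<noteq> 0"
    and a1: "has_boundary_value \<Omega> (U k) (1, P) a1" "a1 \<noteq> 0"
    and \<epsilon>: "\<And>n::nat. small (\<epsilon> n)" "\<epsilon> \<longlonglongrightarrow> 0"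
    and eq: "\<And>n \<eta> \<eta>'. \<lbrakk>\<eta> \<in> {0..<2 * pi}; \<eta>' \<in> {0..<2 * pi}\<rbrakk> \<Longrightarrow> ev (\<epsilon> n) k \<eta> = ev (\<epsilon> n) k \<eta>'"
  shows False
proof -
  \<comment> \<open>The phase that aligns \<open>e * a1\<close> with \<open>a0\<close>: then
    \<open>a0 + e * a1\<close> cannot cancel, and the equation for \<open>c\<close> has a real
    solution.\<close>
  define e where "e = (a0 / of_real (cmod a0)) / (a1 / of_real (cmod a1))"
  define t where "t = cmod a1 / cmod a0"
  define c where "c = (1 - t) / (1 + t)"
  have e1: "cmod e = 1" using a0(2) a1(2) by (simp add: e_def norm_divide norm_mult)
  have t: "t > 0" using a0(2) a1(2) by (simp add: t_def)
  have ea1: "e * a1 = of_real t * a0" using a0(2) a1(2) by (simp add: e_def t_def field_simps)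
  have c1: "\<bar>c\<bar> < 1" using t by (simp add: c_def abs_less_iff field_simps)
  have ct: "(1 + c) * t = 1 - c" using t by (simp add: c_def field_simps)
  have cea: "(1 - c) * a0 = (1 + c) * (e * a1)"
  proof -
    have "(1 + c) * (e * a1) = of_real ((1 + c) * t) * a0" unfolding ea1 by (simp add: mult.assoc)
    then show ?thesis unfolding ct by simp
  qed
  have d: "a0 + e * a1 = of_real (1 + t) * a0" unfolding ea1 by (simp add: algebra_simps)
  define D where "D = cmod (a0 + e * a1)"
  have D: "D > 0" unfolding D_def d norm_mult norm_of_real using t a0(2) by simp
  obtain \<eta> where \<eta>: "\<eta> \<in> {0..<2 * pi}" "exp (- \<i> * of_real \<eta>) = e" by (rule unimodular_exp[OF e1])
  obtain \<eta>' where \<eta>': "\<eta>' \<in> {0..<2 * pi}" "exp (- \<i> * of_real \<eta>') = - e"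
    by (rule unimodular_exp[of "- e"]) (simp_all add: e1)
  \<comment> \<open>Half of the gap between \<open>|c|\<close> and 1, which gives
    \<open>|c| (1 + \<kappa>) \<le> 1 - \<kappa>\<close>.\<close>
  define \<kappa> where "\<kappa> = (1 - \<bar>c\<bar>) / 2"
  have \<kappa>: "\<kappa> > 0" using c1 by (simp add: \<kappa>_def)
  define u where "u = U k"
  have uH: "u \<in> H1 \<Omega>" and uE: "\<forall>V\<in>H1 \<Omega>. grad_inner \<Omega> u V = of_real (\<Lambda> k) * surface_inner B u V"
  proof -
    interpret sp: spectral_pair cscale "H1 \<Omega>" "grad_inner \<Omega>" "surface_inner B" by (rule spectral_pair_H1)
    note ES = sp.eigen_sequenceD(1)[OF seq k]
    show "u \<in> H1 \<Omega>" using ES by (simp add: Q.eigenvector_def u_def)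
    show "\<forall>V\<in>H1 \<Omega>. grad_inner \<Omega> u V = of_real (\<Lambda> k) * surface_inner B u V"
      using Q.eigen_a_left[OF ES] by (simp add: u_def)
  qed
  obtain \<zeta> :: "point \<Rightarrow> complex" and \<delta> where \<zeta>: "Ck 1 \<zeta>" "\<And>y. \<zeta> (surface_pt y) = 0"
    and \<delta>: "\<delta> > 0" and \<zeta>A: "\<And>y. norm (y - P) \<le> \<delta> \<Longrightarrow> \<zeta> (0, y) = 1 \<and> \<zeta> (1, y) = - 1"
    and \<zeta>grad: "\<And>u. u \<in> H1 \<Omega> \<Longrightarrow> sqrt (grad_norm_sq \<Omega> (\<lambda>x. \<zeta> x * u x)) \<le> (1 + \<kappa>) * sqrt (Re (Q.q u u))"
    by (rule wall_cutoff[OF \<kappa>], rule that) (assumption | blast)+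
  obtain K where K: "K > 0" and low: "\<And>\<epsilon> u v a0 a1. \<lbrakk>small \<epsilon>; u \<in> H1 \<Omega>; v \<in> H1 \<Omega>; u - v \<in> W \<epsilon> \<eta>'\<rbrakk>
      \<Longrightarrow> cmod (a0 + e * a1) * sqrt \<epsilon> \<le> K * (2 * sqrt (Re (Q.q v v))
         + sqrt (grad_norm_sq \<Omega> (bump u 0 a0 \<epsilon>)) + sqrt (grad_norm_sq \<Omega> (bump u 1 a1 \<epsilon>)))"
    by (rule defect_lower_bound[OF e1 \<eta>'(2)], rule that) (assumption | blast)+
  \<comment> \<open>Small enough for the bumps to be absorbed twice: in the lower bound for
    \<open>q\<close>, and then as at most \<open>\<kappa> / 8 * q\<close> each in the
    competitor.\<close>
  define s where "s = \<kappa> * D / (32 * K)"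
  have s: "s > 0" unfolding s_def using \<kappa> D K by simp
  obtain v \<rho> where v: "\<forall>n. v n \<in> H1 \<Omega>" "\<rho> \<longlonglongrightarrow> 0"
    and v_def: "\<forall>\<^sub>F n in sequentially. U k - v n \<in> W (\<epsilon> n) \<eta>' \<and>
       Re (Q.q (v n) (v n)) \<le> (1 + \<rho> n) * (ev (\<epsilon> n) k \<eta>' - \<Lambda> k) \<and>
       (\<forall>w\<in>H1 \<Omega>. (\<forall>y\<in>H1 \<Omega>. surface_inner B w y = 0) \<longrightarrow> U k - w \<in> W (\<epsilon> n) \<eta>' \<longrightarrow>
          ev (\<epsilon> n) k \<eta>' - \<Lambda> k \<le> (1 + \<rho> n) * Re (grad_inner \<Omega> w w))"
    using defect[OF \<epsilon> seq k simple, of \<eta>'] by (elim exE conjE) blast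
  obtain v' \<rho>' where \<rho>': "\<rho>' \<longlonglongrightarrow> 0"
    and w: "\<forall>\<^sub>F n in sequentially. U k - v' n \<in> W (\<epsilon> n) \<eta> \<and>
       Re (Q.q (v' n) (v' n)) \<le> (1 + \<rho>' n) * (ev (\<epsilon> n) k \<eta> - \<Lambda> k) \<and>
       (\<forall>w\<in>H1 \<Omega>. (\<forall>y\<in>H1 \<Omega>. surface_inner B w y = 0) \<longrightarrow> U k - w \<in> W (\<epsilon> n) \<eta> \<longrightarrow>
          ev (\<epsilon> n) k \<eta> - \<Lambda> k \<le> (1 + \<rho>' n) * Re (grad_inner \<Omega> w w))"
    using defect[OF \<epsilon> seq k simple, of \<eta>] by (elim exE conjE) blast
  \<comment> \<open>This is \<open>1 - \<kappa>\<close> from the cut-off defect plus four times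
    \<open>\<kappa> / 8\<close> from the two bumps, each of which the competitor counts
    twice.\<close>
  define Z where "Z = 1 - \<kappa> / 2"
  have Z: "0 < Z" "Z < 1" using \<kappa> c1 by (auto simp: Z_def \<kappa>_def)
  have "(\<lambda>n. (1 + \<rho> n) * (1 + \<rho>' n) * Z\<^sup>2) \<longlonglongrightarrow> (1 + 0) * (1 + 0) * Z\<^sup>2"
    by (intro tendsto_intros v(2) \<rho>')
  moreover have "Z\<^sup>2 < 1" using Z by (simp add: power_less_one_iff)
  ultimately have E1: "\<forall>\<^sub>F n in sequentially. (1 + \<rho> n) * (1 + \<rho>' n) * Z\<^sup>2 < 1"
    by (intro order_tendstoD(2)) simp_all
  have E2: "\<forall>\<^sub>F n in sequentially. - 1 < \<rho> n" "\<forall>\<^sub>F n in sequentially. - 1 < \<rho>' n"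
    by (rule order_tendstoD(1)[OF v(2)] order_tendstoD(1)[OF \<rho>'], simp)+
  have E3: "\<forall>\<^sub>F n in sequentially. m * \<epsilon> n < \<delta>"
    by (rule order_tendstoD(2)[OF tendsto_mult_right_zero[OF \<epsilon>(2)] \<delta>])
  note E4 = bump_energy_small[OF \<epsilon> uH uE disjI1[OF refl] a0(1)[folded u_def] s]
    bump_energy_small[OF \<epsilon> uH uE disjI2[OF refl] a1(1)[folded u_def] s]
  have "\<forall>\<^sub>F n in sequentially. False"
    using v_def w E1 E2 E3 E4
  proof eventually_elim
    fix n
    define q where "q = sqrt (Re (Q.q (v n) (v n)))"
    define x0 where "x0 = sqrt (grad_norm_sq \<Omega> (bump u 0 a0 (\<epsilon> n)))"
    define x1 where "x1 = sqrt (grad_norm_sq \<Omega> (bump u 1 a1 (\<epsilon> n)))"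
    define \<Delta> where "\<Delta> = ev (\<epsilon> n) k \<eta> - \<Lambda> k"
    assume v': "U k - v n \<in> W (\<epsilon> n) \<eta>' \<and>
       Re (Q.q (v n) (v n)) \<le> (1 + \<rho> n) * (ev (\<epsilon> n) k \<eta>' - \<Lambda> k) \<and>
       (\<forall>w\<in>H1 \<Omega>. (\<forall>y\<in>H1 \<Omega>. surface_inner B w y = 0) \<longrightarrow> U k - w \<in> W (\<epsilon> n) \<eta>' \<longrightarrow>
          ev (\<epsilon> n) k \<eta>' - \<Lambda> k \<le> (1 + \<rho> n) * Re (grad_inner \<Omega> w w))"
    assume w: "U k - v' n \<in> W (\<epsilon> n) \<eta> \<and>
       Re (Q.q (v' n) (v' n)) \<le> (1 + \<rho>' n) * (ev (\<epsilon> n) k \<eta> - \<Lambda> k) \<and>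
       (\<forall>w\<in>H1 \<Omega>. (\<forall>y\<in>H1 \<Omega>. surface_inner B w y = 0) \<longrightarrow> U k - w \<in> W (\<epsilon> n) \<eta> \<longrightarrow>
          ev (\<epsilon> n) k \<eta> - \<Lambda> k \<le> (1 + \<rho>' n) * Re (grad_inner \<Omega> w w))"
    assume \<rho>: "(1 + \<rho> n) * (1 + \<rho>' n) * Z\<^sup>2 < 1" "- 1 < \<rho> n" "- 1 < \<rho>' n"
      and m\<epsilon>: "m * \<epsilon> n < \<delta>"
      and x: "sqrt (grad_norm_sq \<Omega> (bump u 0 a0 (\<epsilon> n))) \<le> s * sqrt (\<epsilon> n)"
        "sqrt (grad_norm_sq \<Omega> (bump u 1 a1 (\<epsilon> n))) \<le> s * sqrt (\<epsilon> n)"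
    have vH: "v n \<in> H1 \<Omega>" using v(1) by blast
    \<comment> \<open>Here the degenerate band enters: the shift for \<open>\<eta>'\<close> is
      rewritten as \<open>\<Delta>\<close>, the shift for \<open>\<eta>\<close>.\<close>
    have vW: "u - v n \<in> W (\<epsilon> n) \<eta>'" and q\<Delta>: "q\<^sup>2 \<le> (1 + \<rho> n) * \<Delta>"
      using v' Q.q.nonneg[OF vH] unfolding u_def q_def \<Delta>_def eq[OF \<eta>'(1) \<eta>(1)] by simp_all
    have \<epsilon>0: "\<epsilon> n > 0" using \<epsilon>(1)[of n] by (simp add: small_def)
    have q0: "q \<ge> 0" unfolding q_def using Q.q.nonneg[OF vH] by simp
    have "D * sqrt (\<epsilon> n) \<le> K * (2 * q + x0 + x1)"
      unfolding D_def q_def x0_def x1_def by (rule low[OF \<epsilon>(1) uH vH vW])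
    also have "\<dots> \<le> K * (2 * q + s * sqrt (\<epsilon> n) + s * sqrt (\<epsilon> n))"
      using x K unfolding x0_def x1_def by (intro mult_left_mono) auto
    also have "\<dots> = 2 * K * q + (\<kappa> / 16) * D * sqrt (\<epsilon> n)" using K by (simp add: s_def field_simps)
    also have "\<dots> \<le> 2 * K * q + (1 / 2) * D * sqrt (\<epsilon> n)"
      using D \<epsilon>0 by (intro add_left_mono mult_right_mono) (auto simp: \<kappa>_def)
    finally have Dq: "D * sqrt (\<epsilon> n) \<le> 4 * K * q" by simp
    have q_pos: "q > 0"
    proof -
      have "0 < D * sqrt (\<epsilon> n)" using D \<epsilon>0 by simp
      then have "0 < 4 * K * q" using Dq by linarith
      then show ?thesis using K by (simp add: zero_less_mult_iff)
    qed
    have "s * sqrt (\<epsilon> n) = \<kappa> / (32 * K) * (D * sqrt (\<epsilon> n))" by (simp add: s_def)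
    also have "\<dots> \<le> \<kappa> / (32 * K) * (4 * K * q)" by (rule mult_left_mono[OF Dq]) (use \<kappa> K in simp)
    also have "\<dots> = \<kappa> / 8 * q" using K by simp
    finally have xq: "x0 \<le> \<kappa> / 8 * q" "x1 \<le> \<kappa> / 8 * q" using x unfolding x0_def x1_def by simp_all
    have \<zeta>1: "\<zeta> (0, y) = 1 \<and> \<zeta> (1, y) = - 1" if "y \<in> A (\<epsilon> n)" for y
      using \<zeta>A[of y] A_near[OF \<epsilon>0 that, of 0] m\<epsilon> by (simp add: norm_Pair)
    obtain w' where w': "w' \<in> H1 \<Omega>" "\<forall>y\<in>H1 \<Omega>. surface_inner B w' y = 0" "u - w' \<in> W (\<epsilon> n) \<eta>"
      "sqrt (Re (grad_inner \<Omega> w' w')) \<le> \<bar>c\<bar> * sqrt (grad_norm_sq \<Omega> (\<lambda>x. \<zeta> x * v n x)) + 2 * x0 + 2 * x1"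
      using competitor[OF \<epsilon>(1) uH vH vW \<eta>(2) \<eta>'(2) cea less_imp_le[OF c1] \<zeta> \<zeta>1] unfolding x0_def x1_def by blast
    have "\<bar>c\<bar> * sqrt (grad_norm_sq \<Omega> (\<lambda>x. \<zeta> x * v n x)) \<le> \<bar>c\<bar> * ((1 + \<kappa>) * q)"
      using \<zeta>grad[OF vH] unfolding q_def by (rule mult_left_mono) simp
    also have "\<dots> \<le> (1 - \<kappa>) * q"
    proof -
      have "\<bar>c\<bar> * \<kappa> \<le> 1 * \<kappa>" using c1 \<kappa> by (intro mult_right_mono) auto
      then have "\<bar>c\<bar> * (1 + \<kappa>) \<le> 1 - \<kappa>" by (simp add: \<kappa>_def field_simps)
      from mult_right_mono[OF this q0] show ?thesis by (simp only: mult.assoc)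
    qed
    finally have aw: "sqrt (Re (grad_inner \<Omega> w' w')) \<le> Z * q"
      using w'(4) xq by (simp add: Z_def algebra_simps)
    have "Re (grad_inner \<Omega> w' w') \<ge> 0" by (rule H.a.nonneg[OF w'(1)])
    then have "Re (grad_inner \<Omega> w' w') \<le> (Z * q)\<^sup>2" using power_mono[OF aw, of 2] by simp
    then have "(1 + \<rho>' n) * Re (grad_inner \<Omega> w' w') \<le> (1 + \<rho>' n) * (Z * q)\<^sup>2"
      by (rule mult_left_mono) (use \<rho>(3) in simp)
    moreover have "\<Delta> \<le> (1 + \<rho>' n) * Re (grad_inner \<Omega> w' w')"
      using w w'(1-3) unfolding u_def \<Delta>_def by blast
    ultimately have "\<Delta> \<le> (1 + \<rho>' n) * (Z * q)\<^sup>2" by linarith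
    then have "(1 + \<rho> n) * \<Delta> \<le> (1 + \<rho> n) * ((1 + \<rho>' n) * (Z * q)\<^sup>2)"
      by (rule mult_left_mono) (use \<rho>(2) in simp)
    then have "q\<^sup>2 \<le> (1 + \<rho> n) * (1 + \<rho>' n) * Z\<^sup>2 * q\<^sup>2"
      using q\<Delta> by (simp add: power_mult_distrib mult.assoc)
    moreover have "(1 + \<rho> n) * (1 + \<rho>' n) * Z\<^sup>2 * q\<^sup>2 < 1 * q\<^sup>2"
      by (rule mult_strict_right_mono[OF \<rho>(1)]) (use q_pos in simp)
    ultimately show False by simp
  qed
  then show False by simp
qed

text \<open>A failure for arbitrarily small \<epsilon> gives a sequence of degenerate bands;
  \<open>\<beta>\<close> bounds it so that it tends to zero and every member is
  \<open>small\<close>.\<close>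

lemma band_positive:
  assumes seq: "Q.eigen_sequence \<Lambda> U" and k: "k \<ge> 1" and simple: "\<forall>j\<ge>1. \<Lambda> j = \<Lambda> k \<longrightarrow> j = k"
    and a0: "has_boundary_value \<Omega> (U k) (0, P) a0" "a0 \<noteq> 0"
    and a1: "has_boundary_value \<Omega> (U k) (1, P) a1" "a1 \<noteq> 0"
  shows "\<forall>\<^sub>F \<epsilon> in at_right 0. \<exists>a b. a < b \<and> spectral_band B P \<theta> \<epsilon> k = {a..b}"
proof (rule ccontr)
  assume N: "\<not> ?thesis"
  define \<beta> where "\<beta> n = min (w0.r1 / (3 * m)) (1 / real (Suc n))" for n
  have \<beta>: "\<beta> n > 0" for n unfolding \<beta>_def using w0.r1(1) m(1) by simp
  have "\<exists>\<epsilon>>0. \<epsilon> < \<beta> n \<and> \<not> (\<exists>a b. a < b \<and> spectral_band B P \<theta> \<epsilon> k = {a..b})" for n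
    using N \<beta>[of n] unfolding eventually_at_right[OF zero_less_one] by blast
  then have "\<forall>n. \<exists>\<epsilon>. \<epsilon> > 0 \<and> \<epsilon> < \<beta> n \<and> \<not> (\<exists>a b. a < b \<and> spectral_band B P \<theta> \<epsilon> k = {a..b})" by blast
  from choice[OF this] obtain \<epsilon> where \<epsilon>: "\<And>n. \<epsilon> n > 0" "\<And>n. \<epsilon> n < \<beta> n"
    "\<And>n. \<not> (\<exists>a b. a < b \<and> spectral_band B P \<theta> (\<epsilon> n) k = {a..b})" by blast
  have sm: "small (\<epsilon> n)" for n
  proof -
    have "\<epsilon> n < w0.r1 / (3 * m)" using \<epsilon>(2)[of n] unfolding \<beta>_def by simp
    then show ?thesis using \<epsilon>(1) m(1) by (simp add: small_def field_simps)
  qed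
  have "\<epsilon> \<longlonglongrightarrow> 0"
  proof (rule tendsto_sandwich[OF always_eventually always_eventually tendsto_const])
    show "\<forall>n. 0 \<le> \<epsilon> n" using \<epsilon>(1) less_imp_le by blast
    show "\<forall>n. \<epsilon> n \<le> inverse (real (Suc n))"
      using \<epsilon>(2) unfolding \<beta>_def min_less_iff_conj inverse_eq_divide by (blast intro: less_imp_le)
  qed (rule LIMSEQ_inverse_real_of_nat)
  moreover have "ev (\<epsilon> n) k \<eta> = ev (\<epsilon> n) k \<eta>'" if "\<eta> \<in> {0..<2 * pi}" "\<eta>' \<in> {0..<2 * pi}" for n \<eta> \<eta>'
    using band_interval[OF sm k that] \<epsilon>(3)[of n] by blast
  ultimately show False by (rule band_nondegenerate[OF seq k simple a0 a1 sm])
qed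

end

text \<open>If two indices shared the eigenvalue, both eigenfunctions would be multiples of one
  function, and \<open>d U j - c U k\<close> would be null. Pairing it with \<open>U j\<close> gives
  \<open>d = 0\<close> by orthonormality, so \<open>U k\<close> would vanish almost
  everywhere.\<close>

lemma (in periodic_channel) simple_index:
  assumes seq: "Q.eigen_sequence \<Lambda> U" and k: "k \<ge> 1" and s: "simple_eigenvalue B (H1 \<Omega>) (\<Lambda> k)"
  shows "\<forall>j\<ge>1. \<Lambda> j = \<Lambda> k \<longrightarrow> j = k"
proof (intro allI impI, rule ccontr)
  fix j assume j: "j \<ge> 1" "\<Lambda> j = \<Lambda> k" and "j \<noteq> k"
  interpret sp: spectral_pair cscale "H1 \<Omega>" "grad_inner \<Omega>" "surface_inner B" by (rule spectral_pair_H1)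
  note D = sp.eigen_sequenceD[OF seq]
  note ef = eigenfunction_iff[OF spectral_pair_H1 subset_refl]
  obtain V where V: "eigenfunction B (H1 \<Omega>) (\<Lambda> k) V"
    "\<And>V'. eigenfunction B (H1 \<Omega>) (\<Lambda> k) V' \<Longrightarrow> \<exists>c. AE x in leb \<Omega>. V' x = c * V x"
    using s unfolding simple_eigenvalue_def by blast
  obtain c where c: "AE x in leb \<Omega>. U j x = c * V x" using V(2) D(1)[OF j(1)] unfolding ef j(2) by blast
  obtain d where d: "AE x in leb \<Omega>. U k x = d * V x" using V(2) D(1)[OF k] unfolding ef by blast
  note UH = D(2)[OF j(1)] D(2)[OF k]
  define y where "y = cscale d (U j) - cscale c (U k)"
  have yH: "y \<in> H1 \<Omega>" unfolding y_def using UH by blast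
  have "AE x in leb \<Omega>. y x = 0" using c d by eventually_elim (simp add: y_def cscale_def)
  then have y0: "Re (Q.q y y) = 0" using null_iff[OF yH] by blast
  have by0: "Re (surface_inner B y y) = 0"
    using y0 H.a.nonneg[OF yH] Q.b.nonneg[OF yH] unfolding plus_complex.sel by linarith
  have "surface_inner B y (U j) = 0" "surface_inner B y (U k) = 0"
    using Q.b.null_left[OF yH _ by0] UH by blast+
  moreover have "surface_inner B y z = d * surface_inner B (U j) z - c * surface_inner B (U k) z" if "z \<in> H1 \<Omega>" for z
    unfolding y_def using UH that by (simp add: Q.b.diff_left Q.b.scale_left)
  ultimately have "d = 0" using D(3)[OF j(1) j(1)] D(3)[OF k j(1)] UH \<open>j \<noteq> k\<close> by simp
  then have "AE x in leb \<Omega>. U k x = 0" using d by simp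
  then have "Re (Q.q (U k) (U k)) = 0" using null_iff[OF UH(2)] by blast
  then have "Re (surface_inner B (U k) (U k)) = 0"
    using H.a.nonneg[OF UH(2)] Q.b.nonneg[OF UH(2)] unfolding plus_complex.sel by linarith
  then show False using D(3)[OF k k] by simp
qed

theorem mainTheorem5:
  fixes B :: "point set" and P :: plane and \<theta> :: "plane set"
    and \<Lambda>0 :: "nat \<Rightarrow> real" and U0 :: "nat \<Rightarrow> point \<Rightarrow> complex"
    and k :: nat and a0 a1 :: complex
  assumes "periodic_channel B P \<theta>"
    and "eigenvalue_sequence B (H1 (cell B)) \<Lambda>0 U0"
    and "k \<ge> 1"
    and "simple_eigenvalue B (H1 (cell B)) (\<Lambda>0 k)"
    and "has_boundary_value (cell B) (U0 k) (0, P) a0" and "a0 \<noteq> 0"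
    and "has_boundary_value (cell B) (U0 k) (1, P) a1" and "a1 \<noteq> 0"
  shows "\<forall>\<^sub>F \<epsilon> in at_right 0. \<exists>a b. a < b \<and> spectral_band B P \<theta> \<epsilon> k = {a..b}"
proof -
  interpret periodic_channel B P \<theta> by fact
  obtain R where R: "R > 0" "R \<le> 1/2" "R \<le> - snd P / 2" "flat_wall (cell B) (0, P) 1 R" "flat_wall (cell B) (1, P) (- 1) R"
    using walls_exist by blast
  obtain m where m: "m > 0" "\<forall>y\<in>\<theta>. norm y \<le> m" using \<theta>_domain(3) unfolding bounded_pos by blast
  have m\<theta>: "\<theta> \<subseteq> cball 0 m" using m(2) by auto
  interpret channel_walls B P \<theta> R m
    by (rule channel_walls.intro[OF assms(1) channel_walls_axioms.intro[OF R m(1) m\<theta>]])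
  have seq: "Q.eigen_sequence \<Lambda>0 U0"
    using assms(2) unfolding eigenvalue_sequence_iff[OF spectral_pair_H1 subset_refl] .
  show ?thesis
    by (rule band_positive[OF seq assms(3) simple_index[OF seq assms(3,4)] assms(5-8)])
qed

end
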